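(* Let $\Omega\subset\mathbb{R}^n$ be a bounded open subset with Lipschitz boundary $\partial\Omega$. Let $f:\mathbb{R}^n\setminus\Omega\to\mathbb{R}^m$ be an asymptotically flat map. Assume that $f$ is constant along each connected component of $\Sigma=\partial\Omega$. Let $M$ be the graph of $f$ with its natural metric $g$. Then $$m_{ADM}=\frac{1}{2(n-1)\omega_{n-1}}\left(\int_M (S+S^\perp)\,\frac{1}{\sqrt{G}}\,dM+\int_\Sigma \frac{|Df|^2}{1+|Df|^2}\,H^\Sigma\,d\Sigma\right),$$ where $m_{ADM}$ is the ADM mass of $M$, $G=\det(g_{ij})$, $|Df|^2=|Df^1|^2+\dots+|Df^m|^2$, and $H^\Sigma$ is the mean curvature of the hypersurface $\Sigma$ in the Euclidean space $\mathbb{R}^n$ in the direction of the unit normal $\nu$ pointing inward to $\Omega$.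
   Context: Here $n\ge 2$, $m\ge 1$; repeated indices are summed, with $i,j,k,\dots\in\{1,\dots,n\}$ and $\alpha,\beta,\dots\in\{1,\dots,m\}$; $\omega_{n-1}$ is the volume of the unit sphere in $\mathbb{R}^n$. Mean curvature: $H^\Sigma=-\mathrm{div}_{\mathbb{R}^n}\nu$ (the sum of the principal curvatures), so that with $\nu$ pointing into $\Omega$ the sphere of radius $r$ bounding a ball has $H^\Sigma=(n-1)/r$. The statement presupposes that $\Sigma$ is regular enough for $H^\Sigma$ to make sense in the integral. Asymptotically flat map: a $C^2$ map $f=(f^1,\dots,f^m):\mathbb{R}^n\setminus\Omega\to\mathbb{R}^m$ is asymptotically flat if the scalar curvature $S$ of its graph with the natural metric, viewed as a function of $x$, is integrable over the domain of $f$, and there is a constant $p>\frac{n-2}{2}$ such that $f^\alpha_i=\partial f^\alpha/\partial x_i=O(|x|^{-p/2})$ and $f^\alpha_{ij}=\partial^2 f^\alpha/\partial x_i\partial x_j=O(|x|^{-p/2-1})$ at infinity, for all $\alpha,i,j$. Natural metric: the metric induced from $\mathbb{R}^{n+m}$ on $M=\{(x,f(x))\}$; in the graph coordinates $x$, $g_{ij}=\delta_{ij}+f^\alpha_i f^\alpha_j$. $dM$ is its volume element; $d\Sigma$ is the Euclidean area element of $\Sigma$. Functions on the domain of $f$ and on $M$ are identified via the projection $(x,f(x))\mapsto x$. ADM mass (computed in the graph coordinates $x$): $$m_{ADM}=\lim_{r\to\infty}\frac{1}{2(n-1)\omega_{n-1}}\int_{S_r}(g_{iji}-g_{iij})\,\nu_j\,d\mu,$$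 where $g_{ijk}=\partial g_{ij}/\partial x_k$, $S_r=\{|x|=r\}$, in this formula $\nu=x/r$, and $d\mu$ is the Euclidean area element of $S_r$. Function $S^\perp$: let $\eta^\alpha=(-Df^\alpha,e_\alpha)$, where $Df^\alpha$ is the Euclidean gradient and $e_\alpha$ the canonical basis of $\mathbb{R}^m$ (these $\eta^\alpha$ form a basis of the normal bundle of $M$), and let $\nabla f^\alpha$ be the gradient of $f^\alpha$ on $(M,g)$. Then $S^\perp=\langle R^\perp(\nabla f^\alpha,\nabla f^\beta)\eta^\beta,\eta^\alpha\rangle$ (summed over $\alpha,\beta$), where $R^\perp$ is the normal curvature tensor of $M\subset\mathbb{R}^{n+m}$, $R^\perp(X,Y)\xi=\nabla^\perp_X\nabla^\perp_Y\xi-\nabla^\perp_Y\nabla^\perp_X\xi-\nabla^\perp_{[X,Y]}\xi$. By Ricci's equation, equivalently $S^\perp=g(A^\alpha\nabla f^\alpha,A^\beta\nabla f^\beta)-g(A^\alpha\nabla f^\beta,A^\beta\nabla f^\alpha)$, where $A^\alpha$ is the shape operator in the direction $\eta^\alpha$ (this makes sense for $C^2$ maps). *)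

theory Defs
  imports "HOL-Analysis.Analysis" "HOL-Library.Landau_Symbols"
begin

section \<open>Differentiation on a closed domain\<close>

text \<open>Derivatives are taken within the domain \<open>D\<close>, which need not be open. At a boundary point of a
  Lipschitz domain the derivative within \<open>D\<close> is unique, so the \<open>SOME\<close> hidden in
  \<^const>\<open>frechet_derivative\<close> is harmless there.\<close>

definition partial_deriv :: "(real^'n) set \<Rightarrow> 'n \<Rightarrow> (real^'n \<Rightarrow> real) \<Rightarrow> real^'n \<Rightarrow> real" where
  "partial_deriv D i u x = frechet_derivative u (at x within D) (axis i 1)"

definition C1_on :: "(real^'n) set \<Rightarrow> (real^'n \<Rightarrow> real) \<Rightarrow> bool" where
  "C1_on D u \<longleftrightarrow> u differentiable_on D \<and> (\<forall>i. continuous_on D (partial_deriv D i u))"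

definition C2_on :: "(real^'n) set \<Rightarrow> (real^'n \<Rightarrow> real) \<Rightarrow> bool" where
  "C2_on D u \<longleftrightarrow> u differentiable_on D \<and> (\<forall>i. C1_on D (partial_deriv D i u))"

definition D1 :: "(real^'n) set \<Rightarrow> (real^'n \<Rightarrow> real^'m) \<Rightarrow> 'm \<Rightarrow> 'n \<Rightarrow> real^'n \<Rightarrow> real" where
  "D1 D f \<alpha> i = partial_deriv D i (\<lambda>y. f y $ \<alpha>)"

definition D2 :: "(real^'n) set \<Rightarrow> (real^'n \<Rightarrow> real^'m) \<Rightarrow> 'm \<Rightarrow> 'n \<Rightarrow> 'n \<Rightarrow> real^'n \<Rightarrow> real" where
  "D2 D f \<alpha> i j = partial_deriv D j (D1 D f \<alpha> i)"

definition grad :: "(real^'n) set \<Rightarrow> (real^'n \<Rightarrow> real^'m) \<Rightarrow> 'm \<Rightarrow> real^'n \<Rightarrow> real^'n" where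
  "grad D f \<alpha> x = (\<chi> i. D1 D f \<alpha> i x)"

definition grad_norm_sq :: "(real^'n) set \<Rightarrow> (real^'n \<Rightarrow> real^'m) \<Rightarrow> real^'n \<Rightarrow> real" where
  "grad_norm_sq D f x = (\<Sum>\<alpha>\<in>UNIV. (norm (grad D f \<alpha> x))\<^sup>2)"


section \<open>Geometry of the graph\<close>

text \<open>The graph of \<open>f\<close> over \<open>D\<close> lives in \<open>real^'n \<times> real^'m\<close> and is parametrised by
  \<open>X x = (x, f x)\<close>. Every tensor on it is expressed in the coordinates \<open>x\<close>, hence is a function
  of \<open>x\<close>.\<close>

definition graph_metric :: "(real^'n) set \<Rightarrow> (real^'n \<Rightarrow> real^'m) \<Rightarrow> real^'n \<Rightarrow> real^'n^'n" where
  "graph_metric D f x =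
     (\<chi> i j. (if i = j then 1 else 0) + (\<Sum>\<alpha>\<in>UNIV. D1 D f \<alpha> i x * D1 D f \<alpha> j x))"

definition inv_metric :: "(real^'n) set \<Rightarrow> (real^'n \<Rightarrow> real^'m) \<Rightarrow> real^'n \<Rightarrow> real^'n^'n" where
  "inv_metric D f x = matrix_inv (graph_metric D f x)"

definition metric_inner ::
  "(real^'n) set \<Rightarrow> (real^'n \<Rightarrow> real^'m) \<Rightarrow> real^'n \<Rightarrow> real^'n \<Rightarrow> real^'n \<Rightarrow> real" where
  "metric_inner D f x v w = v \<bullet> (graph_metric D f x *v w)"

text \<open>The Riemannian volume of the graph, transported to \<open>D\<close> by the projection \<open>(x, f x) \<mapsto> x\<close>.\<close>

definition graph_volume :: "(real^'n) set \<Rightarrow> (real^'n \<Rightarrow> real^'m) \<Rightarrow> (real^'n) measure" where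
  "graph_volume D f =
     density (restrict_space lborel D) (\<lambda>x. ennreal (sqrt (det (graph_metric D f x))))"

definition tangent_vec ::
  "(real^'n) set \<Rightarrow> (real^'n \<Rightarrow> real^'m) \<Rightarrow> 'n \<Rightarrow> real^'n \<Rightarrow> (real^'n) \<times> (real^'m)" where
  "tangent_vec D f i x = (axis i 1, \<chi> \<alpha>. D1 D f \<alpha> i x)"

definition normal_vec ::
  "(real^'n) set \<Rightarrow> (real^'n \<Rightarrow> real^'m) \<Rightarrow> 'm \<Rightarrow> real^'n \<Rightarrow> (real^'n) \<times> (real^'m)" where
  "normal_vec D f \<alpha> x = (- grad D f \<alpha> x, axis \<alpha> 1)"

text \<open>\<open>hess_vec D f i j\<close> is the second partial derivative \<open>X\<^sub>i\<^sub>j\<close> of the parametrisation; the second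
  fundamental form \<open>second_ff D f i j\<close> on the coordinate vectors is its normal component.\<close>

definition hess_vec ::
  "(real^'n) set \<Rightarrow> (real^'n \<Rightarrow> real^'m) \<Rightarrow> 'n \<Rightarrow> 'n \<Rightarrow> real^'n \<Rightarrow> (real^'n) \<times> (real^'m)" where
  "hess_vec D f i j x = (0, \<chi> \<alpha>. D2 D f \<alpha> i j x)"

definition second_ff ::
  "(real^'n) set \<Rightarrow> (real^'n \<Rightarrow> real^'m) \<Rightarrow> 'n \<Rightarrow> 'n \<Rightarrow> real^'n \<Rightarrow> (real^'n) \<times> (real^'m)" where
  "second_ff D f i j x = hess_vec D f i j x -
     (\<Sum>k\<in>UNIV. \<Sum>l\<in>UNIV. (inv_metric D f x $ k $ l * (hess_vec D f i j x \<bullet> tangent_vec D f k x)) *\<^sub>R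
        tangent_vec D f l x)"

text \<open>The metric of the graph of a \<open>C\<^sup>2\<close> map is only \<open>C\<^sup>1\<close>, so its Riemann tensor is read off from
  Gauss' equation. Theorem \<open>scalar_curv_eq_intrinsic\<close> at the end of this theory shows that the
  resulting scalar curvature is the one of the Levi-Civita connection as soon as that makes sense
  classically, i.e. for \<open>C\<^sup>3\<close> maps.\<close>

definition riemann ::
  "(real^'n) set \<Rightarrow> (real^'n \<Rightarrow> real^'m) \<Rightarrow> 'n \<Rightarrow> 'n \<Rightarrow> 'n \<Rightarrow> 'n \<Rightarrow> real^'n \<Rightarrow> real" where
  "riemann D f i j k l x =
     second_ff D f i l x \<bullet> second_ff D f j k x - second_ff D f i k x \<bullet> second_ff D f j l x"

definition scalar_curv :: "(real^'n) set \<Rightarrow> (real^'n \<Rightarrow> real^'m) \<Rightarrow> real^'n \<Rightarrow> real" where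
  "scalar_curv D f x =
     (\<Sum>i\<in>UNIV. \<Sum>j\<in>UNIV. \<Sum>k\<in>UNIV. \<Sum>l\<in>UNIV.
        inv_metric D f x $ i $ l * inv_metric D f x $ j $ k * riemann D f i j k l x)"

text \<open>Riemannian gradient of \<open>f\<^sup>\<alpha>\<close>, and shape operator in the direction \<open>\<eta>\<^sup>\<alpha>\<close>; the latter is
  determined by \<open>g (A\<^sup>\<alpha> \<partial>\<^sub>i) \<partial>\<^sub>j = X\<^sub>i\<^sub>j \<bullet> \<eta>\<^sup>\<alpha>\<close>.\<close>

definition metric_grad :: "(real^'n) set \<Rightarrow> (real^'n \<Rightarrow> real^'m) \<Rightarrow> 'm \<Rightarrow> real^'n \<Rightarrow> real^'n" where
  "metric_grad D f \<alpha> x = inv_metric D f x *v grad D f \<alpha> x"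

definition shape_op :: "(real^'n) set \<Rightarrow> (real^'n \<Rightarrow> real^'m) \<Rightarrow> 'm \<Rightarrow> real^'n \<Rightarrow> real^'n \<Rightarrow> real^'n" where
  "shape_op D f \<alpha> x v =
     inv_metric D f x *v ((\<chi> i j. hess_vec D f i j x \<bullet> normal_vec D f \<alpha> x) *v v)"

text \<open>\<open>S\<^sup>\<bottom> = \<langle>R\<^sup>\<bottom>(\<nabla>f\<^sup>\<alpha>, \<nabla>f\<^sup>\<beta>) \<eta>\<^sup>\<beta>, \<eta>\<^sup>\<alpha>\<rangle>\<close>, with the normal curvature \<open>R\<^sup>\<bottom>\<close> written through Ricci's
  equation, which is the form available for \<open>C\<^sup>2\<close> maps.\<close>

definition normal_scalar :: "(real^'n) set \<Rightarrow> (real^'n \<Rightarrow> real^'m) \<Rightarrow> real^'n \<Rightarrow> real" where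
  "normal_scalar D f x =
     (\<Sum>\<alpha>\<in>UNIV. \<Sum>\<beta>\<in>UNIV.
        metric_inner D f x (shape_op D f \<alpha> x (metric_grad D f \<alpha> x)) (shape_op D f \<beta> x (metric_grad D f \<beta> x))
      - metric_inner D f x (shape_op D f \<alpha> x (metric_grad D f \<beta> x)) (shape_op D f \<beta> x (metric_grad D f \<alpha> x)))"

definition asymptotically_flat :: "(real^'n) set \<Rightarrow> (real^'n \<Rightarrow> real^'m) \<Rightarrow> bool" where
  "asymptotically_flat D f \<longleftrightarrow>
     (\<forall>\<alpha>. C2_on D (\<lambda>x. f x $ \<alpha>)) \<and>
     set_integrable lborel D (scalar_curv D f) \<and>
     (\<exists>p::real. p > (real CARD('n) - 2) / 2 \<and>
        (\<forall>\<alpha> i. D1 D f \<alpha> i \<in> O[at_infinity](\<lambda>x. norm x powr (- p / 2))) \<and>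
        (\<forall>\<alpha> i j. D2 D f \<alpha> i j \<in> O[at_infinity](\<lambda>x. norm x powr (- p / 2 - 1))))"


section \<open>Area of hypersurfaces\<close>

definition hausdorff_premeasure :: "nat \<Rightarrow> real \<Rightarrow> 'a::metric_space set \<Rightarrow> ennreal" where
  "hausdorff_premeasure k \<delta> A =
     (INF C \<in> {C :: nat \<Rightarrow> 'a set. A \<subseteq> (\<Union>i. C i) \<and> (\<forall>i. bounded (C i) \<and> diameter (C i) \<le> \<delta>)}.
        \<Sum>i. ennreal (diameter (C i) ^ k))"

definition hausdorff_outer :: "nat \<Rightarrow> 'a::metric_space set \<Rightarrow> ennreal" where
  "hausdorff_outer k A = (SUP \<delta>\<in>{0<..}. hausdorff_premeasure k \<delta> A)"

text \<open>The \<open>(n-1)\<close>-dimensional Hausdorff measure, with the normalising constant fixed by giving area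
  \<open>1\<close> to a unit \<open>(n-1)\<close>-cube, so that it agrees with Lebesgue measure on hyperplanes and is the
  Euclidean area element on hypersurfaces.\<close>

definition unit_face :: "(real^'n) set" where
  "unit_face = {x. (\<forall>i. 0 \<le> x $ i \<and> x $ i \<le> 1) \<and> x $ (SOME k. True) = 0}"

definition area_measure :: "(real^'n) measure" where
  "area_measure = measure_of UNIV (sets borel)
     (\<lambda>A. hausdorff_outer (CARD('n) - 1) A /
           hausdorff_outer (CARD('n) - 1) (unit_face :: (real^'n) set))"

definition sphere_area :: "'n::finite itself \<Rightarrow> real" where
  "sphere_area _ = measure area_measure (sphere (0 :: real^'n) 1)"


section \<open>Boundary of the domain\<close>

text \<open>Near each boundary point, \<open>\<Omega>\<close> is the part of the space above the graph of a Lipschitz function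
  over the hyperplane orthogonal to a unit vector \<open>e\<close>.\<close>

definition lipschitz_boundary :: "(real^'n) set \<Rightarrow> bool" where
  "lipschitz_boundary \<Omega> \<longleftrightarrow>
     (\<forall>x\<in>frontier \<Omega>. \<exists>U e L \<phi>. open U \<and> x \<in> U \<and> norm e = 1 \<and> L-lipschitz_on {z. e \<bullet> z = 0} \<phi> \<and>
        \<Omega> \<inter> U = {y\<in>U. e \<bullet> y > \<phi> (y - (e \<bullet> y) *\<^sub>R e)})"

text \<open>\<open>\<nu>\<close> points into \<open>\<Omega>\<close> and the boundary has tangent hyperplane \<open>\<nu>\<^sup>\<bottom>\<close> at \<open>y\<close>: near \<open>y\<close>, every
  cone around \<open>\<nu>\<close> that is smaller than a half-space lies in \<open>\<Omega>\<close> and the opposite one outside.\<close>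

definition inner_unit_normal :: "(real^'n) set \<Rightarrow> real^'n \<Rightarrow> real^'n \<Rightarrow> bool" where
  "inner_unit_normal \<Omega> y \<nu> \<longleftrightarrow> norm \<nu> = 1 \<and>
     (\<forall>\<epsilon>>0. \<forall>\<^sub>F z in nhds y.
        (\<nu> \<bullet> (z - y) > \<epsilon> * norm (z - y) \<longrightarrow> z \<in> \<Omega>) \<and>
        (\<nu> \<bullet> (z - y) < - \<epsilon> * norm (z - y) \<longrightarrow> z \<notin> \<Omega>))"

text \<open>A \<open>C\<^sup>1\<close> extension, by unit vectors, of the inner unit normal of \<open>\<partial>\<Omega>\<close> to an open set \<open>U\<close>. For
  a Lipschitz boundary it exists near a point iff the boundary is a \<open>C\<^sup>2\<close> hypersurface there.
  Because the extension consists of unit vectors, its divergence on \<open>\<partial>\<Omega>\<close> depends on \<open>\<partial>\<Omega>\<close> only.\<close>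

definition unit_normal_field :: "(real^'n) set \<Rightarrow> (real^'n) set \<Rightarrow> (real^'n \<Rightarrow> real^'n) \<Rightarrow> bool" where
  "unit_normal_field \<Omega> U N \<longleftrightarrow> open U \<and> (\<forall>i. C1_on U (\<lambda>y. N y $ i)) \<and> (\<forall>y\<in>U. norm (N y) = 1) \<and>
     (\<forall>y\<in>U \<inter> frontier \<Omega>. inner_unit_normal \<Omega> y (N y))"

definition divergence :: "(real^'n) set \<Rightarrow> (real^'n \<Rightarrow> real^'n) \<Rightarrow> real^'n \<Rightarrow> real" where
  "divergence U N x = (\<Sum>i\<in>UNIV. partial_deriv U i (\<lambda>y. N y $ i) x)"

definition C2_boundary_point :: "(real^'n) set \<Rightarrow> real^'n \<Rightarrow> bool" where
  "C2_boundary_point \<Omega> x \<longleftrightarrow> x \<in> frontier \<Omega> \<and> (\<exists>U N. x \<in> U \<and> unit_normal_field \<Omega> U N)"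

text \<open>The mean curvature is set to \<open>0\<close> at boundary points where it is not defined.\<close>

definition mean_curvature :: "(real^'n) set \<Rightarrow> real^'n \<Rightarrow> real" where
  "mean_curvature \<Omega> x =
     (if C2_boundary_point \<Omega> x
      then SOME h. \<exists>U N. x \<in> U \<and> unit_normal_field \<Omega> U N \<and> h = - divergence U N x
      else 0)"


section \<open>ADM mass\<close>

definition metric_deriv ::
  "(real^'n) set \<Rightarrow> (real^'n \<Rightarrow> real^'m) \<Rightarrow> 'n \<Rightarrow> 'n \<Rightarrow> 'n \<Rightarrow> real^'n \<Rightarrow> real" where
  "metric_deriv D f i j k = partial_deriv D k (\<lambda>y. graph_metric D f y $ i $ j)"

definition adm_flux :: "(real^'n) set \<Rightarrow> (real^'n \<Rightarrow> real^'m) \<Rightarrow> real \<Rightarrow> real" where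
  "adm_flux D f r = 1 / (2 * (real CARD('n) - 1) * sphere_area TYPE('n)) *
     (LINT x:sphere 0 r|area_measure.
        \<Sum>i\<in>UNIV. \<Sum>j\<in>UNIV. (metric_deriv D f i j i x - metric_deriv D f i i j x) * (x $ j / r))"

definition adm_mass :: "(real^'n) set \<Rightarrow> (real^'n \<Rightarrow> real^'m) \<Rightarrow> real" where
  "adm_mass D f = Lim at_top (adm_flux D f)"


section \<open>The scalar curvature is intrinsic\<close>

definition christoffel ::
  "(real^'n) set \<Rightarrow> (real^'n \<Rightarrow> real^'n^'n) \<Rightarrow> 'n \<Rightarrow> 'n \<Rightarrow> 'n \<Rightarrow> real^'n \<Rightarrow> real" where
  "christoffel U g k i j x = 1 / 2 * (\<Sum>l\<in>UNIV. matrix_inv (g x) $ k $ l *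
     (partial_deriv U i (\<lambda>y. g y $ j $ l) x + partial_deriv U j (\<lambda>y. g y $ i $ l) x
      - partial_deriv U l (\<lambda>y. g y $ i $ j) x))"

definition intrinsic_scalar_curv :: "(real^'n) set \<Rightarrow> (real^'n \<Rightarrow> real^'n^'n) \<Rightarrow> real^'n \<Rightarrow> real" where
  "intrinsic_scalar_curv U g x = (\<Sum>j\<in>UNIV. \<Sum>k\<in>UNIV. \<Sum>l\<in>UNIV. matrix_inv (g x) $ j $ k *
     (partial_deriv U l (christoffel U g l j k) x - partial_deriv U j (christoffel U g l l k) x
      + (\<Sum>m\<in>UNIV. christoffel U g l l m x * christoffel U g m j k x
                - christoffel U g l j m x * christoffel U g m l k x)))"

lemma partial_deriv_eqI:
  assumes "open U" "x \<in> U" "(u has_derivative u') (at x)"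
  shows "partial_deriv U i u x = u' (axis i 1)"
  unfolding partial_deriv_def at_within_open[OF assms(2,1)] frechet_derivative_at[OF assms(3), symmetric] ..

lemma partial_deriv_works:
  assumes "open U" "x \<in> U" "u differentiable at x"
  shows "(u has_derivative frechet_derivative u (at x)) (at x)"
    and "partial_deriv U i u x = frechet_derivative u (at x) (axis i 1)"
  using assms(3) frechet_derivative_works partial_deriv_def at_within_open[OF assms(2,1)]
  by (blast, metis)

lemma partial_deriv_add:
  assumes "open U" "x \<in> U" "u differentiable at x" "v differentiable at x"
  shows "partial_deriv U i (\<lambda>y. u y + v y) x = partial_deriv U i u x + partial_deriv U i v x"
  unfolding partial_deriv_works(2)[OF assms(1-3)] partial_deriv_works(2)[OF assms(1,2,4)]
  by (rule partial_deriv_eqI[OF assms(1,2) has_derivative_add,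
      OF partial_deriv_works(1)[OF assms(1-3)] partial_deriv_works(1)[OF assms(1,2,4)]])

lemma partial_deriv_mult:
  assumes "open U" "x \<in> U" "u differentiable at x" "v differentiable at x"
  shows "partial_deriv U i (\<lambda>y. u y * v y) x = partial_deriv U i u x * v x + u x * partial_deriv U i v x"
proof -
  have "partial_deriv U i (\<lambda>y. u y * v y) x
     = u x * frechet_derivative v (at x) (axis i 1) + frechet_derivative u (at x) (axis i 1) * v x"
    by (rule partial_deriv_eqI[OF assms(1,2) has_derivative_mult,
      OF partial_deriv_works(1)[OF assms(1-3)] partial_deriv_works(1)[OF assms(1,2,4)]])
  then show ?thesis
    unfolding partial_deriv_works(2)[OF assms(1-3)] partial_deriv_works(2)[OF assms(1,2,4)] by simp
qed

lemma partial_deriv_sum: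
  fixes u :: "'a::finite \<Rightarrow> real^'n \<Rightarrow> real"
  assumes "open U" "x \<in> U" "\<And>a. u a differentiable at x"
  shows "partial_deriv U i (\<lambda>y. \<Sum>a\<in>UNIV. u a y) x = (\<Sum>a\<in>UNIV. partial_deriv U i (u a) x)"
proof -
  have "((\<lambda>y. \<Sum>a\<in>UNIV. u a y) has_derivative (\<lambda>h. \<Sum>a\<in>UNIV. frechet_derivative (u a) (at x) h)) (at x)"
    by (rule has_derivative_sum) (rule partial_deriv_works(1)[OF assms])
  then show ?thesis
    unfolding partial_deriv_works(2)[OF assms] by (rule partial_deriv_eqI[OF assms(1,2)])
qed

lemma partial_deriv_const: "open U \<Longrightarrow> x \<in> U \<Longrightarrow> partial_deriv U i (\<lambda>_. c) x = 0"
  by (rule partial_deriv_eqI[OF _ _ has_derivative_const])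

lemma partial_deriv_cong:
  assumes "open U" "x \<in> U" "\<And>y. y \<in> U \<Longrightarrow> u y = v y"
  shows "partial_deriv U i u x = partial_deriv U i v x"
proof -
  have "(u has_derivative w) (at x) \<longleftrightarrow> (v has_derivative w) (at x)" for w
  proof
    show "(v has_derivative w) (at x)" if "(u has_derivative w) (at x)"
      by (rule has_derivative_transform_within_open[OF that assms(1,2)]) (rule assms(3))
    show "(u has_derivative w) (at x)" if "(v has_derivative w) (at x)"
      by (rule has_derivative_transform_within_open[OF that assms(1,2)]) (rule assms(3)[symmetric])
  qed
  then show ?thesis unfolding partial_deriv_def at_within_open[OF assms(2,1)] frechet_derivative_def by simp
qed

lemma differentiable_on_openD: "u differentiable_on U \<Longrightarrow> open U \<Longrightarrow> x \<in> U \<Longrightarrow> u differentiable at x"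
  by (metis at_within_open differentiable_on_def)

lemma partial_deriv_line:
  fixes p :: "real^'n"
  assumes "open U" "u differentiable_on U" "p + s *\<^sub>R axis i 1 \<in> U"
  shows "((\<lambda>s. u (p + s *\<^sub>R axis i 1)) has_real_derivative partial_deriv U i u (p + s *\<^sub>R axis i 1)) (at s)"
proof -
  let ?z = "p + s *\<^sub>R axis i 1"
  have d: "u differentiable at ?z" using differentiable_on_openD assms by blast
  define L where "L = frechet_derivative u (at ?z)"
  have L: "(u has_derivative L) (at ?z)"
    using partial_deriv_works(1)[OF assms(1,3) d] by (simp add: L_def)
  have "((\<lambda>s. u (p + s *\<^sub>R axis i 1)) has_derivative (\<lambda>h. L (h *\<^sub>R axis i 1))) (at s)"
    by (rule has_derivative_compose[of "\<lambda>s. p + s *\<^sub>R axis i 1" "\<lambda>h. h *\<^sub>R axis i 1" s UNIV u L])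
       (use L in \<open>auto intro!: derivative_eq_intros\<close>)
  moreover have "L (h *\<^sub>R axis i 1) = partial_deriv U i u ?z * h" for h
    using linear_cmul[OF has_derivative_linear[OF L]] partial_deriv_works(2)[OF assms(1,3) d]
    by (simp add: L_def)
  ultimately show ?thesis by (simp add: has_field_derivative_def)
qed

lemma second_difference:
  fixes x :: "real^'n"
  assumes U: "open U" "C2_on U u" and h: "0 < h" "cball x (2 * h) \<subseteq> U"
  shows "\<exists>z. dist x z \<le> 2 * h \<and>
    u (x + h *\<^sub>R axis i 1 + h *\<^sub>R axis j 1) - u (x + h *\<^sub>R axis i 1) - u (x + h *\<^sub>R axis j 1) + u x
      = h * h * partial_deriv U j (partial_deriv U i u) z"
proof -
  let ?p = "\<lambda>s t. x + s *\<^sub>R axis i 1 + t *\<^sub>R axis j (1::real)"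
  have near: "dist x (?p s t) \<le> 2 * h" if "0 \<le> s" "s \<le> h" "0 \<le> t" "t \<le> h" for s t
  proof -
    have "dist x (?p s t) = norm (s *\<^sub>R axis i 1 + t *\<^sub>R axis j (1::real))"
      by (metis add.assoc add_diff_cancel_left' dist_commute dist_norm)
    also have "\<dots> \<le> \<bar>s\<bar> + \<bar>t\<bar>" by (rule order_trans[OF norm_triangle_ineq]) simp
    finally show ?thesis using that by simp
  qed
  have inU: "?p s t \<in> U" if "0 \<le> s" "s \<le> h" "0 \<le> t" "t \<le> h" for s t
    using near[OF that] h(2) by (auto simp: subset_iff)
  have d0: "u differentiable_on U" and d1: "partial_deriv U i u differentiable_on U"
    using U(2) by (auto simp: C2_on_def C1_on_def)
  define \<phi> where "\<phi> = (\<lambda>s. u (?p s h) - u (?p s 0))"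
  have sw: "?p s t = (x + t *\<^sub>R axis j 1) + s *\<^sub>R axis i 1" for s t by (simp add: add_ac)
  have l: "((\<lambda>s. u (?p s t)) has_real_derivative partial_deriv U i u (?p s t)) (at s)"
    if "0 \<le> s" "s \<le> h" "0 \<le> t" "t \<le> h" for s t
    using partial_deriv_line[OF U(1) d0, of "x + t *\<^sub>R axis j 1" s i] inU[OF that] unfolding sw by simp
  have "\<exists>\<xi>>0. \<xi> < h \<and> \<phi> h - \<phi> 0 = (h - 0) * (partial_deriv U i u (?p \<xi> h) - partial_deriv U i u (?p \<xi> 0))"
    unfolding \<phi>_def by (rule MVT2[OF h(1)]) (rule DERIV_diff; rule l; use h(1) in simp)
  then obtain \<xi> where \<xi>: "0 < \<xi>" "\<xi> < h"
    and e1: "\<phi> h - \<phi> 0 = h * (partial_deriv U i u (?p \<xi> h) - partial_deriv U i u (?p \<xi> 0))" by auto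
  have "\<exists>\<eta>>0. \<eta> < h \<and> partial_deriv U i u (?p \<xi> h) - partial_deriv U i u (?p \<xi> 0)
      = (h - 0) * partial_deriv U j (partial_deriv U i u) (?p \<xi> \<eta>)"
    by (rule MVT2[OF h(1)]) (rule partial_deriv_line[OF U(1) d1]; rule inU; use \<xi> in simp)
  then obtain \<eta> where \<eta>: "0 < \<eta>" "\<eta> < h" and e2: "partial_deriv U i u (?p \<xi> h) - partial_deriv U i u (?p \<xi> 0)
      = h * partial_deriv U j (partial_deriv U i u) (?p \<xi> \<eta>)" by auto
  show ?thesis
  proof (intro exI conjI)
    show "dist x (?p \<xi> \<eta>) \<le> 2 * h" using near \<xi> \<eta> by simp
    show "u (x + h *\<^sub>R axis i 1 + h *\<^sub>R axis j 1) - u (x + h *\<^sub>R axis i 1) - u (x + h *\<^sub>R axis j 1) + u x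
      = h * h * partial_deriv U j (partial_deriv U i u) (?p \<xi> \<eta>)"
      using e1 unfolding e2 \<phi>_def by (simp add: mult.assoc)
  qed
qed

lemma partial_deriv_commute:
  fixes x :: "real^'n"
  assumes U: "open U" "C2_on U u" and x: "x \<in> U"
  shows "partial_deriv U j (partial_deriv U i u) x = partial_deriv U i (partial_deriv U j u) x"
    (is "?a x = ?b x")
proof (rule ccontr)
  assume ne: "?a x \<noteq> ?b x"
  define e where "e = dist (?a x) (?b x) / 2"
  have e: "e > 0" using ne by (simp add: e_def)
  have "isCont ?a x" "isCont ?b x"
    using U x by (auto simp: C2_on_def C1_on_def continuous_on_eq_continuous_at)
  then have "\<exists>d>0. \<forall>z. dist z x < d \<longrightarrow> dist (?a z) (?a x) < e"
    "\<exists>d>0. \<forall>z. dist z x < d \<longrightarrow> dist (?b z) (?b x) < e"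
    using e unfolding continuous_at_eps_delta by (simp_all add: dist_norm)
  then obtain d1 d2 where d: "d1 > 0" "d2 > 0"
    and c: "\<And>z. dist z x < d1 \<Longrightarrow> dist (?a z) (?a x) < e" "\<And>z. dist z x < d2 \<Longrightarrow> dist (?b z) (?b x) < e"
    by blast
  obtain r where r: "r > 0" "cball x r \<subseteq> U" using U(1) x open_contains_cball by blast
  define h where "h = min r (min d1 d2) / 4"
  have h: "h > 0" "2 * h < r" "2 * h < d1" "2 * h < d2" using r d by (auto simp: h_def)
  have "cball x (2 * h) \<subseteq> U" using r(2) h(2) by (auto simp: subset_iff)
  then obtain y z where y: "dist x y \<le> 2 * h" and z: "dist x z \<le> 2 * h" and "h * h * ?a y = h * h * ?b z"
    using second_difference[OF U h(1), of x i j] second_difference[OF U h(1), of x j i]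
    by (auto simp: algebra_simps)
  then have "?a y = ?b z" using h(1) by simp
  moreover have "dist (?a y) (?a x) < e" "dist (?b z) (?b x) < e"
    by (rule c, use y z h in \<open>simp add: dist_commute\<close>)+
  ultimately show False
    using dist_triangle[of "?a x" "?b x" "?a y"] by (simp add: e_def dist_commute)
qed

lemma metric_pos: "v \<bullet> (graph_metric D f x *v v) = v \<bullet> v + (\<Sum>\<alpha>\<in>UNIV. (grad D f \<alpha> x \<bullet> v)\<^sup>2)"
proof -
  have "(graph_metric D f x *v v) $ i = v $ i + (\<Sum>\<alpha>\<in>UNIV. D1 D f \<alpha> i x * (grad D f \<alpha> x \<bullet> v))" for i
    by (simp add: graph_metric_def matrix_vector_mult_def inner_vec_def grad_def distrib_right sum.distrib
        sum_distrib_left sum_distrib_right if_distrib[of "\<lambda>t. t * _"] cong: if_cong)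
       (subst sum.swap, simp add: mult.assoc)
  then have "v \<bullet> (graph_metric D f x *v v)
      = v \<bullet> v + (\<Sum>i\<in>UNIV. \<Sum>\<alpha>\<in>UNIV. v $ i * (D1 D f \<alpha> i x * (grad D f \<alpha> x \<bullet> v)))"
    by (simp add: inner_vec_def distrib_left sum.distrib sum_distrib_left)
  also have "(\<Sum>i\<in>UNIV. \<Sum>\<alpha>\<in>UNIV. v $ i * (D1 D f \<alpha> i x * (grad D f \<alpha> x \<bullet> v)))
      = (\<Sum>\<alpha>\<in>UNIV. (\<Sum>i\<in>UNIV. grad D f \<alpha> x $ i * v $ i) * (grad D f \<alpha> x \<bullet> v))"
    by (subst sum.swap) (simp add: sum_distrib_left sum_distrib_right grad_def mult_ac)
  finally show ?thesis by (simp add: inner_vec_def power2_eq_square)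
qed

lemma metric_invertible: "invertible (graph_metric D f x)"
proof -
  have "v = 0" if "graph_metric D f x *v v = 0" for v
  proof -
    have "v \<bullet> v + (\<Sum>\<alpha>\<in>UNIV. (grad D f \<alpha> x \<bullet> v)\<^sup>2) = 0" using metric_pos[of v D f x] that by simp
    moreover have "(\<Sum>\<alpha>\<in>UNIV. (grad D f \<alpha> x \<bullet> v)\<^sup>2) \<ge> 0" by (simp add: sum_nonneg)
    ultimately have "v \<bullet> v \<le> 0" by linarith
    then show ?thesis by (metis inner_ge_zero inner_eq_zero_iff order_antisym)
  qed
  then show ?thesis by (simp add: invertible_left_inverse matrix_left_invertible_ker)
qed

lemma inv_metric:
  "graph_metric D f x ** inv_metric D f x = mat 1" "inv_metric D f x ** graph_metric D f x = mat 1"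
  using someI_ex[OF metric_invertible[unfolded invertible_def, of D f x]]
  by (auto simp: inv_metric_def matrix_inv_def)

lemma inv_metric_entries:
  "(\<Sum>k\<in>UNIV. graph_metric D f x $ i $ k * inv_metric D f x $ k $ j) = (if i = j then 1 else 0)"
  "(\<Sum>k\<in>UNIV. inv_metric D f x $ i $ k * graph_metric D f x $ k $ j) = (if i = j then 1 else 0)"
  using inv_metric[of D f x] by (simp_all add: matrix_matrix_mult_def mat_def vec_eq_iff)

lemma metric_sym: "graph_metric D f x $ i $ j = graph_metric D f x $ j $ i"
  by (simp add: graph_metric_def mult.commute)

lemma inv_metric_sym: "inv_metric D f x $ i $ j = inv_metric D f x $ j $ i"
proof -
  let ?g = "graph_metric D f x" and ?h = "inv_metric D f x"
  have t: "transpose ?g = ?g" by (simp add: transpose_def vec_eq_iff metric_sym)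
  have "transpose ?h ** ?g = mat 1"
    using inv_metric(1)[of D f x] by (metis matrix_transpose_mul t transpose_mat)
  then have "transpose ?h = ?h"
    by (metis inv_metric(1) matrix_mul_assoc matrix_mul_lid matrix_mul_rid)
  then show ?thesis by (simp add: transpose_def vec_eq_iff)
qed

lemma differentiable_det:
  fixes A :: "real^'n \<Rightarrow> real^'k^'k"
  assumes "\<And>i j. (\<lambda>y. A y $ i $ j) differentiable at x"
  shows "(\<lambda>y. det (A y)) differentiable at x"
proof -
  have "((\<lambda>y. A y $ i $ j) has_derivative frechet_derivative (\<lambda>y. A y $ i $ j) (at x)) (at x)" for i j
    using assms frechet_derivative_works by blast
  then have "(\<lambda>y. \<Prod>i\<in>UNIV. A y $ i $ p i) differentiable at x" for p
    unfolding differentiable_def by - (rule exI, rule has_derivative_prod)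
  then show ?thesis unfolding det_def
    by (intro differentiable_sum differentiable_mult) (auto simp: finite_permutations)
qed

lemma differentiable_inv_metric:
  assumes g: "\<And>i j. (\<lambda>y. graph_metric D f y $ i $ j) differentiable at x"
  shows "(\<lambda>y. inv_metric D f y $ k $ l) differentiable at x"
proof -
  have nz: "det (graph_metric D f y) \<noteq> 0" for y using metric_invertible invertible_det_nz by blast
  have "inv_metric D f y $ k $ l =
     det (\<chi> i j. if j = k then axis l 1 $ i else graph_metric D f y $ i $ j) / det (graph_metric D f y)" for y
  proof -
    have "graph_metric D f y *v (inv_metric D f y *v axis l 1) = axis l 1"
      by (simp add: matrix_vector_mul_assoc inv_metric)
    then have "inv_metric D f y *v axis l 1 =
       (\<chi> k. det (\<chi> i j. if j = k then axis l 1 $ i else graph_metric D f y $ i $ j) / det (graph_metric D f y))"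
      using cramer[OF nz] by blast
    then show ?thesis
      by (simp add: vec_eq_iff matrix_vector_mult_basis column_def)
  qed
  moreover have "(\<lambda>y. det (\<chi> i j. if j = k then axis l 1 $ i else graph_metric D f y $ i $ j)) differentiable at x"
    by (rule differentiable_det, rename_tac i j, case_tac "j = k") (simp_all add: g)
  ultimately show ?thesis
    using differentiable_det[OF g] nz by (simp add: differentiable_divide)
qed

theorem scalar_curv_eq_intrinsic:
  fixes f :: "real^'n \<Rightarrow> real^'m"
  assumes U: "open U" and c2: "\<And>\<alpha>. C2_on U (\<lambda>y. f y $ \<alpha>)"
    and c3: "\<And>\<alpha> i. C2_on U (partial_deriv U i (\<lambda>y. f y $ \<alpha>))" and x: "x \<in> U"
  shows "scalar_curv U f x = intrinsic_scalar_curv U (graph_metric U f) x"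
proof -
  let ?g = "\<lambda>i j y. graph_metric U f y $ i $ j" and ?h = "\<lambda>i j. inv_metric U f x $ i $ j"
  let ?\<Gamma> = "christoffel U (graph_metric U f)"
  define A where "A = (\<lambda>p j k y. \<Sum>\<alpha>\<in>UNIV. D1 U f \<alpha> p y * D2 U f \<alpha> j k y)"
  define H where "H = (\<lambda>p q j k y. \<Sum>\<alpha>\<in>UNIV. D2 U f \<alpha> p q y * D2 U f \<alpha> j k y)"
  define T where "T = (\<lambda>p j k q y. \<Sum>\<alpha>\<in>UNIV. D1 U f \<alpha> p y * partial_deriv U q (D2 U f \<alpha> j k) y)"
  have dd1: "D1 U f \<alpha> i differentiable at y" if "y \<in> U" for \<alpha> i y
    using c3[of i \<alpha>] that U by (auto simp: C2_on_def D1_def intro: differentiable_on_openD)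
  have dd2: "D2 U f \<alpha> i j differentiable at y" if "y \<in> U" for \<alpha> i j y
    using c3[of i \<alpha>] that U by (auto simp: C2_on_def C1_on_def D1_def D2_def intro: differentiable_on_openD)
  have sym2: "D2 U f \<alpha> i j y = D2 U f \<alpha> j i y" if "y \<in> U" for \<alpha> i j y
    using partial_deriv_commute[OF U c2 that] by (simp add: D2_def D1_def)
  have sym3: "partial_deriv U q (D2 U f \<alpha> j k) x = partial_deriv U j (D2 U f \<alpha> q k) x" for q j k \<alpha>
  proof -
    have "partial_deriv U q (D2 U f \<alpha> j k) x = partial_deriv U q (D2 U f \<alpha> k j) x"
      by (rule partial_deriv_cong[OF U x]) (rule sym2)
    also have "\<dots> = partial_deriv U j (D2 U f \<alpha> k q) x"
      using partial_deriv_commute[OF U c3 x] by (simp add: D2_def D1_def)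
    also have "\<dots> = partial_deriv U j (D2 U f \<alpha> q k) x"
      by (rule partial_deriv_cong[OF U x]) (rule sym2)
    finally show ?thesis .
  qed
  have g_eq: "?g i j = (\<lambda>y. (if i = j then 1 else 0) + (\<Sum>\<alpha>\<in>UNIV. D1 U f \<alpha> i y * D1 U f \<alpha> j y))" for i j
    by (simp add: graph_metric_def fun_eq_iff)
  have dg: "?g i j differentiable at y" if "y \<in> U" for i j y
    unfolding g_eq using dd1[OF that] by (intro differentiable_add differentiable_sum differentiable_mult) auto
  have pg: "partial_deriv U q (?g i j) y = A j i q y + A i j q y" if y: "y \<in> U" for i j q y
  proof -
    have m: "(\<lambda>y. D1 U f \<alpha> i y * D1 U f \<alpha> j y) differentiable at y" for \<alpha>
      using dd1[OF y] by (intro differentiable_mult)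
    have s: "(\<lambda>y. \<Sum>\<alpha>\<in>UNIV. D1 U f \<alpha> i y * D1 U f \<alpha> j y) differentiable at y"
      using m by (intro differentiable_sum) auto
    have "partial_deriv U q (?g i j) y = (\<Sum>\<alpha>\<in>UNIV. D2 U f \<alpha> i q y * D1 U f \<alpha> j y + D1 U f \<alpha> i y * D2 U f \<alpha> j q y)"
      unfolding g_eq partial_deriv_add[OF U y differentiable_const s] partial_deriv_const[OF U y]
        partial_deriv_sum[OF U y m] partial_deriv_mult[OF U y dd1[OF y] dd1[OF y]]
      by (simp add: D2_def)
    then show ?thesis by (simp add: A_def sum.distrib mult.commute)
  qed
  have symA: "A p i j y = A p j i y" if "y \<in> U" for p i j y
    using sym2[OF that] by (simp add: A_def)
  have \<Gamma>: "?\<Gamma> k i j y = (\<Sum>l\<in>UNIV. inv_metric U f y $ k $ l * A l i j y)" if y: "y \<in> U" for k i j y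
  proof -
    have "partial_deriv U i (?g j l) y + partial_deriv U j (?g i l) y - partial_deriv U l (?g i j) y = 2 * A l i j y" for l
      using symA[OF y] unfolding pg[OF y] by (metis (no_types, lifting) add.commute add.left_commute add_diff_cancel_right' mult_2 add.assoc)
    then show ?thesis by (simp add: christoffel_def inv_metric_def sum_distrib_left mult_ac)
  qed
  have low: "(\<Sum>l\<in>UNIV. ?g p l y * ?\<Gamma> l j k y) = A p j k y" if y: "y \<in> U" for p j k y
  proof -
    have "(\<Sum>l\<in>UNIV. ?g p l y * ?\<Gamma> l j k y) = (\<Sum>q\<in>UNIV. (\<Sum>l\<in>UNIV. ?g p l y * inv_metric U f y $ l $ q) * A q j k y)"
      unfolding \<Gamma>[OF y] sum_distrib_left sum_distrib_right by (subst sum.swap) (simp add: mult.assoc)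
    then show ?thesis by (simp add: inv_metric_entries if_distrib[of "\<lambda>t. t * _"] cong: if_cong)
  qed
  have dA: "A p j k differentiable at x" for p j k
    unfolding A_def using dd1[OF x] dd2[OF x] by (intro differentiable_sum differentiable_mult) auto
  have d\<Gamma>: "?\<Gamma> l j k differentiable at x" for l j k
  proof -
    have "(\<lambda>y. \<Sum>q\<in>UNIV. inv_metric U f y $ l $ q * A q j k y) differentiable at x"
      using differentiable_inv_metric[OF dg[OF x]] dA by (intro differentiable_sum differentiable_mult) auto
    then show ?thesis
      unfolding differentiable_def using has_derivative_transform_within_open[OF _ U x] \<Gamma> by (metis (no_types, lifting))
  qed
  have der: "(\<Sum>l\<in>UNIV. ?g p l x * partial_deriv U q (?\<Gamma> l j k) x)
      = H p q j k x + T p j k q x - (\<Sum>l\<in>UNIV. (A l p q x + A p l q x) * ?\<Gamma> l j k x)" for p q j k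
  proof -
    have m: "(\<lambda>y. ?g p l y * ?\<Gamma> l j k y) differentiable at x" for l
      using dg[OF x] d\<Gamma> by (intro differentiable_mult)
    have n: "(\<lambda>y. D1 U f \<alpha> p y * D2 U f \<alpha> j k y) differentiable at x" for \<alpha>
      using dd1[OF x] dd2[OF x] by (intro differentiable_mult)
    have "partial_deriv U q (\<lambda>y. \<Sum>l\<in>UNIV. ?g p l y * ?\<Gamma> l j k y) x = partial_deriv U q (A p j k) x"
      by (rule partial_deriv_cong[OF U x]) (rule low)
    moreover have "partial_deriv U q (\<lambda>y. \<Sum>l\<in>UNIV. ?g p l y * ?\<Gamma> l j k y) x
       = (\<Sum>l\<in>UNIV. (A l p q x + A p l q x) * ?\<Gamma> l j k x) + (\<Sum>l\<in>UNIV. ?g p l x * partial_deriv U q (?\<Gamma> l j k) x)"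
      unfolding partial_deriv_sum[OF U x m] partial_deriv_mult[OF U x dg[OF x] d\<Gamma>] pg[OF x] sum.distrib ..
    moreover have "partial_deriv U q (A p j k) x = H p q j k x + T p j k q x"
      unfolding A_def partial_deriv_sum[OF U x n] partial_deriv_mult[OF U x dd1[OF x] dd2[OF x]]
      by (simp add: H_def T_def D2_def sum.distrib)
    ultimately show ?thesis by linarith
  qed
  define K where "K = (\<lambda>l q j k. partial_deriv U q (?\<Gamma> l j k) x - partial_deriv U j (?\<Gamma> l q k) x
      + (\<Sum>m\<in>UNIV. ?\<Gamma> l q m x * ?\<Gamma> m j k x - ?\<Gamma> l j m x * ?\<Gamma> m q k x))"
  let ?B = "\<lambda>i j. second_ff U f i j x"
  have tt: "tangent_vec U f i x \<bullet> tangent_vec U f j x = ?g i j x" for i j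
    by (simp add: tangent_vec_def graph_metric_def inner_axis_axis) (simp add: inner_vec_def)
  have ht: "hess_vec U f i j x \<bullet> tangent_vec U f k x = A k i j x" for i j k
    by (simp add: hess_vec_def tangent_vec_def inner_vec_def A_def mult.commute)
  have hh: "hess_vec U f i j x \<bullet> hess_vec U f k l x = H i j k l x" for i j k l
    by (simp add: hess_vec_def inner_vec_def H_def)
  have B: "?B i j = hess_vec U f i j x - (\<Sum>l\<in>UNIV. ?\<Gamma> l i j x *\<^sub>R tangent_vec U f l x)" for i j
    unfolding second_ff_def \<Gamma>[OF x] ht scaleR_sum_left
    by (subst sum.swap) (simp add: inv_metric_sym)
  have Bt: "?B i j \<bullet> tangent_vec U f p x = 0" for i j p
  proof -
    have "?B i j \<bullet> tangent_vec U f p x = A p i j x - (\<Sum>l\<in>UNIV. ?g p l x * ?\<Gamma> l i j x)"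
      by (simp add: B inner_diff_left inner_sum_left ht tt metric_sym[of U f x p] mult.commute)
    then show ?thesis using low[OF x] by simp
  qed
  have BB: "?B p q \<bullet> ?B j k = H p q j k x - (\<Sum>l\<in>UNIV. A l p q x * ?\<Gamma> l j k x)" for p q j k
  proof -
    have "?B p q \<bullet> ?B j k = hess_vec U f p q x \<bullet> ?B j k"
      using Bt[of j k] by (simp add: B[of p q] inner_diff_left inner_sum_left inner_commute[of "tangent_vec U f _ x"])
    then show ?thesis by (simp add: B[of j k] inner_diff_right inner_sum_right hh ht mult.commute)
  qed
  have gK: "(\<Sum>l\<in>UNIV. ?g p l x * K l q j k) = ?B p q \<bullet> ?B j k - ?B p j \<bullet> ?B q k" for p q j k
  proof -
    have quad: "(\<Sum>l\<in>UNIV. ?g p l x * (\<Sum>m\<in>UNIV. ?\<Gamma> l q m x * ?\<Gamma> m j k x)) = (\<Sum>m\<in>UNIV. A p m q x * ?\<Gamma> m j k x)" for q j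
    proof -
      have "(\<Sum>l\<in>UNIV. ?g p l x * (\<Sum>m\<in>UNIV. ?\<Gamma> l q m x * ?\<Gamma> m j k x))
          = (\<Sum>m\<in>UNIV. (\<Sum>l\<in>UNIV. ?g p l x * ?\<Gamma> l q m x) * ?\<Gamma> m j k x)"
        unfolding sum_distrib_left sum_distrib_right by (subst sum.swap) (simp add: mult.assoc)
      then show ?thesis using low[OF x] symA[OF x] by simp
    qed
    have "(\<Sum>l\<in>UNIV. ?g p l x * K l q j k) =
        (\<Sum>l\<in>UNIV. ?g p l x * partial_deriv U q (?\<Gamma> l j k) x) - (\<Sum>l\<in>UNIV. ?g p l x * partial_deriv U j (?\<Gamma> l q k) x)
        + (\<Sum>l\<in>UNIV. ?g p l x * (\<Sum>m\<in>UNIV. ?\<Gamma> l q m x * ?\<Gamma> m j k x))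
        - (\<Sum>l\<in>UNIV. ?g p l x * (\<Sum>m\<in>UNIV. ?\<Gamma> l j m x * ?\<Gamma> m q k x))"
      by (simp add: K_def sum_subtractf sum.distrib ring_distribs)
    moreover have "T p j k q x = T p q k j x" using sym3 by (simp add: T_def)
    ultimately show ?thesis
      unfolding der quad BB by (simp add: sum.distrib ring_distribs)
  qed
  have K: "K l q j k = (\<Sum>p\<in>UNIV. ?h l p * (?B p q \<bullet> ?B j k - ?B p j \<bullet> ?B q k))" for l q j k
  proof -
    have "(\<Sum>p\<in>UNIV. ?h l p * (\<Sum>m\<in>UNIV. ?g p m x * K m q j k)) = (\<Sum>m\<in>UNIV. (\<Sum>p\<in>UNIV. ?h l p * ?g p m x) * K m q j k)"
      unfolding sum_distrib_left sum_distrib_right by (subst sum.swap) (simp add: mult.assoc)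
    also have "\<dots> = K l q j k"
      by (simp add: inv_metric_entries if_distrib[of "\<lambda>t. t * _"] cong: if_cong)
    finally show ?thesis by (simp add: gK)
  qed
  have symB: "?B i j = ?B j i" for i j
    using sym2[OF x] by (simp add: second_ff_def hess_vec_def)
  have "intrinsic_scalar_curv U (graph_metric U f) x = (\<Sum>j\<in>UNIV. \<Sum>k\<in>UNIV. \<Sum>l\<in>UNIV. ?h j k * K l l j k)"
    by (simp add: intrinsic_scalar_curv_def K_def inv_metric_def)
  also have "\<dots> = (\<Sum>j\<in>UNIV. \<Sum>k\<in>UNIV. \<Sum>l\<in>UNIV. \<Sum>i\<in>UNIV. ?h i l * ?h j k * (?B i l \<bullet> ?B j k))
      - (\<Sum>j\<in>UNIV. \<Sum>k\<in>UNIV. \<Sum>l\<in>UNIV. \<Sum>i\<in>UNIV. ?h i l * ?h j k * (?B i j \<bullet> ?B l k))"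
    by (simp add: K sum_distrib_left sum_subtractf ring_distribs inv_metric_sym mult_ac)
  also have "(\<Sum>j\<in>UNIV. \<Sum>k\<in>UNIV. \<Sum>l\<in>UNIV. \<Sum>i\<in>UNIV. ?h i l * ?h j k * (?B i j \<bullet> ?B l k))
      = (\<Sum>j\<in>UNIV. \<Sum>k\<in>UNIV. \<Sum>l\<in>UNIV. \<Sum>i\<in>UNIV. ?h i l * ?h j k * (?B i k \<bullet> ?B j l))"
    by (subst sum.swap) (simp add: symB inv_metric_sym)
  finally have I: "intrinsic_scalar_curv U (graph_metric U f) x =
     (\<Sum>j\<in>UNIV. \<Sum>k\<in>UNIV. \<Sum>l\<in>UNIV. \<Sum>i\<in>UNIV. ?h i l * ?h j k * riemann U f i j k l x)"
    by (simp add: riemann_def sum_subtractf ring_distribs)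
  have "scalar_curv U f x = (\<Sum>j\<in>UNIV. \<Sum>i\<in>UNIV. \<Sum>k\<in>UNIV. \<Sum>l\<in>UNIV. ?h i l * ?h j k * riemann U f i j k l x)"
    unfolding scalar_curv_def by (rule sum.swap)
  also have "\<dots> = (\<Sum>j\<in>UNIV. \<Sum>k\<in>UNIV. \<Sum>i\<in>UNIV. \<Sum>l\<in>UNIV. ?h i l * ?h j k * riemann U f i j k l x)"
    by (intro sum.cong refl sum.swap)
  also have "\<dots> = (\<Sum>j\<in>UNIV. \<Sum>k\<in>UNIV. \<Sum>l\<in>UNIV. \<Sum>i\<in>UNIV. ?h i l * ?h j k * riemann U f i j k l x)"
    by (intro sum.cong refl sum.swap)
  finally show ?thesis using I by simp
qed

end

theory Submission
 imports Defs
begin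

text \<open>Everything rests on one vector field. Write \<open>h\<close> for the inverse metric and \<open>u\<^sup>\<alpha>\<close> for the Riemannian
gradient of \<open>f\<^sup>\<alpha>\<close>, and let
\<open>X\<^sub>j = \<Sum> (h\<^sup>i\<^sup>k u\<^sup>\<alpha>\<^sub>j - h\<^sup>i\<^sup>j u\<^sup>\<alpha>\<^sub>k) f\<^sup>\<alpha>\<^sub>i\<^sub>k\<close> (\<open>flux_field\<close>). Its divergence is \<open>S + S\<^sup>\<bottom>\<close>: the coefficient of
\<open>f\<^sup>\<alpha>\<^sub>i\<^sub>k\<^sub>j\<close> is antisymmetric in \<open>j, k\<close>, so third derivatives cancel, and what remains is an algebraic
identity between the Hessians (\<open>flux_divergence_algebra\<close>). For maps of class \<open>C\<^sup>2\<close> third derivatives do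
not exist and the identity holds weakly, by the commutation of weak derivatives
(\<open>weak_divergence_flux\<close>). At infinity \<open>X\<close> differs from the integrand of the ADM mass by a term that
does not contribute to the limit. Since \<open>dM / \<surd>G\<close> is Lebesgue measure, integrating \<open>div X\<close> over the
exterior domain inside a large ball gives the mass, once the flux through \<open>\<Sigma>\<close> is known.

On \<open>\<Sigma>\<close> the map is locally constant, so \<open>Df\<^sup>\<alpha> = \<lambda>\<^sup>\<alpha> N\<close> with the unit normal \<open>N\<close>, and the tangential trace
of the Hessian of \<open>f\<^sup>\<alpha>\<close> is \<open>\<lambda>\<^sup>\<alpha> div N\<close>. As the inverse metric is then explicit, \<open>X \<bullet> N\<close> equals
\<open>|Df|\<^sup>2 / (1 + |Df|\<^sup>2) div N\<close>, the integrand of the boundary term up to sign (\<open>flux_normal\<close>).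

The divergence theorem itself is applied on a domain that is only Lipschitz, with Hausdorff measure as
area. Both difficulties dissolve by the structure of the problem. Where \<open>Df \<noteq> 0\<close>, the boundary is a level
set of some \<open>f\<^sup>\<alpha>\<close>, and implicit differentiation turns the Lipschitz chart into a \<open>C\<^sup>1\<close> chart (\<open>C1_chart\<close>).
Where \<open>Df = 0\<close>, the field \<open>X\<close> vanishes; both \<open>X\<close> and the gradient of \<open>|Df|\<^sup>2\<close> are \<open>O(|Df|)\<close>, hence a
cut-off by a function of \<open>k |Df|\<^sup>2\<close> removes a neighbourhood of these points at no cost as \<open>k\<close> tends to
infinity (\<open>divergence_cutoff_limit\<close>). So the theorem is needed on \<open>C\<^sup>1\<close> graphs only
(\<open>gauss_green\<close>), and there Hausdorff measure is the familiar surface integral (\<open>area_graph\<close>): it is so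
on hyperplanes by the uniqueness of translation-invariant measures, and small pieces of \<open>C\<^sup>1\<close> graphs are
nearly isometric to pieces of their tangent planes.\<close>

text \<open>Sums over all indices of a finite type, so that tensor expressions keep a readable size.\<close>

abbreviation sum_all :: "('a \<Rightarrow> 'b::comm_monoid_add) \<Rightarrow> 'b" (binder "\<Sigma>" 10) where
 "sum_all f \<equiv> sum f UNIV"

abbreviation kron :: "'a \<Rightarrow> 'a \<Rightarrow> 'b::zero_neq_one" where
 "kron i j \<equiv> if i = j then 1 else 0"

abbreviation decay :: "real \<Rightarrow> ('a::real_normed_vector \<Rightarrow> real) set" where
 "decay a \<equiv> O[at_infinity](\<lambda>x. norm x powr a)"

text \<open>Script letters for measures: \<open>\<H>\<close> and its approximations \<open>\<P>\<close>, the area \<open>\<A>\<close>, and below \<open>\<L>\<close> for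
Lebesgue measure on a hyperplane.\<close>

notation hausdorff_premeasure ("\<P>") and hausdorff_outer ("\<H>") and area_measure ("\<A>")

section \<open>Fubini along lines, and translation-invariant measures\<close>

text \<open>Each line in a direction \<open>w\<close> with \<open>e \<bullet> w = 1\<close> meets the slab in a half-open interval of length one.
Integrating over the slab therefore amounts to integrating over the lines, which gives Fubini's theorem
along any direction without a choice of coordinates.\<close>

definition slab :: "'a::real_inner \<Rightarrow> 'a set" where
 "slab e = {x. 0 \<le> e \<bullet> x \<and> e \<bullet> x < 1}"

lemma slab_borel [measurable]: "slab (e::'a::euclidean_space) \<in> sets borel"
 unfolding slab_def by measurable

abbreviation slab_int :: "'a::euclidean_space \<Rightarrow> ('a \<Rightarrow> ennreal) \<Rightarrow> ennreal" where
 "slab_int e F \<equiv> \<integral>\<^sup>+x. indicator (slab e) x * F x \<partial>lborel"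

lemma nn_integral_lborel_shift:
 fixes F :: "'a::euclidean_space \<Rightarrow> ennreal"
 assumes [measurable]: "F \<in> borel_measurable borel"
 shows "(\<integral>\<^sup>+x. F (x + c) \<partial>lborel) = (\<integral>\<^sup>+x. F x \<partial>lborel)"
proof -
 have "(\<integral>\<^sup>+x. F x \<partial>lborel) = (\<integral>\<^sup>+x. F x \<partial>distr lborel borel ((+) c))"
  by (simp add: lborel_distr_plus)
 also have "\<dots> = (\<integral>\<^sup>+x. F (c + x) \<partial>lborel)" by (subst nn_integral_distr) auto
 finally show ?thesis by (simp add: add.commute)
qed

lemma nn_integral_line_fubini:
 fixes e w :: "'a::euclidean_space" and F :: "'a \<Rightarrow> ennreal"
 assumes [measurable]: "F \<in> borel_measurable borel" and ew: "e \<bullet> w = 1"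
 shows "(\<integral>\<^sup>+x. F x \<partial>lborel) =
  (slab_int e (\<lambda>x. \<integral>\<^sup>+s. F (x + s *\<^sub>R w) \<partial>lborel))"
proof -
 have "(slab_int e (\<lambda>x. \<integral>\<^sup>+s. F (x + s *\<^sub>R w) \<partial>lborel))
   = (\<integral>\<^sup>+x. (\<integral>\<^sup>+s. indicator (slab e) x * F (x + s *\<^sub>R w) \<partial>lborel) \<partial>lborel)"
  by (subst nn_integral_cmult) auto
 also have "\<dots> = (\<integral>\<^sup>+s. (slab_int e (\<lambda>x. F (x + s *\<^sub>R w))) \<partial>(lborel::real measure))"
  by (rule lborel_pair.Fubini'[symmetric]) measurable
 also have "\<dots> = (\<integral>\<^sup>+s. (\<integral>\<^sup>+x. indicator (slab e) (x - s *\<^sub>R w) * F x \<partial>lborel) \<partial>(lborel::real measure))"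
 proof (rule nn_integral_cong)
  fix s :: real
  show "(slab_int e (\<lambda>x. F (x + s *\<^sub>R w)))
    = (\<integral>\<^sup>+x. indicator (slab e) (x - s *\<^sub>R w) * F x \<partial>lborel)"
   using nn_integral_lborel_shift[of "\<lambda>x. indicator (slab e) (x - s *\<^sub>R w) * F x" "s *\<^sub>R w"] by simp
 qed
 also have "\<dots> = (\<integral>\<^sup>+x. (\<integral>\<^sup>+s. indicator (slab e) (x - s *\<^sub>R w) * F x \<partial>(lborel::real measure)) \<partial>lborel)"
  by (rule lborel_pair.Fubini') measurable
 also have "\<dots> = (\<integral>\<^sup>+x. F x \<partial>lborel)"
 proof (rule nn_integral_cong)
  fix x :: 'a
  have eq: "indicator (slab e) (x - s *\<^sub>R w) = (indicator {e \<bullet> x - 1 <.. e \<bullet> x} s :: ennreal)" for s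
   by (auto simp: slab_def indicator_def inner_diff_right ew)
  show "(\<integral>\<^sup>+s. indicator (slab e) (x - s *\<^sub>R w) * F x \<partial>(lborel::real measure)) = F x"
   unfolding eq by (subst nn_integral_multc) auto
 qed
 finally show ?thesis by simp
qed

text \<open>A shear along \<open>w\<close> by an amount that does not change along \<open>w\<close> only translates each line in the
 direction \<open>w\<close>.\<close>

lemma nn_integral_shear:
 fixes e w :: "'a::euclidean_space" and F :: "'a \<Rightarrow> ennreal"
 assumes [measurable]: "F \<in> borel_measurable borel" "\<phi> \<in> borel_measurable borel" and ew: "e \<bullet> w = 1"
  and inv: "\<And>x s. \<phi> (x + s *\<^sub>R w) = \<phi> x"
 shows "(\<integral>\<^sup>+x. F (x + \<phi> x *\<^sub>R w) \<partial>lborel) = (\<integral>\<^sup>+x. F x \<partial>lborel)"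
proof -
 have "(\<integral>\<^sup>+s. F (x + s *\<^sub>R w + \<phi> x *\<^sub>R w) \<partial>lborel) = (\<integral>\<^sup>+s. F (x + s *\<^sub>R w) \<partial>lborel)" for x
  using nn_integral_lborel_shift[of "\<lambda>s. F (x + s *\<^sub>R w)" "\<phi> x"] by (simp add: algebra_simps)
 then show ?thesis
  by (subst (1 2) nn_integral_line_fubini[OF _ ew]) (simp_all add: inv)
qed

text \<open>The classical Fubini proof of the uniqueness of Haar measure, on a subgroup \<open>V\<close> that carries
 both measures.\<close>

lemma haar_unique_up_to_factor:
 fixes \<mu> m :: "'a::euclidean_space measure"
 assumes "sigma_finite_measure \<mu>" "sigma_finite_measure m"
  and [measurable_cong]: "sets \<mu> = sets borel" "sets m = sets borel"
  and inv: "\<And>v. v \<in> V \<Longrightarrow> distr \<mu> borel ((+) v) = \<mu>" "\<And>v. v \<in> V \<Longrightarrow> distr m borel ((+) v) = m"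
  and V: "AE x in \<mu>. x \<in> V" "AE x in m. x \<in> V" "\<And>v. v \<in> V \<Longrightarrow> - v \<in> V"
  and [measurable]: "B \<in> sets borel" "Q \<in> sets borel"
 shows "emeasure \<mu> B * emeasure m Q = emeasure m B * emeasure \<mu> (uminus -` Q)"
proof -
 interpret \<mu>: sigma_finite_measure \<mu> by fact
 interpret m: sigma_finite_measure m by fact
 interpret P: pair_sigma_finite \<mu> m ..
 have sh\<mu>: "(\<integral>\<^sup>+x. F (v + x) \<partial>\<mu>) = (\<integral>\<^sup>+x. F x \<partial>\<mu>)" if "v \<in> V" and [measurable]: "F \<in> borel_measurable borel" for v and F :: "'a \<Rightarrow> ennreal"
  by (subst inv(1)[OF that(1), symmetric], subst nn_integral_distr) measurable
 have shm: "(\<integral>\<^sup>+x. F (v + x) \<partial>m) = (\<integral>\<^sup>+x. F x \<partial>m)" if "v \<in> V" and [measurable]: "F \<in> borel_measurable borel" for v and F :: "'a \<Rightarrow> ennreal"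
  by (subst inv(2)[OF that(1), symmetric], subst nn_integral_distr) measurable
 have "emeasure \<mu> B * emeasure m Q = (\<integral>\<^sup>+x. indicator B x * emeasure m Q \<partial>\<mu>)"
  by (subst nn_integral_multc) auto
 also have "\<dots> = (\<integral>\<^sup>+x. (\<integral>\<^sup>+y. indicator B x * indicator Q (y - x) \<partial>m) \<partial>\<mu>)"
 proof (rule nn_integral_cong_AE, use V(1) in eventually_elim)
  fix x assume x: "x \<in> V"
  have "(\<integral>\<^sup>+y. indicator Q (- x + y) \<partial>m) = emeasure m Q"
   by (subst shm[OF V(3)[OF x]]) auto
  then show "indicator B x * emeasure m Q = (\<integral>\<^sup>+y. indicator B x * indicator Q (y - x) \<partial>m)"
   by (subst nn_integral_cmult) auto
 qed
 also have "\<dots> = (\<integral>\<^sup>+y. (\<integral>\<^sup>+x. indicator B x * indicator Q (y - x) \<partial>\<mu>) \<partial>m)"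
  by (rule P.Fubini'[symmetric]) measurable
 also have "\<dots> = (\<integral>\<^sup>+y. (\<integral>\<^sup>+x. indicator B (y + x) * indicator Q (- x) \<partial>\<mu>) \<partial>m)"
 proof (rule nn_integral_cong_AE, use V(2) in eventually_elim)
  fix y assume y: "y \<in> V"
  show "(\<integral>\<^sup>+x. indicator B x * indicator Q (y - x) \<partial>\<mu>) = (\<integral>\<^sup>+x. indicator B (y + x) * indicator Q (- x) \<partial>\<mu>)"
   by (subst sh\<mu>[OF y, of "\<lambda>x. indicator B x * indicator Q (y - x)", symmetric]) auto
 qed
 also have "\<dots> = (\<integral>\<^sup>+x. (\<integral>\<^sup>+y. indicator B (y + x) * indicator Q (- x) \<partial>m) \<partial>\<mu>)"
  by (rule P.Fubini') measurable
 also have "\<dots> = (\<integral>\<^sup>+x. emeasure m B * indicator Q (- x) \<partial>\<mu>)"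
 proof (rule nn_integral_cong_AE, use V(1) in eventually_elim)
  fix x assume x: "x \<in> V"
  have "(\<integral>\<^sup>+y. indicator B (y + x) \<partial>m) = (\<integral>\<^sup>+y. indicator B (x + y) \<partial>m)" by (simp add: add.commute)
  also have "\<dots> = emeasure m B" by (subst shm[OF x]) auto
  finally show "(\<integral>\<^sup>+y. indicator B (y + x) * indicator Q (- x) \<partial>m) = emeasure m B * indicator Q (- x)"
   by (subst nn_integral_multc) auto
 qed
 also have "\<dots> = emeasure m B * emeasure \<mu> (uminus -` Q)"
 proof -
  have "(\<lambda>x. indicator Q (- x) :: ennreal) = indicator (uminus -` Q)" by (auto simp: indicator_def fun_eq_iff)
  moreover have "uminus -` Q \<in> sets \<mu>"
   using measurable_sets[of uminus borel borel Q] by (auto simp: assms(3))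
  ultimately show ?thesis by (subst nn_integral_cmult) auto
 qed
 finally show ?thesis .
qed

lemma sigma_finite_measureI_balls:
 fixes M :: "'a::euclidean_space measure"
 assumes "sets M = sets borel" "\<And>r. emeasure M (cball 0 r) < \<infinity>"
 shows "sigma_finite_measure M"
proof
 show "\<exists>A. countable A \<and> A \<subseteq> sets M \<and> \<Union>A = space M \<and> (\<forall>a\<in>A. emeasure M a \<noteq> \<infinity>)"
 proof (intro exI[of _ "range (\<lambda>i::nat. cball 0 (real i))"] conjI)
  show "\<Union>(range (\<lambda>i::nat. cball 0 (real i))) = space M"
   using sets_eq_imp_space_eq[OF assms(1)] real_arch_simple by auto
 qed (use assms in \<open>auto simp: less_top\<close>)
qed

text \<open>The image of Lebesgue measure is again invariant under translations and gives balls the same measure.\<close>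

lemma lborel_orthogonal:
 fixes R :: "'a::euclidean_space \<Rightarrow> 'a"
 assumes R: "orthogonal_transformation R"
 shows "distr lborel borel R = lborel"
proof (rule measure_eqI)
 have lin: "linear R" and bij: "bij R" and nrm: "\<And>x. norm (R x) = norm x"
  using R orthogonal_transformation_linear orthogonal_transformation_bij orthogonal_transformation_norm by auto
 have [measurable]: "R \<in> borel_measurable borel"
  using lin by (intro borel_measurable_continuous_onI linear_continuous_on) (simp add: linear_conv_bounded_linear)
 have vim: "R -` cball 0 r = cball 0 r" for r by (auto simp: nrm)
 fix B assume "B \<in> sets (distr lborel borel R)"
 then have [measurable]: "B \<in> sets borel" by simp
 let ?m = "distr lborel borel R"
 have ball: "emeasure ?m (cball 0 r) = emeasure lborel (cball (0::'a) r)" for r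
  by (subst emeasure_distr) (auto simp: vim)
 have sf: "sigma_finite_measure ?m"
  by (rule sigma_finite_measureI_balls) (simp_all add: ball emeasure_lborel_cball_finite[unfolded infinity_ennreal_def])
 have inv: "distr ?m borel ((+) v) = ?m" for v
 proof -
  obtain u where u: "R u = v" using bij by (metis bij_pointE)
  have "distr ?m borel ((+) v) = distr lborel borel ((+) v \<circ> R)"
   by (subst distr_distr) auto
  also have "(+) v \<circ> R = R \<circ> (+) u" using u lin by (auto simp: linear_add fun_eq_iff)
  also have "distr lborel borel (R \<circ> (+) u) = distr (distr lborel borel ((+) u)) borel R"
   by (subst distr_distr) auto
  finally show ?thesis by (simp add: lborel_distr_plus)
 qed
 have "emeasure ?m B * emeasure lborel (cball (0::'a) 1) = emeasure lborel B * emeasure ?m (uminus -` cball 0 1)"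
  by (rule haar_unique_up_to_factor[where V = UNIV])
   (use sf inv in \<open>auto simp: sigma_finite_lborel lborel_distr_plus\<close>)
 also have "uminus -` cball 0 1 = cball (0::'a) 1" by auto
 finally have "emeasure ?m B * emeasure lborel (cball (0::'a) 1) = emeasure lborel B * emeasure lborel (cball (0::'a) 1)"
  by (simp add: ball)
 moreover have "emeasure lborel (cball (0::'a) 1) \<noteq> 0" "emeasure lborel (cball (0::'a) 1) \<noteq> \<infinity>"
  using content_cball_pos[of 1 "0::'a"] emeasure_lborel_cball_finite[of "0::'a" 1]
  by (auto simp: measure_def less_top)
 ultimately show "emeasure ?m B = emeasure lborel B"
  by (simp add: ennreal_mult_cancel_left mult.commute[of _ "emeasure lborel (cball (0::'a) 1)"])
qed simp

section \<open>Hausdorff measure is a Borel measure\<close>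

lemma hausdorff_premeasure_le:
 assumes "A \<subseteq> (\<Union>i. C i)" "\<And>i. bounded (C i)" "\<And>i. diameter (C i) \<le> \<delta>"
 shows "\<P> k \<delta> A \<le> (\<Sum>i. ennreal (diameter (C i) ^ k))"
 unfolding hausdorff_premeasure_def by (rule INF_lower) (use assms in auto)

lemma hausdorff_premeasure_greatest:
 assumes "\<And>C. A \<subseteq> (\<Union>i. C i) \<Longrightarrow> (\<And>i::nat. bounded (C i)) \<Longrightarrow> (\<And>i. diameter (C i) \<le> \<delta>) \<Longrightarrow>
  c \<le> (\<Sum>i. ennreal (diameter (C i) ^ k))"
 shows "c \<le> \<P> k \<delta> A"
 unfolding hausdorff_premeasure_def by (rule INF_greatest) (use assms in auto)

lemma hausdorff_premeasure_mono: "A \<subseteq> B \<Longrightarrow> \<P> k \<delta> A \<le> \<P> k \<delta> B"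
 by (rule hausdorff_premeasure_greatest, rule hausdorff_premeasure_le) (rule subset_trans)

lemma hausdorff_premeasure_empty:
 assumes "k \<ge> 1" "0 \<le> d"
 shows "\<P> k d ({} :: 'a::metric_space set) = 0"
proof -
 have "\<P> k d ({} :: 'a set) \<le> (\<Sum>i::nat. ennreal (diameter ({} :: 'a set) ^ k))"
  by (rule hausdorff_premeasure_le[where C = "\<lambda>_. {}"]) (use assms in \<open>simp_all add: diameter_empty\<close>)
 moreover have "diameter ({} :: 'a set) ^ k = 0" using assms by (simp add: diameter_empty zero_power)
 ultimately show ?thesis by (simp only: ennreal_0 suminf_zero le_zero_eq)
qed

lemma hausdorff_premeasure_UN:
 "\<P> k d (\<Union>i::nat. A i) \<le> (\<Sum>i. \<P> k d (A i))"
proof (rule ennreal_le_epsilon)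
 fix e :: real assume fin: "(\<Sum>i. \<P> k d (A i)) < top" and e: "0 < e"
 have "\<exists>C. A i \<subseteq> (\<Union>j. C j) \<and> (\<forall>j::nat. bounded (C j) \<and> diameter (C j) \<le> d) \<and>
   (\<Sum>j. ennreal (diameter (C j) ^ k)) \<le> \<P> k d (A i) + ennreal (e * (1/2) ^ Suc i)" for i
 proof -
  have "\<P> k d (A i) < top"
   using fin ennreal_suminf_lessD by blast
  then have "\<P> k d (A i) < \<P> k d (A i) + ennreal (e * (1/2) ^ Suc i)"
   using e by (cases "\<P> k d (A i)") (auto simp flip: ennreal_plus simp: ennreal_less_iff)
  then show ?thesis
   by (subst (asm) (1) hausdorff_premeasure_def) (auto simp: INF_less_iff intro: less_imp_le)
 qed
 then obtain C where C: "\<And>i. A i \<subseteq> (\<Union>j. C i j)" "\<And>i j::nat. bounded (C i j)" "\<And>i j. diameter (C i j) \<le> d"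
  and le: "\<And>i. (\<Sum>j. ennreal (diameter (C i j) ^ k)) \<le> \<P> k d (A i) + ennreal (e * (1/2) ^ Suc i)"
  by metis
 have "\<P> k d (\<Union>i. A i) \<le> (\<Sum>n. ennreal (diameter ((\<lambda>(i,j). C i j) (prod_decode n)) ^ k))"
 proof (rule hausdorff_premeasure_le)
  show "bounded ((\<lambda>(i,j). C i j) (prod_decode n))" "diameter ((\<lambda>(i,j). C i j) (prod_decode n)) \<le> d" for n
   using C(2,3) by (simp_all split: prod.split)
  show "(\<Union>i. A i) \<subseteq> (\<Union>n. (\<lambda>(i,j). C i j) (prod_decode n))"
  proof
   fix x assume "x \<in> (\<Union>i. A i)"
   then obtain i j where "x \<in> C i j" using C(1) by blast
   then have "x \<in> (\<lambda>(i,j). C i j) (prod_decode (prod_encode (i,j)))" by simp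
   then show "x \<in> (\<Union>n. (\<lambda>(i,j). C i j) (prod_decode n))" by (rule UN_I[OF UNIV_I])
  qed
 qed
 also have "\<dots> = (\<Sum>i. \<Sum>j. ennreal (diameter (C i j) ^ k))"
  by (rule suminf_ennreal_2dimen[where f = "\<lambda>p. ennreal (diameter ((\<lambda>(i,j). C i j) p) ^ k)"]) (simp only: prod.case)
 also have "\<dots> \<le> (\<Sum>i. \<P> k d (A i) + ennreal (e * (1/2) ^ Suc i))"
  by (rule suminf_le[OF le]) simp_all
 also have "\<dots> = (\<Sum>i. \<P> k d (A i)) + (\<Sum>i. ennreal (e * (1/2) ^ Suc i))"
  by (rule suminf_add[symmetric]) simp_all
 also have "(\<Sum>i. ennreal (e * (1/2) ^ Suc i)) = ennreal e"
  using sums_mult[OF power_half_series, of e] e by (intro suminf_ennreal_eq) auto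
 finally show "\<P> k d (\<Union>i. A i) \<le> (\<Sum>i. \<P> k d (A i)) + ennreal e" .
qed

lemma hausdorff_premeasure_le_outer: "\<delta> > 0 \<Longrightarrow> \<P> k \<delta> A \<le> \<H> k A"
 unfolding hausdorff_outer_def by (rule SUP_upper) auto

lemma hausdorff_outer_le: "(\<And>\<delta>. \<delta> > 0 \<Longrightarrow> \<P> k \<delta> A \<le> c) \<Longrightarrow> \<H> k A \<le> c"
 unfolding hausdorff_outer_def by (rule SUP_least) auto

lemma hausdorff_outer_mono: "A \<subseteq> B \<Longrightarrow> \<H> k A \<le> \<H> k B"
 by (rule hausdorff_outer_le, rule order_trans[OF hausdorff_premeasure_mono hausdorff_premeasure_le_outer])

lemma hausdorff_outer_empty: "k \<ge> 1 \<Longrightarrow> \<H> k {} = 0"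
 by (rule antisym[OF hausdorff_outer_le]) (simp_all add: hausdorff_premeasure_empty)

lemma hausdorff_outer_UN: "\<H> k (\<Union>i::nat. A i) \<le> (\<Sum>i. \<H> k (A i))"
proof (rule hausdorff_outer_le)
 fix d :: real assume d: "d > 0"
 have "\<P> k d (\<Union>i. A i) \<le> (\<Sum>i. \<P> k d (A i))"
  by (rule hausdorff_premeasure_UN)
 also have "\<dots> \<le> (\<Sum>i. \<H> k (A i))"
  by (intro suminf_le hausdorff_premeasure_le_outer d) auto
 finally show "\<P> k d (\<Union>i. A i) \<le> (\<Sum>i. \<H> k (A i))" .
qed

lemma hausdorff_premeasure_antimono: "d \<le> d' \<Longrightarrow> \<P> k d' A \<le> \<P> k d A"
 by (rule hausdorff_premeasure_greatest, rule hausdorff_premeasure_le) (auto intro: order_trans)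

text \<open>A set of diameter at most \<open>d\<close> cannot meet both \<open>A\<close> and \<open>B\<close>, so each cover splits into two.\<close>

lemma hausdorff_premeasure_separated:
 assumes k: "k \<ge> 1" and sep: "\<And>a b. a \<in> A \<Longrightarrow> b \<in> B \<Longrightarrow> d < dist a b" and d: "0 \<le> d"
 shows "\<P> k d A + \<P> k d B \<le> \<P> k d (A \<union> B)"
proof (rule hausdorff_premeasure_greatest)
 fix C :: "nat \<Rightarrow> 'a set"
 assume C: "A \<union> B \<subseteq> (\<Union>i. C i)" "\<And>i. bounded (C i)" "\<And>i. diameter (C i) \<le> d"
 define CA where "CA i = (if C i \<inter> A = {} then {} else C i)" for i
 define CB where "CB i = (if C i \<inter> B = {} then {} else C i)" for i
 have A: "\<P> k d A \<le> (\<Sum>i. ennreal (diameter (CA i) ^ k))"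
  by (rule hausdorff_premeasure_le) (use C d in \<open>auto simp: CA_def split: if_splits, blast\<close>)
 have B: "\<P> k d B \<le> (\<Sum>i. ennreal (diameter (CB i) ^ k))"
  by (rule hausdorff_premeasure_le) (use C d in \<open>auto simp: CB_def split: if_splits, blast\<close>)
 have disj: "CA i = {} \<or> CB i = {}" for i
 proof (rule ccontr)
  assume "\<not> ?thesis"
  then obtain a b where "a \<in> C i \<inter> A" "b \<in> C i \<inter> B" by (auto simp: CA_def CB_def split: if_splits)
  then show False using sep[of a b] diameter_bounded_bound[OF C(2)[of i], of a b] C(3)[of i] by auto
 qed
 have le: "ennreal (diameter (CA i) ^ k) + ennreal (diameter (CB i) ^ k) \<le> ennreal (diameter (C i) ^ k)" for i
 proof -
  have 0: "(0::real) ^ k = 0" using k by (simp add: zero_power)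
  have "diameter (CA i) = 0 \<and> (diameter (CB i) = 0 \<or> diameter (CB i) = diameter (C i)) \<or>
    diameter (CB i) = 0 \<and> (diameter (CA i) = 0 \<or> diameter (CA i) = diameter (C i))"
   using disj[of i] unfolding CA_def CB_def by (auto split: if_splits)
  then show ?thesis by (elim disjE conjE) (simp_all add: 0)
 qed
 have "\<P> k d A + \<P> k d B
   \<le> (\<Sum>i. ennreal (diameter (CA i) ^ k)) + (\<Sum>i. ennreal (diameter (CB i) ^ k))"
  by (rule add_mono[OF A B])
 also have "\<dots> = (\<Sum>i. ennreal (diameter (CA i) ^ k) + ennreal (diameter (CB i) ^ k))"
  by (rule suminf_add) auto
 also have "\<dots> \<le> (\<Sum>i. ennreal (diameter (C i) ^ k))" by (intro suminf_le le) auto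
 finally show "\<P> k d A + \<P> k d B \<le> (\<Sum>i. ennreal (diameter (C i) ^ k))" .
qed

lemma hausdorff_outer_eq_SUP: "\<H> k A = (SUP n::nat. \<P> k (d / real (Suc n)) A)"
 if d: "d > 0"
proof (rule antisym)
 show "\<H> k A \<le> (SUP n::nat. \<P> k (d / real (Suc n)) A)"
 proof (rule hausdorff_outer_le)
  fix \<delta> :: real assume \<delta>: "\<delta> > 0"
  obtain n where "inverse (real (Suc n)) < \<delta> / d" using reals_Archimedean[of "\<delta> / d"] d \<delta> by auto
  then have "d / real (Suc n) \<le> \<delta>" using d by (simp add: field_simps)
  then have "\<P> k \<delta> A \<le> \<P> k (d / real (Suc n)) A"
   by (rule hausdorff_premeasure_antimono)
  also have "\<dots> \<le> (SUP n::nat. \<P> k (d / real (Suc n)) A)" by (rule SUP_upper) simp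
  finally show "\<P> k \<delta> A \<le> (SUP n::nat. \<P> k (d / real (Suc n)) A)" .
 qed
 show "(SUP n::nat. \<P> k (d / real (Suc n)) A) \<le> \<H> k A"
  using d by (intro SUP_least hausdorff_premeasure_le_outer) simp
qed

lemma hausdorff_outer_separated:
 assumes k: "k \<ge> 1" and d: "d > 0" and sep: "\<And>a b. a \<in> A \<Longrightarrow> b \<in> B \<Longrightarrow> d \<le> dist a b"
 shows "\<H> k A + \<H> k B \<le> \<H> k (A \<union> B)"
proof -
 have d2: "d/2 > 0" using d by simp
 have inc: "incseq (\<lambda>n. \<P> k (d / 2 / real (Suc n)) S)" for S :: "'a set"
  using d by (intro monoI hausdorff_premeasure_antimono divide_left_mono) auto
 have "\<H> k A + \<H> k B
   = (SUP n. \<P> k (d / 2 / real (Suc n)) A + \<P> k (d / 2 / real (Suc n)) B)"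
  unfolding hausdorff_outer_eq_SUP[OF d2] by (rule ennreal_SUP_add[OF inc inc, symmetric])
 also have "\<dots> \<le> (SUP n. \<P> k (d / 2 / real (Suc n)) (A \<union> B))"
 proof (intro SUP_mono bexI)
  fix n :: nat
  have lt: "d / 2 / real (Suc n) < d" using d by (simp add: divide_simps)
  show "\<P> k (d / 2 / real (Suc n)) A + \<P> k (d / 2 / real (Suc n)) B
    \<le> \<P> k (d / 2 / real (Suc n)) (A \<union> B)"
  proof (rule hausdorff_premeasure_separated[OF k])
   show "d / 2 / real (Suc n) < dist a b" if "a \<in> A" "b \<in> B" for a b
    using lt sep[OF that] by linarith
   show "0 \<le> d / 2 / real (Suc n)" using d by simp
  qed
 qed simp
 also have "\<dots> = \<H> k (A \<union> B)" unfolding hausdorff_outer_eq_SUP[OF d2] ..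
 finally show ?thesis .
qed

text \<open>Caratheodory's criterion: cutting along a closed set \<open>F\<close> splits off the sets of points at distance
 at least \<open>1/(n+1)\<close> from \<open>F\<close>; the layers in between have summable measure because every other
 one of them is separated from the rest.\<close>

lemma metric_outer_measure_closed:
 fixes m :: "'a::metric_space set \<Rightarrow> ennreal"
 assumes empty: "m {} = 0" and mono: "\<And>A B. A \<subseteq> B \<Longrightarrow> m A \<le> m B"
  and UN: "\<And>A. m (\<Union>i::nat. A i) \<le> (\<Sum>i. m (A i))"
  and sep: "\<And>A B d. d > 0 \<Longrightarrow> (\<And>a b. a \<in> A \<Longrightarrow> b \<in> B \<Longrightarrow> d \<le> dist a b) \<Longrightarrow> m A + m B \<le> m (A \<union> B)"
  and F: "closed F"
 shows "m (A \<inter> F) + m (A - F) \<le> m A"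
proof (cases "F = {} \<or> m A = top")
 case True then show ?thesis using empty by auto
next
 case False
 then have ne: "F \<noteq> {}" and fin: "m A \<noteq> top" by auto
 have dst: "infdist x F \<le> infdist y F + dist x y" for x y using infdist_triangle by blast
 define T where "T n = {x\<in>A. 1 / real (Suc n) \<le> infdist x F}" for n
 define R where "R n = T (Suc n) - T n" for n
 have R: "1 / real (Suc (Suc n)) \<le> infdist x F" "infdist x F < 1 / real (Suc n)" "x \<in> A" if "x \<in> R n" for x n
  using that by (auto simp: R_def T_def)
 \<comment> \<open>layers of equal parity are separated from each other by a full layer\<close>
 have part: "(\<Sum>i<k. m (R (2*i+p))) \<le> m (\<Union>i<k. R (2*i+p))" for k p
 proof (induction k)
  case (Suc k)
  have "(\<Sum>i<Suc k. m (R (2*i+p))) \<le> m (\<Union>i<k. R (2*i+p)) + m (R (2*k+p))"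
   using Suc by (simp add: add_right_mono)
  also have "\<dots> \<le> m ((\<Union>i<k. R (2*i+p)) \<union> R (2*k+p))"
  proof (cases "k = 0")
   case False
   show ?thesis
   proof (rule sep)
    have "1 / real (2*k+p+1) < 1 / real (2*k+p)" using False by (intro divide_strict_left_mono) auto
    then show "0 < 1 / real (2*k+p) - 1 / real (2*k+p+1)" by simp
    fix a b assume "a \<in> (\<Union>i<k. R (2*i+p))" and b: "b \<in> R (2*k+p)"
    then obtain i where i: "i < k" and a: "a \<in> R (2*i+p)" by auto
    have "1 / real (2*k+p) \<le> 1 / real (Suc (Suc (2*i+p)))"
     using i by (intro divide_left_mono) auto
    also have "\<dots> \<le> infdist a F" using R(1)[OF a] .
    finally show "1 / real (2*k+p) - 1 / real (2*k+p+1) \<le> dist a b"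
     using R(2)[OF b] dst[of a b] by (simp add: add.commute)
   qed
  qed (simp add: empty)
  also have "(\<Union>i<k. R (2*i+p)) \<union> R (2*k+p) = (\<Union>i<Suc k. R (2*i+p))" by (auto simp: less_Suc_eq)
  finally show ?case .
 qed (simp add: empty)
 have part_le: "(\<Sum>i<k. m (R (2*i+p))) \<le> m A" for k p
  using part by (rule order_trans) (intro mono, use R(3) in auto)
 have "(\<Sum>n<2*k. m (R n)) \<le> m A + m A" for k
 proof -
  have "(\<Sum>n<2*k. m (R n)) = (\<Sum>i<k. m (R (2*i+0))) + (\<Sum>i<k. m (R (2*i+1)))"
   by (induction k) (auto simp: algebra_simps)
  also have "\<dots> \<le> m A + m A" by (intro add_mono part_le)
  finally show ?thesis .
 qed
 moreover have "(\<Sum>n<N. m (R n)) \<le> (\<Sum>n<2*N. m (R n))" for N by (rule sum_mono2) auto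
 ultimately have "(\<Sum>n<N. m (R n)) \<le> m A + m A" for N by (rule order_trans[rotated])
 then have "(\<Sum>n. m (R n)) \<le> m A + m A" by (intro suminf_le_const) auto
 then have Rfin: "(\<Sum>n. m (R n)) \<noteq> top" using fin by (auto simp: top_unique)
 have step: "(m (A - F) + m (A \<inter> F)) + (\<Sum>n<N. m (R n)) \<le> m A + (\<Sum>n. m (R n))" for N
 proof -
  define S where "S i = (case i of 0 \<Rightarrow> T N | Suc j \<Rightarrow> R (j + N))" for i
  have "A - F \<subseteq> (\<Union>i. S i)"
  proof
   fix x assume x: "x \<in> A - F"
   then have pos: "infdist x F > 0"
    using F ne by (metis Diff_iff in_closed_iff_infdist_zero infdist_nonneg less_eq_real_def)
   obtain n where "inverse (real (Suc n)) < infdist x F" using reals_Archimedean[OF pos] by auto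
   then have xn: "x \<in> T n" using x by (auto simp: T_def inverse_eq_divide)
   show "x \<in> (\<Union>i. S i)"
   proof (cases "x \<in> T N")
    case True then have "x \<in> S 0" by (simp add: S_def) then show ?thesis by blast
   next
    case False
    have "\<exists>j. x \<in> R (j + N)"
    proof (rule ccontr)
     assume no: "\<not> ?thesis"
     have "x \<notin> T (j + N)" for j using no by (induction j) (use False in \<open>auto simp: R_def\<close>)
     moreover have "x \<in> T (n + N)"
     proof -
      have "1 / real (Suc (n + N)) \<le> 1 / real (Suc n)" by (intro divide_left_mono) auto
      then show ?thesis using xn by (auto simp: T_def)
     qed
     ultimately show False by blast
    qed
    then obtain j where "x \<in> S (Suc j)" by (auto simp: S_def)
    then show ?thesis by blast
   qed
  qed
  then have "m (A - F) \<le> (\<Sum>i. m (S i))" using mono UN order_trans by blast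
  also have "\<dots> = (\<Sum>j. m (R (j + N))) + m (T N)"
   using suminf_offset[of "\<lambda>i. m (S i)" 1] by (simp add: S_def)
  finally have 1: "m (A - F) \<le> (\<Sum>j. m (R (j + N))) + m (T N)" .
  have "m (T N) + m (A \<inter> F) \<le> m (T N \<union> A \<inter> F)"
  proof (rule sep)
   show "0 < 1 / real (Suc N)" by simp
   fix a b assume "a \<in> T N" "b \<in> A \<inter> F"
   then show "1 / real (Suc N) \<le> dist a b" using infdist_le[of b F a] by (auto simp: T_def)
  qed
  also have "\<dots> \<le> m A" by (intro mono) (auto simp: T_def)
  finally have 2: "m (T N) + m (A \<inter> F) \<le> m A" .
  have "(m (A - F) + m (A \<inter> F)) + (\<Sum>n<N. m (R n))
    \<le> (((\<Sum>j. m (R (j + N))) + m (T N)) + m (A \<inter> F)) + (\<Sum>n<N. m (R n))"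
   by (intro add_right_mono 1)
  also have "\<dots> = (m (T N) + m (A \<inter> F)) + ((\<Sum>j. m (R (j + N))) + (\<Sum>n<N. m (R n)))"
   by (simp add: algebra_simps)
  also have "(\<Sum>j. m (R (j + N))) + (\<Sum>n<N. m (R n)) = (\<Sum>n. m (R n))"
   by (rule suminf_offset[symmetric]) simp
  also have "(m (T N) + m (A \<inter> F)) + (\<Sum>n. m (R n)) \<le> m A + (\<Sum>n. m (R n))"
   by (intro add_right_mono 2)
  finally show ?thesis .
 qed
 have "(m (A - F) + m (A \<inter> F)) + (\<Sum>n. m (R n)) \<le> m A + (\<Sum>n. m (R n))"
  by (rule LIMSEQ_le_const2[OF tendsto_add[OF tendsto_const summable_LIMSEQ]]) (use step in auto)
 then show ?thesis using Rfin by (simp add: add.commute ennreal_add_left_cancel_le)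
qed

lemma metric_outer_measure_borel:
 fixes m :: "'a::metric_space set \<Rightarrow> ennreal"
 assumes empty: "m {} = 0" and mono: "\<And>A B. A \<subseteq> B \<Longrightarrow> m A \<le> m B"
  and UN: "\<And>A. m (\<Union>i::nat. A i) \<le> (\<Sum>i. m (A i))"
  and sep: "\<And>A B d. d > 0 \<Longrightarrow> (\<And>a b. a \<in> A \<Longrightarrow> b \<in> B \<Longrightarrow> d \<le> dist a b) \<Longrightarrow> m A + m B \<le> m (A \<union> B)"
 shows "measure_space UNIV (sets borel) m"
proof -
 interpret S: sigma_algebra UNIV "UNIV :: 'a set set" using sigma_algebra_Pow[of "UNIV :: 'a set"] by simp
 let ?L = "lambda_system UNIV UNIV m"
 have "outer_measure_space UNIV m"
  by (auto simp: outer_measure_space_def positive_def increasing_def countably_subadditive_def empty mono UN)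
 then have ms: "measure_space UNIV ?L m" by (rule S.caratheodory_lemma)
 then have sa: "sigma_algebra UNIV ?L" by (simp add: measure_space_def)
 have closed: "F \<in> ?L" if F: "closed F" for F
 proof -
  have "m (F \<inter> A) + m (- F \<inter> A) = m A" for A
  proof (rule antisym)
   show "m (F \<inter> A) + m (- F \<inter> A) \<le> m A"
    using metric_outer_measure_closed[where m = m and A = A, OF empty mono UN sep F] by (simp add: Int_commute Diff_eq)
   have "m A = m (\<Union>i. binaryset (F \<inter> A) (- F \<inter> A) i)"
    unfolding UN_binaryset_eq by (rule arg_cong[of _ _ m]) blast
   also have "\<dots> \<le> (\<Sum>i. m (binaryset (F \<inter> A) (- F \<inter> A) i))" by (rule UN)
   also have "\<dots> = m (F \<inter> A) + m (- F \<inter> A)" by (rule suminf_binaryset_eq[where f = m, OF empty])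
   finally show "m A \<le> m (F \<inter> A) + m (- F \<inter> A)" .
  qed
  then show ?thesis by (simp add: lambda_system_def Compl_eq_Diff_UNIV)
 qed
 have "Collect closed \<subseteq> ?L" using closed by (intro subsetI, elim CollectE)
 then have "sigma_sets UNIV (Collect closed) \<subseteq> ?L" by (rule sigma_algebra.sigma_sets_subset[OF sa])
 moreover have "sets (borel :: 'a measure) = sigma_sets UNIV (Collect closed)"
  unfolding borel_eq_closed by (rule sets_measure_of) simp
 ultimately have "sets borel \<subseteq> ?L" by simp
 then show ?thesis
  by (rule measure_down[OF ms, rotated]) (use sets.sigma_algebra_axioms[of "borel :: 'a measure"] in simp)
qed

text \<open>The images of a cover, restricted to \<open>A\<close>, have diameters larger by a factor of at most \<open>L\<close>.\<close>

lemma hausdorff_outer_lipschitz_image: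
 fixes g :: "'a::real_normed_vector \<Rightarrow> 'b::real_normed_vector"
 assumes L: "L > 0" and g: "\<And>x y. x \<in> A \<Longrightarrow> y \<in> A \<Longrightarrow> dist (g x) (g y) \<le> L * dist x y"
 shows "\<H> k (g ` A) \<le> ennreal (L ^ k) * \<H> k A"
proof (rule hausdorff_outer_le)
 fix t :: real assume t: "t > 0"
 have "\<P> k t (g ` A) \<le> ennreal (L ^ k) * \<P> k (t / L) A"
 proof -
  have "\<P> k t (g ` A) / ennreal (L ^ k) \<le> \<P> k (t / L) A"
  proof (rule hausdorff_premeasure_greatest)
   fix C :: "nat \<Rightarrow> 'a set"
   assume C: "A \<subseteq> (\<Union>i. C i)" "\<And>i. bounded (C i)" "\<And>i. diameter (C i) \<le> t / L"
   have d: "norm (u - v) \<le> L * diameter (C i)" if "u \<in> g ` (C i \<inter> A)" "v \<in> g ` (C i \<inter> A)" for u v i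
   proof -
    from that obtain x y where xy: "x \<in> C i" "x \<in> A" "y \<in> C i" "y \<in> A" "u = g x" "v = g y" by blast
    have "dist u v \<le> L * dist x y" using g xy by simp
    also have "\<dots> \<le> L * diameter (C i)"
     using L diameter_bounded_bound[OF C(2)[of i]] xy by (intro mult_left_mono) auto
    finally show ?thesis by (simp add: dist_norm)
   qed
   have dia: "diameter (g ` (C i \<inter> A)) \<le> L * diameter (C i)" for i
    by (rule diameter_le) (use L diameter_ge_0[OF C(2)] d in auto)
   have bdd: "bounded (g ` (C i \<inter> A))" for i
    unfolding bounded_two_points using d by (auto simp: dist_norm image_iff) blast
   have "\<P> k t (g ` A) \<le> (\<Sum>i. ennreal (diameter (g ` (C i \<inter> A)) ^ k))"
   proof (rule hausdorff_premeasure_le)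
    show "g ` A \<subseteq> (\<Union>i. g ` (C i \<inter> A))" using C(1) by blast
    show "diameter (g ` (C i \<inter> A)) \<le> t" for i
     using dia[of i] mult_left_mono[OF C(3)[of i], of L] L by simp
   qed (rule bdd)
   also have "\<dots> \<le> (\<Sum>i. ennreal (L ^ k) * ennreal (diameter (C i) ^ k))"
   proof (intro suminf_le)
    fix i
    have "diameter (g ` (C i \<inter> A)) ^ k \<le> (L * diameter (C i)) ^ k"
     by (intro power_mono dia diameter_ge_0 bdd)
    then show "ennreal (diameter (g ` (C i \<inter> A)) ^ k) \<le> ennreal (L ^ k) * ennreal (diameter (C i) ^ k)"
     using L by (simp add: power_mult_distrib ennreal_leI flip: ennreal_mult')
   qed auto
   also have "\<dots> = ennreal (L ^ k) * (\<Sum>i. ennreal (diameter (C i) ^ k))" by simp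
   finally have "\<P> k t (g ` A) / ennreal (L ^ k)
     \<le> (ennreal (L ^ k) * (\<Sum>i. ennreal (diameter (C i) ^ k))) / ennreal (L ^ k)"
    by (rule divide_right_mono_ennreal)
   also have "\<dots> = (\<Sum>i. ennreal (diameter (C i) ^ k))"
    using L by (subst mult.commute, intro ennreal_mult_divide_eq) auto
   finally show "\<P> k t (g ` A) / ennreal (L ^ k) \<le> (\<Sum>i. ennreal (diameter (C i) ^ k))" .
  qed
  then have "ennreal (L ^ k) * (\<P> k t (g ` A) / ennreal (L ^ k))
    \<le> ennreal (L ^ k) * \<P> k (t / L) A" by (rule mult_left_mono) simp
  moreover have "ennreal (L ^ k) * (\<P> k t (g ` A) / ennreal (L ^ k)) = \<P> k t (g ` A)"
   unfolding ennreal_times_divide using L by (subst mult.commute, intro ennreal_mult_divide_eq) auto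
  ultimately show ?thesis by simp
 qed
 also have "\<dots> \<le> ennreal (L ^ k) * \<H> k A"
  using t L by (intro mult_left_mono hausdorff_premeasure_le_outer) auto
 finally show "\<P> k t (g ` A) \<le> ennreal (L ^ k) * \<H> k A" .
qed

section \<open>Area on hyperplanes\<close>

lemma hausdorff_outer_isometry:
 fixes g :: "'a::real_normed_vector \<Rightarrow> 'b::real_normed_vector"
 assumes g: "\<And>x y. x \<in> A \<Longrightarrow> y \<in> A \<Longrightarrow> dist (g x) (g y) = dist x y"
 shows "\<H> k (g ` A) = \<H> k A"
proof (rule antisym)
 show "\<H> k (g ` A) \<le> \<H> k A"
  using hausdorff_outer_lipschitz_image[of 1 A g k] g by simp
 have inj: "inj_on g A" using g by (metis dist_eq_0_iff inj_onI)
 have "\<H> k (inv_into A g ` (g ` A)) \<le> ennreal (1 ^ k) * \<H> k (g ` A)"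
  by (rule hausdorff_outer_lipschitz_image) (use g inj in \<open>auto simp: inv_into_f_f\<close>)
 moreover have "inv_into A g ` (g ` A) = A" using inj by (simp add: image_image inv_into_f_f)
 ultimately show "\<H> k A \<le> \<H> k (g ` A)" by simp
qed

definition hausdorff_measure :: "nat \<Rightarrow> 'a::metric_space measure" where
 "hausdorff_measure k = measure_of UNIV (sets borel) (\<H> k)"

lemma hausdorff_measure_space: "k \<ge> 1 \<Longrightarrow> measure_space UNIV (sets borel) (\<H> k :: 'a::metric_space set \<Rightarrow> ennreal)"
 by (rule metric_outer_measure_borel)
  (auto simp: hausdorff_outer_empty hausdorff_outer_mono hausdorff_outer_UN hausdorff_outer_separated)

lemma sets_hausdorff_measure [simp, measurable_cong]: "sets (hausdorff_measure k) = sets borel"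
 unfolding hausdorff_measure_def using sets.sigma_sets_eq[of borel] by (subst sets_measure_of) auto

lemma space_hausdorff_measure [simp]: "space (hausdorff_measure k) = UNIV"
 unfolding hausdorff_measure_def by (subst space_measure_of) auto

lemma emeasure_hausdorff_measure:
 "k \<ge> 1 \<Longrightarrow> B \<in> sets borel \<Longrightarrow> emeasure (hausdorff_measure k) B = \<H> k B"
 using hausdorff_measure_space[of k]
 by (intro emeasure_measure_of[OF hausdorff_measure_def]) (auto simp: measure_space_def)

lemma sets_area_measure [simp, measurable_cong]: "sets \<A> = sets borel"
 unfolding area_measure_def using sets.sigma_sets_eq[of borel] by (subst sets_measure_of) auto

lemma space_area_measure [simp]: "space \<A> = UNIV"
 unfolding area_measure_def by (subst space_measure_of) auto

lemma emeasure_area_measure_quotient: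
 assumes "CARD('n) \<ge> 2" "B \<in> sets borel"
 shows "emeasure \<A> (B :: (real^'n) set) =
  \<H> (CARD('n) - 1) B / \<H> (CARD('n) - 1) (unit_face :: (real^'n) set)"
proof -
 let ?c = "\<H> (CARD('n) - 1) (unit_face :: (real^'n) set)"
 have k: "CARD('n) - 1 \<ge> 1" using assms by simp
 have pos: "positive (sets borel) (\<lambda>A :: (real^'n) set. \<H> (CARD('n) - 1) A / ?c)"
  using hausdorff_outer_empty[OF k, where ?'a = "real^'n"] by (simp add: positive_def)
 have ca: "countably_additive (sets borel) (\<lambda>A :: (real^'n) set. \<H> (CARD('n) - 1) A / ?c)"
  unfolding countably_additive_def
 proof safe
  fix A :: "nat \<Rightarrow> (real^'n) set"
  assume A: "range A \<subseteq> sets borel" "disjoint_family A" "(\<Union>i. A i) \<in> sets borel"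
  have "(\<Sum>i. \<H> (CARD('n) - 1) (A i)) = \<H> (CARD('n) - 1) (\<Union>i. A i)"
   using hausdorff_measure_space[OF k, where ?'a = "real^'n"] A
   unfolding measure_space_def countably_additive_def by blast
  then show "(\<Sum>i. \<H> (CARD('n) - 1) (A i) / ?c) = \<H> (CARD('n) - 1) (\<Union>i. A i) / ?c"
   by (simp add: ennreal_suminf_divide)
 qed
 show ?thesis
  by (rule emeasure_measure_of[OF area_measure_def]) (use pos ca assms in auto)
qed

definition proj :: "'a::real_inner \<Rightarrow> 'a \<Rightarrow> 'a" where
 "proj e x = x - (e \<bullet> x) *\<^sub>R e"

lemma proj_measurable [measurable]: "proj (e::'a::euclidean_space) \<in> borel_measurable borel"
 unfolding proj_def by measurable

lemma inner_proj: "norm e = 1 \<Longrightarrow> e \<bullet> proj e x = 0"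
 by (simp add: proj_def inner_diff_right dot_square_norm)

lemma proj_add_line: "norm e = 1 \<Longrightarrow> proj e (x + s *\<^sub>R e) = proj e x"
 by (simp add: proj_def inner_add_right dot_square_norm algebra_simps)

lemma norm_proj_le: "norm e = 1 \<Longrightarrow> norm (proj e x) \<le> norm x"
proof -
 assume e: "norm e = 1"
 have "(norm (proj e x))\<^sup>2 = (norm x)\<^sup>2 - (e \<bullet> x)\<^sup>2"
  unfolding proj_def power2_norm_eq_inner using e
  by (simp add: inner_diff_left inner_diff_right norm_eq_1 inner_commute[of x e] power2_eq_square)
 then have "(norm (proj e x))\<^sup>2 \<le> (norm x)\<^sup>2" by simp
 then show ?thesis by (simp add: power_mono_iff)
qed

text \<open>Lebesgue measure of the hyperplane orthogonal to \<open>e\<close>, obtained by thickening sets to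
 cylinders of height one.\<close>

definition plane_measure :: "'a::euclidean_space \<Rightarrow> 'a measure" ("\<L>") where
 "\<L> e = distr (density lborel (indicator (slab e))) borel (proj e)"

lemma sets_plane_measure [simp, measurable_cong]: "sets (\<L> e) = sets borel"
 by (simp add: plane_measure_def)

lemma nn_integral_plane_measure:
 assumes [measurable]: "F \<in> borel_measurable borel"
 shows "(\<integral>\<^sup>+x. F x \<partial>\<L> e) = (slab_int e (\<lambda>x. F (proj e x)))"
 unfolding plane_measure_def by (subst nn_integral_distr) (auto simp: nn_integral_density)

lemma emeasure_plane_measure:
 assumes [measurable]: "B \<in> sets borel"
 shows "emeasure (\<L> e) B = (slab_int e (\<lambda>x. indicator B (proj e x)))"
 using nn_integral_plane_measure[of "indicator B" e] by (simp add: nn_integral_indicator)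

lemma AE_plane_measure:
 assumes "norm e = 1"
 shows "AE x in \<L> e. e \<bullet> x = 0"
 unfolding plane_measure_def by (subst AE_distr_iff) (auto simp: inner_proj assms)

lemma plane_measure_shift:
 assumes e: "norm e = 1" and v: "e \<bullet> v = 0"
 shows "distr (\<L> e) borel ((+) v) = \<L> e"
proof (rule measure_eqI)
 fix B assume "B \<in> sets (distr (\<L> e) borel ((+) v))"
 then have [measurable]: "B \<in> sets borel" by simp
 have pv: "proj e (x + v) = v + proj e x" for x using v by (simp add: proj_def inner_add_right)
 have sv: "indicator (slab e) (x + v) = (indicator (slab e) x :: ennreal)" for x
  using v by (simp add: slab_def indicator_def inner_add_right)
 have "emeasure (distr (\<L> e) borel ((+) v)) B = (\<integral>\<^sup>+x. indicator B (v + x) \<partial>\<L> e)"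
  by (subst nn_integral_indicator[symmetric], simp, subst nn_integral_distr) auto
 also have "\<dots> = (\<integral>\<^sup>+x. indicator (slab e) (x + v) * indicator B (proj e (x + v)) \<partial>lborel)"
  by (subst nn_integral_plane_measure) (auto simp: pv sv)
 also have "\<dots> = emeasure (\<L> e) B"
  by (subst nn_integral_lborel_shift[of "\<lambda>x. indicator (slab e) x * indicator B (proj e x)"]) (simp_all add: emeasure_plane_measure)
 finally show "emeasure (distr (\<L> e) borel ((+) v)) B = emeasure (\<L> e) B" .
qed simp

text \<open>The cylinder of height \<open>r\<close> over a ball of radius \<open>r\<close> scales like \<open>r ^ DIM('a)\<close>; one factor \<open>r\<close> belongs to
the height.\<close>

lemma plane_measure_cball_0:
 fixes e :: "'a::euclidean_space"
 assumes e: "norm e = 1" and t: "t > 0"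
 shows "emeasure (\<L> e) (cball 0 t) = ennreal (t ^ (DIM('a) - 1)) * emeasure (\<L> e) (cball 0 1)"
proof -
 \<comment> \<open>the cylinder over the ball of radius \<open>r\<close>, of height \<open>r\<close>\<close>
 define T where "T r = {x::'a. 0 \<le> e \<bullet> x \<and> e \<bullet> x < r \<and> norm (proj e x) \<le> r}" for r
 have [measurable]: "T r \<in> sets borel" for r unfolding T_def by measurable
 have [measurable]: "cball (0::'a) r \<in> sets borel" for r by simp
 have ee: "e \<bullet> e = 1" using e by (simp add: dot_square_norm)
 have thick: "emeasure lborel (T r) = ennreal r * emeasure (\<L> e) (cball 0 r)" if "r > 0" for r
 proof -
  have "emeasure lborel (T r) = (\<integral>\<^sup>+x. indicator (T r) x \<partial>lborel)" by simp
  also have "\<dots> = (slab_int e (\<lambda>x. \<integral>\<^sup>+s. indicator (T r) (x + s *\<^sub>R e) \<partial>lborel))"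
   by (rule nn_integral_line_fubini[OF _ ee]) simp
  also have "\<dots> = (\<integral>\<^sup>+x. ennreal r * (indicator (slab e) x * indicator (cball 0 r) (proj e x)) \<partial>lborel)"
  proof (rule nn_integral_cong)
   fix x :: 'a
   have "(\<lambda>s. indicator (T r) (x + s *\<^sub>R e) :: ennreal) = (\<lambda>s. indicator {- (e \<bullet> x) ..< r - e \<bullet> x} s * indicator (cball 0 r) (proj e x))"
    by (auto simp: T_def indicator_def proj_add_line[OF e] inner_add_right ee fun_eq_iff)
   then have "(\<integral>\<^sup>+s. indicator (T r) (x + s *\<^sub>R e) \<partial>lborel) = ennreal r * indicator (cball 0 r) (proj e x)"
    using that by (simp add: nn_integral_multc)
   then show "indicator (slab e) x * (\<integral>\<^sup>+s. indicator (T r) (x + s *\<^sub>R e) \<partial>lborel)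
     = ennreal r * (indicator (slab e) x * indicator (cball 0 r) (proj e x))"
    by (simp add: mult_ac)
  qed
  also have "\<dots> = ennreal r * emeasure (\<L> e) (cball 0 r)"
   by (subst nn_integral_cmult) (measurable, simp only: emeasure_plane_measure[OF borel_closed[OF closed_cball]])
  finally show ?thesis .
 qed
 have sc: "T t = {x. x /\<^sub>R t \<in> T 1}"
 proof -
  have "proj e (x /\<^sub>R t) = proj e x /\<^sub>R t" for x by (simp add: proj_def scaleR_diff_right)
  then show ?thesis using t by (auto simp: T_def field_simps)
 qed
 have "emeasure lborel (T t) = (\<integral>\<^sup>+x. indicator (T t) x \<partial>density (distr lborel borel (\<lambda>x::'a. 0 + t *\<^sub>R x)) (\<lambda>_. ennreal (\<bar>t\<bar> ^ DIM('a))))"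
  using lborel_affine[of t "0::'a"] t by simp
 also have "\<dots> = (\<integral>\<^sup>+x. ennreal (t ^ DIM('a)) * indicator (T t) (t *\<^sub>R x) \<partial>lborel)"
  using t by (subst nn_integral_density) (auto simp: nn_integral_distr)
 also have "(\<lambda>x. indicator (T t) (t *\<^sub>R x) :: ennreal) = indicator (T 1)"
  using t by (auto simp: sc indicator_def fun_eq_iff)
 also have "(\<integral>\<^sup>+x. ennreal (t ^ DIM('a)) * indicator (T 1) x \<partial>lborel) = ennreal (t ^ DIM('a)) * emeasure lborel (T 1)"
  by (simp add: nn_integral_cmult)
 finally have "ennreal t * emeasure (\<L> e) (cball 0 t) = ennreal (t ^ DIM('a)) * emeasure (\<L> e) (cball 0 1)"
  using thick[OF t] thick[of 1] by simp
 also have "ennreal (t ^ DIM('a)) = ennreal t * ennreal (t ^ (DIM('a) - 1))"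
  using t by (simp add: ennreal_mult'[symmetric] power_eq_if)
 finally show ?thesis using t by (simp add: mult.assoc ennreal_mult_cancel_left)
qed

lemma plane_measure_cball:
 fixes e :: "'a::euclidean_space"
 assumes e: "norm e = 1" and r: "r > 0" and z: "e \<bullet> z = 0"
 shows "emeasure (\<L> e) (cball z r) = ennreal (r ^ (DIM('a) - 1)) * emeasure (\<L> e) (cball 0 1)"
proof -
 have "emeasure (\<L> e) (cball z r) = emeasure (distr (\<L> e) borel ((+) z)) (cball z r)"
  by (simp add: plane_measure_shift[OF e z])
 also have "\<dots> = emeasure (\<L> e) ((+) z -` cball z r)" 
  by (subst emeasure_distr) (auto simp: plane_measure_def)
 also have "(+) z -` cball z r = cball 0 r" by (auto simp: dist_norm)
 finally show ?thesis by (simp add: plane_measure_cball_0[OF e r])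
qed

lemma plane_measure_unit_ball:
 fixes e :: "'a::euclidean_space"
 assumes e: "norm e = 1"
 shows "emeasure (\<L> e) (cball 0 1) \<noteq> 0" "emeasure (\<L> e) (cball 0 1) \<noteq> top"
proof -
 have ee: "e \<bullet> e = 1" using e by (simp add: dot_square_norm)
 let ?S = "slab e \<inter> proj e -` cball 0 1"
 have [measurable]: "?S \<in> sets borel" using measurable_sets[OF proj_measurable, of "cball 0 1" e] by auto
 have eq: "emeasure (\<L> e) (cball 0 1) = emeasure lborel ?S"
 proof -
  have "(\<lambda>x. indicator (slab e) x * indicator (cball 0 1) (proj e x) :: ennreal) = indicator ?S"
   by (auto simp: indicator_def fun_eq_iff)
  then show ?thesis by (simp add: emeasure_plane_measure)
 qed
 have "cball ((1/2) *\<^sub>R e) (1/4) \<subseteq> ?S"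
 proof
  fix x assume "x \<in> cball ((1/2) *\<^sub>R e) (1/4)"
  then have n: "norm (x - (1/2) *\<^sub>R e) \<le> 1/4" by (simp add: dist_norm norm_minus_commute)
  have "\<bar>e \<bullet> (x - (1/2) *\<^sub>R e)\<bar> \<le> 1/4"
   using Cauchy_Schwarz_ineq2[of e "x - (1/2) *\<^sub>R e"] n e by simp
  then have "\<bar>e \<bullet> x - 1/2\<bar> \<le> 1/4" by (simp add: inner_diff_right ee)
  then have "x \<in> slab e" unfolding slab_def abs_le_iff by auto
  moreover have "proj e x = proj e (x - (1/2) *\<^sub>R e)" using proj_add_line[OF e, of x "-1/2"] by simp
  then have "norm (proj e x) \<le> 1" using norm_proj_le[OF e, of "x - (1/2) *\<^sub>R e"] n by simp
  ultimately show "x \<in> ?S" by simp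
 qed
 then have "emeasure lborel (cball ((1/2) *\<^sub>R e) (1/4)) \<le> emeasure lborel ?S" by (intro emeasure_mono) auto
 moreover have "emeasure lborel (cball ((1/2) *\<^sub>R e) (1/4)) \<noteq> 0"
  using content_cball_pos[of "1/4" "(1/2) *\<^sub>R e"] by (auto simp: measure_def)
 ultimately show "emeasure (\<L> e) (cball 0 1) \<noteq> 0" unfolding eq by auto
 have "?S \<subseteq> cball 0 2"
 proof
  fix x assume x: "x \<in> ?S"
  have "norm x \<le> norm (proj e x) + norm ((e \<bullet> x) *\<^sub>R e)"
   using norm_triangle_ineq[of "proj e x" "(e \<bullet> x) *\<^sub>R e"] by (simp add: proj_def)
  then show "x \<in> cball 0 2" using x e by (auto simp: slab_def)
 qed
 then have "emeasure lborel ?S \<le> emeasure lborel (cball 0 2 :: 'a set)" by (intro emeasure_mono) auto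
 also have "\<dots> < \<infinity>" by (rule emeasure_lborel_cball_finite)
 finally show "emeasure (\<L> e) (cball 0 1) \<noteq> top" unfolding eq by auto
qed

text \<open>In \<open>plane_measure_le_hausdorff\<close> the covering sets may be single points, so radius \<open>0\<close> is included; this is
where the hyperplane has to be of positive dimension.\<close>

lemma plane_measure_cball_le:
 fixes e :: "'a::euclidean_space"
 assumes e: "norm e = 1" and d: "DIM('a) \<ge> 2" and t: "t \<ge> 0" and z: "e \<bullet> z = 0"
 shows "emeasure (\<L> e) (cball z t) \<le> ennreal (t ^ (DIM('a) - 1)) * emeasure (\<L> e) (cball 0 1)"
proof (cases "t = 0")
 case True
 obtain c where c: "c \<ge> 0" "emeasure (\<L> e) (cball 0 1) = ennreal c"
  using plane_measure_unit_ball(2)[OF e] by (cases "emeasure (\<L> e) (cball 0 1)") auto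
 have "((\<lambda>r. ennreal (r ^ (DIM('a) - 1) * c)) \<longlongrightarrow> ennreal (0 ^ (DIM('a) - 1) * c)) (at_right 0)"
  by (intro tendsto_intros)
 moreover have "\<forall>\<^sub>F r in at_right 0. emeasure (\<L> e) (cball z 0) \<le> ennreal (r ^ (DIM('a) - 1) * c)"
  using eventually_at_right_less[of "0::real"]
 proof eventually_elim
  case (elim r)
  have "emeasure (\<L> e) (cball z 0) \<le> emeasure (\<L> e) (cball z r)"
   using elim by (intro emeasure_mono) auto
  also have "\<dots> = ennreal (r ^ (DIM('a) - 1) * c)"
   unfolding plane_measure_cball[OF e elim z] c(2) using c(1) elim by (simp add: ennreal_mult')
  finally show ?case .
 qed
 ultimately have "emeasure (\<L> e) (cball z 0) \<le> ennreal (0 ^ (DIM('a) - 1) * c)"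
  by (rule tendsto_lowerbound) simp
 then show ?thesis using True d by (simp add: zero_power)
qed (use assms plane_measure_cball[OF e _ z] in auto)

text \<open>A set of diameter \<open>d\<close> that meets the hyperplane lies in a ball of radius \<open>d\<close> centred on it, so covers by arbitrary sets
become covers by balls.\<close>

lemma plane_measure_le_hausdorff:
 fixes e :: "'a::euclidean_space"
 assumes e: "norm e = 1" and d: "DIM('a) \<ge> 2" and B [measurable]: "B \<in> sets borel" and BV: "B \<subseteq> {x. e \<bullet> x = 0}"
 shows "emeasure (\<L> e) B \<le> emeasure (\<L> e) (cball 0 1) * \<H> (DIM('a) - 1) B"
proof -
 let ?k = "DIM('a) - 1" and ?c = "emeasure (\<L> e) (cball 0 1)"
 have "emeasure (\<L> e) B / ?c \<le> \<P> ?k 1 B"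
 proof (rule hausdorff_premeasure_greatest)
  fix C :: "nat \<Rightarrow> 'a set"
  assume C: "B \<subseteq> (\<Union>i. C i)" "\<And>i. bounded (C i)" "\<And>i. diameter (C i) \<le> 1"
  define S where "S i = (if C i \<inter> B = {} then {} else cball (SOME b. b \<in> C i \<inter> B) (diameter (C i)))" for i
  have sb: "(SOME b. b \<in> C i \<inter> B) \<in> C i \<inter> B" if "C i \<inter> B \<noteq> {}" for i
   by (rule someI_ex) (use that in blast)
  have "B \<subseteq> (\<Union>i. S i)"
  proof
   fix x assume x: "x \<in> B"
   then obtain i where i: "x \<in> C i" using C(1) by blast
   then have "x \<in> S i" using x sb[of i] diameter_bounded_bound[OF C(2)[of i]] by (auto simp: S_def)
   then show "x \<in> (\<Union>i. S i)" by blast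
  qed
  then have "emeasure (\<L> e) B \<le> emeasure (\<L> e) (\<Union>i. S i)"
   by (intro emeasure_mono) (auto simp: S_def)
  also have "\<dots> \<le> (\<Sum>i. emeasure (\<L> e) (S i))"
   by (rule emeasure_subadditive_countably) (auto simp: S_def)
  also have "\<dots> \<le> (\<Sum>i. ennreal (diameter (C i) ^ ?k) * ?c)"
  proof (rule suminf_le)
   fix i
   show "emeasure (\<L> e) (S i) \<le> ennreal (diameter (C i) ^ ?k) * ?c"
   proof (cases "C i \<inter> B = {}")
    case False
    then have "e \<bullet> (SOME b. b \<in> C i \<inter> B) = 0" using sb[OF False] BV by blast
    from plane_measure_cball_le[OF e d diameter_ge_0[OF C(2)] this] show ?thesis
     using False by (simp only: S_def if_False)
   qed (simp add: S_def)
  qed simp_all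
  also have "\<dots> = (\<Sum>i. ennreal (diameter (C i) ^ ?k)) * ?c" by (rule ennreal_suminf_multc)
  finally have "emeasure (\<L> e) B / ?c \<le> ((\<Sum>i. ennreal (diameter (C i) ^ ?k)) * ?c) / ?c"
   by (rule divide_right_mono_ennreal)
  also have "\<dots> = (\<Sum>i. ennreal (diameter (C i) ^ ?k))"
   by (rule ennreal_mult_divide_eq) (use plane_measure_unit_ball[OF e] in auto)
  finally show "emeasure (\<L> e) B / ?c \<le> (\<Sum>i. ennreal (diameter (C i) ^ ?k))" .
 qed
 also have "\<dots> \<le> \<H> ?k B" by (rule hausdorff_premeasure_le_outer) simp
 finally have "?c * (emeasure (\<L> e) B / ?c) \<le> ?c * \<H> ?k B" by (rule mult_left_mono) simp
 moreover have "?c * (emeasure (\<L> e) B / ?c) = emeasure (\<L> e) B"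
  unfolding ennreal_times_divide
  by (subst mult.commute, rule ennreal_mult_divide_eq) (use plane_measure_unit_ball[OF e] in auto)
 ultimately show ?thesis by simp
qed

text \<open>A maximal \<open>t\<close>-separated subset of a ball in the hyperplane is a net, and the volumes of disjoint small balls around
its points bound its size.\<close>

lemma hausdorff_plane_bounded_finite:
 fixes e :: "'a::euclidean_space"
 assumes e: "norm e = 1" and d: "DIM('a) \<ge> 2" and R: "R > 0"
 shows "\<H> (DIM('a) - 1) ({x. e \<bullet> x = 0} \<inter> cball 0 R) < top"
proof -
 let ?k = "DIM('a) - 1" and ?c = "emeasure (\<L> e) (cball 0 1)"
 let ?B = "{x. e \<bullet> x = 0} \<inter> cball 0 R"
 obtain c where c: "c > 0" "?c = ennreal c"
  using plane_measure_unit_ball[OF e] by (cases ?c) (auto simp: less_le)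
 have net: "\<P> ?k (2 * t) ?B \<le> ennreal ((6 * (R + 1)) ^ ?k)" if t: "0 < t" "t \<le> 1" for t
 proof -
  define P where "P F \<longleftrightarrow> finite F \<and> F \<subseteq> ?B \<and> (\<forall>x\<in>F. \<forall>y\<in>F. x \<noteq> y \<longrightarrow> t < dist x y)" for F
  have size: "real (card F) * t ^ ?k \<le> (3 * (R + 1)) ^ ?k" if F: "P F" for F
  proof -
   have fin: "finite F" and FB: "F \<subseteq> ?B" and sep: "\<And>x y. x \<in> F \<Longrightarrow> y \<in> F \<Longrightarrow> x \<noteq> y \<Longrightarrow> t < dist x y"
    using F by (auto simp: P_def)
   have disj: "disjoint_family_on (\<lambda>z. cball z (t/3)) F"
    unfolding disjoint_family_on_def
   proof safe
    fix x y z assume xy: "x \<in> F" "y \<in> F" "x \<noteq> y" and z: "z \<in> cball x (t/3)" "z \<in> cball y (t/3)"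
    have "dist x y \<le> dist x z + dist y z" by (rule dist_triangle2)
    then show "z \<in> {}" using sep[OF xy] z t by auto
   qed
   have "ennreal (real (card F) * ((t/3) ^ ?k * c)) = (\<Sum>z\<in>F. ennreal ((t/3) ^ ?k * c))"
    using c t by (simp add: ennreal_mult' ennreal_of_nat_eq_real_of_nat)
   also have "\<dots> = (\<Sum>z\<in>F. emeasure (\<L> e) (cball z (t/3)))"
    using FB t c by (intro sum.cong refl) (subst plane_measure_cball[OF e], auto simp: ennreal_mult')
   also have "\<dots> = emeasure (\<L> e) (\<Union>z\<in>F. cball z (t/3))"
    using fin disj by (intro sum_emeasure) auto
   also have "\<dots> \<le> emeasure (\<L> e) (cball 0 (R + 1))"
   proof (rule emeasure_mono)
    show "(\<Union>z\<in>F. cball z (t/3)) \<subseteq> cball 0 (R + 1)"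
    proof safe
     fix z x assume z: "z \<in> F" and x: "x \<in> cball z (t/3)"
     have "dist 0 x \<le> dist 0 z + dist z x" by (rule dist_triangle)
     then show "x \<in> cball 0 (R + 1)" using FB z x t by auto
    qed
   qed simp
   also have "\<dots> = ennreal ((R + 1) ^ ?k * c)"
    using R c by (subst plane_measure_cball_0[OF e]) (auto simp: ennreal_mult')
   finally have "real (card F) * ((t/3) ^ ?k * c) \<le> (R + 1) ^ ?k * c"
    using R c by (subst (asm) ennreal_le_iff) auto
   then have "real (card F) * (t/3) ^ ?k \<le> (R + 1) ^ ?k" using c by simp
   then have "real (card F) * (t/3) ^ ?k * 3 ^ ?k \<le> (R + 1) ^ ?k * 3 ^ ?k" by (rule mult_right_mono) simp
   then show ?thesis unfolding power_mult_distrib[of 3 "R + 1"] by (simp add: power_divide mult.commute)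
  qed
  obtain N :: nat where N: "(3 * (R + 1)) ^ ?k / t ^ ?k \<le> real N" using real_arch_simple by blast
  have "card F \<le> N" if "P F" for F
  proof -
   have "real (card F) \<le> (3 * (R + 1)) ^ ?k / t ^ ?k" using size[OF that] t by (simp add: field_simps)
   then show ?thesis using N by simp
  qed
  moreover have "P {}" by (simp add: P_def)
  ultimately obtain F where F: "P F" and mx: "\<And>F'. P F' \<Longrightarrow> card F' \<le> card F"
   using ex_has_greatest_nat[of P "{}" card "Suc N"] by (auto simp: less_Suc_eq_le)
  have fin: "finite F" using F by (simp add: P_def)
  have cover: "?B \<subseteq> (\<Union>z\<in>F. cball z t)"
  proof (rule subsetI, rule ccontr)
   fix x assume x: "x \<in> ?B" "x \<notin> (\<Union>z\<in>F. cball z t)"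
   then have far: "t < dist z x" if "z \<in> F" for z using that by auto
   then have "x \<notin> F" using t by fastforce
   moreover have "P (insert x F)" using F x far by (auto simp: P_def dist_commute)
   ultimately show False using mx[of "insert x F"] fin by simp
  qed
  obtain h where h: "bij_betw h {0..<card F} F" using ex_bij_betw_nat_finite[OF fin] by blast
  define C where "C i = (if i < card F then cball (h i) t else {})" for i
  have dia: "diameter (C i) \<le> 2 * t" for i using t by (simp add: C_def diameter_empty)
  have "\<P> ?k (2 * t) ?B \<le> (\<Sum>i. ennreal (diameter (C i) ^ ?k))"
  proof (rule hausdorff_premeasure_le)
   have Fh: "F = h ` {0..<card F}" using h by (simp add: bij_betw_def)
   have "(\<Union>z\<in>F. cball z t) \<subseteq> (\<Union>i. C i)" 
   proof (intro UN_least)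
    fix z assume "z \<in> F"
    then obtain i where "i < card F" "z = h i" by (subst (asm) Fh) auto
    then have "cball z t = C i" by (simp add: C_def)
    then show "cball z t \<subseteq> (\<Union>i. C i)" by (simp only: UN_upper[OF UNIV_I])
   qed
   then show "?B \<subseteq> (\<Union>i. C i)" by (rule subset_trans[OF cover])
   show "bounded (C i)" for i by (simp add: C_def)
  qed (rule dia)
  also have "\<dots> = (\<Sum>i<card F. ennreal (diameter (C i) ^ ?k))"
  proof (rule suminf_finite)
   fix i assume "i \<notin> {..<card F}"
   then have "diameter (C i) ^ ?k = 0" using d by (simp add: C_def diameter_empty zero_power)
   then show "ennreal (diameter (C i) ^ ?k) = 0" by (simp only: ennreal_0)
  qed simp
  also have "\<dots> \<le> (\<Sum>i<card F. ennreal ((2 * t) ^ ?k))"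
   by (intro sum_mono ennreal_leI power_mono dia) (auto simp: C_def diameter_ge_0)
  also have "\<dots> = ennreal (real (card F) * (2 * t) ^ ?k)"
   using t by (simp add: ennreal_mult' ennreal_of_nat_eq_real_of_nat)
  also have "\<dots> \<le> ennreal ((6 * (R + 1)) ^ ?k)"
  proof (rule ennreal_leI)
   have "real (card F) * (2 * t) ^ ?k = 2 ^ ?k * (real (card F) * t ^ ?k)" by (simp add: power_mult_distrib)
   also have "\<dots> \<le> 2 ^ ?k * (3 * (R + 1)) ^ ?k" by (intro mult_left_mono size[OF F]) simp
   also have "\<dots> = (6 * (R + 1)) ^ ?k" by (simp flip: power_mult_distrib)
   finally show "real (card F) * (2 * t) ^ ?k \<le> (6 * (R + 1)) ^ ?k" .
  qed
  finally show ?thesis .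
 qed
 have "\<H> ?k ?B \<le> ennreal ((6 * (R + 1)) ^ ?k)"
  unfolding hausdorff_outer_eq_SUP[of 2, OF zero_less_numeral]
 proof (rule SUP_least)
  fix n :: nat
  show "\<P> ?k (2 / real (Suc n)) ?B \<le> ennreal ((6 * (R + 1)) ^ ?k)"
   using net[of "1 / real (Suc n)"] by simp
 qed
 then show ?thesis by (simp add: le_less_trans)
qed

text \<open>On a hyperplane through the origin both measures are invariant under translations, hence proportional;
the unit ball determines the factor.\<close>

lemma hausdorff_outer_plane:
 fixes e :: "'a::euclidean_space"
 assumes e: "norm e = 1" and d: "DIM('a) \<ge> 2"
  and B [measurable]: "B \<in> sets borel" and BV: "B \<subseteq> {x. e \<bullet> x = 0}"
 shows "\<H> (DIM('a) - 1) B * emeasure (\<L> e) (cball 0 1)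
  = emeasure (\<L> e) B * \<H> (DIM('a) - 1) ({x. e \<bullet> x = 0} \<inter> cball 0 1)"
proof -
 let ?k = "DIM('a) - 1" and ?V = "{x. e \<bullet> x = 0}"
 have k: "?k \<ge> 1" using d by simp
 have [measurable]: "?V \<in> sets borel" by measurable
 define M :: "'a measure" where "M = density (hausdorff_measure ?k) (indicator ?V)"
 have [measurable_cong]: "sets M = sets borel" by (simp add: M_def)
 have M: "emeasure M S = \<H> ?k (?V \<inter> S)" if [measurable]: "S \<in> sets borel" for S
 proof -
  have "emeasure M S = (\<integral>\<^sup>+x. indicator (?V \<inter> S) x \<partial>hausdorff_measure ?k)"
   unfolding M_def by (subst emeasure_density) (auto intro!: nn_integral_cong simp: indicator_inter_arith simp del: nn_integral_indicator)
  also have "\<dots> = emeasure (hausdorff_measure ?k) (?V \<inter> S)" by (rule nn_integral_indicator) simp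
  also have "\<dots> = \<H> ?k (?V \<inter> S)" by (rule emeasure_hausdorff_measure[OF k]) simp
  finally show ?thesis .
 qed
 have "emeasure M B * emeasure (\<L> e) (cball 0 1)
   = emeasure (\<L> e) B * emeasure M (uminus -` cball 0 1)"
 proof (rule haar_unique_up_to_factor[where V = ?V])
  show "sigma_finite_measure M"
  proof (rule sigma_finite_measureI_balls)
   fix r :: real
   have "emeasure M (cball 0 r) \<le> \<H> ?k (?V \<inter> cball 0 (\<bar>r\<bar> + 1))"
    by (subst M) (auto intro!: hausdorff_outer_mono)
   also have "\<dots> < top" by (rule hausdorff_plane_bounded_finite[OF e d]) simp
   finally show "emeasure M (cball 0 r) < \<infinity>" by simp
  qed (simp add: M_def)
  show "sigma_finite_measure (\<L> e)"
  proof (rule sigma_finite_measureI_balls)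
   fix r :: real
   have "emeasure (\<L> e) (cball 0 r) \<le> emeasure (\<L> e) (cball 0 (\<bar>r\<bar> + 1))"
    by (intro emeasure_mono) auto
   also have "\<dots> < \<infinity>"
    using plane_measure_unit_ball(2)[OF e]
    by (subst plane_measure_cball_0[OF e]) (auto simp: ennreal_mult_less_top less_top)
   finally show "emeasure (\<L> e) (cball 0 r) < \<infinity>" .
  qed simp
  show "distr M borel ((+) v) = M" if v: "v \<in> ?V" for v
  proof (rule measure_eqI)
   fix S assume "S \<in> sets (distr M borel ((+) v))"
   then have [measurable]: "S \<in> sets borel" by simp
   have m: "(+) v -` S \<in> sets borel" using measurable_sets[of "(+) v" borel borel S] by simp
   have "emeasure (distr M borel ((+) v)) S = \<H> ?k (?V \<inter> (+) v -` S)"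
    using M[OF m] by (subst emeasure_distr) (auto simp: M_def)
   also have "\<dots> = \<H> ?k ((+) v ` (?V \<inter> (+) v -` S))"
    by (rule hausdorff_outer_isometry[symmetric]) simp
   also have "(+) v ` (?V \<inter> (+) v -` S) = ?V \<inter> S"
   proof
    show "?V \<inter> S \<subseteq> (+) v ` (?V \<inter> (+) v -` S)"
    proof
     fix x assume "x \<in> ?V \<inter> S"
     then show "x \<in> (+) v ` (?V \<inter> (+) v -` S)"
      using v by (intro image_eqI[of _ _ "x - v"]) (auto simp: inner_diff_right)
    qed
   qed (use v in \<open>auto simp: inner_add_right\<close>)
   finally show "emeasure (distr M borel ((+) v)) S = emeasure M S" by (simp add: M)
  qed (simp add: M_def)
  show "AE x in M. x \<in> ?V" unfolding M_def by (subst AE_density) (auto simp: indicator_def)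
  show "AE x in \<L> e. x \<in> ?V" using AE_plane_measure[OF e] by simp
 qed (auto simp: M_def plane_measure_shift[OF e])
 moreover have "uminus -` cball 0 1 = cball (0::'a) 1" by auto
 moreover have "?V \<inter> B = B" using BV by auto
 ultimately show ?thesis by (simp add: M)
qed

text \<open>By a rotation, the factor between the two measures is the same for all hyperplanes.\<close>

lemma plane_ball_rotation:
 fixes e e' :: "real^'n"
 assumes e: "norm e = 1" and e': "norm e' = 1"
 shows "emeasure (\<L> e) (cball 0 1) = emeasure (\<L> e') (cball 0 1)"
  and "\<H> k ({x. e \<bullet> x = 0} \<inter> cball 0 1) = \<H> k ({x. e' \<bullet> x = 0} \<inter> cball 0 1)"
proof -
 obtain R where R: "orthogonal_transformation R" and Re: "R e = e'"
  using orthogonal_transformation_exists[of e e'] e e' by auto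
 have Rin: "R x \<bullet> R y = x \<bullet> y" for x y using R by (simp add: orthogonal_transformation_def)
 have lin: "linear R" using R by (simp add: orthogonal_transformation_def)
 have nR: "norm (R x) = norm x" for x using R by (simp add: orthogonal_transformation_norm)
 have [measurable]: "R \<in> borel_measurable borel"
  using lin by (intro borel_measurable_continuous_onI linear_continuous_on) (simp add: linear_conv_bounded_linear)
 have eR: "e' \<bullet> R x = e \<bullet> x" for x using Rin[of e x] Re by simp
 have pR: "norm (proj e' (R x)) = norm (proj e x)" for x
 proof -
  have "proj e' (R x) = R (proj e x)" unfolding proj_def eR linear_diff[OF lin] linear_cmul[OF lin] Re ..
  then show ?thesis by (simp add: nR)
 qed
 have [measurable]: "cball (0 :: real^'n) 1 \<in> sets borel" by simp
 have "emeasure (\<L> e') (cball 0 1)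
   = (\<integral>\<^sup>+x. indicator (slab e') x * indicator (cball 0 1) (proj e' x) \<partial>distr lborel borel R)"
  by (simp add: lborel_orthogonal[OF R] emeasure_plane_measure)
 also have "\<dots> = (\<integral>\<^sup>+x. indicator (slab e') (R x) * indicator (cball 0 1) (proj e' (R x)) \<partial>lborel)"
  by (subst nn_integral_distr) auto
 also have "\<dots> = (slab_int e (\<lambda>x. indicator (cball 0 1) (proj e x)))"
  by (intro nn_integral_cong) (simp add: indicator_def slab_def eR pR)
 finally show "emeasure (\<L> e) (cball 0 1) = emeasure (\<L> e') (cball 0 1)"
  by (simp add: emeasure_plane_measure)
 have "{x. e' \<bullet> x = 0} \<inter> cball 0 1 = R ` ({x. e \<bullet> x = 0} \<inter> cball 0 1)"
 proof
  show "{x. e' \<bullet> x = 0} \<inter> cball 0 1 \<subseteq> R ` ({x. e \<bullet> x = 0} \<inter> cball 0 1)"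
  proof
   fix x assume x: "x \<in> {x. e' \<bullet> x = 0} \<inter> cball 0 1"
   obtain y where "x = R y" using orthogonal_transformation_surj[OF R] by (auto simp: surj_def)
   then show "x \<in> R ` ({x. e \<bullet> x = 0} \<inter> cball 0 1)" using x by (auto simp: eR nR)
  qed
 qed (auto simp: eR nR)
 moreover have "dist (R x) (R y) = dist x y" for x y
  using nR[of "x - y"] by (simp add: dist_norm linear_diff[OF lin])
 ultimately show "\<H> k ({x. e \<bullet> x = 0} \<inter> cball 0 1) = \<H> k ({x. e' \<bullet> x = 0} \<inter> cball 0 1)"
  by (metis hausdorff_outer_isometry)
qed

lemma plane_measure_unit_face:
 "emeasure (\<L> (axis (SOME k. True) 1)) (unit_face :: (real^'n) set) = 1"
proof -
 define k :: 'n where "k = (SOME k. True)"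
 let ?e = "axis k 1 :: real^'n"
 have uf: "unit_face = {x :: real^'n. (\<forall>i. 0 \<le> x $ i \<and> x $ i \<le> 1) \<and> x $ k = 0}"
  by (simp add: unit_face_def k_def)
 have [measurable]: "(unit_face :: (real^'n) set) \<in> sets borel"
 proof -
  have "unit_face = (\<Inter>i. {x :: real^'n. 0 \<le> x $ i} \<inter> {x. x $ i \<le> 1}) \<inter> {x. x $ k = 0}"
   by (auto simp: uf)
  moreover have "closed \<dots>"
   by (intro closed_Int closed_INT ballI closed_Collect_le closed_Collect_eq continuous_intros)
  ultimately show ?thesis by (simp only: borel_closed)
 qed
 have pk: "proj ?e x $ i = (if i = k then 0 else x $ i)" for x i
  by (simp add: proj_def inner_axis') (simp add: axis_def)
 define S where "S = {x :: real^'n. x \<in> slab ?e \<and> proj ?e x \<in> unit_face}"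
 have S: "S = {x. (\<forall>i. 0 \<le> x $ i \<and> x $ i \<le> 1) \<and> x $ k < 1}"
  unfolding S_def slab_def uf by (auto simp: inner_axis' pk split: if_splits) (metis less_eq_real_def)+
 have [measurable]: "S \<in> sets borel" unfolding S_def by measurable
 have "emeasure (\<L> ?e) unit_face = emeasure lborel S"
 proof -
  have "(\<lambda>x. indicator (slab ?e) x * indicator unit_face (proj ?e x) :: ennreal) = indicator S"
   by (auto simp: indicator_def fun_eq_iff S_def)
  then show ?thesis by (simp add: emeasure_plane_measure)
 qed
 moreover have "emeasure lborel (box 0 1 :: (real^'n) set) = 1" "emeasure lborel (cbox 0 1 :: (real^'n) set) = 1"
 proof -
  have "(1 :: real^'n) \<bullet> b = 1" if "b \<in> Basis" for b using that by (auto simp: Basis_vec_def inner_axis)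
  then show "emeasure lborel (box 0 1 :: (real^'n) set) = 1" "emeasure lborel (cbox 0 1 :: (real^'n) set) = 1"
   by (simp_all add: emeasure_lborel_box emeasure_lborel_cbox)
 qed
 moreover have "box 0 1 \<subseteq> S" "S \<subseteq> cbox 0 1"
  by (auto simp: S mem_box_cart less_imp_le)
 then have "emeasure lborel (box 0 1 :: (real^'n) set) \<le> emeasure lborel S" "emeasure lborel S \<le> emeasure lborel (cbox 0 1 :: (real^'n) set)"
  by (auto intro!: emeasure_mono)
 ultimately show ?thesis unfolding k_def[symmetric] by (metis antisym)
qed

theorem area_hyperplane:
 fixes e :: "real^'n"
 assumes n: "CARD('n) \<ge> 2" and e: "norm e = 1" and B [measurable]: "B \<in> sets borel" and BV: "B \<subseteq> {x. e \<bullet> x = 0}"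
 shows "emeasure \<A> B = emeasure (\<L> e) B"
proof -
 let ?a = "axis (SOME k. True) 1 :: real^'n" and ?k = "DIM(real^'n) - 1"
 have d: "DIM(real^'n) \<ge> 2" using n by simp
 have a: "norm ?a = 1" by simp
 let ?c = "emeasure (\<L> e) (cball 0 1)" and ?h = "\<H> ?k ({x. e \<bullet> x = 0} \<inter> cball 0 1)"
 have c: "?c \<noteq> 0" "?c \<noteq> top" using plane_measure_unit_ball[OF e] by auto
 have h: "?h < top" by (rule hausdorff_plane_bounded_finite[OF e d]) simp
 have uf [measurable]: "(unit_face :: (real^'n) set) \<in> sets borel"
 proof (rule ccontr)
  assume "\<not> ?thesis"
  then show False using plane_measure_unit_face[where 'n = 'n] by (simp add: emeasure_notin_sets)
 qed
 have "unit_face \<subseteq> {x. ?a \<bullet> x = 0}" by (auto simp: unit_face_def inner_axis')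
 then have "\<H> ?k (unit_face :: (real^'n) set) * ?c = ?h"
  using hausdorff_outer_plane[OF a d uf] plane_measure_unit_face[where 'n = 'n]
   plane_ball_rotation[OF a e] by simp
 moreover have Bh: "\<H> ?k B * ?c = emeasure (\<L> e) B * ?h"
  by (rule hausdorff_outer_plane[OF e d B BV])
 ultimately have "\<H> ?k B * ?c = (emeasure (\<L> e) B * \<H> ?k (unit_face :: (real^'n) set)) * ?c"
  by (simp add: mult.assoc)
 then have eq: "\<H> ?k B = emeasure (\<L> e) B * \<H> ?k (unit_face :: (real^'n) set)"
  using c by (simp add: ennreal_mult_cancel_left mult.commute[of _ ?c])
 have fin: "\<H> ?k (unit_face :: (real^'n) set) \<noteq> top"
  using \<open>_ * ?c = ?h\<close> c h by (auto simp: ennreal_top_mult)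
 \<comment> \<open>the normalising constant of the area is not \<open>0\<close>, since Hausdorff measure dominates Lebesgue measure on the plane\<close>
 have "1 \<le> emeasure (\<L> ?a) (cball 0 1) * \<H> ?k (unit_face :: (real^'n) set)"
  using plane_measure_le_hausdorff[OF a d uf \<open>unit_face \<subseteq> _\<close>] plane_measure_unit_face[where 'n = 'n] by simp
 then have nz: "\<H> ?k (unit_face :: (real^'n) set) \<noteq> 0" by auto
 show ?thesis
  using emeasure_area_measure_quotient[OF n B] eq fin nz by (simp add: ennreal_mult_divide_eq)
qed

section \<open>Area of graphs\<close>

text \<open>Graphs over the hyperplane orthogonal to \<open>e\<close>. The function \<open>\<Phi>\<close> is defined on the whole space and constant
along \<open>e\<close> in all uses; then \<open>lift\<close> is the projection onto its graph along \<open>e\<close>.\<close>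

definition lift :: "'a::real_inner \<Rightarrow> ('a \<Rightarrow> real) \<Rightarrow> 'a \<Rightarrow> 'a" where
 "lift e \<Phi> x = x + (\<Phi> x - e \<bullet> x) *\<^sub>R e"

definition graph :: "'a::real_inner \<Rightarrow> ('a \<Rightarrow> real) \<Rightarrow> 'a set" where
 "graph e \<Phi> = {x. e \<bullet> x = \<Phi> x}"

text \<open>The unit normal of the graph is \<open>(e - q) / sqrt (1 + |q|^2)\<close>. Thickening the graph along
 this normal and along \<open>e\<close> gives two regions that a shear maps to each other, up to the ratio
 of the heights.\<close>

lemma area_linear_graph:
 fixes e q :: "real^'n"
 assumes n: "CARD('n) \<ge> 2" and e: "norm e = 1" and qe: "q \<bullet> e = 0"
  and B [measurable]: "B \<in> sets borel" and BG: "B \<subseteq> graph e (\<lambda>x. q \<bullet> x)"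
 shows "emeasure \<A> B =
  ennreal (sqrt (1 + (norm q)\<^sup>2)) * (slab_int e (\<lambda>x. indicator B (lift e (\<lambda>x. q \<bullet> x) x)))"
proof -
 define J where "J = sqrt (1 + (norm q)\<^sup>2)"
 have J2: "J * J = 1 + q \<bullet> q" by (simp add: J_def power2_norm_eq_inner)
 have J1: "J \<ge> 1" by (simp add: J_def)
 then have J0: "J > 0" by simp
 have ee: "e \<bullet> e = 1" using e by (simp add: norm_eq_1)
 define N where "N = (1 / J) *\<^sub>R (e - q)"
 have "N \<bullet> N = (1 + q \<bullet> q) / (J * J)"
  using qe ee by (simp add: N_def inner_diff_left inner_diff_right inner_commute add_divide_distrib)
 then have NN: "N \<bullet> N = 1" using J2 J0 by (metis divide_self mult_pos_pos less_irrefl)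
 have N: "norm N = 1" using NN by (simp add: norm_eq_1)
 have Ne: "N \<bullet> e = 1 / J" by (simp add: N_def inner_diff_left ee qe)
 define w where "w = J *\<^sub>R e - N"
 have Nw: "N \<bullet> w = 0" using J0 by (simp add: w_def inner_diff_right Ne NN)
 have [measurable]: "lift e (\<lambda>x. q \<bullet> x) \<in> borel_measurable borel" unfolding lift_def by measurable
 have BN: "B \<subseteq> {x. N \<bullet> x = 0}" using BG by (auto simp: graph_def N_def inner_diff_left)
 have lin: "x - (N \<bullet> x) *\<^sub>R (J *\<^sub>R e) = lift e (\<lambda>x. q \<bullet> x) x" for x
  using J0 by (simp add: lift_def N_def inner_diff_left algebra_simps)
 define F where "F x = (indicator (slab N) x * indicator B (x - (N \<bullet> x) *\<^sub>R (J *\<^sub>R e)) :: ennreal)" for x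
 have [measurable]: "F \<in> borel_measurable borel" unfolding F_def by measurable
 have "emeasure \<A> B = (slab_int N (\<lambda>x. indicator B (proj N x)))"
  by (simp add: area_hyperplane[OF n N B BN] emeasure_plane_measure)
 also have "\<dots> = (\<integral>\<^sup>+x. F (x + (N \<bullet> x) *\<^sub>R w) \<partial>lborel)"
 proof (rule nn_integral_cong)
  fix x
  have Nx: "N \<bullet> (x + (N \<bullet> x) *\<^sub>R w) = N \<bullet> x" by (simp add: inner_add_right Nw)
  have "x + (N \<bullet> x) *\<^sub>R w - (N \<bullet> x) *\<^sub>R (J *\<^sub>R e) = proj N x" by (simp add: w_def proj_def algebra_simps)
  then show "indicator (slab N) x * indicator B (proj N x) = F (x + (N \<bullet> x) *\<^sub>R w)"
   unfolding F_def Nx by (simp add: slab_def Nx indicator_def)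
 qed
 also have "\<dots> = (\<integral>\<^sup>+x. F x \<partial>lborel)"
 proof (cases "w = 0")
  case False
  show ?thesis
  proof (rule nn_integral_shear)
   show "((1 / (w \<bullet> w)) *\<^sub>R w) \<bullet> w = 1" using False by simp
  qed (auto simp: inner_add_right Nw)
 qed simp
 also have "\<dots> = (slab_int e (\<lambda>x. \<integral>\<^sup>+s. F (x + s *\<^sub>R e) \<partial>lborel))"
  by (rule nn_integral_line_fubini[OF _ ee]) simp
 also have "\<dots> = (\<integral>\<^sup>+x. ennreal J * (indicator (slab e) x * indicator B (lift e (\<lambda>x. q \<bullet> x) x)) \<partial>lborel)"
 proof (rule nn_integral_cong)
  fix x
  have "lift e (\<lambda>x. q \<bullet> x) (x + s *\<^sub>R e) = lift e (\<lambda>x. q \<bullet> x) x" for s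
   by (simp add: lift_def inner_add_right ee qe algebra_simps)
  then have "F (x + s *\<^sub>R e) = indicator {- J * (N \<bullet> x) ..< J - J * (N \<bullet> x)} s * indicator B (lift e (\<lambda>x. q \<bullet> x) x)" for s
   using J0 unfolding F_def lin by (auto simp: slab_def indicator_def inner_add_right Ne field_simps)
  then have "(\<integral>\<^sup>+s. F (x + s *\<^sub>R e) \<partial>lborel) = ennreal J * indicator B (lift e (\<lambda>x. q \<bullet> x) x)"
   using J0 by (simp add: nn_integral_multc)
  then show "indicator (slab e) x * (\<integral>\<^sup>+s. F (x + s *\<^sub>R e) \<partial>lborel)
    = ennreal J * (indicator (slab e) x * indicator B (lift e (\<lambda>x. q \<bullet> x) x))"
   by (simp add: mult_ac)
 qed
 also have "\<dots> = ennreal J * (slab_int e (\<lambda>x. indicator B (lift e (\<lambda>x. q \<bullet> x) x)))"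
  by (rule nn_integral_cmult) measurable
 finally show ?thesis by (simp add: J_def)
qed

lemma area_lipschitz_image:
 fixes A :: "(real^'n) set"
 assumes n: "CARD('n) \<ge> 2" and L: "L > 0"
  and g: "\<And>x y. x \<in> A \<Longrightarrow> y \<in> A \<Longrightarrow> dist (g x) (g y) \<le> L * dist x y"
  and A: "A \<in> sets borel" and gA: "g ` A \<in> sets borel"
 shows "emeasure \<A> (g ` A :: (real^'n) set) \<le> ennreal (L ^ (CARD('n) - 1)) * emeasure \<A> A"
 unfolding emeasure_area_measure_quotient[OF n A] emeasure_area_measure_quotient[OF n gA] ennreal_times_divide
 by (intro divide_right_mono_ennreal hausdorff_outer_lipschitz_image[OF L g])

text \<open>By the Lindelof property \<open>\<Gamma>\<close> is covered by countably many of the balls; cutting \<open>B\<close> along them adds up the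
local inequalities.\<close>

lemma emeasure_le_from_local:
 fixes M1 M2 :: "'a::euclidean_space measure"
 assumes M [measurable_cong]: "sets M1 = sets borel" "sets M2 = sets borel"
  and \<Gamma> [measurable]: "\<Gamma> \<in> sets borel" and null: "emeasure M1 (- \<Gamma>) = 0"
  and loc: "\<And>y. y \<in> \<Gamma> \<Longrightarrow> \<exists>r>0. \<forall>B\<in>sets borel. B \<subseteq> ball y r \<longrightarrow> emeasure M1 B \<le> c * emeasure M2 B"
  and B [measurable]: "B \<in> sets borel"
 shows "emeasure M1 B \<le> c * emeasure M2 B"
proof -
 obtain r where r: "\<And>y. y \<in> \<Gamma> \<Longrightarrow> r y > 0"
  and le: "\<And>y B. y \<in> \<Gamma> \<Longrightarrow> B \<in> sets borel \<Longrightarrow> B \<subseteq> ball y (r y) \<Longrightarrow> emeasure M1 B \<le> c * emeasure M2 B"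
  using loc by metis
 obtain F where F: "F \<subseteq> (\<lambda>y. ball y (r y)) ` \<Gamma>" "countable F" "\<Union>F = \<Union>((\<lambda>y. ball y (r y)) ` \<Gamma>)"
  using Lindelof[of "(\<lambda>y. ball y (r y)) ` \<Gamma>"] by auto
 have cov: "\<Gamma> \<subseteq> \<Union>F" unfolding F(3) using r by force
 show ?thesis
 proof (cases "F = {}")
  case True
  then have "B \<subseteq> - \<Gamma>" using cov by auto
  then have "emeasure M1 B \<le> emeasure M1 (- \<Gamma>)" by (intro emeasure_mono) (auto simp: M)
  then show ?thesis using null by simp
 next
  case False
  define D where "D = disjointed (from_nat_into F)"
  have rF: "range (from_nat_into F) = F" using False F(2) by (rule range_from_nat_into)
  have ball: "\<exists>y\<in>\<Gamma>. from_nat_into F i = ball y (r y)" for i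
   using F(1) from_nat_into[OF False, of i] by blast
  have [measurable]: "from_nat_into F i \<in> sets borel" for i using ball[of i] by auto
  then have [measurable]: "D i \<in> sets borel" for i
   unfolding D_def using sets.range_disjointed_sets[of "from_nat_into F" borel] by (simp add: image_subset_iff)
  have UD: "(\<Union>i. D i) = \<Union>F" unfolding D_def UN_disjointed_eq using rF by auto
  have dj: "disjoint_family (\<lambda>i. B \<inter> D i)"
   using disjoint_family_disjointed[of "from_nat_into F"] unfolding D_def disjoint_family_on_def by blast
  have "B \<subseteq> (\<Union>i. B \<inter> D i) \<union> - \<Gamma>" using cov unfolding UD[symmetric] by blast
  then have "emeasure M1 B \<le> emeasure M1 ((\<Union>i. B \<inter> D i) \<union> - \<Gamma>)"
   by (rule emeasure_mono) measurable
  also have "\<dots> \<le> emeasure M1 (\<Union>i. B \<inter> D i) + emeasure M1 (- \<Gamma>)"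
   by (rule emeasure_subadditive) (auto simp: M)
  also have "\<dots> = (\<Sum>i. emeasure M1 (B \<inter> D i))"
   unfolding null by (subst suminf_emeasure) (use dj in \<open>auto simp: M\<close>)
  also have "\<dots> \<le> (\<Sum>i. c * emeasure M2 (B \<inter> D i))"
  proof (rule suminf_le)
   fix i
   obtain y where y: "y \<in> \<Gamma>" "from_nat_into F i = ball y (r y)" using ball by blast
   have "B \<inter> D i \<subseteq> ball y (r y)" using disjointed_subset[of "from_nat_into F" i] y by (auto simp: D_def)
   then show "emeasure M1 (B \<inter> D i) \<le> c * emeasure M2 (B \<inter> D i)" by (intro le[OF y(1)]) auto
  qed auto
  also have "\<dots> = c * emeasure M2 (\<Union>i. B \<inter> D i)"
   by (subst ennreal_suminf_cmult, subst suminf_emeasure) (use dj in \<open>auto simp: M\<close>)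
  also have "\<dots> \<le> c * emeasure M2 B" by (intro mult_left_mono emeasure_mono) (auto simp: M)
  finally show ?thesis .
 qed
qed

lemma ennreal_le_all_factors:
 fixes a b :: ennreal
 assumes "\<And>c. c > 1 \<Longrightarrow> a \<le> ennreal c * b"
 shows "a \<le> b"
proof (cases "b = top")
 case False
 then obtain b' where b: "b = ennreal b'" "b' \<ge> 0" by (cases b) auto
 have "((\<lambda>c. ennreal (c * b')) \<longlongrightarrow> ennreal (1 * b')) (at_right 1)" by (intro tendsto_intros)
 moreover have "\<forall>\<^sub>F c in at_right 1. a \<le> ennreal (c * b')"
  using eventually_at_right_less[of "1::real"]
  by eventually_elim (use assms b in \<open>simp add: ennreal_mult'\<close>)
 ultimately have "a \<le> ennreal (1 * b')" by (rule tendsto_lowerbound) simp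
 then show ?thesis using b by simp
qed simp

text \<open>A graph that is of class \<open>C\<^sup>1\<close> over the cylinder \<open>W\<close> and merely continuous elsewhere, with \<open>q\<close> the gradient of
\<open>\<Phi>\<close>.\<close>

locale graph_chart =
 fixes e :: "real^'n" and \<Phi> :: "real^'n \<Rightarrow> real" and q :: "real^'n \<Rightarrow> real^'n" and W :: "(real^'n) set"
 assumes n: "CARD('n) \<ge> 2" and e: "norm e = 1"
  and \<Phi>_cont: "continuous_on UNIV \<Phi>" and \<Phi>_line: "\<And>x s. \<Phi> (x + s *\<^sub>R e) = \<Phi> x"
  and W_open: "open W" and W_line: "\<And>x s. x \<in> W \<Longrightarrow> x + s *\<^sub>R e \<in> W"
  and \<Phi>_deriv: "\<And>x. x \<in> W \<Longrightarrow> (\<Phi> has_derivative (\<lambda>h. q x \<bullet> h)) (at x)"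
  and q_cont: "continuous_on W q"
begin

abbreviation G where "G \<equiv> lift e \<Phi>"
abbreviation \<Gamma> where "\<Gamma> \<equiv> graph e \<Phi>"

definition J where "J x = sqrt (1 + (norm (q x))\<^sup>2)"

lemma ee: "e \<bullet> e = 1" using e by (simp add: norm_eq_1)

lemma \<Phi>_measurable [measurable]: "\<Phi> \<in> borel_measurable borel"
 using \<Phi>_cont by (rule borel_measurable_continuous_onI)

lemma G_cont: "continuous_on UNIV G"
 unfolding lift_def[abs_def] by (intro continuous_intros \<Phi>_cont)

lemma G_measurable [measurable]: "G \<in> borel_measurable borel"
 using G_cont by (rule borel_measurable_continuous_onI)

lemma \<Gamma>_closed: "closed \<Gamma>"
 unfolding graph_def by (intro closed_Collect_eq continuous_intros \<Phi>_cont)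

lemma \<Gamma>_measurable [measurable]: "\<Gamma> \<in> sets borel" using \<Gamma>_closed by simp

lemma W_measurable [measurable]: "W \<in> sets borel" using W_open by simp

lemma \<Phi>_G: "\<Phi> (G x) = \<Phi> x" by (simp add: lift_def \<Phi>_line)

lemma G_in_graph: "G x \<in> \<Gamma>"
 using \<Phi>_G by (simp add: graph_def) (simp add: lift_def inner_add_right ee)

lemma G_line: "G (x + s *\<^sub>R e) = G x"
 by (simp add: lift_def \<Phi>_line inner_add_right ee algebra_simps)

lemma G_id: "x \<in> \<Gamma> \<Longrightarrow> G x = x" by (simp add: graph_def lift_def)

lemma G_in_W: "G x \<in> W \<longleftrightarrow> x \<in> W"
proof
 have "G x + (- (\<Phi> x - e \<bullet> x)) *\<^sub>R e = x" unfolding lift_def by (simp only: scaleR_minus_left add_minus_cancel add.assoc right_minus add_0_right)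
 then show "G x \<in> W \<Longrightarrow> x \<in> W" using W_line[of "G x" "- (\<Phi> x - e \<bullet> x)"] by simp
 show "x \<in> W \<Longrightarrow> G x \<in> W" unfolding lift_def by (rule W_line)
qed

lemma q_e: assumes x: "x \<in> W" shows "q x \<bullet> e = 0"
proof -
 have "((\<lambda>s. \<Phi> (x + s *\<^sub>R e)) has_derivative (\<lambda>s. q x \<bullet> (s *\<^sub>R e))) (at 0)"
  by (rule has_derivative_compose[of "\<lambda>s. x + s *\<^sub>R e" "\<lambda>s. s *\<^sub>R e" 0 UNIV \<Phi>])
   (use \<Phi>_deriv[OF x] in \<open>auto intro!: derivative_eq_intros\<close>)
 moreover have "((\<lambda>s. \<Phi> (x + s *\<^sub>R e)) has_derivative (\<lambda>s. 0)) (at 0)" by (simp add: \<Phi>_line)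
 ultimately have "(\<lambda>s. q x \<bullet> (s *\<^sub>R e)) = (\<lambda>s. 0)" by (rule has_derivative_unique)
 from fun_cong[OF this, of 1] show ?thesis by simp
qed

lemma q_line: assumes x: "x \<in> W" shows "q (x + s *\<^sub>R e) = q x"
proof -
 have "((\<lambda>y. \<Phi> (y + s *\<^sub>R e)) has_derivative (\<lambda>h. q (x + s *\<^sub>R e) \<bullet> h)) (at x)"
  by (rule has_derivative_compose[of "\<lambda>y. y + s *\<^sub>R e" "\<lambda>h. h" x UNIV \<Phi>])
   (use \<Phi>_deriv[OF W_line[OF x]] in \<open>auto intro!: derivative_eq_intros\<close>)
 then have "(\<lambda>h. q (x + s *\<^sub>R e) \<bullet> h) = (\<lambda>h. q x \<bullet> h)"
  unfolding \<Phi>_line by (rule has_derivative_unique[OF _ \<Phi>_deriv[OF x]])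
 then have "q (x + s *\<^sub>R e) \<bullet> h = q x \<bullet> h" for h by (rule fun_cong)
 then show ?thesis by (rule vector_eq_rdot[THEN iffD1, OF allI])
qed

lemma q_G: "x \<in> W \<Longrightarrow> q (G x) = q x" unfolding lift_def by (rule q_line)

lemma J_ge_1: "J x \<ge> 1" by (simp add: J_def)

lemma J_cont: "continuous_on W J"
 unfolding J_def[abs_def] by (intro continuous_intros q_cont)

lemma J_measurable [measurable]: "(\<lambda>x. ennreal (indicator W x * J x)) \<in> borel_measurable borel"
 using borel_measurable_continuous_on_indicator[OF _ J_cont] by (simp add: W_measurable)

abbreviation graph_area where
 "graph_area B \<equiv> \<integral>\<^sup>+x. indicator (slab e) x * (indicator B (G x) * ennreal (indicator W x * J x)) \<partial>lborel"

text \<open>Near \<open>y\<close>, the projection along \<open>e\<close> onto the tangent plane at \<open>y\<close> changes distances on the graph by factors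
in \<open>[1 - d, 1 + d]\<close> only, and \<open>J\<close> varies by a factor of at most \<open>1 + d\<close>. So the two measures compare as they
do on the tangent plane, up to powers of these factors.\<close>

lemma area_comparison:
 assumes y: "y \<in> \<Gamma> \<inter> W" and c: "c > 1"
 shows "\<exists>r>0. ball y r \<subseteq> W \<and> (\<forall>B\<in>sets borel. B \<subseteq> ball y r \<longrightarrow>
  emeasure \<A> (B \<inter> \<Gamma>) \<le> ennreal c * graph_area B \<and>
  graph_area B \<le> ennreal c * emeasure \<A> (B \<inter> \<Gamma>))"
proof -
 define k where "k = CARD('n) - 1"
 have yW: "y \<in> W" using y by simp
 have "((\<lambda>d. (1 + d) * (1 + d) ^ k) \<longlongrightarrow> (1 + 0) * (1 + 0) ^ k) (at_right (0::real))"
  "((\<lambda>d. (1 + d) * (1 / (1 - d)) ^ k) \<longlongrightarrow> (1 + 0) * (1 / (1 - 0)) ^ k) (at_right (0::real))"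
  by (intro tendsto_mult tendsto_add tendsto_power tendsto_divide tendsto_diff tendsto_const tendsto_ident_at; simp)+
 then have "\<forall>\<^sub>F d in at_right 0. (1 + d) * (1 + d) ^ k < c" "\<forall>\<^sub>F d in at_right 0. (1 + d) * (1 / (1 - d)) ^ k < c"
  using c by (simp_all add: order_tendstoD(2))
 moreover have "\<forall>\<^sub>F d in at_right 0. d < (1::real)" by (rule eventually_at_right_field[THEN iffD2]) (auto intro: exI[of _ 1])
 ultimately have "\<forall>\<^sub>F d in at_right 0. (1 + d) * (1 + d) ^ k < c \<and> (1 + d) * (1 / (1 - d)) ^ k < c \<and> d < 1 \<and> 0 < d"
  using eventually_at_right_less[of "0::real"] by eventually_elim auto
 then obtain d :: real where d: "0 < d" "d < 1" and c1: "(1 + d) * (1 + d) ^ k < c"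
  and c2: "(1 + d) * (1 / (1 - d)) ^ k < c"
  using eventually_happens'[OF trivial_limit_at_right_real] by blast
 define q0 where "q0 = q y"
 define J0 where "J0 = J y"
 obtain r1 where r1: "r1 > 0" "ball y r1 \<subseteq> W" using W_open yW by (auto simp: open_contains_ball)
 obtain r2 where r2: "r2 > 0" "\<And>x. x \<in> W \<Longrightarrow> dist x y < r2 \<Longrightarrow> dist (q x) (q y) < d"
  using q_cont yW d unfolding continuous_on_iff by metis
 obtain r3 where r3: "r3 > 0" "\<And>x. x \<in> W \<Longrightarrow> dist x y < r3 \<Longrightarrow> dist (J x) (J y) < d"
  using J_cont yW d unfolding continuous_on_iff by metis
 define r where "r = min r1 (min r2 r3)"
 have r: "r > 0" using r1 r2 r3 by (simp add: r_def)
 have rW: "ball y r \<subseteq> W" using r1(2) by (auto simp: r_def)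
 have Jb: "J0 \<le> (1 + d) * J x" "J x \<le> (1 + d) * J0" if "x \<in> ball y r" for x
 proof -
  have "\<bar>J x - J0\<bar> < d" using r3(2)[of x] that subsetD[OF rW that] by (auto simp: r_def J0_def dist_real_def dist_commute)
  moreover have "d \<le> d * J z" for z using mult_left_mono[OF J_ge_1[of z] less_imp_le[OF d(1)]] by (simp only: mult_1_right)
  from this[of x] this[of y] calculation show "J0 \<le> (1 + d) * J x" "J x \<le> (1 + d) * J0"
   unfolding J0_def distrib_right mult_1 abs_less_iff by linarith+
 qed
 have strict: "\<bar>\<Phi> x - \<Phi> x' - q0 \<bullet> (x - x')\<bar> \<le> d * norm (x - x')" if x: "x \<in> ball y r" "x' \<in> ball y r" for x x'
 proof -
  have "norm ((\<lambda>x. \<Phi> x - q0 \<bullet> x) x - (\<lambda>x. \<Phi> x - q0 \<bullet> x) x') \<le> d * norm (x - x')"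
  proof (rule differentiable_bound[OF convex_ball _ _ x])
   fix z assume z: "z \<in> ball y r"
   show "((\<lambda>x. \<Phi> x - q0 \<bullet> x) has_derivative (\<lambda>h. (q z - q0) \<bullet> h)) (at z within ball y r)"
    using has_derivative_at_withinI[OF \<Phi>_deriv, of z "ball y r"] z rW
    by (auto intro!: derivative_eq_intros simp: inner_diff_left)
   have "norm (q z - q0) \<le> d" using r2(2)[of z] z subsetD[OF rW z] by (auto simp: r_def q0_def dist_norm norm_minus_commute less_imp_le)
   then have "norm ((q z - q0) \<bullet> h) \<le> d * norm h" for h
    using Cauchy_Schwarz_ineq2[of "q z - q0" h] mult_right_mono[of "norm (q z - q0)" d "norm h"] by simp
   then show "onorm (\<lambda>h. (q z - q0) \<bullet> h) \<le> d"
    using d by (intro onorm_bound) auto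
  qed
  then show ?thesis by (simp add: inner_diff_right algebra_simps)
 qed
 \<comment> \<open>the projection onto the parallel of the tangent plane through the origin\<close>
 define G0 where "G0 = lift e (\<lambda>x. q0 \<bullet> x)"
 have q0e: "q0 \<bullet> e = 0" using q_e[OF yW] by (simp add: q0_def)
 have G0_line: "G0 (x + s *\<^sub>R e) = G0 x" for x s
  by (simp add: G0_def lift_def inner_add_right ee q0e algebra_simps)
 have G0_G: "G0 (G x) = G0 x" for x unfolding lift_def[of e \<Phi>] by (rule G0_line)
 have G_G0: "G (G0 x) = G x" for x unfolding G0_def lift_def[of e "\<lambda>x. q0 \<bullet> x"] by (rule G_line)
 have near: "(1 - d) * dist x x' \<le> dist (G0 x) (G0 x')" "dist (G0 x) (G0 x') \<le> (1 + d) * dist x x'"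
  if x: "x \<in> ball y r \<inter> \<Gamma>" "x' \<in> ball y r \<inter> \<Gamma>" for x x'
 proof -
  have "G0 x - G0 x' - (x - x') = (q0 \<bullet> (x - x') - (\<Phi> x - \<Phi> x')) *\<^sub>R e"
   using x by (simp add: G0_def lift_def graph_def inner_diff_right algebra_simps)
  then have "norm (G0 x - G0 x' - (x - x')) = \<bar>\<Phi> x - \<Phi> x' - q0 \<bullet> (x - x')\<bar>" using e by (simp add: abs_minus_commute)
  then have "norm (G0 x - G0 x' - (x - x')) \<le> d * dist x x'" using strict[of x x'] x by (simp add: dist_norm)
  then show "(1 - d) * dist x x' \<le> dist (G0 x) (G0 x')" "dist (G0 x) (G0 x') \<le> (1 + d) * dist x x'"
   using norm_triangle_ineq2[of "x - x'" "x - x' - (G0 x - G0 x')"] norm_triangle_ineq[of "G0 x - G0 x' - (x - x')" "x - x'"]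
   by (simp_all add: dist_norm norm_minus_commute algebra_simps)
 qed
 have "emeasure \<A> (B \<inter> \<Gamma>) \<le> ennreal c * graph_area B \<and>
  graph_area B \<le> ennreal c * emeasure \<A> (B \<inter> \<Gamma>)"
  if [measurable]: "B \<in> sets borel" and B: "B \<subseteq> ball y r" for B
 proof -
  let ?m = "\<integral>\<^sup>+x. indicator (slab e) x * indicator B (G x) \<partial>lborel"
  let ?M = "\<integral>\<^sup>+x. indicator (slab e) x * (indicator B (G x) * ennreal (indicator W x * J x)) \<partial>lborel"
  have BB: "b \<in> ball y r \<inter> \<Gamma>" if "b \<in> B \<inter> \<Gamma>" for b using that B by blast
  have im: "G0 ` (B \<inter> \<Gamma>) = {z \<in> graph e (\<lambda>x. q0 \<bullet> x). G z \<in> B}"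
  proof safe
   fix b assume b: "b \<in> B" "b \<in> \<Gamma>"
   show "G0 b \<in> graph e (\<lambda>x. q0 \<bullet> x)" by (simp add: G0_def lift_def graph_def inner_add_right ee q0e)
   show "G (G0 b) \<in> B" using b by (simp add: G_G0 G_id)
  next
   fix z assume z: "z \<in> graph e (\<lambda>x. q0 \<bullet> x)" "G z \<in> B"
   have "G0 (G z) = z" unfolding G0_G using z(1) by (simp add: G0_def lift_def graph_def)
   then show "z \<in> G0 ` (B \<inter> \<Gamma>)" using z(2) G_in_graph by (intro image_eqI[of _ _ "G z"]) auto
  qed
  have gm [measurable]: "graph e (\<lambda>x. q0 \<bullet> x) \<in> sets borel" unfolding graph_def by measurable
  have imm [measurable]: "G0 ` (B \<inter> \<Gamma>) \<in> sets borel" unfolding im by measurable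
  have J0a: "emeasure \<A> (G0 ` (B \<inter> \<Gamma>)) = ennreal J0 * ?m"
  proof -
   have "indicator (G0 ` (B \<inter> \<Gamma>)) (G0 x) = (indicator B (G x) :: ennreal)" for x
   proof -
    have "G0 x \<in> graph e (\<lambda>x. q0 \<bullet> x)" by (simp add: G0_def lift_def graph_def inner_add_right ee q0e)
    then show ?thesis unfolding im by (simp add: indicator_def G_G0)
   qed
   moreover have "G0 ` (B \<inter> \<Gamma>) \<subseteq> graph e (\<lambda>x. q0 \<bullet> x)" unfolding im by auto
   ultimately show ?thesis
    using area_linear_graph[OF n e q0e imm] by (simp add: J0_def J_def q0_def[symmetric] G0_def[symmetric])
  qed
  have GB: "indicator B (G x) \<noteq> (0::ennreal) \<Longrightarrow> x \<in> W \<and> G x \<in> ball y r" for x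
   using B rW G_in_W[of x] by (auto simp: indicator_def split: if_splits)
  have JG: "J (G x) = J x" if "x \<in> W" for x using q_G[OF that] by (simp add: J_def)
  have M1: "ennreal J0 * ?m \<le> ennreal (1 + d) * ?M"
  proof -
   have "ennreal J0 * ?m = (\<integral>\<^sup>+x. ennreal J0 * (indicator (slab e) x * indicator B (G x)) \<partial>lborel)"
    by (rule nn_integral_cmult[symmetric]) measurable
   also have "\<dots> \<le> (\<integral>\<^sup>+x. ennreal (1 + d) * (indicator (slab e) x * (indicator B (G x) * ennreal (indicator W x * J x))) \<partial>lborel)"
   proof (rule nn_integral_mono)
    fix x
    show "ennreal J0 * (indicator (slab e) x * indicator B (G x)) \<le> ennreal (1 + d) * (indicator (slab e) x * (indicator B (G x) * ennreal (indicator W x * J x)))"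
    proof (cases "indicator B (G x) = (0::ennreal)")
     case False
     then have "x \<in> W" "J0 \<le> (1 + d) * J x" using GB[OF False] Jb(1)[of "G x"] JG by auto
     then have "ennreal J0 \<le> ennreal ((1 + d) * (indicator W x * J x))" by (intro ennreal_leI) simp
     also have "\<dots> = ennreal (1 + d) * ennreal (indicator W x * J x)" using d by (intro ennreal_mult') simp
     finally have "ennreal J0 * (indicator (slab e) x * indicator B (G x))
       \<le> (ennreal (1 + d) * ennreal (indicator W x * J x)) * (indicator (slab e) x * indicator B (G x))"
      by (rule mult_right_mono) simp
     then show ?thesis by (simp only: mult_ac)
    qed simp
   qed
   also have "\<dots> = ennreal (1 + d) * ?M" by (rule nn_integral_cmult) measurable
   finally show ?thesis .
  qed
  have M2: "?M \<le> ennreal (1 + d) * (ennreal J0 * ?m)"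
  proof -
   have "?M \<le> (\<integral>\<^sup>+x. ennreal ((1 + d) * J0) * (indicator (slab e) x * indicator B (G x)) \<partial>lborel)"
   proof (rule nn_integral_mono)
    fix x
    show "indicator (slab e) x * (indicator B (G x) * ennreal (indicator W x * J x)) \<le> ennreal ((1 + d) * J0) * (indicator (slab e) x * indicator B (G x))"
    proof (cases "indicator B (G x) = (0::ennreal)")
     case False
     then have "x \<in> W" "J x \<le> (1 + d) * J0" using GB[OF False] Jb(2)[of "G x"] JG by auto
     then have "ennreal (indicator W x * J x) \<le> ennreal ((1 + d) * J0)" by (intro ennreal_leI) simp
     then have "ennreal (indicator W x * J x) * (indicator (slab e) x * indicator B (G x))
       \<le> ennreal ((1 + d) * J0) * (indicator (slab e) x * indicator B (G x))" by (rule mult_right_mono) simp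
     then show ?thesis by (simp only: mult_ac)
    qed simp
   qed
   also have "\<dots> = ennreal ((1 + d) * J0) * ?m" by (rule nn_integral_cmult) measurable
   also have "ennreal ((1 + d) * J0) = ennreal (1 + d) * ennreal J0" using d by (intro ennreal_mult') simp
   finally show ?thesis by (simp only: mult.assoc)
  qed
  have A1: "emeasure \<A> (B \<inter> \<Gamma>) \<le> ennreal ((1 / (1 - d)) ^ k) * emeasure \<A> (G0 ` (B \<inter> \<Gamma>))"
  proof -
   have eq: "G ` (G0 ` (B \<inter> \<Gamma>)) = B \<inter> \<Gamma>" by (auto simp: image_image G_G0 G_id intro!: image_eqI)
   have "emeasure \<A> (G ` (G0 ` (B \<inter> \<Gamma>))) \<le> ennreal ((1 / (1 - d)) ^ k) * emeasure \<A> (G0 ` (B \<inter> \<Gamma>))"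
    unfolding k_def
   proof (rule area_lipschitz_image[OF n])
    fix u v assume "u \<in> G0 ` (B \<inter> \<Gamma>)" "v \<in> G0 ` (B \<inter> \<Gamma>)"
    then obtain a b where ab: "a \<in> B \<inter> \<Gamma>" "b \<in> B \<inter> \<Gamma>" "u = G0 a" "v = G0 b" by (elim imageE)
    then have "(1 - d) * dist a b \<le> dist u v" using near(1)[OF BB[OF ab(1)] BB[OF ab(2)]] by simp
    then show "dist (G u) (G v) \<le> 1 / (1 - d) * dist u v"
     using ab d by (simp add: G_G0 G_id pos_le_divide_eq mult.commute)
   qed (use d in \<open>simp_all add: eq\<close>)
   then show ?thesis unfolding eq .
  qed
  have A2: "emeasure \<A> (G0 ` (B \<inter> \<Gamma>)) \<le> ennreal ((1 + d) ^ k) * emeasure \<A> (B \<inter> \<Gamma>)"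
   unfolding k_def
  proof (rule area_lipschitz_image[OF n])
   show "dist (G0 u) (G0 v) \<le> (1 + d) * dist u v" if "u \<in> B \<inter> \<Gamma>" "v \<in> B \<inter> \<Gamma>" for u v
    using near(2)[OF BB[OF that(1)] BB[OF that(2)]] .
  qed (use d in simp_all)
  show ?thesis
  proof
   have "emeasure \<A> (B \<inter> \<Gamma>) \<le> ennreal ((1 / (1 - d)) ^ k) * (ennreal (1 + d) * ?M)"
    using A1[unfolded J0a] mult_left_mono[OF M1 zero_le, of "ennreal ((1 / (1 - d)) ^ k)"] by (rule order_trans)
   also have "\<dots> = ennreal ((1 + d) * (1 / (1 - d)) ^ k) * ?M"
   proof -
    have "ennreal ((1 + d) * (1 / (1 - d)) ^ k) = ennreal (1 + d) * ennreal ((1 / (1 - d)) ^ k)"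
     using d by (intro ennreal_mult') simp
    then show ?thesis by (simp only: mult_ac)
   qed
   also have "\<dots> \<le> ennreal c * ?M" using c2 by (intro mult_right_mono ennreal_leI) auto
   finally show "emeasure \<A> (B \<inter> \<Gamma>) \<le> ennreal c * ?M" .
   have "?M \<le> ennreal (1 + d) * (ennreal ((1 + d) ^ k) * emeasure \<A> (B \<inter> \<Gamma>))"
    using M2 mult_left_mono[OF A2[unfolded J0a] zero_le, of "ennreal (1 + d)"] by (rule order_trans)
   also have "\<dots> = ennreal ((1 + d) * (1 + d) ^ k) * emeasure \<A> (B \<inter> \<Gamma>)"
   proof -
    have "ennreal ((1 + d) * (1 + d) ^ k) = ennreal (1 + d) * ennreal ((1 + d) ^ k)"
     using d by (intro ennreal_mult') simp
    then show ?thesis by (simp only: mult_ac)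
   qed
   also have "\<dots> \<le> ennreal c * emeasure \<A> (B \<inter> \<Gamma>)" using c1 by (intro mult_right_mono ennreal_leI) auto
   finally show "?M \<le> ennreal c * emeasure \<A> (B \<inter> \<Gamma>)" .
  qed
 qed
 then show ?thesis using r rW by blast
qed

text \<open>The comparison holds near each point with every factor \<open>c > 1\<close>, in both directions.\<close>

theorem area_graph:
 assumes [measurable]: "B \<in> sets borel" and BW: "B \<subseteq> W"
 shows "emeasure \<A> (B \<inter> \<Gamma>) =
  (slab_int e (\<lambda>x. indicator B (G x) * ennreal (J x)))"
proof -
 let ?M = "\<lambda>B. \<integral>\<^sup>+x. indicator (slab e) x * (indicator B (G x) * ennreal (indicator W x * J x)) \<partial>lborel"
 define M1 where "M1 = density \<A> (indicator (\<Gamma> \<inter> W))"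
 define M2 where "M2 = distr (density lborel (\<lambda>x. indicator (slab e) x * ennreal (indicator W x * J x))) borel G"
 have m [simp]: "sets M1 = sets borel" "sets M2 = sets borel" by (auto simp: M1_def M2_def)
 have M1: "emeasure M1 S = emeasure \<A> (\<Gamma> \<inter> W \<inter> S)" if [measurable]: "S \<in> sets borel" for S
 proof -
  have "emeasure M1 S = (\<integral>\<^sup>+x. indicator (\<Gamma> \<inter> W \<inter> S) x \<partial>\<A>)"
   unfolding M1_def by (subst emeasure_density) (auto intro!: nn_integral_cong simp: indicator_inter_arith simp del: nn_integral_indicator)
  also have "\<dots> = emeasure \<A> (\<Gamma> \<inter> W \<inter> S)" by (rule nn_integral_indicator) simp
  finally show ?thesis .
 qed
 have M2: "emeasure M2 S = ?M S" if [measurable]: "S \<in> sets borel" for S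
  unfolding M2_def nn_integral_indicator[symmetric, OF measurable_sets[OF G_measurable that]]
  by (subst nn_integral_indicator[symmetric], simp, subst nn_integral_distr, simp, simp, subst nn_integral_density)
   (auto simp: mult_ac)
 have WS: "\<Gamma> \<inter> W \<inter> S = S \<inter> \<Gamma>" if "S \<subseteq> W" for S using that by auto
 have "emeasure M1 B = emeasure M2 B"
 proof (rule antisym; rule ennreal_le_all_factors)
  fix c :: real assume c: "c > 1"
  have loc: "\<exists>r>0. \<forall>B\<in>sets borel. B \<subseteq> ball y r \<longrightarrow> emeasure M1 B \<le> ennreal c * emeasure M2 B \<and> emeasure M2 B \<le> ennreal c * emeasure M1 B"
   if y: "y \<in> \<Gamma> \<inter> W" for y
  proof -
   obtain r where r: "r > 0" "ball y r \<subseteq> W"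
    and cmp: "\<And>B. B \<in> sets borel \<Longrightarrow> B \<subseteq> ball y r \<Longrightarrow>
     emeasure \<A> (B \<inter> \<Gamma>) \<le> ennreal c * ?M B \<and> ?M B \<le> ennreal c * emeasure \<A> (B \<inter> \<Gamma>)"
    using area_comparison[OF y c] by blast
   show ?thesis
   proof (intro exI[of _ r] conjI[OF r(1)] ballI impI)
    fix S :: "(real^'n) set" assume S: "S \<in> sets borel" "S \<subseteq> ball y r"
    then have "S \<subseteq> W" using r(2) by blast
    then show "emeasure M1 S \<le> ennreal c * emeasure M2 S \<and> emeasure M2 S \<le> ennreal c * emeasure M1 S"
     using cmp[OF S] by (simp only: M1[OF S(1)] M2[OF S(1)] WS)
   qed
  qed
  show "emeasure M1 B \<le> ennreal c * emeasure M2 B"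
  proof (rule emeasure_le_from_local[where \<Gamma> = "\<Gamma> \<inter> W"])
   have "\<Gamma> \<inter> W \<inter> - (\<Gamma> \<inter> W) = {}" by blast
   then show "emeasure M1 (- (\<Gamma> \<inter> W)) = 0" by (subst M1) simp_all
   show "\<exists>r>0. \<forall>B\<in>sets borel. B \<subseteq> ball y r \<longrightarrow> emeasure M1 B \<le> ennreal c * emeasure M2 B" if "y \<in> \<Gamma> \<inter> W" for y
    using loc[OF that] by blast
  qed simp_all
  show "emeasure M2 B \<le> ennreal c * emeasure M1 B"
  proof (rule emeasure_le_from_local[where \<Gamma> = "\<Gamma> \<inter> W"])
   have zero: "indicator (- (\<Gamma> \<inter> W)) (G x) * ennreal (indicator W x * J x) = 0" for x
    using G_in_graph[of x] G_in_W[of x] by (cases "x \<in> W") simp_all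
   have "?M (- (\<Gamma> \<inter> W)) = 0" by (simp only: zero mult_zero_right nn_integral_const mult_zero_left)
   then show "emeasure M2 (- (\<Gamma> \<inter> W)) = 0" by (subst M2) simp_all
   show "\<exists>r>0. \<forall>B\<in>sets borel. B \<subseteq> ball y r \<longrightarrow> emeasure M2 B \<le> ennreal c * emeasure M1 B" if "y \<in> \<Gamma> \<inter> W" for y
    using loc[OF that] by blast
  qed simp_all
 qed
 also have "emeasure M1 B = emeasure \<A> (B \<inter> \<Gamma>)" by (simp add: M1 WS BW)
 also have "emeasure M2 B = (slab_int e (\<lambda>x. indicator B (G x) * ennreal (J x)))"
  unfolding M2[OF assms(1)] by (intro nn_integral_cong) (use BW G_in_W in \<open>auto simp: indicator_def\<close>)
 finally show ?thesis .
qed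

end

section \<open>Cut-off functions and weak derivatives\<close>

text \<open>A rational transition from \<open>0\<close> on \<open>t \<le> 1\<close> to \<open>1\<close> on \<open>t \<ge> 2\<close>. The squares of the positive parts make it of
class \<open>C\<^sup>1\<close> across both ends; \<open>step'\<close> is its derivative.\<close>

definition step :: "real \<Rightarrow> real" where
 "step t = (max 0 (t - 1))\<^sup>2 / ((max 0 (t - 1))\<^sup>2 + (max 0 (2 - t))\<^sup>2)"

definition step' :: "real \<Rightarrow> real" where
 "step' t = 2 * max 0 (t - 1) * max 0 (2 - t) * (max 0 (t - 1) + max 0 (2 - t))
  / ((max 0 (t - 1))\<^sup>2 + (max 0 (2 - t))\<^sup>2)\<^sup>2"

lemma step_denominator: "(max 0 (t - 1))\<^sup>2 + (max 0 (2 - t))\<^sup>2 > (0::real)"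
proof (cases "t > 1")
 case True
 then show ?thesis by (intro add_pos_nonneg) simp_all
next
 case False
 then show ?thesis by (intro add_nonneg_pos) simp_all
qed

lemma step_eq_0: "t \<le> 1 \<Longrightarrow> step t = 0" by (simp add: step_def)
lemma step_eq_1: "t \<ge> 2 \<Longrightarrow> step t = 1" by (simp add: step_def)
lemma step_bounds: "0 \<le> step t" "step t \<le> 1"
 unfolding step_def using step_denominator[of t] by (simp_all add: divide_nonneg_pos pos_divide_le_eq)
lemma step'_nonneg: "0 \<le> step' t" by (simp add: step'_def)
lemma step'_eq_0: "t \<le> 1 \<or> t \<ge> 2 \<Longrightarrow> step' t = 0" by (auto simp: step'_def)

lemma DERIV_max_square: "((\<lambda>t. (max 0 t)\<^sup>2) has_real_derivative 2 * max 0 t) (at t)"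
proof (cases t "0::real" rule: linorder_cases)
 case less
 have "((\<lambda>t. 0) has_real_derivative 0) (at t)" by simp
 then have "((\<lambda>t. (max 0 t)\<^sup>2) has_real_derivative 0) (at t)"
  by (rule has_field_derivative_transform_within_open[of _ _ _ "{..<0}"]) (use less in auto)
 then show ?thesis using less by simp
next
 case greater
 have "((\<lambda>t. t\<^sup>2) has_real_derivative 2 * t) (at t)" by (auto intro!: derivative_eq_intros)
 then have "((\<lambda>t. (max 0 t)\<^sup>2) has_real_derivative 2 * t) (at t)"
  by (rule has_field_derivative_transform_within_open[of _ _ _ "{0<..}"]) (use greater in auto)
 then show ?thesis using greater by simp
next
 case equal
 have "((\<lambda>h::real. max 0 h) \<longlongrightarrow> max 0 0) (at 0)" by (intro tendsto_intros)
 moreover have "\<forall>\<^sub>F h in at (0::real). max 0 h = ((max 0 (0 + h))\<^sup>2 - (max 0 (0::real))\<^sup>2) / h"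
  unfolding eventually_at by (intro exI[of _ 1]) (auto simp: power2_eq_square max_def)
 ultimately have "((\<lambda>h. ((max 0 (0 + h))\<^sup>2 - (max 0 (0::real))\<^sup>2) / h) \<longlongrightarrow> max 0 0) (at 0)"
  by (rule Lim_transform_eventually)
 then show ?thesis using equal by (simp add: DERIV_def)
qed

lemma DERIV_step: "(step has_real_derivative step' t) (at t)"
proof -
 let ?a = "max 0 (t - 1)" and ?b = "max 0 (2 - t)"
 have a: "((\<lambda>t. (max 0 (t - 1))\<^sup>2) has_real_derivative 2 * ?a) (at t)"
 proof -
  have "((\<lambda>t. t - 1) has_real_derivative 1) (at t)" by (auto intro!: derivative_eq_intros)
  from DERIV_chain2[OF DERIV_max_square this] show ?thesis by simp
 qed
 have b: "((\<lambda>t. (max 0 (2 - t))\<^sup>2) has_real_derivative - (2 * ?b)) (at t)"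
 proof -
  have "((\<lambda>t. 2 - t) has_real_derivative - 1) (at t)" by (auto intro!: derivative_eq_intros)
  from DERIV_chain2[OF DERIV_max_square this] show ?thesis by simp
 qed
 have "((\<lambda>t. (max 0 (t - 1))\<^sup>2 / ((max 0 (t - 1))\<^sup>2 + (max 0 (2 - t))\<^sup>2)) has_real_derivative
   (2 * ?a * (?a\<^sup>2 + ?b\<^sup>2) - ?a\<^sup>2 * (2 * ?a + - (2 * ?b))) / ((?a\<^sup>2 + ?b\<^sup>2) * (?a\<^sup>2 + ?b\<^sup>2))) (at t)"
  by (rule DERIV_divide[OF a DERIV_add[OF a b] less_imp_neq[OF step_denominator, symmetric]])
 moreover have "2 * ?a * (?a\<^sup>2 + ?b\<^sup>2) - ?a\<^sup>2 * (2 * ?a + - (2 * ?b)) = 2 * ?a * ?b * (?a + ?b)"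
  by (simp add: power2_eq_square algebra_simps)
 ultimately show ?thesis
  unfolding step_def[abs_def] step'_def by (simp add: power2_eq_square)
qed

lemma step'_cont: "continuous_on UNIV step'"
 unfolding step'_def[abs_def]
 by (intro continuous_intros ballI) (use step_denominator in \<open>auto simp: less_le[of "0::real"]\<close>)

lemma step_cont: "continuous_on UNIV step"
 by (rule DERIV_continuous_on, rule has_field_derivative_at_within, rule DERIV_step)

lemma step_measurable [measurable]: "step \<in> borel_measurable borel" "step' \<in> borel_measurable borel"
 by (rule borel_measurable_continuous_onI, rule step_cont, rule borel_measurable_continuous_onI, rule step'_cont)

lemma step'_bounded: "\<exists>C. \<forall>t. step' t \<le> C"
proof -
 have "bounded (step' ` {1..2})"
  by (intro compact_imp_bounded compact_continuous_image continuous_on_subset[OF step'_cont]) auto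
 then obtain C where "\<forall>x\<in>step' ` {1..2}. norm x \<le> C" unfolding bounded_iff by blast
 then have C: "\<And>t. t \<in> {1..2} \<Longrightarrow> \<bar>step' t\<bar> \<le> C" by simp
 have "step' t \<le> max 0 C" for t
  using C[of t] step'_eq_0[of t] by (cases "t \<in> {1..2}") (auto simp: max_def)
 then show ?thesis by blast
qed

lemma nn_integral_step': "(\<integral>\<^sup>+t. ennreal (step' t) \<partial>lborel) = 1"
proof -
 have "(\<integral>\<^sup>+t. ennreal (step' t) \<partial>lborel) = (\<integral>\<^sup>+t. ennreal (step' t) * indicator {1..2} t \<partial>lborel)"
  by (intro nn_integral_cong) (auto simp: indicator_def step'_eq_0)
 also have "\<dots> = ennreal (step 2 - step 1)"
  by (rule nn_integral_FTC_Icc) (use DERIV_step step'_nonneg in auto)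
 finally show ?thesis by (simp add: step_eq_0 step_eq_1)
qed

text \<open>The gradient is carried along as an argument, so that integrands can name it.\<close>

definition C1fun :: "('a::euclidean_space \<Rightarrow> real) \<Rightarrow> ('a \<Rightarrow> 'a) \<Rightarrow> bool" where
 "C1fun u g \<longleftrightarrow> (\<forall>x. GDERIV u x :> g x) \<and> continuous_on UNIV g"

lemma GDERIV_unique: "GDERIV u x :> a \<Longrightarrow> GDERIV u x :> b \<Longrightarrow> a = b"
proof -
 assume "GDERIV u x :> a" "GDERIV u x :> b"
 then have "(\<lambda>h. h \<bullet> a) = (\<lambda>h. h \<bullet> b)" unfolding gderiv_def by (rule has_derivative_unique)
 then have "h \<bullet> a = h \<bullet> b" for h by (rule fun_cong)
 then show "a = b" by (rule vector_eq_ldot[THEN iffD1, OF allI])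
qed

lemma GDERIV_cong_open:
 assumes "GDERIV u x :> a" "open S" "x \<in> S" "\<And>y. y \<in> S \<Longrightarrow> u y = v y"
 shows "GDERIV v x :> a"
 using assms unfolding gderiv_def by (blast intro: has_derivative_transform_within_open)

lemma GDERIV_cont: "GDERIV u x :> a \<Longrightarrow> isCont u x"
 unfolding gderiv_def by (rule has_derivative_continuous)

lemma C1fun_unique: "C1fun u g \<Longrightarrow> C1fun u g' \<Longrightarrow> g = g'"
 unfolding C1fun_def using GDERIV_unique by blast

lemma C1fun_cont: "C1fun u g \<Longrightarrow> continuous_on S u"
 unfolding C1fun_def using GDERIV_cont by (auto intro!: continuous_at_imp_continuous_on)

lemma C1fun_grad_cont: "C1fun u g \<Longrightarrow> continuous_on S g"
 unfolding C1fun_def by (auto intro: continuous_on_subset)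

lemma C1fun_const: "C1fun (\<lambda>x. c) (\<lambda>x. 0)"
 by (simp add: C1fun_def GDERIV_const)

lemma C1fun_add: "C1fun u g \<Longrightarrow> C1fun v h \<Longrightarrow> C1fun (\<lambda>x. u x + v x) (\<lambda>x. g x + h x)"
 by (auto simp: C1fun_def intro: GDERIV_add continuous_on_add)

lemma C1fun_mult: "C1fun u g \<Longrightarrow> C1fun v h \<Longrightarrow> C1fun (\<lambda>x. u x * v x) (\<lambda>x. u x *\<^sub>R h x + v x *\<^sub>R g x)"
 using C1fun_cont[of u g UNIV] C1fun_cont[of v h UNIV]
 by (auto simp: C1fun_def intro: GDERIV_mult continuous_intros)

lemma C1fun_one_minus: "C1fun u g \<Longrightarrow> C1fun (\<lambda>x. 1 - u x) (\<lambda>x. - g x)"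
 using GDERIV_diff[OF GDERIV_const] by (fastforce simp: C1fun_def intro: continuous_intros)

lemma C1fun_grad_zero:
 assumes u: "C1fun u g" and S: "open S" "x \<in> S" "\<And>y. y \<in> S \<Longrightarrow> u y = c"
 shows "g x = 0"
proof -
 have "GDERIV u x :> 0" by (rule GDERIV_cong_open[OF GDERIV_const S(1,2)]) (use S(3) in auto)
 then show ?thesis using u GDERIV_unique unfolding C1fun_def by blast
qed

definition C1c :: "'a::euclidean_space set \<Rightarrow> ('a \<Rightarrow> real) \<Rightarrow> ('a \<Rightarrow> 'a) \<Rightarrow> bool" where
 "C1c S u g \<longleftrightarrow> C1fun u g \<and> (\<exists>K. compact K \<and> K \<subseteq> S \<and> (\<forall>x. x \<notin> K \<longrightarrow> u x = 0))"

lemma C1c_grad_zero: "C1fun u g \<Longrightarrow> compact K \<Longrightarrow> (\<And>x. x \<notin> K \<Longrightarrow> u x = 0) \<Longrightarrow> x \<notin> K \<Longrightarrow> g x = 0"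
 by (rule C1fun_grad_zero[of u g "- K" x 0]) (auto simp: compact_imp_closed)

text \<open>Extension by zero of a function on \<open>S\<close> that vanishes off a compact subset.\<close>

lemma C1c_glue:
 assumes S: "open S" and K: "compact K" "K \<subseteq> S" and zero: "\<And>x. x \<notin> K \<Longrightarrow> u x = 0" "\<And>x. x \<notin> K \<Longrightarrow> g x = 0"
  and d: "\<And>x. x \<in> S \<Longrightarrow> GDERIV u x :> g x" and c: "continuous_on S g"
 shows "C1c S u g"
proof -
 have oK: "open (- K)" using K by (simp add: compact_imp_closed open_Compl)
 have "GDERIV u x :> g x" for x
 proof (cases "x \<in> S")
  case False
  then have x: "x \<in> - K" using K by auto
  have "GDERIV u x :> 0" by (rule GDERIV_cong_open[OF GDERIV_const oK x]) (use zero in auto)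
  then show ?thesis using zero x by simp
 qed (rule d)
 moreover have "continuous_on (S \<union> - K) g"
  by (rule continuous_on_open_Un[OF S oK c]) (use zero in \<open>auto intro: continuous_on_eq[OF continuous_on_const[of _ 0]]\<close>)
 moreover have "S \<union> - K = UNIV" using K by auto
 ultimately show ?thesis using K zero unfolding C1c_def C1fun_def by auto
qed

lemma bump_exists:
 fixes y :: "'a::euclidean_space"
 assumes r: "r > 0"
 shows "\<exists>\<beta> g. C1fun \<beta> g \<and> (\<forall>x. 0 \<le> \<beta> x \<and> \<beta> x \<le> 1) \<and> (\<forall>x. dist x y \<le> r / 2 \<longrightarrow> \<beta> x = 1) \<and>
  (\<forall>x. r \<le> dist x y \<longrightarrow> \<beta> x = 0)"
proof (intro exI conjI allI impI)
 let ?l = "\<lambda>x. 3 - 2 / r\<^sup>2 * ((x - y) \<bullet> (x - y))"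
 let ?b = "\<lambda>x. step (?l x)" and ?g = "\<lambda>x. step' (?l x) *\<^sub>R (- (4 / r\<^sup>2) *\<^sub>R (x - y))"
 have "GDERIV (\<lambda>x. 3 - c * ((x - y) \<bullet> (x - y))) x :> - (2 * c) *\<^sub>R (x - y)" for x c
  unfolding gderiv_def by (auto intro!: derivative_eq_intros simp: inner_commute)
 from this[of "2 / r\<^sup>2"] have "GDERIV ?l x :> - (4 / r\<^sup>2) *\<^sub>R (x - y)" for x by simp
 then have "GDERIV ?b x :> ?g x" for x by (rule GDERIV_DERIV_compose) (rule DERIV_step)
 moreover have "continuous_on UNIV ?g"
  by (intro continuous_intros continuous_on_compose2[OF step'_cont]) auto
 ultimately show "C1fun ?b ?g" by (simp add: C1fun_def)
 fix x
 show "0 \<le> ?b x" "?b x \<le> 1" by (rule step_bounds)+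
 have d: "(x - y) \<bullet> (x - y) = (dist x y)\<^sup>2" by (simp add: dist_norm power2_norm_eq_inner)
 { assume "dist x y \<le> r / 2"
  then have "(dist x y)\<^sup>2 \<le> (r / 2)\<^sup>2" by (intro power_mono) auto
  then have "2 * (dist x y)\<^sup>2 \<le> r\<^sup>2"
   using zero_le_power2[of "dist x y"] by (simp only: power_divide power2_eq_square)
  then show "?b x = 1" unfolding d using r by (intro step_eq_1) (simp add: field_simps) }
 { assume "r \<le> dist x y"
  then have "r\<^sup>2 \<le> (dist x y)\<^sup>2" using r by (intro power_mono) auto
  then show "?b x = 0" unfolding d using r by (intro step_eq_0) (simp add: field_simps) }
qed

text \<open>Multiplying by \<open>c = 1 - (\<Prod>y. 1 - bump y)\<close> splits a function into summands supported in single
 balls, so an additive property that holds for functions supported in one ball holds for the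
 product with \<open>c\<close>. This takes the place of a partition of unity.\<close>

lemma localization:
 fixes I :: "'a::euclidean_space set"
 assumes I: "finite I" and r: "\<And>y. y \<in> I \<Longrightarrow> r y > 0"
  and zero: "P (\<lambda>x. 0) (\<lambda>x. 0)"
  and add: "\<And>u g v h. C1fun u g \<Longrightarrow> C1fun v h \<Longrightarrow> P u g \<Longrightarrow> P v h \<Longrightarrow> P (\<lambda>x. u x + v x) (\<lambda>x. g x + h x)"
  and loc: "\<And>u g y. y \<in> I \<Longrightarrow> C1fun u g \<Longrightarrow> (\<And>x. r y \<le> dist x y \<Longrightarrow> u x = 0) \<Longrightarrow> P u g"
 shows "\<exists>c g. C1fun c g \<and> (\<forall>x. 0 \<le> c x \<and> c x \<le> 1) \<and> (\<forall>x. \<forall>y\<in>I. dist x y \<le> r y / 2 \<longrightarrow> c x = 1) \<and>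
  (\<forall>x. (\<forall>y\<in>I. r y \<le> dist x y) \<longrightarrow> c x = 0) \<and>
  (\<forall>u h. C1fun u h \<longrightarrow> P (\<lambda>x. u x * c x) (\<lambda>x. u x *\<^sub>R g x + c x *\<^sub>R h x))" (is "?C I")
 using I r loc
proof (induction I)
 case empty
 show ?case by (rule exI[of _ "\<lambda>x. 0"], rule exI[of _ "\<lambda>x. 0"]) (simp add: C1fun_const zero)
next
 case (insert y I)
 have "?C I"
 proof (rule insert.IH)
  show "r z > 0" if "z \<in> I" for z using insert.prems(1) that by simp
  show "P u g" if "z \<in> I" "C1fun u g" "\<And>x. r z \<le> dist x z \<Longrightarrow> u x = 0" for u g z
   by (rule insert.prems(2)[of z]) (use that in simp_all)
 qed
 then obtain c g where c: "C1fun c g" "\<And>x. 0 \<le> c x" "\<And>x. c x \<le> 1" "\<And>x y. y \<in> I \<Longrightarrow> dist x y \<le> r y / 2 \<Longrightarrow> c x = 1"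
  "\<And>x. (\<And>y. y \<in> I \<Longrightarrow> r y \<le> dist x y) \<Longrightarrow> c x = 0"
  and P: "\<And>u h. C1fun u h \<Longrightarrow> P (\<lambda>x. u x * c x) (\<lambda>x. u x *\<^sub>R g x + c x *\<^sub>R h x)"
  by blast
 have "r y > 0" using insert.prems by simp
 from bump_exists[OF this, of y] obtain \<beta> g\<beta> where b: "C1fun \<beta> g\<beta>" "\<And>x. 0 \<le> \<beta> x" "\<And>x. \<beta> x \<le> 1"
  "\<And>x. dist x y \<le> r y / 2 \<Longrightarrow> \<beta> x = 1" "\<And>x. r y \<le> dist x y \<Longrightarrow> \<beta> x = 0" by auto
 define c' where "c' x = c x + (1 - c x) * \<beta> x" for x
 define g' where "g' x = g x + ((1 - c x) *\<^sub>R g\<beta> x + \<beta> x *\<^sub>R (- g x))" for x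
 have c': "C1fun c' g'"
  unfolding c'_def[abs_def] g'_def[abs_def] by (intro C1fun_add C1fun_mult C1fun_one_minus c(1) b(1))
 have P': "P (\<lambda>x. u x * c' x) (\<lambda>x. u x *\<^sub>R g' x + c' x *\<^sub>R h x)" if u: "C1fun u h" for u h
 proof -
  note m1 = C1fun_mult[OF u C1fun_one_minus[OF c(1)]]
  note m2 = C1fun_mult[OF m1 b(1)]
  note m3 = C1fun_mult[OF u c(1)]
  have p2: "P (\<lambda>x. u x * (1 - c x) * \<beta> x) (\<lambda>x. (u x * (1 - c x)) *\<^sub>R g\<beta> x + \<beta> x *\<^sub>R (u x *\<^sub>R - g x + (1 - c x) *\<^sub>R h x))"
   by (rule insert.prems(2)[OF _ m2]) (auto simp: b(5))
  note p = add[OF m3 m2 P[OF u] p2]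
  have eq: "(\<lambda>x. u x * c x + u x * (1 - c x) * \<beta> x) = (\<lambda>x. u x * c' x)"
   by (simp add: c'_def algebra_simps)
  have geq: "(\<lambda>x. u x *\<^sub>R g x + c x *\<^sub>R h x + ((u x * (1 - c x)) *\<^sub>R g\<beta> x + \<beta> x *\<^sub>R (u x *\<^sub>R - g x + (1 - c x) *\<^sub>R h x)))
    = (\<lambda>x. u x *\<^sub>R g' x + c' x *\<^sub>R h x)"
   by (rule C1fun_unique[OF C1fun_add[OF m3 m2, unfolded eq] C1fun_mult[OF u c']])
  show ?thesis using p unfolding eq geq .
 qed
 show ?case
 proof (intro exI[of _ c'] exI[of _ g'] conjI allI ballI impI c' P')
  fix x
  have 1: "0 \<le> (1 - c x) * \<beta> x" "(1 - c x) * \<beta> x \<le> 1 - c x" using c(3)[of x] b(2,3)[of x]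
   by (auto intro: mult_left_le)
  then show "0 \<le> c' x" "c' x \<le> 1" using c(2)[of x] by (simp_all add: c'_def)
  show "c' x = 1" if "z \<in> insert y I" "dist x z \<le> r z / 2" for z
   using that c(4)[of z x] b(4)[of x] by (auto simp: c'_def)
  show "c' x = 0" if "\<forall>z\<in>insert y I. r z \<le> dist x z"
   using that c(5)[of x] b(5)[of x] by (simp add: c'_def)
 qed
qed

text \<open>Finitely many bumps cover \<open>K\<close>; localization of the trivial property yields their union \<open>c\<close>.\<close>

lemma cutoff_exists:
 fixes K :: "'a::euclidean_space set"
 assumes K: "compact K" "K \<subseteq> S" and S: "open S"
 shows "\<exists>c g V. C1c S c g \<and> (\<forall>x. 0 \<le> c x \<and> c x \<le> 1) \<and> open V \<and> K \<subseteq> V \<and> (\<forall>x\<in>V. c x = 1)"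
proof -
 have "\<forall>y\<in>K. \<exists>r>0. cball y r \<subseteq> S" using K S by (meson open_contains_cball subsetD)
 then obtain r where r: "\<And>y. y \<in> K \<Longrightarrow> r y > 0" "\<And>y. y \<in> K \<Longrightarrow> cball y (r y) \<subseteq> S" by metis
 obtain I where I: "I \<subseteq> K" "finite I" "K \<subseteq> (\<Union>y\<in>I. ball y (r y / 2))"
  by (rule compactE_image[OF K(1), of K "\<lambda>y. ball y (r y / 2)"]) (use r(1) in force)+
 obtain c g where c: "C1fun c g" "\<And>x. 0 \<le> c x" "\<And>x. c x \<le> 1" "\<And>x y. y \<in> I \<Longrightarrow> dist x y \<le> r y / 2 \<Longrightarrow> c x = 1"
  "\<And>x. (\<And>y. y \<in> I \<Longrightarrow> r y \<le> dist x y) \<Longrightarrow> c x = 0"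
 proof -
  have "\<exists>c g. C1fun c g \<and> (\<forall>x. 0 \<le> c x \<and> c x \<le> 1) \<and> (\<forall>x. \<forall>y\<in>I. dist x y \<le> r y / 2 \<longrightarrow> c x = 1) \<and>
   (\<forall>x. (\<forall>y\<in>I. r y \<le> dist x y) \<longrightarrow> c x = 0) \<and>
   (\<forall>u h. C1fun u h \<longrightarrow> (\<lambda>_ _. True) (\<lambda>x. u x * c x) (\<lambda>x. u x *\<^sub>R g x + c x *\<^sub>R h x))"
   by (rule localization) (use I r in auto)
  then show ?thesis using that by blast
 qed
 have "c x = 0" if "x \<notin> (\<Union>y\<in>I. cball y (r y))" for x
  by (rule c(5)) (use that in \<open>force simp: dist_commute\<close>)
 then have "C1c S c g"
  unfolding C1c_def using c(1) I
  by (intro conjI exI[of _ "\<Union>y\<in>I. cball y (r y)"] UN_least r(2) compact_UN) auto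
 moreover have "c x = 1" if "x \<in> (\<Union>y\<in>I. ball y (r y / 2))" for x
  using that c(4)[of _ x] by (auto simp: dist_commute less_imp_le)
 ultimately show ?thesis using c I by (intro exI[of _ c] exI[of _ g] exI[of _ "\<Union>y\<in>I. ball y (r y / 2)"]) auto
qed

lemma integrable_continuous_compact_support:
 fixes f :: "'a::euclidean_space \<Rightarrow> real"
 assumes "continuous_on K f" "compact K" "\<And>x. x \<notin> K \<Longrightarrow> f x = 0"
 shows "integrable lborel f"
proof -
 have "integrable lborel (\<lambda>x. indicator K x *\<^sub>R f x)" using assms by (intro borel_integrable_compact)
 moreover have "(\<lambda>x. indicator K x *\<^sub>R f x) = f" using assms(3) by (auto simp: indicator_def fun_eq_iff)
 ultimately show ?thesis by simp
qed

text \<open>Difference quotients of \<open>u\<close> are bounded by the maximum of the gradient and supported in a common ball.\<close>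

lemma difference_quotient_limit:
 fixes u \<phi> :: "'a::euclidean_space \<Rightarrow> real" and a :: 'a
 assumes u: "C1c UNIV u g" and \<phi>: "continuous_on UNIV \<phi>"
 shows "(\<lambda>n. \<integral>x. (u (x + (1 / real (Suc n)) *\<^sub>R a) - u x) * real (Suc n) * \<phi> x \<partial>lborel)
  \<longlonglongrightarrow> (\<integral>x. (g x \<bullet> a) * \<phi> x \<partial>lborel)"
proof -
 obtain K where K: "compact K" "\<And>x. x \<notin> K \<Longrightarrow> u x = 0" and cu: "C1fun u g" using u by (auto simp: C1c_def)
 have gc: "continuous_on UNIV g" and gd: "\<And>x. GDERIV u x :> g x" using cu by (auto simp: C1fun_def)
 have uc: "continuous_on UNIV u" by (rule C1fun_cont[OF cu])
 have g0: "g x = 0" if "x \<notin> K" for x using C1c_grad_zero[OF cu K(1) K(2)] that by blast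
 obtain M where M: "\<And>x. norm (g x) \<le> M" "M \<ge> 0"
 proof -
  have "bounded (g ` K)" by (intro compact_imp_bounded compact_continuous_image continuous_on_subset[OF gc] K) auto
  then obtain M where "\<And>x. x \<in> K \<Longrightarrow> norm (g x) \<le> M" "M > 0" unfolding bounded_pos by auto
  then show ?thesis using g0 that[of M] by (metis norm_zero less_imp_le)
 qed
 obtain R where R: "K \<subseteq> ball 0 R" using compact_imp_bounded[OF K(1)] bounded_subset_ballD by blast
 let ?B = "cball 0 (R + norm a)"
 have \<phi>m [measurable]: "\<phi> \<in> borel_measurable borel" "u \<in> borel_measurable borel" "g \<in> borel_measurable borel"
  using \<phi> uc gc by (auto intro: borel_measurable_continuous_onI)
 show ?thesis
 proof (rule integral_dominated_convergence[where w = "\<lambda>x. indicator ?B x *\<^sub>R (M * norm a * \<bar>\<phi> x\<bar>)"])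
  show "integrable lborel (\<lambda>x. indicator ?B x *\<^sub>R (M * norm a * \<bar>\<phi> x\<bar>))"
   by (intro borel_integrable_compact continuous_intros continuous_on_subset[OF \<phi>]) auto
  show "AE x in lborel. (\<lambda>n. (u (x + (1 / real (Suc n)) *\<^sub>R a) - u x) * real (Suc n) * \<phi> x) \<longlonglongrightarrow> (g x \<bullet> a) * \<phi> x"
  proof (rule AE_I2, intro tendsto_mult tendsto_const)
   fix x
   have "((\<lambda>s. u (x + s *\<^sub>R a)) has_derivative (\<lambda>s. (s *\<^sub>R a) \<bullet> g x)) (at 0)"
    by (rule has_derivative_compose[of "\<lambda>s. x + s *\<^sub>R a" "\<lambda>s. s *\<^sub>R a" 0 UNIV u])
     (use gd[of x] in \<open>auto intro!: derivative_eq_intros simp: gderiv_def\<close>)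
   then have "((\<lambda>s. u (x + s *\<^sub>R a)) has_real_derivative (g x \<bullet> a)) (at 0)"
    by (simp add: has_field_derivative_def inner_commute mult.commute[of _ "a \<bullet> g x"])
   then have "((\<lambda>h. (u (x + h *\<^sub>R a) - u x) / h) \<longlongrightarrow> g x \<bullet> a) (at 0)" by (simp add: DERIV_def)
   moreover have "filterlim (\<lambda>n. 1 / real (Suc n)) (at 0) sequentially"
    unfolding filterlim_at using LIMSEQ_inverse_real_of_nat by (simp add: inverse_eq_divide)
   ultimately have "(\<lambda>n. (u (x + (1 / real (Suc n)) *\<^sub>R a) - u x) / (1 / real (Suc n))) \<longlonglongrightarrow> g x \<bullet> a"
    by (rule filterlim_compose)
   then show "(\<lambda>n. (u (x + (1 / real (Suc n)) *\<^sub>R a) - u x) * real (Suc n)) \<longlonglongrightarrow> g x \<bullet> a" by simp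
  qed
  fix n
  show "AE x in lborel. norm ((u (x + (1 / real (Suc n)) *\<^sub>R a) - u x) * real (Suc n) * \<phi> x) \<le> indicator ?B x *\<^sub>R (M * norm a * \<bar>\<phi> x\<bar>)"
  proof (rule AE_I2)
   fix x
   let ?h = "1 / real (Suc n)"
   show "norm ((u (x + ?h *\<^sub>R a) - u x) * real (Suc n) * \<phi> x) \<le> indicator ?B x *\<^sub>R (M * norm a * \<bar>\<phi> x\<bar>)"
   proof (cases "x \<in> ?B")
    case True
    have "norm (u (x + ?h *\<^sub>R a) - u x) \<le> M * norm (x + ?h *\<^sub>R a - x)"
    proof (rule differentiable_bound[of UNIV])
     fix z
     show "(u has_derivative (\<lambda>h. h \<bullet> g z)) (at z within UNIV)" using gd[of z] by (simp add: gderiv_def)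
     have "norm (h \<bullet> g z) \<le> M * norm h" for h
      using Cauchy_Schwarz_ineq2[of h "g z"] mult_right_mono[OF M(1)[of z], of "norm h"] by (simp add: mult.commute)
     then show "onorm (\<lambda>h. h \<bullet> g z) \<le> M" using M(2) by (intro onorm_bound) auto
    qed auto
    then have "\<bar>u (x + ?h *\<^sub>R a) - u x\<bar> \<le> M * norm a * ?h" by simp
    then have "\<bar>u (x + ?h *\<^sub>R a) - u x\<bar> * real (Suc n) \<le> M * norm a" by (simp add: pos_le_divide_eq)
    then have "\<bar>u (x + ?h *\<^sub>R a) - u x\<bar> * real (Suc n) * \<bar>\<phi> x\<bar> \<le> M * norm a * \<bar>\<phi> x\<bar>" by (rule mult_right_mono) simp
    then show ?thesis using True by (simp add: abs_mult)
   next
    case False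
    then have far: "norm x > R + norm a" by simp
    have "norm (?h *\<^sub>R a) \<le> norm a"
     using mult_left_mono[of 1 "1 + real n" "norm a"] by (simp add: divide_le_eq)
    then have "norm (x + ?h *\<^sub>R a) \<ge> norm x - norm a"
     using norm_triangle_ineq2[of x "- (?h *\<^sub>R a)"] by simp
    then have "R < norm (x + ?h *\<^sub>R a)" "R < norm x" using far norm_ge_zero[of a] by linarith+
    then have "x + ?h *\<^sub>R a \<notin> K" "x \<notin> K" using R by (auto simp: subset_iff)
    then show ?thesis using False K(2) by simp
   qed
  qed
 qed measurable
qed

lemma lborel_integral_shift:
 fixes f :: "'a::euclidean_space \<Rightarrow> real"
 assumes [measurable]: "f \<in> borel_measurable borel"
 shows "(\<integral>x. f (x + a) \<partial>lborel) = (\<integral>x. f x \<partial>lborel)"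
proof -
 have "(\<integral>x. f x \<partial>lborel) = (\<integral>x. f x \<partial>distr lborel borel ((+) a))" by (simp add: lborel_distr_plus)
 also have "\<dots> = (\<integral>x. f (a + x) \<partial>lborel)" by (rule integral_distr) auto
 finally show ?thesis by (simp add: add.commute)
qed

lemma integrable_lborel_shift:
 fixes f :: "'a::euclidean_space \<Rightarrow> real"
 assumes "integrable lborel f"
 shows "integrable lborel (\<lambda>x. f (x + a))"
proof -
 have "integrable (distr lborel borel ((+) a)) f" using assms by (simp add: lborel_distr_plus)
 then have "integrable lborel (\<lambda>x. f (a + x))"
  by (subst (asm) integrable_distr_eq) (use borel_measurable_integrable[OF assms] in auto)
 then show ?thesis by (simp add: add.commute)
qed

lemma C1c_integrable: "C1c UNIV u g \<Longrightarrow> continuous_on UNIV \<phi> \<Longrightarrow> integrable lborel (\<lambda>x. u x * \<phi> x)"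
 unfolding C1c_def by (elim conjE exE)
  (rule integrable_continuous_compact_support, auto intro: continuous_intros C1fun_cont continuous_on_subset)

lemma C1c_grad_integrable:
 assumes "C1c UNIV u g" "continuous_on UNIV \<phi>"
 shows "integrable lborel (\<lambda>x. (g x \<bullet> a) * \<phi> x)"
proof -
 obtain K where K: "compact K" "\<And>x. x \<notin> K \<Longrightarrow> u x = 0" and cu: "C1fun u g" using assms by (auto simp: C1c_def)
 show ?thesis
  by (rule integrable_continuous_compact_support[OF _ K(1)])
   (use C1c_grad_zero[OF cu K] in \<open>auto intro!: continuous_intros continuous_on_subset[OF assms(2)] C1fun_grad_cont[OF cu]\<close>)
qed

lemma integral_derivative_zero:
 fixes a :: "'a::euclidean_space"
 assumes u: "C1c UNIV u g"
 shows "(\<integral>x. g x \<bullet> a \<partial>lborel) = 0"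
proof -
 have cu: "C1fun u g" using u by (simp add: C1c_def)
 have int: "integrable lborel u" using C1c_integrable[OF u continuous_on_const[of _ 1]] by simp
 have um: "u \<in> borel_measurable borel" using C1fun_cont[OF cu] by (rule borel_measurable_continuous_onI)
 have "(\<integral>x. (u (x + (1 / real (Suc n)) *\<^sub>R a) - u x) * real (Suc n) * 1 \<partial>lborel) = 0" for n
  using int integrable_lborel_shift[OF int, of "(1 / real (Suc n)) *\<^sub>R a"] lborel_integral_shift[OF um]
  by simp
 then show ?thesis
  using difference_quotient_limit[OF u continuous_on_const[of _ 1], of a] by (simp add: LIMSEQ_const_iff)
qed

text \<open>The mixed derivatives of \<open>v\<close> commute in the weak sense, even if \<open>v\<close> is only \<open>C\<^sup>1\<close>:
 one derivative is moved from \<open>u\<close> to \<open>v\<close> as a difference quotient.\<close>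

lemma weak_derivatives_commute:
 fixes a b :: "'a::euclidean_space"
 assumes u: "C1c UNIV u g" and v: "C1c UNIV v h"
 shows "(\<integral>x. (g x \<bullet> a) * (h x \<bullet> b) \<partial>lborel) = (\<integral>x. (g x \<bullet> b) * (h x \<bullet> a) \<partial>lborel)"
proof -
 have cu: "C1fun u g" and cv: "C1fun v h" using u v by (auto simp: C1c_def)
 note cont = C1fun_cont[OF cu, of UNIV] C1fun_cont[OF cv, of UNIV] C1fun_grad_cont[OF cu, of UNIV] C1fun_grad_cont[OF cv, of UNIV]
 have cg: "continuous_on UNIV (\<lambda>x. g x \<bullet> b)" and ch: "continuous_on UNIV (\<lambda>x. h x \<bullet> b)"
  using cont by (auto intro: continuous_intros)
 have shift: "C1c UNIV (\<lambda>x. u (x + s *\<^sub>R a)) (\<lambda>x. g (x + s *\<^sub>R a))" for s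
 proof -
  obtain K where K: "compact K" "\<And>x. x \<notin> K \<Longrightarrow> u x = 0" using u by (auto simp: C1c_def)
  have "GDERIV (\<lambda>x. u (x + s *\<^sub>R a)) x :> g (x + s *\<^sub>R a)" for x
  proof -
   have "GDERIV u (x + s *\<^sub>R a) :> g (x + s *\<^sub>R a)" using cu by (simp add: C1fun_def)
   then have D: "(u has_derivative (\<lambda>h. h \<bullet> g (x + s *\<^sub>R a))) (at (x + s *\<^sub>R a))" by (simp add: gderiv_def)
   have T: "((\<lambda>x. x + s *\<^sub>R a) has_derivative (\<lambda>h. h)) (at x)" by (auto intro!: derivative_eq_intros)
   show ?thesis unfolding gderiv_def by (rule has_derivative_compose[OF T D])
  qed
  moreover have "continuous_on UNIV (\<lambda>x. g (x + s *\<^sub>R a))"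
   by (intro continuous_on_compose2[OF cont(3)] continuous_intros) auto
  moreover have "compact ((\<lambda>x. x - s *\<^sub>R a) ` K)" by (intro compact_continuous_image continuous_intros K)
  moreover have "u (x + s *\<^sub>R a) = 0" if "x \<notin> (\<lambda>x. x - s *\<^sub>R a) ` K" for x
   by (rule K(2)) (use that image_eqI[of x "\<lambda>x. x - s *\<^sub>R a" "x + s *\<^sub>R a" K] in auto)
  ultimately show ?thesis unfolding C1c_def C1fun_def
   by (intro conjI allI exI[of _ "(\<lambda>x. x - s *\<^sub>R a) ` K"] impI subset_UNIV)
 qed
 have step: "(\<integral>x. (u (x + (1 / real (Suc n)) *\<^sub>R a) - u x) * real (Suc n) * (h x \<bullet> b) \<partial>lborel)
   = - (\<integral>x. (v (x + (1 / real (Suc n)) *\<^sub>R (- a)) - v x) * real (Suc n) * (g x \<bullet> b) \<partial>lborel)" for n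
 proof -
  let ?s = "1 / real (Suc n)" and ?N = "real (Suc n)"
  let ?us = "\<lambda>x. u (x + ?s *\<^sub>R a)" and ?gs = "\<lambda>x. g (x + ?s *\<^sub>R a)"
  have prod: "C1c UNIV (\<lambda>x. u x * v x) (\<lambda>x. u x *\<^sub>R h x + v x *\<^sub>R g x)" if "C1c UNIV u g" for u g
   using that C1fun_mult[OF _ cv, of u g] unfolding C1c_def by auto
  have parts: "(\<integral>x. u x * (h x \<bullet> b) \<partial>lborel) = - (\<integral>x. (g x \<bullet> b) * v x \<partial>lborel)" if "C1c UNIV u g" for u g
  proof -
   have "(\<integral>x. (u x *\<^sub>R h x + v x *\<^sub>R g x) \<bullet> b \<partial>lborel) = 0" by (rule integral_derivative_zero[OF prod[OF that]])
   then have "(\<integral>x. u x * (h x \<bullet> b) + (g x \<bullet> b) * v x \<partial>lborel) = 0" by (simp add: inner_add_left mult.commute)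
   then show ?thesis
    using C1c_integrable[OF that ch] C1c_grad_integrable[OF that cont(2), of b] by simp
  qed
  have i1: "integrable lborel (\<lambda>x. ?us x * (h x \<bullet> b))" "integrable lborel (\<lambda>x. u x * (h x \<bullet> b))"
   by (rule C1c_integrable[OF shift ch], rule C1c_integrable[OF u ch])
  have vm: "integrable lborel (\<lambda>x. (g x \<bullet> b) * v x)" by (rule C1c_grad_integrable[OF u cont(2)])
  have vs: "continuous_on UNIV (\<lambda>x. v (x + ?s *\<^sub>R (- a)))"
   by (intro continuous_on_compose2[OF cont(2)] continuous_intros) auto
  have vm2: "integrable lborel (\<lambda>x. (g x \<bullet> b) * v (x + ?s *\<^sub>R (- a)))" by (rule C1c_grad_integrable[OF u vs])
  have "(\<integral>x. (?gs x \<bullet> b) * v x \<partial>lborel) = (\<integral>x. (g x \<bullet> b) * v (x + ?s *\<^sub>R (- a)) \<partial>lborel)"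
  proof -
   have "continuous_on UNIV (\<lambda>x. (g x \<bullet> b) * v (x + ?s *\<^sub>R (- a)))" by (intro continuous_on_mult cg vs)
   from lborel_integral_shift[OF borel_measurable_continuous_onI[OF this], where a = "?s *\<^sub>R a"]
   show ?thesis by simp
  qed
  then have "(\<integral>x. ?us x * (h x \<bullet> b) - u x * (h x \<bullet> b) \<partial>lborel)
    = - (\<integral>x. (g x \<bullet> b) * v (x + ?s *\<^sub>R (- a)) - (g x \<bullet> b) * v x \<partial>lborel)"
   using parts[OF shift[of ?s]] parts[OF u] i1 vm vm2 by simp
  then have "?N * (\<integral>x. ?us x * (h x \<bullet> b) - u x * (h x \<bullet> b) \<partial>lborel)
    = - (?N * (\<integral>x. (g x \<bullet> b) * v (x + ?s *\<^sub>R (- a)) - (g x \<bullet> b) * v x \<partial>lborel))" by simp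
  then show ?thesis
   unfolding integral_mult_right_zero[symmetric] left_diff_distrib right_diff_distrib by (simp only: mult_ac)
 qed
 have "(\<lambda>n. - (\<integral>x. (v (x + (1 / real (Suc n)) *\<^sub>R (- a)) - v x) * real (Suc n) * (g x \<bullet> b) \<partial>lborel))
   \<longlonglongrightarrow> - (\<integral>x. (h x \<bullet> (- a)) * (g x \<bullet> b) \<partial>lborel)"
  by (intro tendsto_minus difference_quotient_limit v cg)
 then have "(\<integral>x. (g x \<bullet> a) * (h x \<bullet> b) \<partial>lborel) = - (\<integral>x. (h x \<bullet> (- a)) * (g x \<bullet> b) \<partial>lborel)"
  using difference_quotient_limit[OF u ch, of a] unfolding step by (intro LIMSEQ_unique)
 then show ?thesis by (simp add: mult.commute)
qed

text \<open>The vector field \<open>A ((\<partial>\<^sub>b v) a - (\<partial>\<^sub>a v) b)\<close> has divergence \<open>\<partial>\<^sub>a A \<partial>\<^sub>b v - \<partial>\<^sub>b A \<partial>\<^sub>a v\<close>: testing with \<open>\<psi>\<close> pairs the derivatives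
of \<open>\<psi> A\<close> and of \<open>v\<close>, which commute weakly. Both functions are first cut off to the whole space.\<close>

lemma weak_divergence_pair:
 fixes a b :: "'a::euclidean_space"
 assumes S: "open S" and A: "\<And>x. x \<in> S \<Longrightarrow> GDERIV A x :> gA x" "continuous_on S gA"
  and v: "\<And>x. x \<in> S \<Longrightarrow> GDERIV v x :> gv x" "continuous_on S gv" and \<psi>: "C1c S \<psi> g"
 shows "(\<integral>x. indicator S x * (\<psi> x * ((gA x \<bullet> a) * (gv x \<bullet> b) - (gA x \<bullet> b) * (gv x \<bullet> a))
   + A x * ((g x \<bullet> a) * (gv x \<bullet> b) - (g x \<bullet> b) * (gv x \<bullet> a))) \<partial>lborel) = 0" (is "?I = 0")
  and "integrable lborel (\<lambda>x. indicator S x * (\<psi> x * ((gA x \<bullet> a) * (gv x \<bullet> b) - (gA x \<bullet> b) * (gv x \<bullet> a))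
   + A x * ((g x \<bullet> a) * (gv x \<bullet> b) - (g x \<bullet> b) * (gv x \<bullet> a))))" (is "integrable lborel ?f")
proof -
 obtain K where K: "compact K" "K \<subseteq> S" "\<And>x. x \<notin> K \<Longrightarrow> \<psi> x = 0" and c\<psi>: "C1fun \<psi> g" using \<psi> by (auto simp: C1c_def)
 have g0: "x \<notin> K \<Longrightarrow> g x = 0" for x by (rule C1c_grad_zero[OF c\<psi> K(1,3)])
 have Acont: "continuous_on S A" "continuous_on S v"
  by (intro continuous_at_imp_continuous_on ballI GDERIV_cont[OF A(1)] GDERIV_cont[OF v(1)]; assumption)+
 define B where "B x = (if x \<in> K then \<psi> x * A x else 0)" for x
 define gB where "gB x = (if x \<in> K then \<psi> x *\<^sub>R gA x + A x *\<^sub>R g x else 0)" for x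
 have B: "C1c S B gB"
 proof (rule C1c_glue[OF S K(1,2)])
  have eq: "B x = \<psi> x * A x" "gB x = \<psi> x *\<^sub>R gA x + A x *\<^sub>R g x" for x
   using K(3) g0 by (auto simp: B_def gB_def)
  show "GDERIV B x :> gB x" if "x \<in> S" for x
   unfolding eq[abs_def] using A(1)[OF that] c\<psi> by (intro GDERIV_mult) (auto simp: C1fun_def)
  show "continuous_on S gB"
   unfolding eq[abs_def] by (intro continuous_intros Acont A(2) C1fun_cont[OF c\<psi>] C1fun_grad_cont[OF c\<psi>])
 qed (auto simp: B_def gB_def)
 obtain \<zeta> g\<zeta> V where \<zeta>: "C1c S \<zeta> g\<zeta>" "open V" "K \<subseteq> V" "\<And>x. x \<in> V \<Longrightarrow> \<zeta> x = 1"
  using cutoff_exists[OF K(1,2) S] by blast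
 obtain L where L: "compact L" "L \<subseteq> S" "\<And>x. x \<notin> L \<Longrightarrow> \<zeta> x = 0" and c\<zeta>: "C1fun \<zeta> g\<zeta>" using \<zeta>(1) by (auto simp: C1c_def)
 have g\<zeta>0: "x \<notin> L \<Longrightarrow> g\<zeta> x = 0" for x by (rule C1c_grad_zero[OF c\<zeta> L(1,3)])
 have g\<zeta>1: "g\<zeta> x = 0" if "x \<in> K" for x by (rule C1fun_grad_zero[OF c\<zeta> \<zeta>(2)]) (use that \<zeta> in auto)
 define w where "w x = (if x \<in> L then \<zeta> x * v x else 0)" for x
 define gw where "gw x = (if x \<in> L then \<zeta> x *\<^sub>R gv x + v x *\<^sub>R g\<zeta> x else 0)" for x
 have w: "C1c S w gw"
 proof (rule C1c_glue[OF S L(1,2)])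
  have eq: "w x = \<zeta> x * v x" "gw x = \<zeta> x *\<^sub>R gv x + v x *\<^sub>R g\<zeta> x" for x
   using L(3) g\<zeta>0 by (auto simp: w_def gw_def)
  show "GDERIV w x :> gw x" if "x \<in> S" for x
   unfolding eq[abs_def] using v(1)[OF that] c\<zeta> by (intro GDERIV_mult) (auto simp: C1fun_def)
  show "continuous_on S gw"
   unfolding eq[abs_def] by (intro continuous_intros Acont v(2) C1fun_cont[OF c\<zeta>] C1fun_grad_cont[OF c\<zeta>])
 qed (auto simp: w_def gw_def)
 have up: "C1c UNIV B gB" "C1c UNIV w gw" using B w by (auto simp: C1c_def)
 have feq: "?f = (\<lambda>x. (gB x \<bullet> a) * (gw x \<bullet> b) - (gB x \<bullet> b) * (gw x \<bullet> a))"
 proof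
  fix x
  show "?f x = (gB x \<bullet> a) * (gw x \<bullet> b) - (gB x \<bullet> b) * (gw x \<bullet> a)"
  proof (cases "x \<in> K")
   case True
   then have "x \<in> L" using \<zeta>(3,4) L(3) by fastforce
   then show ?thesis
    using True subsetD[OF K(2) True] \<zeta>(4)[OF subsetD[OF \<zeta>(3) True]] g\<zeta>1[OF True]
    by (auto simp: gB_def gw_def inner_add_left algebra_simps)
  qed (simp add: K(3) g0 gB_def)
 qed
 have cw: "continuous_on UNIV (\<lambda>x. gw x \<bullet> a)" "continuous_on UNIV (\<lambda>x. gw x \<bullet> b)"
  using up(2) by (auto simp: C1c_def C1fun_def intro: continuous_intros)
 have i: "integrable lborel (\<lambda>x. (gB x \<bullet> a) * (gw x \<bullet> b))" "integrable lborel (\<lambda>x. (gB x \<bullet> b) * (gw x \<bullet> a))"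
  by (rule C1c_grad_integrable[OF up(1)], rule cw)+
 show "integrable lborel ?f" unfolding feq using i by simp
 show "?I = 0" unfolding feq using i weak_derivatives_commute[OF up, of a b] by simp
qed

section \<open>Green's formula for continuous fields\<close>

text \<open>The substitution reverses every line in direction \<open>e\<close> and scales it by \<open>d\<close>, sending the height \<open>t\<close> to the
point at distance \<open>d t\<close> below the graph.\<close>

lemma nn_integral_flip:
 fixes e :: "'a::euclidean_space" and F :: "'a \<Rightarrow> ennreal"
 assumes e: "norm e = 1" and [measurable]: "F \<in> borel_measurable borel" "\<Phi> \<in> borel_measurable borel"
  and inv: "\<And>x s. \<Phi> (x + s *\<^sub>R e) = \<Phi> x" and d: "d > 0"
 shows "(\<integral>\<^sup>+x. F x \<partial>lborel) = (\<integral>\<^sup>+x. ennreal d * F (x + (\<Phi> x - (1 + d) * (e \<bullet> x)) *\<^sub>R e) \<partial>lborel)"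
proof -
 have ee: "e \<bullet> e = 1" using e by (simp add: norm_eq_1)
 have inner: "(\<integral>\<^sup>+s. F (x + s *\<^sub>R e) \<partial>lborel)
   = (\<integral>\<^sup>+s. ennreal d * F (x + s *\<^sub>R e + (\<Phi> (x + s *\<^sub>R e) - (1 + d) * (e \<bullet> (x + s *\<^sub>R e))) *\<^sub>R e) \<partial>lborel)" for x
 proof -
  let ?c = "\<Phi> x - (1 + d) * (e \<bullet> x)"
  have "(\<integral>\<^sup>+s. F (x + s *\<^sub>R e) \<partial>lborel) = ennreal \<bar>- d\<bar> * (\<integral>\<^sup>+s. F (x + (?c + - d * s) *\<^sub>R e) \<partial>lborel)"
   by (rule nn_integral_real_affine) (use d in auto)
  also have "\<dots> = (\<integral>\<^sup>+s. ennreal d * F (x + (?c + - d * s) *\<^sub>R e) \<partial>lborel)"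
   using d by (subst nn_integral_cmult) auto
  also have "\<dots> = (\<integral>\<^sup>+s. ennreal d * F (x + s *\<^sub>R e + (\<Phi> (x + s *\<^sub>R e) - (1 + d) * (e \<bullet> (x + s *\<^sub>R e))) *\<^sub>R e) \<partial>lborel)"
   by (simp add: inv inner_add_right ee algebra_simps)
  finally show ?thesis .
 qed
 show ?thesis
  by (subst (1 2) nn_integral_line_fubini[OF _ ee]) (simp_all only: inner, measurable)
qed

lemma integral_flip:
 fixes e :: "'a::euclidean_space" and f :: "'a \<Rightarrow> real"
 assumes e: "norm e = 1" and [measurable]: "f \<in> borel_measurable borel" "\<Phi> \<in> borel_measurable borel"
  and inv: "\<And>x s. \<Phi> (x + s *\<^sub>R e) = \<Phi> x" and d: "d > 0"
 shows "(\<integral>x. f x \<partial>lborel) = (\<integral>x. d * f (x + (\<Phi> x - (1 + d) * (e \<bullet> x)) *\<^sub>R e) \<partial>lborel)"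
proof -
 let ?T = "\<lambda>x. x + (\<Phi> x - (1 + d) * (e \<bullet> x)) *\<^sub>R e"
 have "lborel = distr (density lborel (\<lambda>x. ennreal d)) borel ?T"
 proof (rule measure_eqI)
  fix B :: "'a set" assume "B \<in> sets lborel"
  then have [measurable]: "B \<in> sets borel" by simp
  have "emeasure (distr (density lborel (\<lambda>x. ennreal d)) borel ?T) B
    = (\<integral>\<^sup>+x. indicator B x \<partial>distr (density lborel (\<lambda>x. ennreal d)) borel ?T)" by simp
  also have "\<dots> = (\<integral>\<^sup>+x. ennreal d * indicator B (?T x) \<partial>lborel)"
   by (subst nn_integral_distr, simp, simp, subst nn_integral_density) auto
  also have "\<dots> = (\<integral>\<^sup>+x. indicator B x \<partial>lborel)"
   by (rule nn_integral_flip[OF e _ _ inv d, symmetric]) auto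
  finally show "emeasure lborel B = emeasure (distr (density lborel (\<lambda>x. ennreal d)) borel ?T) B" by simp
 qed simp
 then have "(\<integral>x. f x \<partial>lborel) = (\<integral>x. f x \<partial>distr (density lborel (\<lambda>x. ennreal d)) borel ?T)" by simp
 also have "\<dots> = (\<integral>x. f (?T x) \<partial>density lborel (\<lambda>x. ennreal d))" by (rule integral_distr) auto
 also have "\<dots> = (\<integral>x. d *\<^sub>R f (?T x) \<partial>lborel)" by (rule integral_density) (use d in auto)
 finally show ?thesis by simp
qed

text \<open>A function constant along \<open>e\<close> is integrated over the lines in direction \<open>e\<close>, and the weight \<open>p\<close> has total
mass one on each of them, just like the indicator of the slab.\<close>

lemma integral_line_weight:
 fixes e :: "'a::euclidean_space" and f :: "'a \<Rightarrow> real" and p :: "real \<Rightarrow> real"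
 assumes e: "norm e = 1" and [measurable]: "f \<in> borel_measurable borel" "p \<in> borel_measurable borel"
  and p: "\<And>t. p t \<ge> 0" "(\<integral>\<^sup>+t. ennreal (p t) \<partial>lborel) = 1"
  and inv: "\<And>x s. f (x + s *\<^sub>R e) = f x" and int: "integrable lborel (\<lambda>x. p (e \<bullet> x) * f x)"
 shows "(\<integral>x. p (e \<bullet> x) * f x \<partial>lborel) = (\<integral>x. indicator (slab e) x * f x \<partial>lborel)"
proof -
 have ee: "e \<bullet> e = 1" using e by (simp add: norm_eq_1)
 have nn: "(\<integral>\<^sup>+x. ennreal (p (e \<bullet> x)) * F x \<partial>lborel) = (slab_int e (\<lambda>x. F x))"
  if [measurable]: "F \<in> borel_measurable borel" and F: "\<And>x s. F (x + s *\<^sub>R e) = F x" for F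
 proof -
  have "(\<integral>\<^sup>+s. ennreal (p (e \<bullet> x + s)) * F x \<partial>lborel) = F x" for x
  proof -
   have "(\<integral>\<^sup>+s. ennreal (p (e \<bullet> x + s)) * F x \<partial>lborel) = (\<integral>\<^sup>+s. ennreal (p (s + e \<bullet> x)) \<partial>lborel) * F x"
    by (subst nn_integral_multc) (auto simp: add.commute)
   also have "(\<integral>\<^sup>+s. ennreal (p (s + e \<bullet> x)) \<partial>lborel) = 1"
    using nn_integral_lborel_shift[of "\<lambda>s. ennreal (p s)" "e \<bullet> x"] p(2) by simp
   finally show ?thesis by simp
  qed
  then show ?thesis
   by (subst nn_integral_line_fubini[OF _ ee]) (simp_all add: F inner_add_right ee)
 qed
 have pos: "(\<integral>\<^sup>+x. ennreal (p (e \<bullet> x) * g x) \<partial>lborel) = (\<integral>\<^sup>+x. ennreal (indicator (slab e) x * g x) \<partial>lborel)"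
  if [measurable]: "g \<in> borel_measurable borel" and g: "\<And>x s. g (x + s *\<^sub>R e) = g x" for g :: "'a \<Rightarrow> real"
 proof -
  have "(\<integral>\<^sup>+x. ennreal (p (e \<bullet> x) * g x) \<partial>lborel) = (\<integral>\<^sup>+x. ennreal (p (e \<bullet> x)) * ennreal (g x) \<partial>lborel)"
   by (intro nn_integral_cong ennreal_mult' p)
  also have "\<dots> = (slab_int e (\<lambda>x. ennreal (g x)))" by (rule nn) (auto simp: g)
  also have "\<dots> = (\<integral>\<^sup>+x. ennreal (indicator (slab e) x * g x) \<partial>lborel)"
   by (intro nn_integral_cong) (auto simp: indicator_def)
  finally show ?thesis .
 qed
 have "integrable lborel (\<lambda>x. indicator (slab e) x * f x)"
  using int pos[of "\<lambda>x. \<bar>f x\<bar>"] unfolding integrable_iff_bounded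
  by (simp add: inv abs_mult p(1))
 then show ?thesis
  using int pos[of f] pos[of "\<lambda>x. - f x"] by (simp add: real_lebesgue_integral_def inv)
qed

lemma lborel_graph_null:
 fixes e :: "'a::euclidean_space"
 assumes e: "norm e = 1" and cont: "continuous_on UNIV \<Phi>" and inv: "\<And>x s. \<Phi> (x + s *\<^sub>R e) = \<Phi> x"
 shows "AE x in lborel. x \<notin> graph e \<Phi>"
proof -
 have ee: "e \<bullet> e = 1" using e by (simp add: norm_eq_1)
 have [measurable]: "\<Phi> \<in> borel_measurable borel" using cont by (rule borel_measurable_continuous_onI)
 have [measurable]: "graph e \<Phi> \<in> sets borel" unfolding graph_def by measurable
 have "(\<integral>\<^sup>+s. indicator (graph e \<Phi>) (x + s *\<^sub>R e) \<partial>lborel) = (0::ennreal)" for x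
 proof -
  have "(\<integral>\<^sup>+s. indicator (graph e \<Phi>) (x + s *\<^sub>R e) \<partial>lborel) = (\<integral>\<^sup>+s. indicator {\<Phi> x - e \<bullet> x} s \<partial>lborel)"
   by (intro nn_integral_cong) (auto simp: graph_def inv inner_add_right ee indicator_def)
  then show ?thesis by simp
 qed
 then have "emeasure lborel (graph e \<Phi>) = 0"
  by (subst nn_integral_indicator[symmetric], simp, subst nn_integral_line_fubini[OF _ ee]) simp_all
 then show ?thesis by (intro AE_not_in null_setsI) auto
qed

text \<open>\<open>s\<close> is the divergence of \<open>X\<close> in the sense of distributions on the interior of \<open>E\<close>.\<close>

definition weak_divergence :: "'a::euclidean_space set \<Rightarrow> ('a \<Rightarrow> real) \<Rightarrow> ('a \<Rightarrow> 'a) \<Rightarrow> bool" where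
 "weak_divergence E s X \<longleftrightarrow>
  (\<forall>\<psi> g. C1c (interior E) \<psi> g \<longrightarrow> (LINT x:E|lborel. \<psi> x * s x + g x \<bullet> X x) = 0)"

lemma set_integrable_compact:
 fixes f :: "'a::euclidean_space \<Rightarrow> real"
 shows "compact E \<Longrightarrow> continuous_on E f \<Longrightarrow> set_integrable lborel E f"
 unfolding set_integrable_def by (rule borel_integrable_compact)

context graph_chart
begin

definition normal where "normal x = (1 / J x) *\<^sub>R (e - q x)"

lemma area_graph_integral:
 fixes h :: "real^'n \<Rightarrow> real"
 assumes [measurable]: "h \<in> borel_measurable borel"
 shows "(\<integral>x. indicator (\<Gamma> \<inter> W) x * h x \<partial>\<A>)
  = (\<integral>x. indicator (slab e) x * (indicator W x * J x * h (G x)) \<partial>lborel)"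
proof -
 let ?d = "\<lambda>x. ennreal (indicator (slab e) x * (indicator W x * J x))"
 have [measurable]: "(\<lambda>x. indicator W x * J x) \<in> borel_measurable borel"
  using borel_measurable_continuous_on_indicator[OF _ J_cont] by simp
 have J0: "0 \<le> J x" for x using J_ge_1[of x] by simp
 have eq: "density \<A> (\<lambda>x. ennreal (indicator (\<Gamma> \<inter> W) x)) = distr (density lborel ?d) borel G"
 proof (rule measure_eqI)
  fix B assume "B \<in> sets (density \<A> (\<lambda>x. ennreal (indicator (\<Gamma> \<inter> W) x)))"
  then have [measurable]: "B \<in> sets borel" by simp
  have "emeasure (density \<A> (\<lambda>x. ennreal (indicator (\<Gamma> \<inter> W) x))) B
    = (\<integral>\<^sup>+x. indicator ((B \<inter> W) \<inter> \<Gamma>) x \<partial>\<A>)"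
   by (subst emeasure_density) (auto intro!: nn_integral_cong simp: indicator_def simp del: nn_integral_indicator)
  also have "\<dots> = (slab_int e (\<lambda>x. indicator (B \<inter> W) (G x) * ennreal (J x)))"
   by (subst nn_integral_indicator) (auto intro!: area_graph)
  also have "\<dots> = (\<integral>\<^sup>+x. ?d x * indicator B (G x) \<partial>lborel)"
   by (intro nn_integral_cong) (auto simp: indicator_def G_in_W)
  also have "\<dots> = (\<integral>\<^sup>+x. indicator B x \<partial>distr (density lborel ?d) borel G)"
   by (subst nn_integral_distr, simp, simp, subst nn_integral_density) auto
  finally show "emeasure (density \<A> (\<lambda>x. ennreal (indicator (\<Gamma> \<inter> W) x))) B = emeasure (distr (density lborel ?d) borel G) B"
   by simp
 qed simp
 have "(\<integral>x. indicator (\<Gamma> \<inter> W) x * h x \<partial>\<A>) = (\<integral>x. h x \<partial>density \<A> (\<lambda>x. ennreal (indicator (\<Gamma> \<inter> W) x)))"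
  by (subst integral_density) auto
 also have "\<dots> = (\<integral>x. h (G x) \<partial>density lborel ?d)"
  unfolding eq by (rule integral_distr) auto
 also have "\<dots> = (\<integral>x. indicator (slab e) x * (indicator W x * J x) * h (G x) \<partial>lborel)"
  by (subst integral_density) (auto simp: J0)
 finally show ?thesis by (simp only: mult.assoc)
qed

text \<open>The boundary term arises from cutting off at distance of order \<open>d n\<close> below the graph, measured
 along \<open>e\<close>: the gradient of the cutoff integrates to one over each vertical line.\<close>

theorem gauss_green_chart:
 assumes E: "compact E" and U: "open U" "U \<subseteq> W" and EU: "E \<inter> U = {x\<in>U. e \<bullet> x \<le> \<Phi> x}"
  and X: "continuous_on E X" and s: "continuous_on E s" and weak: "weak_divergence E s X"
  and w: "\<And>x. x \<in> interior E \<Longrightarrow> GDERIV w x :> gw x" "continuous_on E w" "continuous_on E gw"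
  and K: "compact K" "K \<subseteq> U" and zero: "\<And>x. x \<in> E - K \<Longrightarrow> w x = 0" "\<And>x. x \<in> E - K \<Longrightarrow> gw x = 0"
 shows "(LINT x:E|lborel. w x * s x + gw x \<bullet> X x) = (LINT x:\<Gamma> \<inter> U|\<A>. w x * (X x \<bullet> normal x))"
proof -
 have Ec: "closed E" using E by (rule compact_imp_closed)
 have [measurable]: "E \<in> sets borel" "K \<in> sets borel" "U \<in> sets borel"
  using Ec K U by (auto simp: compact_imp_closed)
 define d where "d n = 1 / real (Suc n)" for n
 have d: "d n > 0" for n by (simp add: d_def)
 have d0: "d \<longlonglongrightarrow> 0" using LIMSEQ_inverse_real_of_nat by (simp add: d_def[abs_def] inverse_eq_divide)
 \<comment> \<open>the integrand of the boundary term before normalisation: \<open>q - e\<close> is the gradient of \<open>\<Phi> x - e \<bullet> x\<close>\<close>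
 define H where "H x = indicator (E \<inter> K) x *\<^sub>R (w x * ((q x - e) \<bullet> X x))" for x
 have hc: "continuous_on (E \<inter> K) (\<lambda>x. w x * ((q x - e) \<bullet> X x))"
  using K(2) U(2) by (intro continuous_intros continuous_on_subset[OF w(2)] continuous_on_subset[OF q_cont] continuous_on_subset[OF X]) auto
 have [measurable]: "H \<in> borel_measurable borel"
  unfolding H_def[abs_def] by (rule borel_measurable_continuous_on_indicator[OF _ hc]) auto
 have cEK: "compact (E \<inter> K)" using E K by (simp add: compact_Int)
 obtain M where M: "\<And>x. \<bar>H x\<bar> \<le> M" "M \<ge> 0"
 proof -
  have "bounded ((\<lambda>x. w x * ((q x - e) \<bullet> X x)) ` (E \<inter> K))"
   by (intro compact_imp_bounded compact_continuous_image hc cEK)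
  then obtain M where "\<forall>y\<in>(\<lambda>x. w x * ((q x - e) \<bullet> X x)) ` (E \<inter> K). norm y \<le> M" "M > 0"
   unfolding bounded_pos by blast
  then show ?thesis by (intro that[of M]) (auto simp: H_def indicator_def)
 qed
 let ?t = "\<lambda>n x. (\<Phi> x - e \<bullet> x) / d n"
 have tc: "continuous_on S (\<lambda>x. step (?t n x))" "continuous_on S (\<lambda>x. step' (?t n x))" for S n
  by (rule continuous_on_compose2[OF step_cont] continuous_on_compose2[OF step'_cont];
    use d[of n] in \<open>auto intro!: continuous_intros continuous_on_subset[OF \<Phi>_cont]\<close>)+
 define L where "L x = w x * s x + gw x \<bullet> X x" for x
 have Lc: "continuous_on E L" unfolding L_def[abs_def] by (intro continuous_intros w X s)
 define A where "A n x = indicator E x *\<^sub>R (step (?t n x) * L x)" for n x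
 define B where "B n x = H x * (step' (?t n x) / d n)" for n x
 have Ai: "integrable lborel (A n)" for n
  unfolding A_def[abs_def] by (intro borel_integrable_compact E continuous_on_mult tc Lc)
 have Bi: "integrable lborel (B n)" for n
 proof -
  have "integrable lborel (\<lambda>x. indicator (E \<inter> K) x *\<^sub>R ((w x * ((q x - e) \<bullet> X x)) * (step' (?t n x) / d n)))"
   by (intro borel_integrable_compact cEK continuous_on_mult hc continuous_on_divide tc continuous_on_const) (use d[of n] in auto)
  then show ?thesis by (simp add: B_def[abs_def] H_def mult.assoc)
 qed
 have cut: "(\<integral>x. A n x \<partial>lborel) = - (\<integral>x. B n x \<partial>lborel)" for n
 proof -
  \<comment> \<open>the test function vanishes within distance \<open>d n\<close> below the graph, so its support is compact in the interior\<close>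
  define \<psi> where "\<psi> x = (if x \<in> E \<inter> U then w x * step (?t n x) else 0)" for x
  define g where "g x = (if x \<in> E \<inter> U then w x *\<^sub>R (step' (?t n x) *\<^sub>R ((1 / d n) *\<^sub>R (q x - e))) + step (?t n x) *\<^sub>R gw x else 0)" for x
  let ?K = "E \<inter> K \<inter> {x. e \<bullet> x \<le> \<Phi> x - d n}"
  have below: "x \<in> interior E" if "x \<in> U" "e \<bullet> x < \<Phi> x" for x
  proof (rule interiorI)
   show "open (U \<inter> {x. e \<bullet> x < \<Phi> x})" using U(1) by (intro open_Int open_Collect_less continuous_intros \<Phi>_cont)
   show "U \<inter> {x. e \<bullet> x < \<Phi> x} \<subseteq> E"
   proof
    fix z assume "z \<in> U \<inter> {x. e \<bullet> x < \<Phi> x}"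
    then have "z \<in> E \<inter> U" unfolding EU by simp
    then show "z \<in> E" by simp
   qed
  qed (use that in auto)
  have "C1c (interior E \<inter> U) \<psi> g"
  proof (rule C1c_glue[where K = ?K])
   have "closed {x. e \<bullet> x \<le> \<Phi> x - d n}" by (intro closed_Collect_le continuous_intros \<Phi>_cont)
   then show "compact ?K" using cEK by (rule compact_Int_closed[rotated])
   show "?K \<subseteq> interior E \<inter> U"
   proof
    fix z assume z: "z \<in> ?K"
    then have "z \<in> U" "e \<bullet> z < \<Phi> z" using K(2) d[of n] by (blast, simp)
    then show "z \<in> interior E \<inter> U" using below by simp
   qed
   have out: "w x = 0 \<and> gw x = 0 \<or> step (?t n x) = 0 \<and> step' (?t n x) = 0" if "x \<notin> ?K" "x \<in> E \<inter> U" for x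
   proof (cases "x \<in> K")
    case True
    then have "?t n x \<le> 1" using that d[of n] by (simp add: divide_le_eq)
    then show ?thesis by (simp add: step_eq_0 step'_eq_0)
   qed (use that zero in auto)
   show "\<psi> x = 0" "g x = 0" if "x \<notin> ?K" for x
    using out[OF that] by (auto simp: \<psi>_def g_def)
   fix x assume x: "x \<in> interior E \<inter> U"
   then have xW: "x \<in> W" using U by auto
   have "GDERIV (\<lambda>x. ?t n x) x :> (1 / d n) *\<^sub>R (q x - e)"
   proof -
    have "((\<lambda>x. (1 / d n) * (\<Phi> x - e \<bullet> x)) has_derivative (\<lambda>h. (1 / d n) * (q x \<bullet> h - e \<bullet> h))) (at x)"
     by (intro has_derivative_mult_right has_derivative_diff \<Phi>_deriv[OF xW] has_derivative_inner_right has_derivative_ident)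
    then show ?thesis unfolding gderiv_def by (simp add: inner_diff_right inner_commute)
   qed
   then have "GDERIV (\<lambda>x. w x * step (?t n x)) x :> w x *\<^sub>R (step' (?t n x) *\<^sub>R ((1 / d n) *\<^sub>R (q x - e))) + step (?t n x) *\<^sub>R gw x"
    using x by (intro GDERIV_mult w(1) GDERIV_DERIV_compose[OF _ DERIV_step]) auto
   moreover have "open (interior E \<inter> U)" using U by auto
   moreover have "w y * step (?t n y) = \<psi> y" if "y \<in> interior E \<inter> U" for y
    using that interior_subset[of E] by (simp add: \<psi>_def subset_iff)
   ultimately have "GDERIV \<psi> x :> w x *\<^sub>R (step' (?t n x) *\<^sub>R ((1 / d n) *\<^sub>R (q x - e))) + step (?t n x) *\<^sub>R gw x"
    by (rule GDERIV_cong_open[OF _ _ x])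
   then show "GDERIV \<psi> x :> g x" using x interior_subset[of E] by (simp add: g_def subset_iff)
  next
   have "continuous_on (interior E \<inter> U) (\<lambda>x. w x *\<^sub>R (step' (?t n x) *\<^sub>R ((1 / d n) *\<^sub>R (q x - e))) + step (?t n x) *\<^sub>R gw x)"
    using interior_subset U(2)
    by (intro continuous_intros tc continuous_on_subset[OF w(2)] continuous_on_subset[OF w(3)] continuous_on_subset[OF q_cont]) auto
   then show "continuous_on (interior E \<inter> U) g"
    by (rule continuous_on_eq) (use interior_subset[of E] in \<open>simp add: g_def subset_iff\<close>)
  qed (use U in auto)
  then have "C1c (interior E) \<psi> g" by (auto simp: C1c_def)
  then have "(LINT x:E|lborel. \<psi> x * s x + g x \<bullet> X x) = 0" using weak by (simp add: weak_divergence_def)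
  moreover have "indicator E x *\<^sub>R (\<psi> x * s x + g x \<bullet> X x) = A n x + B n x" for x
  proof (cases "x \<in> E")
   case True
   show ?thesis
   proof (cases "x \<in> K")
    case xK: True
    then have "x \<in> U" using K(2) by blast
    then show ?thesis using True xK
     by (simp add: \<psi>_def g_def A_def B_def H_def L_def inner_add_left algebra_simps)
   next
    case False
    then show ?thesis using True zero[of x] by (simp add: \<psi>_def g_def A_def B_def H_def L_def)
   qed
  qed (simp add: A_def B_def H_def)
  ultimately have "(\<integral>x. A n x + B n x \<partial>lborel) = 0" by (simp add: set_lebesgue_integral_def)
  then show ?thesis using Ai Bi by simp
 qed
 have limA: "(\<lambda>n. \<integral>x. A n x \<partial>lborel) \<longlonglongrightarrow> (\<integral>x. indicator E x *\<^sub>R L x \<partial>lborel)"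
 proof (rule integral_dominated_convergence[where w = "\<lambda>x. indicator E x *\<^sub>R \<bar>L x\<bar>"])
  show "integrable lborel (\<lambda>x. indicator E x *\<^sub>R \<bar>L x\<bar>)" by (intro borel_integrable_compact E continuous_intros Lc)
  show "(\<lambda>x. indicator E x *\<^sub>R L x) \<in> borel_measurable lborel"
   using borel_integrable_compact[OF E Lc] by (rule borel_measurable_integrable)
  show "A n \<in> borel_measurable lborel" for n using Ai by (rule borel_measurable_integrable)
  show "AE x in lborel. norm (A n x) \<le> indicator E x *\<^sub>R \<bar>L x\<bar>" for n
  proof (rule AE_I2)
   fix x
   have "\<bar>step (?t n x) * L x\<bar> \<le> \<bar>L x\<bar>" using step_bounds[of "?t n x"] by (simp add: abs_mult mult_left_le_one_le)
   then show "norm (A n x) \<le> indicator E x *\<^sub>R \<bar>L x\<bar>" by (auto simp: A_def indicator_def)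
  qed
  show "AE x in lborel. (\<lambda>n. A n x) \<longlonglongrightarrow> indicator E x *\<^sub>R L x"
   using lborel_graph_null[OF e \<Phi>_cont \<Phi>_line]
  proof eventually_elim
   case (elim x)
   show ?case
   proof (cases "x \<in> E \<inter> K")
    case True
    then have "e \<bullet> x \<le> \<Phi> x" using EU K by blast
    then have lt: "e \<bullet> x < \<Phi> x" using elim by (auto simp: graph_def)
    have "\<forall>\<^sub>F n in sequentially. d n < (\<Phi> x - e \<bullet> x) / 2" using d0 lt by (intro order_tendstoD) auto
    then have "\<forall>\<^sub>F n in sequentially. indicator E x *\<^sub>R L x = A n x"
    proof eventually_elim
     case (elim n)
     then have "?t n x \<ge> 2" using d[of n] by (simp add: le_divide_eq)
     then show ?case by (simp add: A_def step_eq_1)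
    qed
    then show ?thesis by (rule Lim_transform_eventually[OF tendsto_const])
   next
    case False
    then have L0: "indicator E x *\<^sub>R L x = 0" using zero[of x] by (auto simp: L_def indicator_def)
    then have A0: "A n x = 0" for n by (auto simp: A_def indicator_def)
    show ?thesis unfolding L0 A0 by (rule tendsto_const)
   qed
  qed
 qed
 \<comment> \<open>rescales the layer below the graph to the heights between \<open>1\<close> and \<open>2\<close>, the support of \<open>step'\<close>\<close>
 let ?T = "\<lambda>n x. x + (\<Phi> x - (1 + d n) * (e \<bullet> x)) *\<^sub>R e"
 have T: "?T n x = G x + (- d n * (e \<bullet> x)) *\<^sub>R e" for n x by (simp add: lift_def algebra_simps)
 have Beq: "(\<integral>x. B n x \<partial>lborel) = (\<integral>x. step' (e \<bullet> x) * H (?T n x) \<partial>lborel)" for n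
 proof -
  have "(\<integral>x. B n x \<partial>lborel) = (\<integral>x. d n * B n (?T n x) \<partial>lborel)"
   by (rule integral_flip[OF e _ _ \<Phi>_line d]) (unfold B_def, measurable)
  also have "\<dots> = (\<integral>x. step' (e \<bullet> x) * H (?T n x) \<partial>lborel)"
  proof (rule Bochner_Integration.integral_cong[OF refl])
   fix x
   have "?t n (?T n x) = e \<bullet> x"
    unfolding \<Phi>_line inner_add_right inner_scaleR_right ee using d[of n] by (simp add: algebra_simps)
   then show "d n * B n (?T n x) = step' (e \<bullet> x) * H (?T n x)" using d[of n] by (simp add: B_def)
  qed
  finally show ?thesis .
 qed
 obtain R where R: "R > 0" "K \<subseteq> cball 0 R"
  using compact_imp_bounded[OF K(1)] unfolding bounded_pos by (auto simp: subset_iff)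
 obtain C where C: "\<And>t. step' t \<le> C" using step'_bounded by blast
 have C0: "C \<ge> 0" using C[of 0] step'_nonneg[of 0] by linarith
 have HT: "(\<lambda>n. H (?T n x)) \<longlonglongrightarrow> H (G x)" if t: "1 \<le> e \<bullet> x" for x
 proof -
  have Tlim: "(\<lambda>n. ?T n x) \<longlonglongrightarrow> G x"
  proof -
   have "(\<lambda>n. G x + (- d n * (e \<bullet> x)) *\<^sub>R e) \<longlonglongrightarrow> G x + (- 0 * (e \<bullet> x)) *\<^sub>R e" by (intro tendsto_intros d0)
   then show ?thesis unfolding T by simp
  qed
  show ?thesis
  proof (cases "G x \<in> U")
   case True
   have GE: "G x \<in> E \<inter> U" unfolding EU using True G_in_graph[of x] by (simp add: graph_def)
   have "continuous_on (E \<inter> U) (\<lambda>z. w z * ((q z - e) \<bullet> X z))"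
    using U(2) by (intro continuous_intros continuous_on_subset[OF w(2)] continuous_on_subset[OF q_cont] continuous_on_subset[OF X]) auto
   then have c: "continuous_on (E \<inter> U) H"
    by (rule continuous_on_eq) (use zero in \<open>auto simp: H_def indicator_def\<close>)
   have "\<forall>\<^sub>F n in sequentially. ?T n x \<in> U" using Tlim U(1) True by (rule topological_tendstoD)
   then have ev: "\<forall>\<^sub>F n in sequentially. ?T n x \<in> E \<inter> U"
   proof eventually_elim
    case (elim n)
    have "e \<bullet> ?T n x = \<Phi> (?T n x) - d n * (e \<bullet> x)"
     unfolding \<Phi>_line inner_add_right inner_scaleR_right ee by (simp add: algebra_simps)
    then have "e \<bullet> ?T n x \<le> \<Phi> (?T n x)" using d[of n] t by simp
    then show ?case using elim EU by blast
   qed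
   show ?thesis by (rule continuous_on_tendsto_compose[OF c Tlim GE ev])
  next
   case False
   then have "G x \<in> - K" using K by auto
   moreover have "open (- K)" using K by (simp add: compact_imp_closed open_Compl)
   ultimately have "\<forall>\<^sub>F n in sequentially. ?T n x \<in> - K" using Tlim topological_tendstoD by blast
   then have "\<forall>\<^sub>F n in sequentially. H (G x) = H (?T n x)"
    by eventually_elim (use \<open>G x \<in> - K\<close> in \<open>auto simp: H_def indicator_def\<close>)
   then show ?thesis by (rule Lim_transform_eventually[OF tendsto_const])
  qed
 qed
 let ?w = "\<lambda>x. indicator (cball 0 (R + 2)) x *\<^sub>R (C * M) :: real"
 have wi: "integrable lborel ?w" by (intro borel_integrable_compact) auto
 have bound: "\<bar>step' (e \<bullet> x) * H z\<bar> \<le> ?w x" if "z \<in> K \<Longrightarrow> norm (proj e x) \<le> R" for x z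
 proof (cases "step' (e \<bullet> x) = 0 \<or> z \<notin> K")
  case True
  then show ?thesis using C0 M by (auto simp: H_def indicator_def)
 next
  case False
  then have "1 < e \<bullet> x" "e \<bullet> x < 2" "z \<in> K" using step'_eq_0[of "e \<bullet> x"] by force+
  then have "norm x \<le> R + 2"
   using that norm_triangle_ineq[of "proj e x" "(e \<bullet> x) *\<^sub>R e"] e by (simp add: proj_def)
  moreover have "\<bar>step' (e \<bullet> x) * H z\<bar> \<le> C * M"
   unfolding abs_mult using C M C0 step'_nonneg by (intro mult_mono) auto
  ultimately show ?thesis by simp
 qed
 have pT: "proj e (?T n x) = proj e x" "proj e (G x) = proj e x" for n x
  unfolding lift_def by (rule proj_add_line[OF e])+
 have pR: "norm (proj e x) \<le> R" if "z \<in> K" "proj e z = proj e x" for z x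
  using norm_proj_le[OF e, of z] that R by (auto simp: subset_iff)
 have limB: "(\<lambda>n. \<integral>x. B n x \<partial>lborel) \<longlonglongrightarrow> (\<integral>x. step' (e \<bullet> x) * H (G x) \<partial>lborel)"
  unfolding Beq
 proof (rule integral_dominated_convergence[OF _ _ wi])
  show "AE x in lborel. (\<lambda>n. step' (e \<bullet> x) * H (?T n x)) \<longlonglongrightarrow> step' (e \<bullet> x) * H (G x)"
  proof (rule AE_I2)
   fix x
   show "(\<lambda>n. step' (e \<bullet> x) * H (?T n x)) \<longlonglongrightarrow> step' (e \<bullet> x) * H (G x)"
    using HT[of x] by (cases "1 \<le> e \<bullet> x") (auto intro!: tendsto_mult_left simp: step'_eq_0)
  qed
  show "AE x in lborel. norm (step' (e \<bullet> x) * H (?T n x)) \<le> ?w x" for n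
   using bound pR pT by (intro AE_I2) (simp only: real_norm_def)
 qed measurable
 have "integrable lborel (\<lambda>x. step' (e \<bullet> x) * H (G x))"
  by (rule Bochner_Integration.integrable_bound[OF wi])
   (measurable, use bound pR pT in \<open>intro AE_I2, simp only: real_norm_def abs_of_nonneg[OF abs_ge_zero], force intro: order_trans[OF _ abs_ge_self]\<close>)
 then have weight: "(\<integral>x. step' (e \<bullet> x) * H (G x) \<partial>lborel) = (\<integral>x. indicator (slab e) x * H (G x) \<partial>lborel)"
  by (intro integral_line_weight[OF e]) (auto simp: step'_nonneg nn_integral_step' G_line)
 have "(LINT x:E|lborel. w x * s x + gw x \<bullet> X x) = (\<integral>x. indicator E x *\<^sub>R L x \<partial>lborel)"
  by (simp add: set_lebesgue_integral_def L_def)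
 also have "\<dots> = - (\<integral>x. step' (e \<bullet> x) * H (G x) \<partial>lborel)"
  using limA tendsto_minus[OF limB] unfolding cut by (rule LIMSEQ_unique)
 also have "\<dots> = - (\<integral>x. indicator (slab e) x * H (G x) \<partial>lborel)" unfolding weight ..
 also have "\<dots> = (LINT x:\<Gamma> \<inter> U|\<A>. w x * (X x \<bullet> normal x))"
 proof -
  have GUE: "\<Gamma> \<inter> U \<subseteq> E"
  proof
   fix z assume "z \<in> \<Gamma> \<inter> U"
   then have "z \<in> E \<inter> U" unfolding EU by (simp add: graph_def)
   then show "z \<in> E" by simp
  qed
  have Jnz: "J x \<noteq> 0" for x using J_ge_1[of x] by auto
  let ?h = "\<lambda>x. indicator (\<Gamma> \<inter> U) x *\<^sub>R (w x * (X x \<bullet> normal x))"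
  have hm [measurable]: "?h \<in> borel_measurable borel"
  proof (rule borel_measurable_continuous_on_indicator)
   show "continuous_on (\<Gamma> \<inter> U) (\<lambda>x. w x * (X x \<bullet> normal x))"
    unfolding normal_def using GUE U(2) Jnz
    by (intro continuous_intros continuous_on_subset[OF w(2)] continuous_on_subset[OF X] continuous_on_subset[OF J_cont] continuous_on_subset[OF q_cont]) auto
  qed auto
  have "(LINT x:\<Gamma> \<inter> U|\<A>. w x * (X x \<bullet> normal x)) = (\<integral>x. indicator (\<Gamma> \<inter> W) x * ?h x \<partial>\<A>)"
   unfolding set_lebesgue_integral_def
   by (rule Bochner_Integration.integral_cong[OF refl]) (use U(2) in \<open>auto simp: indicator_def\<close>)
  also have "\<dots> = (\<integral>x. indicator (slab e) x * (indicator W x * J x * ?h (G x)) \<partial>lborel)"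
   by (rule area_graph_integral[OF hm])
  also have "\<dots> = (\<integral>x. - (indicator (slab e) x * H (G x)) \<partial>lborel)"
  proof (rule Bochner_Integration.integral_cong[OF refl])
   fix x
   have "indicator W x * J x * ?h (G x) = - H (G x)"
   proof (cases "G x \<in> U")
    case True
    then have xW: "x \<in> W" using U(2) G_in_W by auto
    have JG: "J (G x) = J x" "q (G x) = q x" using q_G[OF xW] by (simp_all add: J_def)
    have GE: "G x \<in> E" using True GUE G_in_graph by auto
    show ?thesis
    proof (cases "G x \<in> K")
     case False
     then show ?thesis using zero(1)[of "G x"] GE by (simp add: H_def)
    next
     case inK: True
     show ?thesis using True xW GE inK G_in_graph[of x] Jnz[of x]
      by (simp add: H_def normal_def JG inner_diff_left inner_diff_right inner_commute algebra_simps)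
    qed
   qed (use K(2) in \<open>auto simp: H_def indicator_def\<close>)
   then show "indicator (slab e) x * (indicator W x * J x * ?h (G x)) = - (indicator (slab e) x * H (G x))" by simp
  qed
  finally show ?thesis by simp
 qed
 finally show ?thesis .
qed

end

text \<open>Localization: near each point of \<open>E\<close> either there is no boundary, or the weight \<open>w\<close> vanishes, or the boundary
is a \<open>C\<^sup>1\<close> graph with \<open>E\<close> below it. The second alternative admits arbitrary singularities of the boundary on
the zero set of the weight. The function \<open>h\<close> stands for \<open>w\<close> times the outer flux of \<open>X\<close>; it may be given by
another expression that agrees almost everywhere.\<close>

theorem gauss_green:
 fixes X :: "real^'n \<Rightarrow> real^'n"
 assumes E: "compact E" and X: "continuous_on E X" and s: "continuous_on E s" and weak: "weak_divergence E s X"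
  and w: "\<And>x. x \<in> interior E \<Longrightarrow> GDERIV w x :> gw x" "continuous_on E w" "continuous_on E gw"
  and Bd: "Bd \<in> sets borel" "Bd \<subseteq> E" and h: "set_integrable \<A> Bd h"
  and loc: "\<And>y. y \<in> E \<Longrightarrow> \<exists>r>0.
   ball y r \<subseteq> interior E \<and> Bd \<inter> ball y r = {}
  \<or> (\<forall>x\<in>E \<inter> ball y r. w x = 0 \<and> gw x = 0) \<and> (\<forall>x\<in>Bd \<inter> ball y r. h x = 0)
  \<or> (\<exists>e \<Phi> q W. graph_chart e \<Phi> q W \<and> ball y r \<subseteq> W \<and> E \<inter> ball y r = {x\<in>ball y r. e \<bullet> x \<le> \<Phi> x} \<and>
     Bd \<inter> ball y r = graph e \<Phi> \<inter> ball y r \<and>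
     (AE x in \<A>. x \<in> Bd \<inter> ball y r \<longrightarrow> h x = w x * (X x \<bullet> graph_chart.normal e q x)))" (is "\<And>y. _ \<Longrightarrow> \<exists>r>0. ?loc y r")
 shows "(LINT x:E|lborel. w x * s x + gw x \<bullet> X x) = (LINT x:Bd|\<A>. h x)"
proof -
 \<comment> \<open>the claim for the weight \<open>u w\<close>; \<open>P\<close> is additive in \<open>u\<close>, and \<open>u = 1\<close> is the theorem\<close>
 define P where "P u gu \<longleftrightarrow> (LINT x:E|lborel. u x * (w x * s x + gw x \<bullet> X x) + w x * (gu x \<bullet> X x)) = (LINT x:Bd|\<A>. u x * h x)" for u gu
 have hm: "(\<lambda>x. indicator Bd x *\<^sub>R h x) \<in> borel_measurable borel"
  using h unfolding set_integrable_def by (auto dest: borel_measurable_integrable)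
 have ci: "set_integrable lborel E (\<lambda>x. u x * (w x * s x + gw x \<bullet> X x) + w x * (gu x \<bullet> X x))" if "C1fun u gu" for u gu
  by (intro set_integrable_compact E continuous_intros C1fun_cont[OF that] C1fun_grad_cont[OF that] w X s)
 have bi: "set_integrable \<A> Bd (\<lambda>x. u x * h x)" if u: "C1fun u gu" for u gu
 proof -
  have "bounded (u ` E)" by (intro compact_imp_bounded compact_continuous_image C1fun_cont[OF u] E)
  then obtain M where M: "\<forall>y\<in>u ` E. norm y \<le> M" unfolding bounded_iff by blast
  have um: "u \<in> borel_measurable borel" using C1fun_cont[OF u] by (rule borel_measurable_continuous_onI)
  have "integrable \<A> (\<lambda>x. M *\<^sub>R (indicator Bd x *\<^sub>R h x))" using h by (simp add: set_integrable_def)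
  then have "integrable \<A> (\<lambda>x. u x * (indicator Bd x *\<^sub>R h x))"
  proof (rule Bochner_Integration.integrable_bound)
   show "(\<lambda>x. u x * (indicator Bd x *\<^sub>R h x)) \<in> borel_measurable \<A>"
    using um hm by (simp add: borel_measurable_times cong: measurable_cong_sets)
   show "AE x in \<A>. norm (u x * (indicator Bd x *\<^sub>R h x)) \<le> norm (M *\<^sub>R (indicator Bd x *\<^sub>R h x))"
   proof (rule AE_I2)
    fix x
    show "norm (u x * (indicator Bd x *\<^sub>R h x)) \<le> norm (M *\<^sub>R (indicator Bd x *\<^sub>R h x))"
    proof (cases "x \<in> Bd")
     case True
     then have "\<bar>u x\<bar> \<le> M" using M Bd(2) by auto
     then have "\<bar>u x\<bar> \<le> \<bar>M\<bar>" by simp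
     then show ?thesis using True by (simp add: abs_mult mult_right_mono)
    qed simp
   qed
  qed
  then show ?thesis by (simp add: set_integrable_def mult.left_commute)
 qed
 have "\<forall>y\<in>E. \<exists>r>0. \<forall>u gu. C1fun u gu \<longrightarrow> (\<forall>x. r / 2 \<le> dist x y \<longrightarrow> u x = 0) \<longrightarrow> P u gu"
 proof
  fix y assume "y \<in> E"
  from loc[OF this] obtain r where r: "r > 0" and cases: "?loc y r"
   by blast
  have "P u gu" if u: "C1fun u gu" and u0: "\<And>x. r / 2 \<le> dist x y \<Longrightarrow> u x = 0" for u gu
  proof -
   let ?K = "cball y (r / 2)"
   have K: "compact ?K" "?K \<subseteq> ball y r" using r by auto
   have uK: "u x = 0" if "x \<notin> ?K" for x using that u0[of x] by (auto simp: dist_commute)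
   have gK: "gu x = 0" if "x \<notin> ?K" for x by (rule C1c_grad_zero[OF u K(1) uK that])
   define w' where "w' x = u x * w x" for x
   define gw' where "gw' x = u x *\<^sub>R gw x + w x *\<^sub>R gu x" for x
   have w': "GDERIV w' x :> gw' x" if "x \<in> interior E" for x
    unfolding w'_def[abs_def] gw'_def using u w(1)[OF that] by (intro GDERIV_mult) (auto simp: C1fun_def)
   have w'c: "continuous_on E w'" "continuous_on E gw'"
    unfolding w'_def[abs_def] gw'_def[abs_def]
    by (intro continuous_intros C1fun_cont[OF u] C1fun_grad_cont[OF u] w)+
   have w'0: "w' x = 0" "gw' x = 0" if "x \<notin> ?K" for x
    using uK[OF that] gK[OF that] by (simp_all add: w'_def gw'_def)
   have LHS: "(LINT x:E|lborel. u x * (w x * s x + gw x \<bullet> X x) + w x * (gu x \<bullet> X x)) = (LINT x:E|lborel. w' x * s x + gw' x \<bullet> X x)"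
    unfolding w'_def gw'_def by (simp add: inner_add_left algebra_simps)
   from cases show ?thesis
   proof (elim disjE conjE exE)
    assume int: "ball y r \<subseteq> interior E" and Bd0: "Bd \<inter> ball y r = {}"
    have "C1c (interior E) w' gw'"
    proof (rule C1c_glue[OF open_interior K(1)])
     show "continuous_on (interior E) gw'" using w'c(2) interior_subset by (rule continuous_on_subset)
    qed (use K int w'0 w' in auto)
    then have "(LINT x:E|lborel. w' x * s x + gw' x \<bullet> X x) = 0" using weak by (simp add: weak_divergence_def)
    moreover have Bd_zero: "indicator Bd x *\<^sub>R (u x * h x) = 0" for x
    proof (cases "x \<in> ?K")
     case True
     then have "x \<notin> Bd" using Bd0 K(2) by blast
     then show ?thesis by simp
    qed (simp add: uK)
    have "(LINT x:Bd|\<A>. u x * h x) = 0"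
     unfolding set_lebesgue_integral_def Bd_zero by simp
    ultimately show ?thesis by (simp add: P_def LHS)
   next
    assume 0: "\<forall>x\<in>E \<inter> ball y r. w x = 0 \<and> gw x = 0" "\<forall>x\<in>Bd \<inter> ball y r. h x = 0"
    have zeroE: "indicator E x *\<^sub>R (w' x * s x + gw' x \<bullet> X x) = 0" for x
    proof (cases "x \<in> E \<and> x \<in> ?K")
     case True
     then have "w x = 0 \<and> gw x = 0" using 0(1) K(2) by blast
     then show ?thesis by (simp add: w'_def gw'_def)
    qed (use w'0[of x] in auto)
    have zeroBd: "indicator Bd x *\<^sub>R (u x * h x) = 0" for x
     using 0(2) K(2) uK[of x] by (cases "x \<in> Bd \<and> x \<in> ?K") (auto simp: indicator_def)
    show ?thesis unfolding P_def LHS unfolding set_lebesgue_integral_def zeroE zeroBd by simp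
   next
    fix e \<Phi> q W
    assume "graph_chart e \<Phi> q W" and bW: "ball y r \<subseteq> W" and Eb: "E \<inter> ball y r = {x\<in>ball y r. e \<bullet> x \<le> \<Phi> x}"
     and Bdb: "Bd \<inter> ball y r = graph e \<Phi> \<inter> ball y r"
     and ae: "AE x in \<A>. x \<in> Bd \<inter> ball y r \<longrightarrow> h x = w x * (X x \<bullet> graph_chart.normal e q x)"
    then interpret graph_chart e \<Phi> q W by simp
    have "(LINT x:E|lborel. w' x * s x + gw' x \<bullet> X x) = (LINT x:\<Gamma> \<inter> ball y r|\<A>. w' x * (X x \<bullet> normal x))"
     by (rule gauss_green_chart[OF E open_ball bW Eb X s weak w' w'c K]) (use w'0 in auto)
    also have "\<dots> = (LINT x:Bd|\<A>. u x * h x)"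
     unfolding set_lebesgue_integral_def
    proof (rule integral_cong_AE)
     have "graph e \<Phi> \<inter> ball y r \<subseteq> E" using Bdb Bd(2) by blast
     moreover have "J x \<noteq> 0" for x using J_ge_1[of x] by auto
     ultimately have "continuous_on (\<Gamma> \<inter> ball y r) (\<lambda>x. w' x * (X x \<bullet> normal x))"
      unfolding normal_def using bW
      by (intro continuous_intros continuous_on_subset[OF w'c(1)] continuous_on_subset[OF X] continuous_on_subset[OF J_cont] continuous_on_subset[OF q_cont])
       blast+
     then have "(\<lambda>x. indicator (\<Gamma> \<inter> ball y r) x *\<^sub>R (w' x * (X x \<bullet> normal x))) \<in> borel_measurable borel"
      by (intro borel_measurable_continuous_on_indicator) auto
     then show "(\<lambda>x. indicator (\<Gamma> \<inter> ball y r) x *\<^sub>R (w' x * (X x \<bullet> normal x))) \<in> borel_measurable \<A>"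
      by (simp cong: measurable_cong_sets)
     show "(\<lambda>x. indicator Bd x *\<^sub>R (u x * h x)) \<in> borel_measurable \<A>"
      using bi[OF u] unfolding set_integrable_def by (rule borel_measurable_integrable)
     show "AE x in \<A>. indicator (\<Gamma> \<inter> ball y r) x *\<^sub>R (w' x * (X x \<bullet> normal x)) = indicator Bd x *\<^sub>R (u x * h x)"
      using ae
     proof eventually_elim
      case (elim x)
      show ?case
      proof (cases "x \<in> ball y r")
       case True
       then have "x \<in> \<Gamma> \<inter> ball y r \<longleftrightarrow> x \<in> Bd" using Bdb by blast
       then show ?thesis using elim True by (auto simp: w'_def indicator_def)
      next
       case False
       then have "x \<notin> ?K" using K(2) by blast
       then show ?thesis using False uK[of x] by (simp add: indicator_def)
      qed
     qed
    qed
    finally show ?thesis by (simp add: P_def LHS)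
   qed
  qed
  then show "\<exists>r>0. \<forall>u gu. C1fun u gu \<longrightarrow> (\<forall>x. r / 2 \<le> dist x y \<longrightarrow> u x = 0) \<longrightarrow> P u gu" using r by blast
 qed
 then obtain r where r: "\<And>y. y \<in> E \<Longrightarrow> r y > 0"
  and Ploc: "\<And>y u gu. y \<in> E \<Longrightarrow> C1fun u gu \<Longrightarrow> (\<And>x. r y / 2 \<le> dist x y \<Longrightarrow> u x = 0) \<Longrightarrow> P u gu"
  by metis
 obtain I where I: "I \<subseteq> E" "finite I" "E \<subseteq> (\<Union>y\<in>I. ball y (r y / 2 / 2))"
  by (rule compactE_image[OF E, of E "\<lambda>y. ball y (r y / 2 / 2)"]) (use r in force)+
 have "\<exists>c g. C1fun c g \<and> (\<forall>x. 0 \<le> c x \<and> c x \<le> 1) \<and> (\<forall>x. \<forall>y\<in>I. dist x y \<le> r y / 2 / 2 \<longrightarrow> c x = 1) \<and>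
   (\<forall>x. (\<forall>y\<in>I. r y / 2 \<le> dist x y) \<longrightarrow> c x = 0) \<and>
   (\<forall>u h. C1fun u h \<longrightarrow> P (\<lambda>x. u x * c x) (\<lambda>x. u x *\<^sub>R g x + c x *\<^sub>R h x))"
 proof (rule localization)
  show "P (\<lambda>x. 0) (\<lambda>x. 0)" by (simp add: P_def)
  show "P (\<lambda>x. u x + v x) (\<lambda>x. g x + h x)" if "C1fun u g" "C1fun v h" "P u g" "P v h" for u g v h
   using that set_integral_add(2)[OF ci[OF that(1)] ci[OF that(2)]] set_integral_add(2)[OF bi[OF that(1)] bi[OF that(2)]]
   by (simp add: P_def inner_add_left algebra_simps)
  show "P u g" if "y \<in> I" "C1fun u g" "\<And>x. r y / 2 \<le> dist x y \<Longrightarrow> u x = 0" for u g y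
   by (rule Ploc[of y]) (use that I in auto)
 qed (use I r in auto)
 then obtain c g where c: "C1fun c g" "\<And>x y. y \<in> I \<Longrightarrow> dist x y \<le> r y / 2 / 2 \<Longrightarrow> c x = 1"
  and P: "\<And>u h. C1fun u h \<Longrightarrow> P (\<lambda>x. u x * c x) (\<lambda>x. u x *\<^sub>R g x + c x *\<^sub>R h x)" by blast
 define V where "V = (\<Union>y\<in>I. ball y (r y / 2 / 2))"
 have c1: "c x = 1" if "x \<in> V" for x
  using that c(2)[of _ x] by (force simp: V_def dist_commute)
 have g0: "g x = 0" if "x \<in> V" for x
  by (rule C1fun_grad_zero[OF c(1) _ that c1]) (auto simp: V_def)
 have "P c g" using P[OF C1fun_const[of 1]] by simp
 moreover have "(LINT x:E|lborel. c x * (w x * s x + gw x \<bullet> X x) + w x * (g x \<bullet> X x)) = (LINT x:E|lborel. w x * s x + gw x \<bullet> X x)"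
  using I(3) c1 g0 unfolding set_lebesgue_integral_def V_def[symmetric]
  by (intro Bochner_Integration.integral_cong refl) (auto simp: indicator_def subset_iff)
 moreover have "(LINT x:Bd|\<A>. c x * h x) = (LINT x:Bd|\<A>. h x)"
  using I(3) Bd(2) c1 unfolding set_lebesgue_integral_def V_def[symmetric]
  by (intro Bochner_Integration.integral_cong refl) (auto simp: indicator_def subset_iff)
 ultimately show ?thesis by (simp add: P_def)
qed

section \<open>The flux field and its divergence\<close>

text \<open>With the Euclidean metric in place of \<open>inv_metric\<close>, the radial component of \<open>flux_field\<close> is the ADM integrand.\<close>

definition flux_coeff :: "(real^'n) set \<Rightarrow> (real^'n \<Rightarrow> real^'m) \<Rightarrow> 'm \<Rightarrow> 'n \<Rightarrow> 'n \<Rightarrow> 'n \<Rightarrow> real^'n \<Rightarrow> real" where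
 "flux_coeff D f \<alpha> i j k x = inv_metric D f x $ i $ k * metric_grad D f \<alpha> x $ j"

definition flux_field :: "(real^'n) set \<Rightarrow> (real^'n \<Rightarrow> real^'m) \<Rightarrow> real^'n \<Rightarrow> real^'n" where
 "flux_field D f x = (\<chi> j. \<Sigma> \<alpha> i k.
  (flux_coeff D f \<alpha> i j k x - flux_coeff D f \<alpha> i k j x) * D2 D f \<alpha> i k x)"

lemma sum_swap3: "(\<Sigma> i j k. f i j k) = (\<Sigma> k i j. f i j k)"
 by (subst (2) sum.swap, subst sum.swap) rule

lemma sum_swap4: "(\<Sigma> i j k l. f i j k l) = (\<Sigma> l i j k. f i j k l)"
 by (subst sum_swap3, subst sum.swap) rule

lemma sum_swap5: "(\<Sigma> i j k l m. f i j k l m) = (\<Sigma> m i j k l. f i j k l m)"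
 by (subst sum_swap4, subst sum.swap) rule

lemma metric_grad_component:
 "metric_grad D f \<alpha> x $ j = (\<Sigma> l. inv_metric D f x $ j $ l * D1 D f \<alpha> l x)"
 by (simp add: metric_grad_def matrix_vector_mult_def grad_def)

text \<open>The algebra behind the divergence of the flux field, at one point: \<open>h\<close> stands for the inverse metric, \<open>F\<close> for
the Hessians, \<open>u\<close> for the Riemannian gradients, \<open>c\<close> for their inner products, and \<open>dh\<close>, \<open>du\<close> for derivatives of
\<open>h\<close> and \<open>u\<close>. On the right-hand side, the first sum is the scalar curvature and the second one is \<open>S\<^sup>\<bottom>\<close>. With
the abbreviations \<open>T\<close> for traces, \<open>W\<close> for traces of products, \<open>Q\<close> and \<open>Z\<close> for the contractions that involve
\<open>u\<close>, the four products on the left are evaluated one by one; the terms with \<open>Z\<close> cancel.\<close>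

lemma flux_divergence_algebra:
 fixes h :: "'n::finite \<Rightarrow> 'n \<Rightarrow> real" and F :: "'m::finite \<Rightarrow> 'n \<Rightarrow> 'n \<Rightarrow> real" and u :: "'m \<Rightarrow> 'n \<Rightarrow> real" and c :: "'m \<Rightarrow> 'm \<Rightarrow> real"
 assumes hs: "\<And>i j. h i j = h j i" and Fs: "\<And>\<alpha> i j. F \<alpha> i j = F \<alpha> j i"
 defines "A \<equiv> \<lambda>\<alpha> i j. \<Sigma> a. h i a * F \<alpha> a j"
  and "V \<equiv> \<lambda>\<alpha> \<beta> i. \<Sigma> k. F \<alpha> i k * u \<beta> k"
 assumes dh: "\<And>j i k. dh j i k = - (\<Sigma> \<beta>. A \<beta> i j * u \<beta> k + u \<beta> i * A \<beta> k j)"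
  and du: "\<And>j \<alpha> l. du j \<alpha> l = A \<alpha> l j - (\<Sigma> \<beta>. c \<alpha> \<beta> * A \<beta> l j + u \<beta> l * V \<beta> \<alpha> j)"
 shows "(\<Sigma> \<alpha> i j k.
   (dh j i k * u \<alpha> j + h i k * du j \<alpha> j - (dh j i j * u \<alpha> k + h i j * du j \<alpha> k)) * F \<alpha> i k)
  = (\<Sigma> \<alpha> \<beta>. (kron \<alpha> \<beta> - c \<alpha> \<beta>) *
    ((\<Sigma> i. A \<alpha> i i) * (\<Sigma> i. A \<beta> i i) - (\<Sigma> j k. A \<alpha> j k * A \<beta> k j)))
  + (\<Sigma> \<alpha> \<beta>. (\<Sigma> i. V \<alpha> \<alpha> i * (\<Sigma> a. h i a * V \<beta> \<beta> a))
    - (\<Sigma> i. V \<alpha> \<beta> i * (\<Sigma> a. h i a * V \<beta> \<alpha> a)))"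
proof -
 define Q where "Q \<alpha> \<beta> \<gamma> d = (\<Sigma> i. V \<alpha> \<beta> i * (\<Sigma> a. h i a * V \<gamma> d a))" for \<alpha> \<beta> \<gamma> d
 define T where "T \<alpha> = (\<Sigma> i. A \<alpha> i i)" for \<alpha>
 define W where "W \<alpha> \<beta> = (\<Sigma> j k. A \<alpha> j k * A \<beta> k j)" for \<alpha> \<beta>
 define Z where "Z \<alpha> \<beta> \<gamma> = (\<Sigma> i. u \<alpha> i * V \<beta> \<gamma> i)" for \<alpha> \<beta> \<gamma>
 have AV: "(\<Sigma> j. A \<beta> i j * u \<alpha> j) = (\<Sigma> a. h i a * V \<beta> \<alpha> a)" for \<alpha> \<beta> i
  unfolding A_def V_def sum_distrib_left sum_distrib_right by (subst sum.swap) (simp add: mult.assoc)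
 have V': "(\<Sigma> i. F \<alpha> i k * u \<beta> i) = V \<alpha> \<beta> k" for \<alpha> \<beta> k by (simp add: V_def Fs[of \<alpha> k])
 have hF: "(\<Sigma> i. h i j * F \<alpha> i k) = A \<alpha> j k" for \<alpha> j k by (simp add: A_def hs[of j])
 have hF': "(\<Sigma> i k. h i k * F \<alpha> i k) = T \<alpha>" for \<alpha>
  unfolding T_def A_def by (intro sum.cong refl) (simp add: Fs[of \<alpha>])
 have Qs: "Q \<alpha> \<beta> \<gamma> d = Q \<gamma> d \<alpha> \<beta>" for \<alpha> \<beta> \<gamma> d
  unfolding Q_def sum_distrib_left by (subst sum.swap) (simp add: hs mult_ac)
 have Zs: "Z \<alpha> \<beta> \<gamma> = Z \<gamma> \<beta> \<alpha>" for \<alpha> \<beta> \<gamma>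
  unfolding Z_def V_def sum_distrib_left by (subst sum.swap) (simp add: Fs[of \<beta>] mult_ac)
 have t1: "(\<Sigma> i j k. dh j i k * u \<alpha> j * F \<alpha> i k) = - (\<Sigma> \<beta>. 2 * Q \<alpha> \<beta> \<beta> \<alpha>)" for \<alpha>
 proof -
  have a: "(\<Sigma> i j k. (A \<beta> i j * u \<beta> k) * u \<alpha> j * F \<alpha> i k) = Q \<alpha> \<beta> \<beta> \<alpha>" for \<beta>
  proof -
   have "(\<Sigma> j k. (A \<beta> i j * u \<beta> k) * u \<alpha> j * F \<alpha> i k) = (\<Sigma> j. A \<beta> i j * u \<alpha> j) * V \<alpha> \<beta> i" for i
    unfolding V_def sum_product by (simp add: mult_ac)
   then show ?thesis unfolding Q_def AV by (simp only: mult.commute)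
  qed
  have b: "(\<Sigma> i j k. (u \<beta> i * A \<beta> k j) * u \<alpha> j * F \<alpha> i k) = Q \<alpha> \<beta> \<beta> \<alpha>" for \<beta>
  proof -
   have "(\<Sigma> i j k. (u \<beta> i * A \<beta> k j) * u \<alpha> j * F \<alpha> i k)
     = (\<Sigma> k i j. (u \<beta> i * A \<beta> k j) * u \<alpha> j * F \<alpha> i k)"
    by (rule sum_swap3)
   also have "\<dots> = (\<Sigma> k. V \<alpha> \<beta> k * (\<Sigma> j. A \<beta> k j * u \<alpha> j))"
    unfolding V'[symmetric] sum_product by (simp add: mult_ac)
   finally show ?thesis unfolding Q_def AV .
  qed
  have "(\<Sigma> i j k. dh j i k * u \<alpha> j * F \<alpha> i k)
    = - (\<Sigma> i j k \<beta>. (A \<beta> i j * u \<beta> k) * u \<alpha> j * F \<alpha> i k + (u \<beta> i * A \<beta> k j) * u \<alpha> j * F \<alpha> i k)"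
   unfolding dh by (simp only: minus_mult_left[symmetric] sum_distrib_right sum_negf distrib_right)
  also have "(\<Sigma> i j k \<beta>. (A \<beta> i j * u \<beta> k) * u \<alpha> j * F \<alpha> i k + (u \<beta> i * A \<beta> k j) * u \<alpha> j * F \<alpha> i k)
    = (\<Sigma> \<beta> i j k. (A \<beta> i j * u \<beta> k) * u \<alpha> j * F \<alpha> i k + (u \<beta> i * A \<beta> k j) * u \<alpha> j * F \<alpha> i k)"
   by (rule sum_swap4)
  finally show ?thesis by (simp only: sum.distrib a b mult_2)
 qed
 have t2: "(\<Sigma> i j k. h i k * du j \<alpha> j * F \<alpha> i k)
   = T \<alpha> * T \<alpha> - (\<Sigma> \<beta>. c \<alpha> \<beta> * (T \<alpha> * T \<beta>) + T \<alpha> * Z \<beta> \<beta> \<alpha>)" for \<alpha>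
 proof -
  have "(\<Sigma> i j k. h i k * du j \<alpha> j * F \<alpha> i k) = (\<Sigma> i k. h i k * F \<alpha> i k) * (\<Sigma> j. du j \<alpha> j)"
  proof -
   have "(\<Sigma> j k. h i k * du j \<alpha> j * F \<alpha> i k) = (\<Sigma> k. h i k * F \<alpha> i k) * (\<Sigma> j. du j \<alpha> j)" for i
    unfolding sum_product by (subst sum.swap) (simp add: mult_ac)
   then show ?thesis by (simp only: sum_distrib_right)
  qed
  also have "(\<Sigma> j. du j \<alpha> j) = T \<alpha> - (\<Sigma> \<beta>. c \<alpha> \<beta> * T \<beta> + Z \<beta> \<beta> \<alpha>)"
  proof -
   have "(\<Sigma> j \<beta>. c \<alpha> \<beta> * A \<beta> j j + u \<beta> j * V \<beta> \<alpha> j) = (\<Sigma> \<beta> j. c \<alpha> \<beta> * A \<beta> j j + u \<beta> j * V \<beta> \<alpha> j)"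
    by (rule sum.swap)
   then show ?thesis unfolding du T_def Z_def sum_subtractf sum.distrib sum_distrib_left by simp
  qed
  finally show ?thesis unfolding hF' right_diff_distrib distrib_left sum_distrib_left by (simp only: mult_ac)
 qed
 have t4: "(\<Sigma> i j k. dh j i j * u \<alpha> k * F \<alpha> i k) = - (\<Sigma> \<beta>. Q \<alpha> \<alpha> \<beta> \<beta> + T \<beta> * Z \<beta> \<alpha> \<alpha>)" for \<alpha>
 proof -
  have tr: "(\<Sigma> j. dh j i j) = - (\<Sigma> \<beta>. (\<Sigma> a. h i a * V \<beta> \<beta> a) + u \<beta> i * T \<beta>)" for i
  proof -
   have "(\<Sigma> j \<beta>. A \<beta> i j * u \<beta> j + u \<beta> i * A \<beta> j j) = (\<Sigma> \<beta> j. A \<beta> i j * u \<beta> j + u \<beta> i * A \<beta> j j)"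
    by (rule sum.swap)
   then show ?thesis unfolding dh sum_negf AV[symmetric] T_def sum_distrib_left sum.distrib by simp
  qed
  have "(\<Sigma> i j k. dh j i j * u \<alpha> k * F \<alpha> i k) = (\<Sigma> i. (\<Sigma> j. dh j i j) * V \<alpha> \<alpha> i)"
   unfolding V_def sum_product by (simp add: mult_ac)
  also have "\<dots> = (\<Sigma> i. - (\<Sigma> \<beta>. (\<Sigma> a. h i a * V \<beta> \<beta> a) + u \<beta> i * T \<beta>) * V \<alpha> \<alpha> i)"
   by (simp only: tr)
  also have "\<dots> = - (\<Sigma> i \<beta>. V \<alpha> \<alpha> i * (\<Sigma> a. h i a * V \<beta> \<beta> a) + T \<beta> * (u \<beta> i * V \<alpha> \<alpha> i))"
  proof -
   have "- (\<Sigma> \<beta>. (\<Sigma> a. h i a * V \<beta> \<beta> a) + u \<beta> i * T \<beta>) * V \<alpha> \<alpha> i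
    = - (\<Sigma> \<beta>. V \<alpha> \<alpha> i * (\<Sigma> a. h i a * V \<beta> \<beta> a) + T \<beta> * (u \<beta> i * V \<alpha> \<alpha> i))" for i
   proof -
    have "(\<Sigma> \<beta>. (\<Sigma> a. h i a * V \<beta> \<beta> a) + u \<beta> i * T \<beta>) * V \<alpha> \<alpha> i
      = (\<Sigma> \<beta>. ((\<Sigma> a. h i a * V \<beta> \<beta> a) + u \<beta> i * T \<beta>) * V \<alpha> \<alpha> i)"
     by (rule sum_distrib_right)
    also have "\<dots> = (\<Sigma> \<beta>. V \<alpha> \<alpha> i * (\<Sigma> a. h i a * V \<beta> \<beta> a) + T \<beta> * (u \<beta> i * V \<alpha> \<alpha> i))"
     by (intro sum.cong refl) (simp only: distrib_right, simp only: mult_ac)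
    finally show ?thesis by (simp only: minus_mult_left[symmetric])
   qed
   then show ?thesis by (simp only: sum_negf)
  qed
  also have "(\<Sigma> i \<beta>. V \<alpha> \<alpha> i * (\<Sigma> a. h i a * V \<beta> \<beta> a) + T \<beta> * (u \<beta> i * V \<alpha> \<alpha> i)) = (\<Sigma> \<beta>. Q \<alpha> \<alpha> \<beta> \<beta> + T \<beta> * Z \<beta> \<alpha> \<alpha>)"
  proof -
   have "(\<Sigma> i \<beta>. V \<alpha> \<alpha> i * (\<Sigma> a. h i a * V \<beta> \<beta> a) + T \<beta> * (u \<beta> i * V \<alpha> \<alpha> i))
    = (\<Sigma> \<beta> i. V \<alpha> \<alpha> i * (\<Sigma> a. h i a * V \<beta> \<beta> a) + T \<beta> * (u \<beta> i * V \<alpha> \<alpha> i))" by (rule sum.swap)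
   then show ?thesis unfolding Q_def Z_def sum.distrib sum_distrib_left .
  qed
  finally show ?thesis .
 qed
 have t3: "(\<Sigma> i j k. h i j * du j \<alpha> k * F \<alpha> i k)
   = W \<alpha> \<alpha> - (\<Sigma> \<beta>. c \<alpha> \<beta> * W \<alpha> \<beta> + Q \<alpha> \<beta> \<beta> \<alpha>)" for \<alpha>
 proof -
  have "(\<Sigma> i j k. h i j * du j \<alpha> k * F \<alpha> i k) = (\<Sigma> j k. A \<alpha> j k * du j \<alpha> k)"
  proof -
   have "(\<Sigma> i j k. h i j * du j \<alpha> k * F \<alpha> i k) = (\<Sigma> k i j. h i j * du j \<alpha> k * F \<alpha> i k)"
    by (rule sum_swap3)
   also have "\<dots> = (\<Sigma> j k i. h i j * du j \<alpha> k * F \<alpha> i k)" by (rule sum_swap3)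
   also have "\<dots> = (\<Sigma> j k. A \<alpha> j k * du j \<alpha> k)"
    unfolding hF[symmetric] sum_distrib_right by (simp only: mult_ac)
   finally show ?thesis .
  qed
  also have "\<dots> = W \<alpha> \<alpha> - (\<Sigma> j k \<beta>. c \<alpha> \<beta> * (A \<alpha> j k * A \<beta> k j) + (A \<alpha> j k * u \<beta> k) * V \<beta> \<alpha> j)"
   unfolding du W_def right_diff_distrib sum_subtractf sum_distrib_left distrib_left by (simp only: mult_ac)
  also have "(\<Sigma> j k \<beta>. c \<alpha> \<beta> * (A \<alpha> j k * A \<beta> k j) + (A \<alpha> j k * u \<beta> k) * V \<beta> \<alpha> j)
    = (\<Sigma> \<beta> j k. c \<alpha> \<beta> * (A \<alpha> j k * A \<beta> k j) + (A \<alpha> j k * u \<beta> k) * V \<beta> \<alpha> j)"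
   by (rule sum_swap3)
  also have "\<dots> = (\<Sigma> \<beta>. c \<alpha> \<beta> * W \<alpha> \<beta> + Q \<beta> \<alpha> \<alpha> \<beta>)"
  proof -
   have "(\<Sigma> j k. (A \<alpha> j k * u \<beta> k) * V \<beta> \<alpha> j) = Q \<beta> \<alpha> \<alpha> \<beta>" for \<beta>
    unfolding Q_def AV[symmetric] sum_distrib_left by (simp only: mult_ac)
   then show ?thesis by (simp only: sum.distrib W_def sum_distrib_left)
  qed
  also have "\<dots> = (\<Sigma> \<beta>. c \<alpha> \<beta> * W \<alpha> \<beta> + Q \<alpha> \<beta> \<beta> \<alpha>)" by (simp only: Qs[of _ \<alpha> \<alpha>])
  finally show ?thesis .
 qed
 have cancel: "(\<Sigma> \<alpha> \<beta>. T \<alpha> * Z \<beta> \<beta> \<alpha>) = (\<Sigma> \<alpha> \<beta>. T \<beta> * Z \<beta> \<alpha> \<alpha>)"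
  by (subst sum.swap) (subst Zs, rule refl)
 have diag: "(\<Sigma> \<alpha> \<beta>. (kron \<alpha> \<beta> - c \<alpha> \<beta>) * (T \<alpha> * T \<beta> - W \<alpha> \<beta>))
   = (\<Sigma> \<alpha>. T \<alpha> * T \<alpha> - W \<alpha> \<alpha>) - (\<Sigma> \<alpha> \<beta>. c \<alpha> \<beta> * (T \<alpha> * T \<beta> - W \<alpha> \<beta>))"
  by (simp add: left_diff_distrib sum_subtractf if_distrib[of "\<lambda>t. t * _"] cong: if_cong)
 have "(\<Sigma> \<alpha> i j k.
   (dh j i k * u \<alpha> j + h i k * du j \<alpha> j - (dh j i j * u \<alpha> k + h i j * du j \<alpha> k)) * F \<alpha> i k)
  = (\<Sigma> \<alpha>. - (\<Sigma> \<beta>. 2 * Q \<alpha> \<beta> \<beta> \<alpha>) + (T \<alpha> * T \<alpha> - (\<Sigma> \<beta>. c \<alpha> \<beta> * (T \<alpha> * T \<beta>) + T \<alpha> * Z \<beta> \<beta> \<alpha>))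
   - (- (\<Sigma> \<beta>. Q \<alpha> \<alpha> \<beta> \<beta> + T \<beta> * Z \<beta> \<alpha> \<alpha>) + (W \<alpha> \<alpha> - (\<Sigma> \<beta>. c \<alpha> \<beta> * W \<alpha> \<beta> + Q \<alpha> \<beta> \<beta> \<alpha>))))"
  by (simp only: left_diff_distrib distrib_right sum.distrib sum_subtractf t1 t2 t3 t4)
 also have "\<dots> = (\<Sigma> \<alpha> \<beta>. (kron \<alpha> \<beta> - c \<alpha> \<beta>) * (T \<alpha> * T \<beta> - W \<alpha> \<beta>))
  + (\<Sigma> \<alpha> \<beta>. Q \<alpha> \<alpha> \<beta> \<beta> - Q \<alpha> \<beta> \<beta> \<alpha>)"
  unfolding diag using cancel
  by (simp add: right_diff_distrib sum.distrib sum_subtractf sum_negf sum_distrib_left[symmetric, of 2])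
 finally show ?thesis unfolding T_def W_def Q_def .
qed

lemma hess_normal: "hess_vec D f i j x \<bullet> normal_vec D f \<alpha> x = D2 D f \<alpha> i j x"
 by (simp add: hess_vec_def normal_vec_def inner_axis)

text \<open>The second fundamental form is \<open>\<Sum> G\<^sup>\<alpha>\<^sup>\<beta> f\<^sup>\<alpha>\<^sub>i\<^sub>j \<eta>\<^sup>\<beta>\<close> with \<open>G\<^sup>\<alpha>\<^sup>\<beta>\<close> the inverse of \<open>\<langle>\<eta>\<^sup>\<alpha>, \<eta>\<^sup>\<beta>\<rangle>\<close>, and that inverse is
\<open>\<delta>\<^sup>\<alpha>\<^sup>\<beta> - \<langle>\<nabla>f\<^sup>\<alpha>, \<nabla>f\<^sup>\<beta>\<rangle>\<close>.\<close>

lemma second_ff_inner: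
 "second_ff D f i j x \<bullet> second_ff D f k l x =
  (\<Sigma> \<alpha> \<beta>. (kron \<alpha> \<beta> - metric_grad D f \<beta> x \<bullet> grad D f \<alpha> x) * (D2 D f \<alpha> i j x * D2 D f \<beta> k l x))"
proof -
 let ?h = "\<lambda>a b. inv_metric D f x $ a $ b" and ?t = "\<lambda>a. tangent_vec D f a x"
 let ?g = "\<lambda>a b. graph_metric D f x $ a $ b"
 define A where "A i j a = hess_vec D f i j x \<bullet> ?t a" for i j a
 have A: "A i j a = (\<Sigma> \<alpha>. D2 D f \<alpha> i j x * D1 D f \<alpha> a x)" for i j a
  by (simp add: A_def hess_vec_def tangent_vec_def inner_vec_def)
 have hh: "hess_vec D f i j x \<bullet> hess_vec D f k l x = (\<Sigma> \<alpha>. D2 D f \<alpha> i j x * D2 D f \<alpha> k l x)"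
  by (simp add: hess_vec_def inner_vec_def)
 have tt: "?t a \<bullet> ?t b = ?g a b" for a b
  by (simp add: tangent_vec_def graph_metric_def inner_axis_axis) (simp add: inner_vec_def)
 have B: "second_ff D f i j x = hess_vec D f i j x - (\<Sigma> a b. (?h a b * A i j a) *\<^sub>R ?t b)" for i j
  by (simp add: second_ff_def A_def)
 have ht: "(\<Sigma> a b. (?h a b * A i j a) *\<^sub>R ?t b) \<bullet> hess_vec D f k l x = (\<Sigma> a b. ?h a b * A i j a * A k l b)" for i j k l
  by (simp add: inner_sum_left A_def) (simp only: inner_commute[of "hess_vec D f k l x"])
 have Bt: "second_ff D f i j x \<bullet> ?t c = 0" for i j c
 proof -
  have "(\<Sigma> a b. (?h a b * A i j a) *\<^sub>R ?t b) \<bullet> ?t c = (\<Sigma> a. A i j a * (\<Sigma> b. ?h a b * ?g b c))"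
   by (simp add: inner_sum_left tt sum_distrib_left mult_ac)
  also have "\<dots> = A i j c" by (simp add: inv_metric_entries if_distrib[of "\<lambda>t. _ * t"] cong: if_cong)
  finally show ?thesis by (simp add: B inner_diff_left) (simp add: A_def)
 qed
 have "second_ff D f i j x \<bullet> second_ff D f k l x = hess_vec D f k l x \<bullet> second_ff D f i j x"
  unfolding B[of k l] by (simp add: inner_diff_right inner_sum_right Bt inner_commute[of "second_ff D f i j x" "hess_vec D f k l x"])
 also have "\<dots> = (\<Sigma> \<alpha>. D2 D f \<alpha> i j x * D2 D f \<alpha> k l x) - (\<Sigma> a b. ?h a b * A i j a * A k l b)"
  unfolding B[of i j] by (simp add: inner_commute[of "hess_vec D f k l x"] inner_diff_left hh ht)
 also have "(\<Sigma> a b. ?h a b * A i j a * A k l b)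
   = (\<Sigma> \<alpha> \<beta>. (metric_grad D f \<beta> x \<bullet> grad D f \<alpha> x) * (D2 D f \<alpha> i j x * D2 D f \<beta> k l x))"
 proof -
  have mg: "metric_grad D f \<beta> x \<bullet> grad D f \<alpha> x = (\<Sigma> a b. ?h a b * D1 D f \<alpha> a x * D1 D f \<beta> b x)" for \<alpha> \<beta>
   by (simp only: inner_vec_def metric_grad_component grad_def vec_lambda_beta inner_real_def sum_distrib_right) (simp only: mult_ac)
  have "(\<Sigma> a b. ?h a b * A i j a * A k l b)
   = (\<Sigma> a b \<alpha> \<beta>. (?h a b * D1 D f \<alpha> a x * D1 D f \<beta> b x) * (D2 D f \<alpha> i j x * D2 D f \<beta> k l x))"
   unfolding A mult.assoc sum_product unfolding sum_distrib_left by (simp only: mult_ac)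
  also have "\<dots> = (\<Sigma> \<alpha> \<beta> a b. (?h a b * D1 D f \<alpha> a x * D1 D f \<beta> b x) * (D2 D f \<alpha> i j x * D2 D f \<beta> k l x))"
   by (subst sum_swap4, subst sum_swap4, rule refl)
  finally show ?thesis by (simp only: mg sum_distrib_right)
 qed
 finally show ?thesis
  by (simp add: left_diff_distrib sum_subtractf if_distrib[of "\<lambda>t. t * _"] cong: if_cong)
qed

lemma scalar_curv_formula:
 "scalar_curv D f x = (\<Sigma> \<alpha> \<beta>. (kron \<alpha> \<beta> - metric_grad D f \<beta> x \<bullet> grad D f \<alpha> x) *
   ((\<Sigma> i a. inv_metric D f x $ i $ a * D2 D f \<alpha> a i x) * (\<Sigma> i a. inv_metric D f x $ i $ a * D2 D f \<beta> a i x)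
   - (\<Sigma> j k. (\<Sigma> a. inv_metric D f x $ j $ a * D2 D f \<alpha> a k x) * (\<Sigma> a. inv_metric D f x $ k $ a * D2 D f \<beta> a j x))))"
proof -
 let ?h = "\<lambda>a b. inv_metric D f x $ a $ b" and ?F = "\<lambda>\<alpha> i j. D2 D f \<alpha> i j x"
 define d where "d \<alpha> \<beta> = kron \<alpha> \<beta> - metric_grad D f \<beta> x \<bullet> grad D f \<alpha> x" for \<alpha> \<beta>
 define U where "U \<alpha> \<beta> i j k l = ?h i l * ?h j k * (?F \<alpha> i l * ?F \<beta> j k) - ?h i l * ?h j k * (?F \<alpha> i k * ?F \<beta> j l)" for \<alpha> \<beta> i j k l
 have "scalar_curv D f x = (\<Sigma> i j k l \<alpha> \<beta>. d \<alpha> \<beta> * U \<alpha> \<beta> i j k l)"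
  unfolding scalar_curv_def riemann_def second_ff_inner d_def[symmetric] U_def sum_subtractf[symmetric]
  unfolding sum_distrib_left right_diff_distrib sum_subtractf by (simp only: mult_ac)
 also have "\<dots> = (\<Sigma> \<alpha> \<beta> i j k l. d \<alpha> \<beta> * U \<alpha> \<beta> i j k l)"
 proof -
  have "(\<Sigma> j k l \<alpha> \<beta>. d \<alpha> \<beta> * U \<alpha> \<beta> i j k l)
    = (\<Sigma> \<alpha> \<beta> j k l. d \<alpha> \<beta> * U \<alpha> \<beta> i j k l)" for i
   by (subst sum_swap5, subst sum_swap5, rule refl)
  then have "(\<Sigma> i j k l \<alpha> \<beta>. d \<alpha> \<beta> * U \<alpha> \<beta> i j k l)
    = (\<Sigma> i \<alpha> \<beta> j k l. d \<alpha> \<beta> * U \<alpha> \<beta> i j k l)" by simp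
  also have "\<dots> = (\<Sigma> \<alpha> \<beta> i j k l. d \<alpha> \<beta> * U \<alpha> \<beta> i j k l)"
   by (subst sum.swap, intro sum.cong refl, rule sum.swap)
  finally show ?thesis .
 qed
 also have "\<dots> = (\<Sigma> \<alpha> \<beta>. d \<alpha> \<beta> * (\<Sigma> i j k l. U \<alpha> \<beta> i j k l))"
  by (simp only: sum_distrib_left)
 also have "\<dots> = (\<Sigma> \<alpha> \<beta>. d \<alpha> \<beta> * ((\<Sigma> i a. ?h i a * ?F \<alpha> a i) * (\<Sigma> i a. ?h i a * ?F \<beta> a i)
   - (\<Sigma> j k. (\<Sigma> a. ?h j a * ?F \<alpha> a k) * (\<Sigma> a. ?h k a * ?F \<beta> a j))))"
 proof (intro sum.cong refl arg_cong2[where f = "(*)"])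
  fix \<alpha> \<beta>
  have 1: "(\<Sigma> i j k l. ?h i l * ?h j k * (?F \<alpha> i l * ?F \<beta> j k))
   = (\<Sigma> i a. ?h i a * ?F \<alpha> a i) * (\<Sigma> i a. ?h i a * ?F \<beta> a i)"
  proof -
   have tr: "(\<Sigma> i a. ?h i a * ?F \<alpha> a i) = (\<Sigma> i l. ?h i l * ?F \<alpha> i l)" for \<alpha>
    by (subst sum.swap) (simp add: inv_metric_sym)
   have "(\<Sigma> j k l. ?h i l * ?h j k * (?F \<alpha> i l * ?F \<beta> j k))
     = (\<Sigma> l. ?h i l * ?F \<alpha> i l) * (\<Sigma> j k. ?h j k * ?F \<beta> j k)" for i
    unfolding sum_distrib_left sum_distrib_right by (simp only: mult_ac)
   then show ?thesis by (simp only: tr sum_distrib_right)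
  qed
  have 2: "(\<Sigma> i j k l. ?h i l * ?h j k * (?F \<alpha> i k * ?F \<beta> j l))
   = (\<Sigma> j k. (\<Sigma> a. ?h j a * ?F \<alpha> a k) * (\<Sigma> a. ?h k a * ?F \<beta> a j))"
  proof -
   have "(\<Sigma> i j k l. ?h i l * ?h j k * (?F \<alpha> i k * ?F \<beta> j l))
    = (\<Sigma> l k i j. ?h i l * ?h j k * (?F \<alpha> i k * ?F \<beta> j l))"
    by (subst sum_swap4, rule sum.cong[OF refl], rule sum_swap3)
   also have "\<dots> = (\<Sigma> l k. (\<Sigma> a. ?h l a * ?F \<alpha> a k) * (\<Sigma> a. ?h k a * ?F \<beta> a l))"
    unfolding sum_product by (intro sum.cong refl) (simp add: inv_metric_sym mult_ac)
   finally show ?thesis .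
  qed
  show "(\<Sigma> i j k l. U \<alpha> \<beta> i j k l)
  = (\<Sigma> i a. ?h i a * ?F \<alpha> a i) * (\<Sigma> i a. ?h i a * ?F \<beta> a i)
   - (\<Sigma> j k. (\<Sigma> a. ?h j a * ?F \<alpha> a k) * (\<Sigma> a. ?h k a * ?F \<beta> a j))"
   unfolding U_def sum_subtractf 1 2 ..
 qed
 finally show ?thesis unfolding d_def .
qed

lemma normal_scalar_formula:
 "normal_scalar D f x = (\<Sigma> \<alpha> \<beta>.
   (\<Sigma> i. (\<Sigma> k. D2 D f \<alpha> i k x * metric_grad D f \<alpha> x $ k) * (\<Sigma> a. inv_metric D f x $ i $ a * (\<Sigma> k. D2 D f \<beta> a k x * metric_grad D f \<beta> x $ k)))
  - (\<Sigma> i. (\<Sigma> k. D2 D f \<alpha> i k x * metric_grad D f \<beta> x $ k) * (\<Sigma> a. inv_metric D f x $ i $ a * (\<Sigma> k. D2 D f \<beta> a k x * metric_grad D f \<alpha> x $ k))))"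
proof -
 let ?H = "inv_metric D f x"
 have so: "shape_op D f \<alpha> x v = ?H *v (\<chi> i. \<Sigma> k. D2 D f \<alpha> i k x * v $ k)" for \<alpha> v
  by (simp add: shape_op_def hess_normal matrix_vector_mult_def)
 have mi: "metric_inner D f x (?H *v y) (?H *v z) = (\<Sigma> i. y $ i * (\<Sigma> a. ?H $ i $ a * z $ a))" for y z
 proof -
  have "metric_inner D f x (?H *v y) (?H *v z) = (?H *v y) \<bullet> z"
   by (simp add: metric_inner_def matrix_vector_mul_assoc inv_metric)
  also have "\<dots> = (\<Sigma> a i. y $ i * (?H $ i $ a * z $ a))"
   by (simp add: inner_vec_def matrix_vector_mult_def sum_distrib_right, intro sum.cong refl, subst inv_metric_sym, simp only: mult_ac)
  also have "\<dots> = (\<Sigma> i. y $ i * (\<Sigma> a. ?H $ i $ a * z $ a))"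
   by (subst sum.swap) (simp add: sum_distrib_left)
  finally show ?thesis .
 qed
 show ?thesis unfolding normal_scalar_def so mi by simp
qed

section \<open>The weak divergence of the flux field\<close>

text \<open>The metric dominates the Euclidean one, so its inverse is dominated by the identity.\<close>

lemma inv_metric_bound: "\<bar>inv_metric D f x $ i $ j\<bar> \<le> 1"
proof -
 let ?w = "axis j 1 :: real^'a" and ?g = "graph_metric D f x"
 define v where "v = inv_metric D f x *v ?w"
 have gv: "?g *v v = ?w" by (simp add: v_def matrix_vector_mul_assoc inv_metric)
 have "v \<bullet> v \<le> v \<bullet> (?g *v v)" unfolding metric_pos by (simp add: sum_nonneg)
 also have "\<dots> \<le> norm v * norm ?w" unfolding gv by (rule norm_cauchy_schwarz)
 finally have "norm v * norm v \<le> norm v * 1" by (simp add: power2_norm_eq_inner[symmetric] power2_eq_square)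
 then have "norm v \<le> 1" by (cases "v = 0") auto
 then have "\<bar>v $ i\<bar> \<le> 1" using component_le_norm_cart[of v i] by linarith
 moreover have "v $ i = inv_metric D f x $ i $ j" by (simp add: v_def matrix_vector_mult_basis column_def)
 ultimately show ?thesis by simp
qed

lemma inv_metric_diff:
 "inv_metric D f x $ i $ j - inv_metric D' f' y $ i $ j =
  (\<Sigma> k l. inv_metric D f x $ i $ k * (graph_metric D' f' y $ k $ l - graph_metric D f x $ k $ l) * inv_metric D' f' y $ l $ j)"
proof -
 have 1: "(\<Sigma> k l. inv_metric D f x $ i $ k * graph_metric D' f' y $ k $ l * inv_metric D' f' y $ l $ j) = inv_metric D f x $ i $ j"
  unfolding mult.assoc sum_distrib_left[symmetric] inv_metric_entries by (simp add: if_distrib[of "\<lambda>t. _ * t"] cong: if_cong)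
 have 2: "(\<Sigma> k l. inv_metric D f x $ i $ k * graph_metric D f x $ k $ l * inv_metric D' f' y $ l $ j) = inv_metric D' f' y $ i $ j"
  by (subst sum.swap, unfold sum_distrib_right[symmetric] inv_metric_entries) (simp add: if_distrib[of "\<lambda>t. t * _"] cong: if_cong)
 show ?thesis unfolding right_diff_distrib left_diff_distrib sum_subtractf 1 2 ..
qed

lemma GDERIV_sum: "(\<And>a. a \<in> A \<Longrightarrow> GDERIV (u a) x :> g a) \<Longrightarrow> GDERIV (\<lambda>y. \<Sum>a\<in>A. u a y) x :> (\<Sum>a\<in>A. g a)"
 unfolding gderiv_def inner_sum_right by (rule has_derivative_sum)

lemma has_derivative_partials:
 fixes w :: "real^'n \<Rightarrow> real"
 assumes w: "w differentiable (at x within D)"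
 shows "(w has_derivative (\<lambda>h. (\<chi> i. partial_deriv D i w x) \<bullet> h)) (at x within D)"
proof -
 let ?L = "frechet_derivative w (at x within D)"
 have d: "(w has_derivative ?L) (at x within D)" using w frechet_derivative_works by blast
 have "?L h = (\<chi> i. ?L (axis i 1)) \<bullet> h" for h
 proof -
  have "h = (\<Sigma> i. h $ i *\<^sub>R axis i 1)" using basis_expansion[of h] by (simp add: scalar_mult_eq_scaleR)
  then have "?L h = ?L (\<Sigma> i. h $ i *\<^sub>R axis i 1)" by (rule arg_cong)
  also have "\<dots> = (\<Sigma> i. h $ i * ?L (axis i 1))"
   using has_derivative_linear[OF d] by (simp add: linear_sum linear_cmul)
  finally show ?thesis by (simp add: inner_vec_def mult.commute)
 qed
 then have "?L = (\<lambda>h. (\<chi> i. ?L (axis i 1)) \<bullet> h)" by (rule ext)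
 then show ?thesis unfolding partial_deriv_def using d by (simp only:)
qed

lemma GDERIV_frechet:
 fixes u :: "real^'n \<Rightarrow> real"
 shows "u differentiable at x \<Longrightarrow> GDERIV u x :> (\<chi> i. frechet_derivative u (at x) (axis i 1))"
 using has_derivative_partials[of u x UNIV] by (simp add: gderiv_def partial_deriv_def inner_commute)

lemma GDERIV_partial_deriv:
 fixes u :: "real^'n \<Rightarrow> real"
 assumes u: "u differentiable_on D" and x: "x \<in> interior D"
 shows "GDERIV u x :> (\<chi> i. partial_deriv D i u x)"
proof -
 have aw: "at x within D = at x" using x by (rule at_within_interior)
 have "x \<in> D" using x interior_subset by auto
 then have "u differentiable at x" using u unfolding differentiable_on_def aw[symmetric] by blast
 then show ?thesis unfolding partial_deriv_def aw by (rule GDERIV_frechet)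
qed

lemma partial_deriv_interior: "x \<in> interior D \<Longrightarrow> partial_deriv D i u x = partial_deriv (interior D) i u x"
 using at_within_interior[of x D] at_within_open[of x "interior D"] by (simp add: partial_deriv_def)

lemma C1_on_interior: "C1_on D u \<Longrightarrow> C1_on (interior D) u"
 unfolding C1_on_def
proof (elim conjE, intro conjI allI)
 assume u: "u differentiable_on D" "\<forall>i. continuous_on D (partial_deriv D i u)"
 show "u differentiable_on interior D" using u(1) interior_subset by (rule differentiable_on_subset)
 fix i
 have "continuous_on (interior D) (partial_deriv D i u)" using u(2) interior_subset by (blast intro: continuous_on_subset)
 then show "continuous_on (interior D) (partial_deriv (interior D) i u)"
  by (rule continuous_on_eq) (rule partial_deriv_interior)
qed

lemma C2_on_interior: "C2_on D u \<Longrightarrow> C2_on (interior D) u"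
proof -
 assume u: "C2_on D u"
 have "C1_on (interior D) (partial_deriv (interior D) i u)" for i
 proof -
  have c: "C1_on (interior D) (partial_deriv D i u)" using u by (auto simp: C2_on_def intro: C1_on_interior)
  have d: "partial_deriv (interior D) i u differentiable_on interior D"
   unfolding differentiable_on_def
  proof
   fix x assume x: "x \<in> interior D"
   have "partial_deriv D i u differentiable at x within interior D" using c x by (auto simp: C1_on_def differentiable_on_def)
   then show "partial_deriv (interior D) i u differentiable at x within interior D"
    by (rule differentiable_transform_within[OF _ zero_less_one x]) (rule partial_deriv_interior)
  qed
  have eq: "partial_deriv (interior D) j (partial_deriv (interior D) i u) x = partial_deriv (interior D) j (partial_deriv D i u) x"
   if "x \<in> interior D" for j x
   by (rule partial_deriv_cong[OF open_interior that]) (rule partial_deriv_interior[symmetric])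
  have "continuous_on (interior D) (partial_deriv (interior D) j (partial_deriv (interior D) i u))" for j
  proof (rule continuous_on_eq)
   show "continuous_on (interior D) (partial_deriv (interior D) j (partial_deriv D i u))"
    using c unfolding C1_on_def by blast
  qed (rule eq[symmetric])
  then show ?thesis using d unfolding C1_on_def by blast
 qed
 moreover have "u differentiable_on interior D"
  using u interior_subset[of D] unfolding C2_on_def by (blast intro: differentiable_on_subset)
 ultimately show ?thesis unfolding C2_on_def by blast
qed

text \<open>The letters follow the usual index notation: \<open>p\<close> and \<open>F\<close> are the first and second derivatives of \<open>f\<close>, \<open>g\<close> and \<open>h\<close>
the metric and its inverse, \<open>u\<close> the Riemannian gradients.\<close>

locale C2_map =
 fixes D :: "(real^'n) set" and f :: "real^'n \<Rightarrow> real^'m"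
 assumes C2: "\<And>\<alpha>. C2_on D (\<lambda>x. f x $ \<alpha>)"
begin

abbreviation p where "p \<alpha> i x \<equiv> D1 D f \<alpha> i x"
abbreviation F where "F \<alpha> i j x \<equiv> D2 D f \<alpha> i j x"
abbreviation g where "g i j x \<equiv> graph_metric D f x $ i $ j"
abbreviation h where "h i j x \<equiv> inv_metric D f x $ i $ j"
abbreviation u where "u \<alpha> i x \<equiv> metric_grad D f \<alpha> x $ i"

lemma f_differentiable: "(\<lambda>x. f x $ \<alpha>) differentiable_on D"
 and p_differentiable: "D1 D f \<alpha> i differentiable_on D"
 and F_cont: "continuous_on D (D2 D f \<alpha> i j)"
 using C2[of \<alpha>] unfolding C2_on_def C1_on_def D1_def D2_def by blast+

lemma p_cont: "continuous_on D (D1 D f \<alpha> i)"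
 by (rule differentiable_imp_continuous_on) (rule p_differentiable)

lemma g_eq: "g i j x = kron i j + (\<Sigma> \<alpha>. p \<alpha> i x * p \<alpha> j x)"
 by (simp add: graph_metric_def)

lemma g_cont: "continuous_on D (\<lambda>x. g i j x)"
 unfolding g_eq by (intro continuous_intros p_cont)

lemma h_cont: "continuous_on D (\<lambda>x. h i j x)"
 unfolding continuous_on_def
proof
 fix x assume x: "x \<in> D"
 have "((\<lambda>y. h i j y - h i j x) \<longlongrightarrow> 0) (at x within D)"
 proof (rule Lim_null_comparison)
  show "\<forall>\<^sub>F y in at x within D. norm (h i j y - h i j x) \<le> (\<Sigma> k l. \<bar>g k l x - g k l y\<bar>)"
  proof (rule always_eventually, rule allI)
   fix y
   have "norm (h i j y - h i j x) \<le> (\<Sigma> k l. norm (h i k y * (g k l x - g k l y) * h l j x))"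
    unfolding inv_metric_diff by (intro order_trans[OF norm_sum] sum_mono norm_sum)
   also have "\<dots> \<le> (\<Sigma> k l. \<bar>g k l x - g k l y\<bar>)"
   proof (intro sum_mono)
    fix k l
    have "\<bar>h i k y\<bar> * \<bar>g k l x - g k l y\<bar> * \<bar>h l j x\<bar> \<le> 1 * \<bar>g k l x - g k l y\<bar> * 1"
     by (intro mult_mono inv_metric_bound) auto
    then show "norm (h i k y * (g k l x - g k l y) * h l j x) \<le> \<bar>g k l x - g k l y\<bar>" by (simp add: abs_mult)
   qed
   finally show "norm (h i j y - h i j x) \<le> (\<Sigma> k l. \<bar>g k l x - g k l y\<bar>)" .
  qed
  have "((\<lambda>y. \<Sigma> k l. \<bar>g k l x - g k l y\<bar>) \<longlongrightarrow> (\<Sigma> k l. \<bar>g k l x - g k l x\<bar>)) (at x within D)"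
   by (intro tendsto_sum tendsto_rabs tendsto_diff tendsto_const) (rule g_cont[unfolded continuous_on_def, rule_format, OF x])
  then show "((\<lambda>y. \<Sigma> k l. \<bar>g k l x - g k l y\<bar>) \<longlongrightarrow> 0) (at x within D)" by simp
 qed
 then show "((\<lambda>y. h i j y) \<longlongrightarrow> h i j x) (at x within D)" by (simp add: LIM_zero_iff)
qed

lemma u_cont: "continuous_on D (\<lambda>x. u \<alpha> i x)"
 unfolding metric_grad_component by (intro continuous_intros h_cont p_cont)

lemma flux_coeff_cont: "continuous_on D (flux_coeff D f \<alpha> i j k)"
 unfolding flux_coeff_def[abs_def] by (intro continuous_intros h_cont u_cont)

lemma flux_field_cont: "continuous_on D (flux_field D f)"
 unfolding flux_field_def[abs_def] by (intro continuous_intros flux_coeff_cont F_cont)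

lemma metric_grad_cont: "continuous_on D (metric_grad D f \<alpha>)" "continuous_on D (grad D f \<alpha>)"
proof -
 have "continuous_on D (\<lambda>x. \<chi> i. u \<alpha> i x)" by (intro continuous_on_vec_lambda u_cont)
 then show "continuous_on D (metric_grad D f \<alpha>)" by simp
 show "continuous_on D (grad D f \<alpha>)" unfolding grad_def[abs_def] by (intro continuous_on_vec_lambda p_cont)
qed

lemma curvature_cont: "continuous_on D (scalar_curv D f)" "continuous_on D (normal_scalar D f)"
 unfolding scalar_curv_formula[abs_def] normal_scalar_formula[abs_def]
 by (intro continuous_on_sum continuous_on_mult continuous_on_diff continuous_on_const continuous_on_inner
   h_cont u_cont F_cont metric_grad_cont)+

lemma p_GDERIV: "x \<in> interior D \<Longrightarrow> GDERIV (D1 D f \<alpha> i) x :> (\<chi> j. F \<alpha> i j x)"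
 unfolding D2_def by (rule GDERIV_partial_deriv[OF p_differentiable])

lemma F_sym: assumes x: "x \<in> interior D" shows "F \<alpha> i j x = F \<alpha> j i x"
proof -
 let ?O = "interior D" and ?v = "\<lambda>y. f y $ \<alpha>"
 have F: "F \<alpha> i j x = partial_deriv ?O j (partial_deriv ?O i ?v) x" for i j
  unfolding D2_def D1_def partial_deriv_interior[OF x]
  by (rule partial_deriv_cong[OF open_interior x]) (rule partial_deriv_interior)
 show ?thesis unfolding F by (rule partial_deriv_commute[OF open_interior C2_on_interior[OF C2] x])
qed

text \<open>The rule \<open>dh = - h (dg) h\<close>, with \<open>dg\<close> expressed by the Hessians.\<close>

lemma inv_metric_GDERIV:
 assumes x: "x \<in> interior D"
 shows "GDERIV (\<lambda>x. h i k x) x :>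
  (\<chi> j. - (\<Sigma> \<beta>. (\<Sigma> a. h i a x * F \<beta> a j x) * u \<beta> k x + u \<beta> i x * (\<Sigma> a. h k a x * F \<beta> a j x)))"
proof -
 define dg where "dg k l = (\<chi> j. \<Sigma> \<beta>. F \<beta> k j x * p \<beta> l x + p \<beta> k x * F \<beta> l j x)" for k l
 have g': "GDERIV (\<lambda>y. g k l y) x :> dg k l" for k l
 proof -
  have "GDERIV (\<lambda>y. kron k l + (\<Sigma> \<alpha>. p \<alpha> k y * p \<alpha> l y)) x
   :> 0 + (\<Sigma> \<alpha>. p \<alpha> k x *\<^sub>R (\<chi> j. F \<alpha> l j x) + p \<alpha> l x *\<^sub>R (\<chi> j. F \<alpha> k j x))"
   by (intro GDERIV_add GDERIV_const GDERIV_sum GDERIV_mult p_GDERIV x)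
  moreover have "0 + (\<Sigma> \<alpha>. p \<alpha> k x *\<^sub>R (\<chi> j. F \<alpha> l j x) + p \<alpha> l x *\<^sub>R (\<chi> j. F \<alpha> k j x)) = dg k l"
   by (simp add: dg_def vec_eq_iff sum_component mult.commute add.commute)
  ultimately show ?thesis unfolding g_eq by simp
 qed
 have gd: "(\<lambda>y. g k l y) differentiable at x" for k l
  using g'[of k l] unfolding gderiv_def differentiable_def by blast
 define dh where "dh i k = (\<chi> j. frechet_derivative (\<lambda>y. h i k y) (at x) (axis j 1))" for i k
 have h': "GDERIV (\<lambda>y. h i k y) x :> dh i k" for i k
  unfolding dh_def by (rule GDERIV_frechet[OF differentiable_inv_metric[OF gd]])
 have zero: "(\<Sigma> k. h i k x *\<^sub>R dg k l + g k l x *\<^sub>R dh i k) = 0" for i l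
 proof (rule GDERIV_unique)
  show "GDERIV (\<lambda>y. \<Sigma> k. h i k y * g k l y) x :> (\<Sigma> k. h i k x *\<^sub>R dg k l + g k l x *\<^sub>R dh i k)"
   by (intro GDERIV_sum GDERIV_mult h' g')
  show "GDERIV (\<lambda>y. \<Sigma> k. h i k y * g k l y) x :> 0"
   unfolding inv_metric_entries by (rule GDERIV_const)
 qed
 have dh: "dh i m $ j = - (\<Sigma> l. (\<Sigma> k. h i k x * dg k l $ j) * h l m x)" for i m j
 proof -
  have "(\<Sigma> k. h i k x * dg k l $ j) + (\<Sigma> k. g k l x * dh i k $ j) = 0" for l
   using arg_cong[OF zero[of i l], of "\<lambda>v. v $ j"] by (simp add: sum_component sum.distrib)
  then have "(\<Sigma> k. h i k x * dg k l $ j) = - (\<Sigma> k. g k l x * dh i k $ j)" for l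
   by (simp add: eq_neg_iff_add_eq_0)
  then have "- (\<Sigma> l. (\<Sigma> k. h i k x * dg k l $ j) * h l m x) = (\<Sigma> l k. g k l x * dh i k $ j * h l m x)"
   by (simp add: sum_negf sum_distrib_right)
  also have "\<dots> = (\<Sigma> k l. dh i k $ j * (g k l x * h l m x))" by (subst sum.swap) (simp add: mult_ac)
  also have "\<dots> = (\<Sigma> k. dh i k $ j * kron k m)"
   unfolding sum_distrib_left[symmetric] inv_metric_entries ..
  also have "\<dots> = dh i m $ j" by (simp add: if_distrib[of "\<lambda>t. _ * t"] cong: if_cong)
  finally show ?thesis by simp
 qed
 have "(\<Sigma> l. (\<Sigma> k. h i k x * dg k l $ j) * h l m x)
  = (\<Sigma> \<beta>. (\<Sigma> a. h i a x * F \<beta> a j x) * u \<beta> m x + u \<beta> i x * (\<Sigma> a. h m a x * F \<beta> a j x))" for m j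
 proof -
  have "(\<Sigma> l. (\<Sigma> k. h i k x * dg k l $ j) * h l m x)
    = (\<Sigma> l k \<beta>. (h i k x * F \<beta> k j x) * (h l m x * p \<beta> l x) + (h i k x * p \<beta> k x) * (h l m x * F \<beta> l j x))"
   by (simp add: dg_def sum_distrib_left sum_distrib_right distrib_left distrib_right mult_ac)
  also have "\<dots> = (\<Sigma> \<beta> l k. (h i k x * F \<beta> k j x) * (h l m x * p \<beta> l x) + (h i k x * p \<beta> k x) * (h l m x * F \<beta> l j x))"
   by (rule sum_swap3)
  also have "\<dots> = (\<Sigma> \<beta>. (\<Sigma> a. h i a x * F \<beta> a j x) * u \<beta> m x + u \<beta> i x * (\<Sigma> a. h m a x * F \<beta> a j x))"
  proof (rule sum.cong[OF refl])
   fix \<beta>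
   have 1: "(\<Sigma> l k. (h i k x * F \<beta> k j x) * (h l m x * p \<beta> l x)) = (\<Sigma> a. h i a x * F \<beta> a j x) * u \<beta> m x"
    unfolding metric_grad_component sum_product by (subst sum.swap) (simp add: inv_metric_sym[of D f x m])
   have 2: "(\<Sigma> l k. (h i k x * p \<beta> k x) * (h l m x * F \<beta> l j x)) = u \<beta> i x * (\<Sigma> a. h m a x * F \<beta> a j x)"
    unfolding metric_grad_component sum_product by (subst sum.swap) (simp add: inv_metric_sym[of D f x m])
   show "(\<Sigma> l k. (h i k x * F \<beta> k j x) * (h l m x * p \<beta> l x) + (h i k x * p \<beta> k x) * (h l m x * F \<beta> l j x))
    = (\<Sigma> a. h i a x * F \<beta> a j x) * u \<beta> m x + u \<beta> i x * (\<Sigma> a. h m a x * F \<beta> a j x)"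
    unfolding sum.distrib 1 2 ..
  qed
  finally show ?thesis .
 qed
 then have "dh i k = (\<chi> j. - (\<Sigma> \<beta>. (\<Sigma> a. h i a x * F \<beta> a j x) * u \<beta> k x + u \<beta> i x * (\<Sigma> a. h k a x * F \<beta> a j x)))"
  by (simp add: vec_eq_iff dh)
 then show ?thesis using h'[of i k] by simp
qed

text \<open>Second derivatives of \<open>f\<close> enter the flux field as first derivatives of the \<open>C\<^sup>1\<close> functions
 \<open>D1 D f \<alpha> i\<close>, with coefficients antisymmetric in the remaining pair of indices. Third
 derivatives would cancel in its divergence, and in the weak sense they never appear.\<close>

theorem weak_divergence_flux:
 assumes E: "interior E \<subseteq> interior D"
 shows "weak_divergence E (\<lambda>x. scalar_curv D f x + normal_scalar D f x) (flux_field D f)"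
 unfolding weak_divergence_def
proof (intro allI impI)
 fix \<psi> G assume \<psi>: "C1c (interior E) \<psi> G"
 let ?S = "interior E" and ?A = "\<lambda>\<alpha> i j k. flux_coeff D f \<alpha> i j k"
 have inD: "x \<in> interior D" if "x \<in> ?S" for x using that E by auto
 define dh where "dh x j i k = - (\<Sigma> \<beta>. (\<Sigma> a. h i a x * F \<beta> a j x) * u \<beta> k x + u \<beta> i x * (\<Sigma> a. h k a x * F \<beta> a j x))" for x j i k
 define du where "du x j \<alpha> l = (\<Sigma> c. h l c x * F \<alpha> c j x + p \<alpha> c x * dh x j l c)" for x j \<alpha> l
 define DA where "DA \<alpha> i j k x = (\<chi> l. dh x l i k * u \<alpha> j x + h i k x * du x l \<alpha> j)" for \<alpha> i j k x
 have h': "GDERIV (\<lambda>x. h i k x) x :> (\<chi> j. dh x j i k)" if "x \<in> ?S" for i k x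
  unfolding dh_def by (rule inv_metric_GDERIV[OF inD[OF that]])
 have u': "GDERIV (\<lambda>x. u \<alpha> l x) x :> (\<chi> j. du x j \<alpha> l)" if "x \<in> ?S" for \<alpha> l x
 proof -
  have "GDERIV (\<lambda>x. \<Sigma> c. h l c x * p \<alpha> c x) x :> (\<Sigma> c. h l c x *\<^sub>R (\<chi> j. F \<alpha> c j x) + p \<alpha> c x *\<^sub>R (\<chi> j. dh x j l c))"
   by (intro GDERIV_sum GDERIV_mult p_GDERIV h' inD that)
  moreover have "(\<Sigma> c. h l c x *\<^sub>R (\<chi> j. F \<alpha> c j x) + p \<alpha> c x *\<^sub>R (\<chi> j. dh x j l c)) = (\<chi> j. du x j \<alpha> l)"
   by (simp add: vec_eq_iff sum_component du_def)
  ultimately show ?thesis unfolding metric_grad_component by simp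
 qed
 have A': "GDERIV (?A \<alpha> i j k) x :> DA \<alpha> i j k x" if "x \<in> ?S" for \<alpha> i j k x
 proof -
  have "GDERIV (\<lambda>x. h i k x * u \<alpha> j x) x :> h i k x *\<^sub>R (\<chi> l. du x l \<alpha> j) + u \<alpha> j x *\<^sub>R (\<chi> l. dh x l i k)"
   by (intro GDERIV_mult h' u' that)
  moreover have "h i k x *\<^sub>R (\<chi> l. du x l \<alpha> j) + u \<alpha> j x *\<^sub>R (\<chi> l. dh x l i k) = DA \<alpha> i j k x"
   by (simp add: vec_eq_iff DA_def)
  ultimately show ?thesis unfolding flux_coeff_def[abs_def] by simp
 qed
 have sub: "?S \<subseteq> D" using E interior_subset by blast
 note cont = continuous_on_subset[OF h_cont sub] continuous_on_subset[OF u_cont sub] continuous_on_subset[OF p_cont sub] continuous_on_subset[OF F_cont sub]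
 have dhc: "continuous_on ?S (\<lambda>x. dh x j i k)" for j i k
  unfolding dh_def by (intro continuous_intros cont)
 have DAc: "continuous_on ?S (DA \<alpha> i j k)" for \<alpha> i j k
  unfolding DA_def[abs_def] du_def by (intro continuous_intros cont dhc)
 have Fc: "continuous_on ?S (\<lambda>x. \<chi> j. F \<alpha> i j x)" for \<alpha> i
  by (intro continuous_intros cont)
 let ?I = "\<lambda>\<alpha> i j k x. indicator ?S x * (\<psi> x * ((DA \<alpha> i j k x \<bullet> axis j 1) * ((\<chi> j. F \<alpha> i j x) \<bullet> axis k 1) - (DA \<alpha> i j k x \<bullet> axis k 1) * ((\<chi> j. F \<alpha> i j x) \<bullet> axis j 1))
   + ?A \<alpha> i j k x * ((G x \<bullet> axis j 1) * ((\<chi> j. F \<alpha> i j x) \<bullet> axis k 1) - (G x \<bullet> axis k 1) * ((\<chi> j. F \<alpha> i j x) \<bullet> axis j 1)))"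
 have pair: "(\<integral>x. ?I \<alpha> i j k x \<partial>lborel) = 0" "integrable lborel (?I \<alpha> i j k)" for \<alpha> i j k
  by (rule weak_divergence_pair[OF open_interior A' DAc p_GDERIV[OF inD] Fc \<psi>]; assumption)+
 have sum0: "(\<integral>x. (\<Sigma> \<alpha> i j k. ?I \<alpha> i j k x) \<partial>lborel) = 0"
  by (simp only: Bochner_Integration.integral_sum Bochner_Integration.integrable_sum pair sum.neutral_const)
 obtain K where K: "compact K" "K \<subseteq> ?S" "\<And>x. x \<notin> K \<Longrightarrow> \<psi> x = 0" and c\<psi>: "C1fun \<psi> G" using \<psi> by (auto simp: C1c_def)
 have G0: "G x = 0" if "x \<notin> K" for x by (rule C1c_grad_zero[OF c\<psi> K(1,3) that])
 have point: "(\<Sigma> \<alpha> i j k. ?I \<alpha> i j k x)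
  = indicator E x *\<^sub>R (\<psi> x * (scalar_curv D f x + normal_scalar D f x) + G x \<bullet> flux_field D f x)" for x
 proof (cases "x \<in> ?S")
  case False
  then have "x \<notin> K" using K(2) by auto
  then show ?thesis using False by (simp add: K(3) G0)
 next
  case True
  have xE: "x \<in> E" using True interior_subset by auto
  have ax: "v \<bullet> axis l 1 = v $ l" for v :: "real^'n" and l by (simp add: inner_axis)
  have swap: "(\<Sigma> j k. T j k - T' j k) = (\<Sigma> j k. T j k - T' k j)" for T T' :: "'n \<Rightarrow> 'n \<Rightarrow> real"
   unfolding sum_subtractf by (subst sum.swap[of "\<lambda>j k. T' k j"]) simp
  have s: "(\<Sigma> \<alpha> i j k. DA \<alpha> i j k x $ j * F \<alpha> i k x - DA \<alpha> i j k x $ k * F \<alpha> i j x)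
   = scalar_curv D f x + normal_scalar D f x"
  proof -
   have "(\<Sigma> \<alpha> i j k. DA \<alpha> i j k x $ j * F \<alpha> i k x - DA \<alpha> i j k x $ k * F \<alpha> i j x)
    = (\<Sigma> \<alpha> i j k. (dh x j i k * u \<alpha> j x + h i k x * du x j \<alpha> j - (dh x j i j * u \<alpha> k x + h i j x * du x j \<alpha> k)) * F \<alpha> i k x)"
    by (rule sum.cong[OF refl], rule sum.cong[OF refl], subst swap) (simp add: DA_def left_diff_distrib)
   also have "\<dots> = scalar_curv D f x + normal_scalar D f x"
    unfolding scalar_curv_formula normal_scalar_formula
   proof (rule flux_divergence_algebra[where c = "\<lambda>\<alpha> \<beta>. metric_grad D f \<beta> x \<bullet> grad D f \<alpha> x"])
    show "h i j x = h j i x" for i j by (rule inv_metric_sym)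
    show "F \<alpha> i j x = F \<alpha> j i x" for \<alpha> i j by (rule F_sym[OF inD[OF True]])
    show "dh x j i k = - (\<Sigma> \<beta>. (\<Sigma> a. h i a x * F \<beta> a j x) * u \<beta> k x + u \<beta> i x * (\<Sigma> a. h k a x * F \<beta> a j x))" for j i k
     by (rule dh_def)
    show "du x j \<alpha> l = (\<Sigma> a. h l a x * F \<alpha> a j x)
     - (\<Sigma> \<beta>. (metric_grad D f \<beta> x \<bullet> grad D f \<alpha> x) * (\<Sigma> a. h l a x * F \<beta> a j x) + u \<beta> l x * (\<Sigma> k. F \<beta> j k x * u \<alpha> k x))" for j \<alpha> l
    proof -
     define B where "B \<beta> i = (\<Sigma> a. h i a x * F \<beta> a j x)" for \<beta> i
     have dhB: "dh x j l c = - (\<Sigma> \<beta>. B \<beta> l * u \<beta> c x + u \<beta> l x * B \<beta> c)" for c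
      by (simp only: dh_def B_def)
     have mg: "(\<Sigma> c. p \<alpha> c x * u \<beta> c x) = metric_grad D f \<beta> x \<bullet> grad D f \<alpha> x" for \<beta>
      by (simp add: inner_vec_def grad_def mult.commute)
     have V: "(\<Sigma> c. p \<alpha> c x * B \<beta> c) = (\<Sigma> k. F \<beta> j k x * u \<alpha> k x)" for \<beta>
      unfolding metric_grad_component sum_distrib_left B_def
      by (subst sum.swap, intro sum.cong refl) (subst F_sym[OF inD[OF True]], subst inv_metric_sym, simp only: mult_ac)
     have "(\<Sigma> c. p \<alpha> c x * dh x j l c) = - (\<Sigma> c \<beta>. (p \<alpha> c x * u \<beta> c x) * B \<beta> l + u \<beta> l x * (p \<alpha> c x * B \<beta> c))"
      unfolding dhB minus_mult_right[symmetric] sum_negf sum_distrib_left distrib_left by (simp only: mult_ac)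
     also have "(\<Sigma> c \<beta>. (p \<alpha> c x * u \<beta> c x) * B \<beta> l + u \<beta> l x * (p \<alpha> c x * B \<beta> c))
       = (\<Sigma> \<beta> c. (p \<alpha> c x * u \<beta> c x) * B \<beta> l + u \<beta> l x * (p \<alpha> c x * B \<beta> c))"
      by (rule sum.swap)
     also have "\<dots> = (\<Sigma> \<beta>. (metric_grad D f \<beta> x \<bullet> grad D f \<alpha> x) * B \<beta> l + u \<beta> l x * (\<Sigma> k. F \<beta> j k x * u \<alpha> k x))"
      by (simp only: sum.distrib sum_distrib_left[symmetric] sum_distrib_right[symmetric] mg V)
     finally show ?thesis unfolding du_def sum.distrib by (simp add: B_def)
    qed
   qed
   finally show ?thesis .
  qed
  have X: "(\<Sigma> \<alpha> i j k. ?A \<alpha> i j k x * (G x $ j * F \<alpha> i k x - G x $ k * F \<alpha> i j x)) = G x \<bullet> flux_field D f x"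
  proof -
   have "(\<Sigma> \<alpha> i j k. ?A \<alpha> i j k x * (G x $ j * F \<alpha> i k x - G x $ k * F \<alpha> i j x))
    = (\<Sigma> \<alpha> i j k. G x $ j * ((?A \<alpha> i j k x - ?A \<alpha> i k j x) * F \<alpha> i k x))"
    by (rule sum.cong[OF refl], rule sum.cong[OF refl], unfold right_diff_distrib[of "?A _ _ _ _ _"], subst swap)
     (simp add: left_diff_distrib right_diff_distrib mult_ac)
   also have "\<dots> = (\<Sigma> j \<alpha> i k. G x $ j * ((?A \<alpha> i j k x - ?A \<alpha> i k j x) * F \<alpha> i k x))"
    by (rule sum_swap3)
   finally show ?thesis by (simp add: inner_vec_def flux_field_def sum_distrib_left)
  qed
  have "(\<Sigma> \<alpha> i j k. ?I \<alpha> i j k x)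
   = \<psi> x * (\<Sigma> \<alpha> i j k. DA \<alpha> i j k x $ j * F \<alpha> i k x - DA \<alpha> i j k x $ k * F \<alpha> i j x)
    + (\<Sigma> \<alpha> i j k. ?A \<alpha> i j k x * (G x $ j * F \<alpha> i k x - G x $ k * F \<alpha> i j x))"
   using True by (simp add: ax sum.distrib sum_distrib_left)
  then show ?thesis using xE by (simp only: s X indicator_simps scaleR_one)
 qed
 show "(LINT x:E|lborel. \<psi> x * (scalar_curv D f x + normal_scalar D f x) + G x \<bullet> flux_field D f x) = 0"
  using sum0 unfolding point set_lebesgue_integral_def .
qed

end

section \<open>Lipschitz boundaries\<close>

text \<open>A chart of a Lipschitz boundary, with the graph function extended to the whole space by composing it with
the projection along \<open>e\<close>; that extension is constant along \<open>e\<close> by its Lipschitz condition. The domain lies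
above the graph.\<close>

locale lipschitz_chart =
 fixes \<Omega> :: "(real^'n) set" and y0 e :: "real^'n" and r L :: real and \<Phi> :: "real^'n \<Rightarrow> real"
 assumes open_\<Omega>: "open \<Omega>" and y0: "y0 \<in> frontier \<Omega>" and r: "r > 0" and L: "L \<ge> 0" and e: "norm e = 1"
  and \<Phi>_lip: "\<And>x y. \<bar>\<Phi> x - \<Phi> y\<bar> \<le> L * norm (proj e (x - y))"
  and \<Omega>_chart: "\<And>y. y \<in> ball y0 r \<Longrightarrow> y \<in> \<Omega> \<longleftrightarrow> \<Phi> y < e \<bullet> y"
begin

abbreviation G where "G \<equiv> lift e \<Phi>"

lemma ee: "e \<bullet> e = 1" using e by (simp add: norm_eq_1)

lemma \<Phi>_line: "\<Phi> (x + s *\<^sub>R e) = \<Phi> x"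
 using \<Phi>_lip[of "x + s *\<^sub>R e" x] ee by (simp add: proj_def)

lemma \<Phi>_cont: "continuous_on S \<Phi>"
proof -
 have "dist (\<Phi> x) (\<Phi> y) \<le> L * dist x y" for x y
 proof -
  have "L * norm (proj e (x - y)) \<le> L * norm (x - y)" by (intro mult_left_mono norm_proj_le e L)
  then show ?thesis using \<Phi>_lip[of x y] by (simp add: dist_norm)
 qed
 then have "L-lipschitz_on S \<Phi>" by (intro lipschitz_onI L)
 then show ?thesis by (rule lipschitz_on_continuous_on)
qed

lemma frontier_iff: assumes y: "y \<in> ball y0 r" shows "y \<in> frontier \<Omega> \<longleftrightarrow> e \<bullet> y = \<Phi> y"
proof
 assume "y \<in> frontier \<Omega>"
 then have c: "y \<in> closure \<Omega>" and "y \<notin> \<Omega>" using open_\<Omega> by (auto simp: frontier_def interior_open)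
 then have le: "e \<bullet> y \<le> \<Phi> y" using \<Omega>_chart[OF y] by simp
 define S where "S = ball y0 r \<inter> {z. e \<bullet> z < \<Phi> z}"
 have S: "open S" unfolding S_def by (intro open_Int open_ball open_Collect_less continuous_intros \<Phi>_cont)
 have "z \<notin> \<Omega>" if "z \<in> S" for z using that \<Omega>_chart[of z] by (auto simp: S_def)
 then have "S \<inter> \<Omega> = {}" by auto
 then have "S \<inter> closure \<Omega> = {}" using open_Int_closure_eq_empty[OF S] by simp
 then have "y \<notin> S" using c by auto
 then show "e \<bullet> y = \<Phi> y" using y le by (simp add: S_def)
next
 assume eq: "e \<bullet> y = \<Phi> y"
 have nin: "y \<notin> \<Omega>" using \<Omega>_chart[OF y] eq by simp
 have "y \<in> closure \<Omega>" unfolding closure_approachable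
 proof (intro allI impI)
  fix \<epsilon> :: real assume \<epsilon>: "\<epsilon> > 0"
  define t where "t = min \<epsilon> (r - dist y0 y) / 2"
  have t: "0 < t" "t < \<epsilon>" "t < r - dist y0 y" using y \<epsilon> by (auto simp: t_def min_def field_simps)
  have d: "dist (y + t *\<^sub>R e) y = t" using t e by (simp add: dist_norm)
  have "dist y0 (y + t *\<^sub>R e) < r" using dist_triangle[of y0 "y + t *\<^sub>R e" y] d t by (simp add: dist_commute)
  then have "y + t *\<^sub>R e \<in> \<Omega>" using \<Omega>_chart[of "y + t *\<^sub>R e"] t eq by (simp add: \<Phi>_line inner_add_right ee)
  then show "\<exists>z\<in>\<Omega>. dist z y < \<epsilon>" using t(2) by (intro bexI[of _ "y + t *\<^sub>R e"]) (simp_all only: d)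
 qed
 then show "y \<in> frontier \<Omega>" using nin open_\<Omega> by (simp add: frontier_def interior_open)
qed

lemma lift_diff: "G x - G y = proj e (x - y) + (\<Phi> x - \<Phi> y) *\<^sub>R e"
 by (simp add: lift_def proj_def inner_diff_right algebra_simps)

lemma lift_dist: "dist (G x) (G y) \<le> (1 + L) * norm (proj e (x - y))"
proof -
 have "norm (G x - G y) \<le> norm (proj e (x - y)) + \<bar>\<Phi> x - \<Phi> y\<bar>"
  unfolding lift_diff using e by (intro order_trans[OF norm_triangle_ineq]) simp
 then show ?thesis using \<Phi>_lip[of x y] by (simp add: dist_norm distrib_right)
qed

lemma lift_dist': "dist (G x) (G y) \<le> (1 + L) * dist x y"
proof -
 have "(1 + L) * norm (proj e (x - y)) \<le> (1 + L) * norm (x - y)" using L by (intro mult_left_mono norm_proj_le e) simp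
 then show ?thesis using lift_dist[of x y] by (simp only: dist_norm)
qed

lemma lift_y0: "G y0 = y0" using frontier_iff[of y0] y0 r by (simp add: lift_def)

text \<open>Points of the graph over the ball of radius \<open>\<rho>\<close> stay in the chart, because \<open>lift\<close> is \<open>1 + L\<close>-Lipschitz.\<close>

definition \<rho> where "\<rho> = r / (1 + L)"

lemma \<rho>: "0 < \<rho>" "\<rho> \<le> r" using r L by (auto simp: \<rho>_def field_simps)

lemma lift_near: assumes "norm (proj e (x - y0)) < \<rho>" shows "G x \<in> ball y0 r" "G x \<in> frontier \<Omega>"
proof -
 have "dist (G x) y0 < r" using lift_dist[of x y0] assms L by (simp add: lift_y0 \<rho>_def field_simps)
 then show b: "G x \<in> ball y0 r" by (simp add: dist_commute)
 have "e \<bullet> G x = \<Phi> (G x)" by (simp add: lift_def \<Phi>_line inner_add_right ee)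
 then show "G x \<in> frontier \<Omega>" using frontier_iff[OF b] by simp
qed

lemma proj_ball: "x \<in> ball y0 d \<Longrightarrow> norm (proj e (x - y0)) < d"
 using norm_proj_le[OF e, of "x - y0"] by (simp add: dist_norm norm_minus_commute)

text \<open>A graph over a ball is connected, so the part of the boundary in a chart belongs to a single
 component of the boundary.\<close>

lemma locally_constant:
 assumes f: "\<forall>C\<in>components (frontier \<Omega>). f constant_on C" and y: "y \<in> frontier \<Omega>" "y \<in> ball y0 \<rho>"
 shows "f y = f y0"
proof -
 let ?S = "G ` ball y0 \<rho>"
 have c: "connected ?S"
  by (rule connected_continuous_image)
   (auto simp: lift_def[abs_def] intro!: continuous_intros \<Phi>_cont convex_connected)
 have s: "?S \<subseteq> frontier \<Omega>" using lift_near(2) proj_ball by auto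
 have y0S: "y0 \<in> ?S" using lift_y0 \<rho> by (metis centre_in_ball image_eqI)
 have "G y = y" using frontier_iff[of y] y \<rho> by (simp add: lift_def)
 then have yS: "y \<in> ?S" using y by (metis image_eqI)
 let ?C = "connected_component_set (frontier \<Omega>) y0"
 have "?S \<subseteq> ?C" by (rule connected_component_maximal[OF y0S c s])
 moreover have "?C \<in> components (frontier \<Omega>)" using y0 by (auto simp: components_def)
 ultimately show ?thesis using f y0S yS unfolding constant_on_def by (metis subsetD)
qed

lemma area_finite:
 assumes n: "CARD('n) \<ge> 2"
 shows "emeasure \<A> (frontier \<Omega> \<inter> ball y0 \<rho>) < top"
proof -
 define R where "R = norm y0 + \<rho>"
 have R: "R > 0" using \<rho> by (simp add: R_def add_nonneg_pos)
 let ?A = "{x. e \<bullet> x = 0} \<inter> cball 0 R :: (real^'n) set"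
 have cA: "compact ?A" by (intro closed_Int_compact closed_hyperplane compact_cball)
 have G: "continuous_on S G" for S unfolding lift_def[abs_def] by (intro continuous_intros \<Phi>_cont)
 have cG: "compact (G ` ?A)" by (intro compact_continuous_image G cA)
 have [measurable]: "?A \<in> sets borel" "G ` ?A \<in> sets borel" using cA cG by (auto intro: borel_closed compact_imp_closed)
 have "frontier \<Omega> \<inter> ball y0 \<rho> \<subseteq> G ` ?A"
 proof
  fix y assume y: "y \<in> frontier \<Omega> \<inter> ball y0 \<rho>"
  then have "y = G y" using frontier_iff[of y] \<rho> by (simp add: lift_def)
  also have "\<dots> = G (proj e y)"
  proof -
   have "\<Phi> (proj e y) = \<Phi> y" using \<Phi>_line[of "proj e y" "e \<bullet> y"] by (simp add: proj_def)
   then show ?thesis by (simp add: lift_def inner_proj[OF e]) (simp add: proj_def algebra_simps)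
  qed
  finally have 1: "y = G (proj e y)" .
  have "norm y \<le> R" using y norm_triangle_ineq2[of y y0] by (simp add: R_def dist_norm norm_minus_commute)
  then have "proj e y \<in> ?A" using norm_proj_le[OF e, of y] by (simp add: inner_proj[OF e])
  then show "y \<in> G ` ?A" using 1 by (rule rev_image_eqI)
 qed
 then have "emeasure \<A> (frontier \<Omega> \<inter> ball y0 \<rho>) \<le> emeasure \<A> (G ` ?A)"
  by (intro emeasure_mono) auto
 also have "\<dots> \<le> ennreal ((1 + L) ^ (CARD('n) - 1)) * emeasure \<A> ?A"
  by (rule area_lipschitz_image[OF n _ lift_dist']) (use L in auto)
 also have "emeasure \<A> ?A < top"
 proof -
  have "emeasure \<A> ?A = emeasure (\<L> e) ?A" by (rule area_hyperplane[OF n e]) auto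
  also have "\<dots> \<le> emeasure (\<L> e) (cball 0 R)" by (rule emeasure_mono) auto
  also have "\<dots> < top" unfolding plane_measure_cball_0[OF e R] using plane_measure_unit_ball[OF e]
   by (intro ennreal_mult_less_top[THEN iffD2]) (simp add: less_top)
  finally show ?thesis .
 qed
 then have "ennreal ((1 + L) ^ (CARD('n) - 1)) * emeasure \<A> ?A < top"
  by (simp add: ennreal_mult_less_top)
 finally show ?thesis .
qed

lemma boundary_null: "AE x in lborel. x \<notin> frontier \<Omega> \<inter> ball y0 r"
 using lborel_graph_null[OF e \<Phi>_cont \<Phi>_line]
proof eventually_elim
 case (elim x) then show ?case using frontier_iff[of x] by (auto simp: graph_def)
qed

end

lemma lipschitz_chart_exists:
 fixes \<Omega> :: "(real^'n) set"
 assumes "open \<Omega>" "lipschitz_boundary \<Omega>" "y0 \<in> frontier \<Omega>"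
 obtains e r L \<Phi> where "lipschitz_chart \<Omega> y0 e r L \<Phi>"
proof -
 obtain U e L \<phi> where U: "open U" "y0 \<in> U" "norm e = 1" "L-lipschitz_on {z. e \<bullet> z = 0} \<phi>"
  "\<Omega> \<inter> U = {y\<in>U. e \<bullet> y > \<phi> (y - (e \<bullet> y) *\<^sub>R e)}"
  using bspec[OF assms(2)[unfolded lipschitz_boundary_def] assms(3)] by (elim exE conjE) (rule that)
 obtain r where r: "r > 0" "ball y0 r \<subseteq> U" by (rule openE[OF U(1,2)])
 have "lipschitz_chart \<Omega> y0 e r L (\<lambda>x. \<phi> (proj e x))"
 proof
  show "L \<ge> 0" using U(4) by (rule lipschitz_on_nonneg)
  fix x y
  have "dist (\<phi> (proj e x)) (\<phi> (proj e y)) \<le> L * dist (proj e x) (proj e y)"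
   by (rule lipschitz_onD[OF U(4)]) (simp_all add: inner_proj[OF U(3)])
  moreover have "proj e x - proj e y = proj e (x - y)" by (simp add: proj_def inner_diff_right algebra_simps)
  ultimately show "\<bar>\<phi> (proj e x) - \<phi> (proj e y)\<bar> \<le> L * norm (proj e (x - y))" by (simp add: dist_norm)
 next
  fix y assume "y \<in> ball y0 r"
  then have "y \<in> U" using r by auto
  then have "y \<in> \<Omega> \<longleftrightarrow> y \<in> \<Omega> \<inter> U" by simp
  also have "\<dots> \<longleftrightarrow> \<phi> (proj e y) < e \<bullet> y" unfolding U(5) using \<open>y \<in> U\<close> by (simp add: proj_def)
  finally show "y \<in> \<Omega> \<longleftrightarrow> \<phi> (proj e y) < e \<bullet> y" .
 qed (use assms U r in auto)
 then show thesis by (rule that)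
qed

lemma compact_finite_balls:
 assumes "compact S" "\<And>y. y \<in> S \<Longrightarrow> \<exists>r>0. P (S \<inter> ball y r)"
  and Un: "\<And>A B. P A \<Longrightarrow> P B \<Longrightarrow> P (A \<union> B)" and sub: "\<And>A B. P A \<Longrightarrow> B \<subseteq> A \<Longrightarrow> P B" and emp: "P {}"
 shows "P S"
proof -
 obtain r where r: "\<And>y. y \<in> S \<Longrightarrow> r y > 0 \<and> P (S \<inter> ball y (r y))" using assms(2) by metis
 obtain C where C: "C \<subseteq> S" "finite C" "S \<subseteq> (\<Union>c\<in>C. ball c (r c))"
 proof (rule compactE_image[OF assms(1)])
  show "S \<subseteq> (\<Union>c\<in>S. ball c (r c))"
  proof
   fix y assume "y \<in> S" then show "y \<in> (\<Union>c\<in>S. ball c (r c))" using r by (intro UN_I[of y]) auto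
  qed
 qed auto
 have "P (\<Union>c\<in>C. S \<inter> ball c (r c))" using C(2,1)
 proof (induction C)
  case (insert c C) then show ?case using r by (simp add: Un)
 qed (simp add: emp)
 moreover have "S \<subseteq> (\<Union>c\<in>C. S \<inter> ball c (r c))" using C(3) by auto
 ultimately show ?thesis using sub by blast
qed

lemma boundary_null:
 fixes \<Omega> :: "(real^'n) set"
 assumes "open \<Omega>" "bounded \<Omega>" "lipschitz_boundary \<Omega>"
 shows "AE x in lborel. x \<notin> frontier \<Omega>"
proof (rule compact_finite_balls[of "frontier \<Omega>"])
 show "compact (frontier \<Omega>)" using assms(2) by (rule compact_frontier_bounded)
 fix y assume "y \<in> frontier \<Omega>"
 then obtain e r L \<Phi> where "lipschitz_chart \<Omega> y e r L \<Phi>" using lipschitz_chart_exists[OF assms(1,3)] by blast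
 then interpret lipschitz_chart \<Omega> y e r L \<Phi> .
 show "\<exists>r>0. AE x in lborel. x \<notin> frontier \<Omega> \<inter> ball y r" using r boundary_null by blast
next
 fix A B :: "(real^'n) set" assume "AE x in lborel. x \<notin> A" "AE x in lborel. x \<notin> B"
 then show "AE x in lborel. x \<notin> A \<union> B" by eventually_elim auto
next
 fix A B :: "(real^'n) set" assume "AE x in lborel. x \<notin> A" "B \<subseteq> A"
 then show "AE x in lborel. x \<notin> B" by (auto elim!: eventually_mono)
qed simp

lemma compact_area_finite:
 fixes S :: "(real^'n) set"
 assumes S: "compact S"
  and loc: "\<And>y. y \<in> S \<Longrightarrow> \<exists>r>0. \<exists>B\<in>sets borel. S \<inter> ball y r \<subseteq> B \<and> emeasure \<A> B < top"
 shows "emeasure \<A> S < top"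
proof -
 define P where "P A \<longleftrightarrow> (\<exists>B\<in>sets borel. A \<subseteq> B \<and> emeasure \<A> B < top)" for A :: "(real^'n) set"
 have "P S"
 proof (rule compact_finite_balls[OF S])
  fix A B assume "P A" "P B"
  then obtain A' B' where [measurable]: "A' \<in> sets borel" "B' \<in> sets borel" and *: "A \<subseteq> A'" "B \<subseteq> B'"
   "emeasure \<A> A' < top" "emeasure \<A> B' < top" unfolding P_def by auto
  have "emeasure \<A> (A' \<union> B') \<le> emeasure \<A> A' + emeasure \<A> B'"
   by (rule emeasure_subadditive) auto
  also have "\<dots> < top" using * by (simp add: ennreal_add_less_top)
  finally show "P (A \<union> B)" unfolding P_def using * by (intro bexI[of _ "A' \<union> B'"]) auto
 next
  fix A B assume "P A" "B \<subseteq> A"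
  then show "P B" unfolding P_def by (meson subset_trans)
 next
  show "P {}" unfolding P_def by (intro bexI[of _ "{}"]) auto
 qed (use loc in \<open>auto simp: P_def\<close>)
 then obtain B where "B \<in> sets borel" "S \<subseteq> B" "emeasure \<A> B < top" unfolding P_def by auto
 then show ?thesis using emeasure_mono[of S B \<A>] by (simp add: order_le_less_trans)
qed

lemma boundary_area_finite:
 fixes \<Omega> :: "(real^'n) set"
 assumes n: "CARD('n) \<ge> 2" and "open \<Omega>" "bounded \<Omega>" "lipschitz_boundary \<Omega>"
 shows "emeasure \<A> (frontier \<Omega>) < top"
proof (rule compact_area_finite)
 show "compact (frontier \<Omega>)" using assms(3) by (rule compact_frontier_bounded)
 fix y assume "y \<in> frontier \<Omega>"
 then obtain e r L \<Phi> where "lipschitz_chart \<Omega> y e r L \<Phi>" using lipschitz_chart_exists[OF assms(2,4)] by blast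
 then interpret lipschitz_chart \<Omega> y e r L \<Phi> .
 show "\<exists>r>0. \<exists>B\<in>sets borel. frontier \<Omega> \<inter> ball y r \<subseteq> B \<and> emeasure \<A> B < top"
  using \<rho>(1) area_finite[OF n] by (intro exI[of _ \<rho>] conjI bexI[of _ "frontier \<Omega> \<inter> ball y \<rho>"]) auto
qed

text \<open>If \<open>\<nu> \<noteq> m\<close>, the direction \<open>\<nu> - m\<close> makes an acute angle with \<open>\<nu>\<close> and an obtuse one with \<open>m\<close>, so it would point
both into the domain and out of it.\<close>

lemma inner_unit_normal_unique:
 fixes \<Omega> :: "(real^'n) set"
 assumes \<nu>: "inner_unit_normal \<Omega> y \<nu>" and m: "inner_unit_normal \<Omega> y m"
 shows "\<nu> = m"
proof (rule ccontr)
 assume ne: "\<nu> \<noteq> m"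
 define d where "d = \<nu> - m"
 have d: "norm d > 0" using ne by (simp add: d_def)
 have n: "\<nu> \<bullet> \<nu> = 1" "m \<bullet> m = 1" using \<nu> m by (auto simp: inner_unit_normal_def norm_eq_1)
 have dd: "(norm d)\<^sup>2 = 2 * (1 - \<nu> \<bullet> m)" unfolding power2_norm_eq_inner d_def using n
  by (simp add: inner_diff_left inner_diff_right inner_commute)
 have nd: "\<nu> \<bullet> d = (norm d)\<^sup>2 / 2" "m \<bullet> d = - ((norm d)\<^sup>2 / 2)" unfolding dd using n
  by (simp_all add: d_def inner_diff_right inner_commute[of m \<nu>] field_simps)
 \<comment> \<open>half the inner product of \<open>\<nu>\<close> with the unit vector in direction \<open>d\<close>\<close>
 define e where "e = norm d / 4"
 have e: "e > 0" using d by (simp add: e_def)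
 have lim: "((\<lambda>t. y + t *\<^sub>R d) \<longlongrightarrow> y + 0 *\<^sub>R d) (at_right 0)" by (intro tendsto_intros)
 then have flt: "filterlim (\<lambda>t. y + t *\<^sub>R d) (nhds y) (at_right 0)" by simp
 have "\<forall>\<^sub>F z in nhds y. (\<nu> \<bullet> (z - y) > e * norm (z - y) \<longrightarrow> z \<in> \<Omega>) \<and> (m \<bullet> (z - y) < - e * norm (z - y) \<longrightarrow> z \<notin> \<Omega>)"
 proof -
  have 1: "\<forall>\<^sub>F z in nhds y. (\<nu> \<bullet> (z - y) > e * norm (z - y) \<longrightarrow> z \<in> \<Omega>) \<and> (\<nu> \<bullet> (z - y) < - e * norm (z - y) \<longrightarrow> z \<notin> \<Omega>)"
   using \<nu> e unfolding inner_unit_normal_def by blast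
  have 2: "\<forall>\<^sub>F z in nhds y. (m \<bullet> (z - y) > e * norm (z - y) \<longrightarrow> z \<in> \<Omega>) \<and> (m \<bullet> (z - y) < - e * norm (z - y) \<longrightarrow> z \<notin> \<Omega>)"
   using m e unfolding inner_unit_normal_def by blast
  show ?thesis using 1 2 by eventually_elim blast
 qed
 then have "\<forall>\<^sub>F t in at_right 0. (\<nu> \<bullet> (t *\<^sub>R d) > e * norm (t *\<^sub>R d) \<longrightarrow> y + t *\<^sub>R d \<in> \<Omega>) \<and> (m \<bullet> (t *\<^sub>R d) < - e * norm (t *\<^sub>R d) \<longrightarrow> y + t *\<^sub>R d \<notin> \<Omega>)"
  using eventually_compose_filterlim[OF _ flt] by fastforce
 moreover have "\<forall>\<^sub>F t in at_right (0::real). t > 0" by (rule eventually_at_right_less)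
 ultimately have "\<forall>\<^sub>F t in at_right (0::real). False"
 proof eventually_elim
  case (elim t)
  have "(t * norm d) * (norm d / 4) < (t * norm d) * (norm d / 2)" using elim d by (intro mult_strict_left_mono mult_pos_pos) auto
  then have *: "e * (t * norm d) < t * ((norm d)\<^sup>2 / 2)" by (simp add: e_def power2_eq_square mult_ac)
  then have "y + t *\<^sub>R d \<in> \<Omega>" "y + t *\<^sub>R d \<notin> \<Omega>" using elim nd by auto
  then show ?case by simp
 qed
 then show False by simp
qed

text \<open>The boundary crosses every short segment through \<open>y + t *\<^sub>R \<tau>\<close> in the direction of the normal,
 at distance \<open>o(t)\<close> from \<open>y + t *\<^sub>R \<tau>\<close>; so tangential derivatives can be computed along the
 boundary even where it is merely differentiable.\<close>

lemma tangential_derivative_zero: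
 fixes \<Omega> :: "(real^'n) set" and u :: "real^'n \<Rightarrow> real"
 assumes \<Omega>: "open \<Omega>" and y: "y \<in> frontier \<Omega>" and \<nu>: "inner_unit_normal \<Omega> y \<nu>" and \<tau>: "\<tau> \<bullet> \<nu> = 0"
  and u: "(u has_derivative (\<lambda>h. v \<bullet> h)) (at y within - \<Omega>)"
  and const: "r > 0" "\<And>z. z \<in> frontier \<Omega> \<Longrightarrow> z \<in> ball y r \<Longrightarrow> u z = u y"
 shows "v \<bullet> \<tau> = 0"
proof -
 have n: "\<nu> \<bullet> \<nu> = 1" "norm \<nu> = 1" using \<nu> by (auto simp: inner_unit_normal_def norm_eq_1)
 have bound: "\<bar>v \<bullet> \<tau>\<bar> \<le> e * (\<bar>v \<bullet> \<nu>\<bar> + norm \<tau> + 1)" if e: "0 < e" "e \<le> 1" for e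
 proof -
  define e' where "e' = e / (2 * (norm \<tau> + 1))"
  have e': "e' > 0" using e by (simp add: e'_def add_nonneg_pos)
  obtain d1 where d1: "d1 > 0" "\<And>z. dist z y < d1 \<Longrightarrow> (\<nu> \<bullet> (z - y) > e' * norm (z - y) \<longrightarrow> z \<in> \<Omega>) \<and> (\<nu> \<bullet> (z - y) < - e' * norm (z - y) \<longrightarrow> z \<notin> \<Omega>)"
   using \<nu> e' unfolding inner_unit_normal_def eventually_nhds_metric by blast
  obtain d2 where d2: "d2 > 0" "\<And>z. z \<in> - \<Omega> \<Longrightarrow> norm (z - y) < d2 \<Longrightarrow> norm (u z - u y - v \<bullet> (z - y)) \<le> e * norm (z - y)"
   using u e unfolding has_derivative_within_alt by blast
  define t where "t = min r (min d1 d2) / (2 * (norm \<tau> + 1))"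
  have t: "t > 0" using const(1) d1(1) d2(1) by (simp add: t_def add_nonneg_pos)
  have tt: "t * (norm \<tau> + 1) < min r (min d1 d2)"
  proof -
   have "t * (norm \<tau> + 1) = min r (min d1 d2) / 2" by (simp add: t_def field_simps add_nonneg_eq_0_iff)
   then show ?thesis using const(1) d1(1) d2(1) by linarith
  qed
  define z where "z s = y + t *\<^sub>R \<tau> + s *\<^sub>R \<nu>" for s
  have nz: "norm (z s - y) \<le> t * (norm \<tau> + 1)" if "\<bar>s\<bar> \<le> t * e" for s
  proof -
   have "norm (z s - y) \<le> norm (t *\<^sub>R \<tau>) + norm (s *\<^sub>R \<nu>)" unfolding z_def by (metis add.assoc add_diff_cancel_left' norm_triangle_ineq)
   also have "\<dots> = t * norm \<tau> + \<bar>s\<bar>" using t n by simp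
   also have "\<dots> \<le> t * norm \<tau> + t * 1" using that mult_left_mono[OF e(2), of t] t by linarith
   finally show ?thesis by (simp add: distrib_left)
  qed
  have nuz: "\<nu> \<bullet> (z s - y) = s" for s using n \<tau> by (simp add: z_def inner_add_right inner_commute inner_diff_right)
  have small: "e' * norm (z s - y) < t * e" if "\<bar>s\<bar> \<le> t * e" for s
  proof -
   have "e' * norm (z s - y) \<le> e' * (t * (norm \<tau> + 1))" using nz[OF that] e' by simp
   also have "\<dots> = t * e / 2" by (simp add: e'_def field_simps add_nonneg_eq_0_iff)
   also have "\<dots> < t * e" using t e by simp
   finally show ?thesis .
  qed
  have in\<Omega>: "z (t * e) \<in> \<Omega>" "z (- (t * e)) \<notin> \<Omega>"
  proof -
   have "dist (z (t * e)) y < d1" "dist (z (- (t * e))) y < d1"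
    using nz[of "t * e"] nz[of "- (t * e)"] tt t e by (simp_all add: dist_norm)
   then show "z (t * e) \<in> \<Omega>" "z (- (t * e)) \<notin> \<Omega>"
    using d1(2)[of "z (t * e)"] d1(2)[of "z (- (t * e))"] small[of "t * e"] small[of "- (t * e)"] t e unfolding nuz by auto
  qed
  have "z ` {- (t * e)..t * e} \<inter> frontier \<Omega> \<noteq> {}"
  proof (rule connected_Int_frontier)
   show "connected (z ` {- (t * e)..t * e})"
    unfolding z_def[abs_def] by (intro connected_continuous_image continuous_intros connected_Icc)
   have in1: "z ` {- (t * e)..t * e} \<inter> \<Omega> \<noteq> {}" and in2: "z ` {- (t * e)..t * e} - \<Omega> \<noteq> {}"
   proof -
    have "z (t * e) \<in> z ` {- (t * e)..t * e}" "z (- (t * e)) \<in> z ` {- (t * e)..t * e}"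
     using t e by (intro imageI; simp)+
    then show "z ` {- (t * e)..t * e} \<inter> \<Omega> \<noteq> {}" "z ` {- (t * e)..t * e} - \<Omega> \<noteq> {}"
     using in\<Omega> by (metis IntI empty_iff, metis DiffI empty_iff)
   qed
   show "z ` {- (t * e)..t * e} \<inter> \<Omega> \<noteq> {}" by (rule in1)
   show "z ` {- (t * e)..t * e} - \<Omega> \<noteq> {}" by (rule in2)
  qed
  then obtain s where "s \<in> {- (t * e)..t * e}" "z s \<in> frontier \<Omega>" by blast
  then have s: "\<bar>s\<bar> \<le> t * e" "z s \<in> frontier \<Omega>" by auto
  have no: "norm (z s - y) < min r (min d1 d2)" using nz[OF s(1)] tt by linarith
  have "z s \<in> - \<Omega>" using s(2) \<Omega> by (auto simp: frontier_def interior_open)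
  then have "norm (u (z s) - u y - v \<bullet> (z s - y)) \<le> e * norm (z s - y)" using no d2(2) by simp
  moreover have "u (z s) = u y" using const(2)[OF s(2)] no by (simp add: dist_norm norm_minus_commute)
  moreover have "v \<bullet> (z s - y) = t * (v \<bullet> \<tau>) + s * (v \<bullet> \<nu>)" by (simp add: z_def inner_add_right inner_diff_right)
  ultimately have "\<bar>t * (v \<bullet> \<tau>) + s * (v \<bullet> \<nu>)\<bar> \<le> e * (t * (norm \<tau> + 1))"
   using mult_left_mono[OF nz[OF s(1)] less_imp_le[OF e(1)]] by simp
  then have "\<bar>t * (v \<bullet> \<tau>)\<bar> \<le> e * (t * (norm \<tau> + 1)) + \<bar>s * (v \<bullet> \<nu>)\<bar>" by linarith
  also have "\<bar>s * (v \<bullet> \<nu>)\<bar> \<le> t * e * \<bar>v \<bullet> \<nu>\<bar>" unfolding abs_mult using s(1) by (intro mult_right_mono) auto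
  finally have "t * \<bar>v \<bullet> \<tau>\<bar> \<le> t * (e * (\<bar>v \<bullet> \<nu>\<bar> + norm \<tau> + 1))" using t by (simp add: abs_mult algebra_simps)
  then show ?thesis using t by simp
 qed
 have "\<bar>v \<bullet> \<tau>\<bar> \<le> 0"
 proof (rule field_le_epsilon)
  fix d :: real assume d: "d > 0"
  define M where "M = \<bar>v \<bullet> \<nu>\<bar> + norm \<tau> + 1"
  have M: "M > 0" unfolding M_def by (simp add: add_nonneg_pos)
  have "min 1 (d / M) * M \<le> d" using M by (simp add: min_def field_simps)
  moreover have "\<bar>v \<bullet> \<tau>\<bar> \<le> min 1 (d / M) * M" unfolding M_def[symmetric] using bound[of "min 1 (d / M)"] M d by (simp add: M_def)
  ultimately show "\<bar>v \<bullet> \<tau>\<bar> \<le> 0 + d" by simp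
 qed
 then show ?thesis by simp
qed

section \<open>The flux field at the boundary\<close>

lemma normal_multiple:
 fixes v \<nu> :: "'a::real_inner"
 assumes \<nu>: "norm \<nu> = 1" and t: "\<And>\<tau>. \<tau> \<bullet> \<nu> = 0 \<Longrightarrow> v \<bullet> \<tau> = 0"
 shows "v = (v \<bullet> \<nu>) *\<^sub>R \<nu>"
proof -
 have n: "\<nu> \<bullet> \<nu> = 1" using \<nu> by (simp add: norm_eq_1)
 define \<tau> where "\<tau> = v - (v \<bullet> \<nu>) *\<^sub>R \<nu>"
 have 0: "\<tau> \<bullet> \<nu> = 0" using n by (simp add: \<tau>_def inner_diff_left)
 have "\<tau> \<bullet> (v - (v \<bullet> \<nu>) *\<^sub>R \<nu>) = v \<bullet> \<tau> - (v \<bullet> \<nu>) * (\<tau> \<bullet> \<nu>)"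
  by (simp add: inner_diff_right inner_commute[of \<tau> v])
 then have "\<tau> \<bullet> \<tau> = v \<bullet> \<tau> - (v \<bullet> \<nu>) * (\<tau> \<bullet> \<nu>)" unfolding \<tau>_def[symmetric] .
 then have "\<tau> \<bullet> \<tau> = 0" using t[OF 0] 0 by simp
 then show ?thesis by (simp add: \<tau>_def)
qed

lemma unit_normal_fieldD:
 assumes "unit_normal_field \<Omega> U N"
 shows "open U" "C1_on U (\<lambda>z. N z $ i)" "y \<in> U \<Longrightarrow> norm (N y) = 1"
  "y \<in> frontier \<Omega> \<Longrightarrow> y \<in> U \<Longrightarrow> inner_unit_normal \<Omega> y (N y)"
 using assms unfolding unit_normal_field_def by blast+

text \<open>The gradient of the \<open>i\<close>-th component of the normal field.\<close>

definition unit_normal_deriv :: "(real^'n) set \<Rightarrow> (real^'n \<Rightarrow> real^'n) \<Rightarrow> real^'n \<Rightarrow> 'n \<Rightarrow> real^'n" where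
 "unit_normal_deriv U N y i = (\<chi> j. partial_deriv U j (\<lambda>z. N z $ i) y)"

lemma unit_normal_field_deriv:
 assumes U: "unit_normal_field \<Omega> U N" and y: "y \<in> U"
 shows "((\<lambda>z. N z $ i) has_derivative (\<lambda>h. unit_normal_deriv U N y i \<bullet> h)) (at y)"
  and "divergence U N y = (\<Sigma> i. unit_normal_deriv U N y i $ i)"
  and "(\<Sigma> i. N y $ i *\<^sub>R unit_normal_deriv U N y i) = 0"
proof -
 have o: "open U" using U by (rule unit_normal_fieldD)
 have aw: "at y within U = at y" using y o by (rule at_within_open)
 have d: "(\<lambda>z. N z $ i) differentiable (at y within U)" for i
  using unit_normal_fieldD(2)[OF U, of i] y unfolding C1_on_def differentiable_on_def by blast
 show D: "((\<lambda>z. N z $ i) has_derivative (\<lambda>h. unit_normal_deriv U N y i \<bullet> h)) (at y)" for i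
  using has_derivative_partials[OF d] unfolding unit_normal_deriv_def aw by simp
 show "divergence U N y = (\<Sigma> i. unit_normal_deriv U N y i $ i)"
  by (simp add: divergence_def unit_normal_deriv_def)
 have "((\<lambda>z. \<Sigma> i. N z $ i * N z $ i) has_derivative (\<lambda>h. \<Sigma> i. N y $ i * (unit_normal_deriv U N y i \<bullet> h) + (unit_normal_deriv U N y i \<bullet> h) * N y $ i)) (at y)"
  by (intro has_derivative_sum has_derivative_mult D)
 moreover have "((\<lambda>z. \<Sigma> i. N z $ i * N z $ i) has_derivative (\<lambda>h. 0)) (at y)"
 proof (rule has_derivative_transform_within_open[OF has_derivative_const[of 1] o y])
  fix z assume "z \<in> U"
  then have "norm (N z) = 1" by (rule unit_normal_fieldD[OF U])
  then show "1 = (\<Sigma> i. N z $ i * N z $ i)" by (simp add: norm_eq_1 inner_vec_def)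
 qed
 ultimately have eq: "(\<lambda>h. \<Sigma> i. N y $ i * (unit_normal_deriv U N y i \<bullet> h) + (unit_normal_deriv U N y i \<bullet> h) * N y $ i) = (\<lambda>h. 0)"
  by (rule has_derivative_unique)
 have "(\<Sigma> i. N y $ i * (unit_normal_deriv U N y i \<bullet> h) + (unit_normal_deriv U N y i \<bullet> h) * N y $ i) = 0" for h
  by (rule fun_cong[OF eq])
 then have "2 * (\<Sigma> i. N y $ i * (unit_normal_deriv U N y i \<bullet> h)) = 0" for h
  by (simp add: mult.commute[of _ "N y $ _"] sum_distrib_left[symmetric])
 then have "(\<Sigma> i. N y $ i *\<^sub>R unit_normal_deriv U N y i) \<bullet> h = 0" for h
  by (simp add: inner_sum_left)
 from this[of "\<Sigma> i. N y $ i *\<^sub>R unit_normal_deriv U N y i"]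
 show "(\<Sigma> i. N y $ i *\<^sub>R unit_normal_deriv U N y i) = 0" by (simp only: inner_eq_zero_iff)
qed

text \<open>Two extensions of the normal agree along the boundary, so their difference has gradients
 normal to it; the trace of the difference of the derivatives is then a normal-normal component,
 which vanishes for unit fields.\<close>

lemma divergence_unit_normal_unique:
 fixes \<Omega> :: "(real^'n) set"
 assumes \<Omega>: "open \<Omega>" and y: "y \<in> frontier \<Omega>"
  and U: "unit_normal_field \<Omega> U N" "y \<in> U" and V: "unit_normal_field \<Omega> V M" "y \<in> V"
 shows "divergence U N y = divergence V M y"
proof -
 let ?A = "unit_normal_deriv U N y" and ?B = "unit_normal_deriv V M y"
 note A = unit_normal_field_deriv[OF U] and B = unit_normal_field_deriv[OF V]
 have eq: "N z = M z" if "z \<in> frontier \<Omega>" "z \<in> U \<inter> V" for z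
  using that by (intro inner_unit_normal_unique[of \<Omega> z] unit_normal_fieldD(4)[OF U(1)] unit_normal_fieldD(4)[OF V(1)]) auto
 have neq: "N y = M y" using eq[OF y] U(2) V(2) by simp
 have nu: "inner_unit_normal \<Omega> y (N y)" by (rule unit_normal_fieldD(4)[OF U(1) y U(2)])
 then have n1: "norm (N y) = 1" by (simp add: inner_unit_normal_def)
 have "open (U \<inter> V)" by (intro open_Int unit_normal_fieldD(1)[OF U(1)] unit_normal_fieldD(1)[OF V(1)])
 then obtain r where r: "r > 0" "ball y r \<subseteq> U \<inter> V" by (rule openE[OF _ IntI[OF U(2) V(2)]])
 have dd: "((\<lambda>z. N z $ i - M z $ i) has_derivative (\<lambda>h. (?A i - ?B i) \<bullet> h)) (at y within - \<Omega>)" for i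
  unfolding inner_diff_left by (rule has_derivative_diff[OF has_derivative_at_withinI[OF A(1)] has_derivative_at_withinI[OF B(1)]])
 have same: "N z $ i - M z $ i = N y $ i - M y $ i" if "z \<in> frontier \<Omega>" "z \<in> ball y r" for z i
  unfolding eq[OF that(1) subsetD[OF r(2) that(2)]] neq by simp
 have perp: "(?A i - ?B i) \<bullet> \<tau> = 0" if "\<tau> \<bullet> N y = 0" for i \<tau>
  by (rule tangential_derivative_zero[OF \<Omega> y nu that dd r(1) same])
 have par: "?A i - ?B i = ((?A i - ?B i) \<bullet> N y) *\<^sub>R N y" for i
  by (rule normal_multiple[OF n1 perp])
 have comp: "(?A i - ?B i) $ i = N y $ i * ((?A i - ?B i) \<bullet> N y)" for i
  using arg_cong[OF par, of "\<lambda>v. v $ i"] by simp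
 have "divergence U N y - divergence V M y = (\<Sigma> i. (?A i - ?B i) $ i)"
  unfolding A(2) B(2) by (simp add: sum_subtractf)
 then have "divergence U N y - divergence V M y = (\<Sigma> i. N y $ i *\<^sub>R (?A i - ?B i)) \<bullet> N y"
  unfolding comp by (simp only: inner_sum_left inner_scaleR_left)
 moreover have "(\<Sigma> i. N y $ i *\<^sub>R (?A i - ?B i)) = 0"
  unfolding scaleR_diff_right sum_subtractf A(3) using B(3)[folded neq] by simp
 ultimately have "divergence U N y - divergence V M y = 0" by (simp only: inner_zero_left)
 then show ?thesis by (simp only: right_minus_eq)
qed

lemma mean_curvature_eq:
 fixes \<Omega> :: "(real^'n) set"
 assumes \<Omega>: "open \<Omega>" and y: "y \<in> frontier \<Omega>" and U: "unit_normal_field \<Omega> U N" "y \<in> U"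
 shows "mean_curvature \<Omega> y = - divergence U N y"
proof -
 have "C2_boundary_point \<Omega> y" using y U by (auto simp: C2_boundary_point_def)
 moreover have "(SOME h. \<exists>U N. y \<in> U \<and> unit_normal_field \<Omega> U N \<and> h = - divergence U N y) = - divergence U N y"
 proof (rule some_equality)
  show "\<exists>U' N'. y \<in> U' \<and> unit_normal_field \<Omega> U' N' \<and> - divergence U N y = - divergence U' N' y" using U by blast
  fix h assume "\<exists>U N. y \<in> U \<and> unit_normal_field \<Omega> U N \<and> h = - divergence U N y"
  then obtain V M where V: "y \<in> V" "unit_normal_field \<Omega> V M" "h = - divergence V M y" by blast
  then show "h = - divergence U N y" using divergence_unit_normal_unique[OF \<Omega> y U V(2,1)] by simp
 qed
 ultimately show ?thesis by (simp add: mean_curvature_def)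
qed

lemma C2_boundary_points_borel: "{y. C2_boundary_point \<Omega> y} \<in> sets borel"
proof -
 have "{y. C2_boundary_point \<Omega> y} = frontier \<Omega> \<inter> \<Union>{U. \<exists>N. unit_normal_field \<Omega> U N}"
  by (auto simp: C2_boundary_point_def)
 moreover have "open (\<Union>{U. \<exists>N. unit_normal_field \<Omega> U N})" by (rule open_Union) (auto dest: unit_normal_fieldD(1))
 ultimately show ?thesis by (metis borel_closed borel_open frontier_closed sets.Int)
qed

text \<open>The extension of the normal that serves one point serves all boundary points near it.\<close>

lemma mean_curvature_cont:
 fixes \<Omega> :: "(real^'n) set"
 assumes \<Omega>: "open \<Omega>"
 shows "continuous_on {y. C2_boundary_point \<Omega> y} (mean_curvature \<Omega>)"
 unfolding continuous_on_def
proof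
 let ?P = "{y. C2_boundary_point \<Omega> y}"
 fix y assume "y \<in> ?P"
 then obtain U N where y: "y \<in> frontier \<Omega>" and U: "unit_normal_field \<Omega> U N" "y \<in> U" by (auto simp: C2_boundary_point_def)
 have o: "open U" by (rule unit_normal_fieldD(1)[OF U(1)])
 have "continuous_on U (\<lambda>y. - divergence U N y)"
  unfolding divergence_def using unit_normal_fieldD(2)[OF U(1)] by (intro continuous_intros) (simp add: C1_on_def)
 then have "continuous_on (?P \<inter> U) (\<lambda>y. - divergence U N y)" by (rule continuous_on_subset) auto
 then have "continuous_on (?P \<inter> U) (mean_curvature \<Omega>)"
  by (rule continuous_on_eq) (use mean_curvature_eq[OF \<Omega> _ U(1)] in \<open>auto simp: C2_boundary_point_def\<close>)
 then have "(mean_curvature \<Omega> \<longlongrightarrow> mean_curvature \<Omega> y) (at y within ?P \<inter> U)"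
  using \<open>y \<in> ?P\<close> U(2) by (auto simp: continuous_on_def)
 moreover have "at y within ?P \<inter> U = at y within ?P" by (rule at_within_nhd[OF U(2) o]) auto
 ultimately show "(mean_curvature \<Omega> \<longlongrightarrow> mean_curvature \<Omega> y) (at y within ?P)" by simp
qed

locale exterior_map = C2_map "- \<Omega>" f for \<Omega> :: "(real^'n) set" and f :: "real^'n \<Rightarrow> real^'m" +
 assumes n: "CARD('n) \<ge> 2" and open_\<Omega>: "open \<Omega>" and bounded_\<Omega>: "bounded \<Omega>" and lip: "lipschitz_boundary \<Omega>"
  and const: "\<forall>C\<in>components (frontier \<Omega>). f constant_on C"
begin

abbreviation D where "D \<equiv> - \<Omega>"
abbreviation \<sigma> where "\<sigma> x \<equiv> grad_norm_sq (- \<Omega>) f x"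

definition boundary_term where "boundary_term x = \<sigma> x / (1 + \<sigma> x) * mean_curvature \<Omega> x"

lemma frontier_D: "y \<in> frontier \<Omega> \<Longrightarrow> y \<in> D"
 using open_\<Omega> by (simp add: frontier_def interior_open)

lemma \<sigma>_cont: "continuous_on D \<sigma>"
 unfolding grad_norm_sq_def by (intro continuous_intros metric_grad_cont)

lemma \<sigma>_nonneg: "\<sigma> x \<ge> 0" by (simp add: grad_norm_sq_def sum_nonneg)

lemma f_deriv: "y \<in> D \<Longrightarrow> ((\<lambda>x. f x $ \<alpha>) has_derivative (\<lambda>h. grad D f \<alpha> y \<bullet> h)) (at y within D)"
 unfolding grad_def D1_def by (rule has_derivative_partials) (use f_differentiable in \<open>simp add: differentiable_on_def\<close>)

lemma p_deriv: "y \<in> D \<Longrightarrow> (D1 D f \<alpha> i has_derivative (\<lambda>h. (\<chi> j. F \<alpha> i j y) \<bullet> h)) (at y within D)"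
 unfolding D2_def by (rule has_derivative_partials) (use p_differentiable in \<open>simp add: differentiable_on_def\<close>)

lemma locally_constant:
 assumes "y \<in> frontier \<Omega>"
 obtains r where "r > 0" "\<And>z. z \<in> frontier \<Omega> \<Longrightarrow> z \<in> ball y r \<Longrightarrow> f z = f y"
proof -
 obtain e r L \<Phi> where "lipschitz_chart \<Omega> y e r L \<Phi>" by (rule lipschitz_chart_exists[OF open_\<Omega> lip assms])
 then interpret chart: lipschitz_chart \<Omega> y e r L \<Phi> .
 show thesis by (rule that[OF chart.\<rho>(1) chart.locally_constant[OF const]])
qed

text \<open>\<open>f\<close> is constant on the boundary near \<open>y\<close>, so its tangential derivatives vanish.\<close>

lemma grad_normal:
 assumes y: "y \<in> frontier \<Omega>" and \<nu>: "inner_unit_normal \<Omega> y \<nu>"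
 shows "grad D f \<alpha> y = (grad D f \<alpha> y \<bullet> \<nu>) *\<^sub>R \<nu>"
proof (rule normal_multiple)
 show "norm \<nu> = 1" using \<nu> by (simp add: inner_unit_normal_def)
 obtain r where r: "r > 0" "\<And>z. z \<in> frontier \<Omega> \<Longrightarrow> z \<in> ball y r \<Longrightarrow> f z = f y"
  by (rule locally_constant[OF y]) (rule that)
 show "grad D f \<alpha> y \<bullet> \<tau> = 0" if "\<tau> \<bullet> \<nu> = 0" for \<tau>
  by (rule tangential_derivative_zero[OF open_\<Omega> y \<nu> that f_deriv[OF frontier_D[OF y]] r(1)]) (simp add: r(2))
qed

text \<open>Differentiating \<open>Df\<^sup>\<alpha> = \<lambda>\<^sup>\<alpha> N\<close> along the boundary: the tangential trace of the Hessian of a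
 function that is constant on the boundary is its normal derivative times the divergence of \<open>N\<close>.\<close>

lemma hessian_tangential_trace:
 assumes y: "y \<in> frontier \<Omega>" and U: "unit_normal_field \<Omega> U N" "y \<in> U"
 shows "(\<Sigma> k. F \<alpha> k k y) - (\<Sigma> k j. N y $ k * N y $ j * F \<alpha> k j y)
  = (grad D f \<alpha> y \<bullet> N y) * divergence U N y"
proof -
 define A where "A = unit_normal_deriv U N y"
 define H where "H i = (\<chi> j. F \<alpha> i j y)" for i
 define l where "l = grad D f \<alpha> y \<bullet> N y"
 note dN = unit_normal_field_deriv[OF U, folded A_def]
 have pH: "(D1 D f \<alpha> i has_derivative (\<lambda>h. H i \<bullet> h)) (at y within D)" for i
  unfolding H_def by (rule p_deriv[OF frontier_D[OF y]])
 have normal: "inner_unit_normal \<Omega> z (N z)" if "z \<in> frontier \<Omega>" "z \<in> U" for z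
  by (rule unit_normal_fieldD(4)[OF U(1) that])
 have nn: "N y \<bullet> N y = 1" using normal[OF y U(2)] by (simp add: inner_unit_normal_def norm_eq_1)
 define w where "w i z = p \<alpha> i z - (\<Sigma> k. p \<alpha> k z * N z $ k) * N z $ i" for i z
 have lw: "(\<Sigma> k. p \<alpha> k z * N z $ k) = grad D f \<alpha> z \<bullet> N z" for z by (simp add: inner_vec_def grad_def)
 have w0: "w i z = 0" if "z \<in> frontier \<Omega>" "z \<in> U" for z i
  using arg_cong[OF grad_normal[OF that(1) normal[OF that], of \<alpha>], of "\<lambda>v. v $ i"] unfolding w_def lw by (simp add: grad_def)
 have pl: "p \<alpha> i y = l * N y $ i" for i using w0[OF y U(2), of i] unfolding w_def lw l_def by simp
 define K where "K = (\<Sigma> k. N y $ k *\<^sub>R H k)"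
 define V where "V i = H i - N y $ i *\<^sub>R K - l *\<^sub>R A i" for i
 have dw: "(w i has_derivative (\<lambda>h. V i \<bullet> h)) (at y within D)" for i
 proof -
  have "(w i has_derivative (\<lambda>h. H i \<bullet> h - ((\<Sigma> k. p \<alpha> k y * N y $ k) * (A i \<bullet> h) + (\<Sigma> k. p \<alpha> k y * (A k \<bullet> h) + (H k \<bullet> h) * N y $ k) * N y $ i))) (at y within D)"
   unfolding w_def[abs_def] by (intro has_derivative_diff has_derivative_mult has_derivative_sum pH has_derivative_at_withinI[OF dN(1)])
  moreover have "H i \<bullet> h - ((\<Sigma> k. p \<alpha> k y * N y $ k) * (A i \<bullet> h) + (\<Sigma> k. p \<alpha> k y * (A k \<bullet> h) + (H k \<bullet> h) * N y $ k) * N y $ i) = V i \<bullet> h" for h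
  proof -
   have "(\<Sigma> k. p \<alpha> k y * (A k \<bullet> h)) = l * ((\<Sigma> k. N y $ k *\<^sub>R A k) \<bullet> h)"
    unfolding pl by (simp add: inner_sum_left sum_distrib_left mult.assoc)
   then have "(\<Sigma> k. p \<alpha> k y * (A k \<bullet> h)) = 0" unfolding dN(3) by simp
   then show ?thesis unfolding lw l_def[symmetric] sum.distrib V_def inner_diff_left
    by (simp add: K_def inner_sum_left mult_ac)
  qed
  ultimately show ?thesis by simp
 qed
 have "open U" by (rule unit_normal_fieldD(1)[OF U(1)])
 then obtain r where r: "r > 0" "ball y r \<subseteq> U" using U(2) by (rule openE)
 have par: "V i = (V i \<bullet> N y) *\<^sub>R N y" for i
 proof (rule normal_multiple)
  show "norm (N y) = 1" using nn by (simp add: norm_eq_1)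
  show "V i \<bullet> \<tau> = 0" if "\<tau> \<bullet> N y = 0" for \<tau>
   by (rule tangential_derivative_zero[OF open_\<Omega> y normal[OF y U(2)] that dw r(1)]) (use r w0 y U(2) in auto)
 qed
 have "(\<Sigma> i. V i $ i) = (\<Sigma> i. (V i \<bullet> N y) * N y $ i)"
  by (rule sum.cong[OF refl]) (use arg_cong[OF par, of "\<lambda>v. v $ _"] in \<open>simp only: vector_scaleR_component real_scaleR_def\<close>)
 also have "\<dots> = (\<Sigma> i. N y $ i *\<^sub>R V i) \<bullet> N y" by (simp add: inner_sum_left mult.commute)
 also have "(\<Sigma> i. N y $ i *\<^sub>R V i) = 0"
 proof -
  have "(\<Sigma> i. N y $ i *\<^sub>R V i) = K - (\<Sigma> i. N y $ i * N y $ i) *\<^sub>R K - l *\<^sub>R (\<Sigma> i. N y $ i *\<^sub>R A i)"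
   by (simp add: V_def scaleR_diff_right sum_subtractf scaleR_left.sum scaleR_right.sum mult.commute K_def[symmetric])
  then show ?thesis using nn by (simp add: dN(3) inner_vec_def)
 qed
 finally have "(\<Sigma> i. V i $ i) = 0" by simp
 moreover have "(\<Sigma> i. V i $ i) = (\<Sigma> k. F \<alpha> k k y) - (\<Sigma> i. N y $ i * (\<Sigma> k. N y $ k * F \<alpha> k i y)) - l * divergence U N y"
  unfolding dN(2) V_def K_def H_def by (simp add: sum_subtractf sum_component sum_distrib_left)
 moreover have "(\<Sigma> i. N y $ i * (\<Sigma> k. N y $ k * F \<alpha> k i y)) = (\<Sigma> k j. N y $ k * N y $ j * F \<alpha> k j y)"
  unfolding sum_distrib_left by (subst sum.swap) (simp add: mult_ac)
 ultimately show ?thesis by (simp add: l_def)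
qed

text \<open>With \<open>Df\<^sup>\<alpha> = \<lambda>\<^sup>\<alpha> N\<close> and \<open>s = |Df|\<^sup>2\<close> the metric is \<open>1 + s N N\<^sup>T\<close>, its inverse \<open>1 - s / (1 + s) N N\<^sup>T\<close>, and
\<open>u\<^sup>\<alpha> = \<lambda>\<^sup>\<alpha> / (1 + s) N\<close>. The contraction with \<open>N\<close> leaves the tangential trace of the Hessian, with the factor
\<open>\<lambda>\<^sup>\<alpha> / (1 + s)\<close>. The minus sign comes from the convention for the mean curvature, as \<open>N\<close> points into \<open>\<Omega>\<close>.\<close>

lemma flux_normal:
 assumes y: "y \<in> frontier \<Omega>" and U: "unit_normal_field \<Omega> U N" "y \<in> U"
 shows "flux_field D f y \<bullet> N y = - boundary_term y"
proof -
 have normal: "inner_unit_normal \<Omega> y (N y)" by (rule unit_normal_fieldD(4)[OF U(1) y U(2)])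
 have nn: "(\<Sigma> i. N y $ i * N y $ i) = 1" using normal by (simp add: inner_unit_normal_def norm_eq_1 inner_vec_def)
 define l where "l \<alpha> = grad D f \<alpha> y \<bullet> N y" for \<alpha>
 have gl: "grad D f \<alpha> y = l \<alpha> *\<^sub>R N y" for \<alpha> unfolding l_def by (rule grad_normal[OF y normal])
 have pl: "p \<alpha> i y = l \<alpha> * N y $ i" for \<alpha> i using arg_cong[OF gl, of "\<lambda>v. v $ i" \<alpha>] by (simp add: grad_def)
 have \<sigma>l: "\<sigma> y = (\<Sigma> \<alpha>. l \<alpha> * l \<alpha>)"
  unfolding grad_norm_sq_def gl using normal by (simp add: inner_unit_normal_def power2_eq_square)
 define s where "s = \<sigma> y"
 have s: "s \<ge> 0" unfolding s_def by (rule \<sigma>_nonneg)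
 have gN: "g i j y = kron i j + s * N y $ i * N y $ j" for i j
  unfolding g_eq pl s_def \<sigma>l by (simp add: sum_distrib_left sum_distrib_right mult_ac)
 define m where "m i j = kron i j - s / (1 + s) * (N y $ i * N y $ j)" for i j
 have gm: "(\<Sigma> k. g i k y * m k j) = kron i j" for i j
 proof -
  have "(\<Sigma> k. g i k y * m k j) = (\<Sigma> k. kron i k * m k j) + s * N y $ i * (\<Sigma> k. N y $ k * m k j)"
   by (simp add: gN distrib_right sum.distrib sum_distrib_left mult.assoc)
  also have "(\<Sigma> k. N y $ k * m k j) = N y $ j - s / (1 + s) * (\<Sigma> k. N y $ k * N y $ k) * N y $ j"
   by (simp add: m_def right_diff_distrib sum_subtractf sum_distrib_left sum_distrib_right mult_ac if_distrib[of "\<lambda>t. _ * t"] cong: if_cong)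
  also have "\<dots> = N y $ j / (1 + s)" unfolding nn using s by (simp add: field_simps add_nonneg_eq_0_iff)
  also have "(\<Sigma> k. kron i k * m k j) = m i j" by (simp add: if_distrib[of "\<lambda>t. t * _"] cong: if_cong)
  finally show ?thesis by (simp add: m_def)
 qed
 have hm: "h i j y = m i j" for i j
 proof -
  have "(\<Sigma> k. h i k y * (\<Sigma> a. g k a y * m a j)) = h i j y"
   unfolding gm by (simp add: if_distrib[of "\<lambda>t. _ * t"] cong: if_cong)
  moreover have "(\<Sigma> k. h i k y * (\<Sigma> a. g k a y * m a j)) = (\<Sigma> a. (\<Sigma> k. h i k y * g k a y) * m a j)"
   unfolding sum_distrib_left sum_distrib_right by (subst sum.swap) (simp add: mult.assoc)
  moreover have "\<dots> = m i j" unfolding inv_metric_entries by (simp add: if_distrib[of "\<lambda>t. t * _"] cong: if_cong)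
  ultimately show ?thesis by simp
 qed
 have mN: "(\<Sigma> j. N y $ j * m i j) = N y $ i / (1 + s)" for i
 proof -
  have "(\<Sigma> j. N y $ j * m i j) = N y $ i - s / (1 + s) * (\<Sigma> k. N y $ k * N y $ k) * N y $ i"
   by (simp add: m_def right_diff_distrib sum_subtractf sum_distrib_left sum_distrib_right mult_ac if_distrib[of "\<lambda>t. _ * t"] cong: if_cong)
  then show ?thesis unfolding nn using s by (simp add: field_simps add_nonneg_eq_0_iff)
 qed
 have uN: "u \<alpha> i y = l \<alpha> / (1 + s) * N y $ i" for \<alpha> i
 proof -
  have "u \<alpha> i y = l \<alpha> * (\<Sigma> j. N y $ j * m i j)"
   unfolding metric_grad_component hm pl sum_distrib_left by (simp add: mult_ac)
  then show ?thesis by (simp add: mN)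
 qed
 have coeff: "(\<Sigma> j. N y $ j * (h i k y * u \<alpha> j y - h i j y * u \<alpha> k y)) = l \<alpha> / (1 + s) * (kron i k - N y $ i * N y $ k)" for \<alpha> i k
 proof -
  have "(\<Sigma> j. N y $ j * (h i k y * u \<alpha> j y - h i j y * u \<alpha> k y))
   = m i k * (l \<alpha> / (1 + s)) * (\<Sigma> j. N y $ j * N y $ j) - (\<Sigma> j. N y $ j * m i j) * (l \<alpha> / (1 + s) * N y $ k)"
   by (simp add: hm uN right_diff_distrib sum_subtractf sum_distrib_left sum_distrib_right sum_divide_distrib mult_ac)
  also have "\<dots> = l \<alpha> / (1 + s) * (m i k - N y $ i * N y $ k / (1 + s))"
   unfolding nn mN by (simp add: right_diff_distrib mult_ac)
  also have "m i k - N y $ i * N y $ k / (1 + s) = kron i k - N y $ i * N y $ k"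
  proof -
   have "s / (1 + s) * (N y $ i * N y $ k) + N y $ i * N y $ k / (1 + s) = N y $ i * N y $ k"
   proof -
    have "t * X + X / r = X" if "t + 1 / r = 1" for t r X :: real
     using arg_cong[OF that, of "\<lambda>t. t * X"] by (simp add: distrib_right)
    moreover have "s / (1 + s) + 1 / (1 + s) = 1"
     using s by (simp add: add_divide_distrib[symmetric] add.commute)
    ultimately show ?thesis by blast
   qed
   then show ?thesis unfolding m_def by linarith
  qed
  finally show ?thesis .
 qed
 have "flux_field D f y \<bullet> N y = (\<Sigma> j \<alpha> i k. N y $ j * (h i k y * u \<alpha> j y - h i j y * u \<alpha> k y) * F \<alpha> i k y)"
  by (simp add: inner_vec_def flux_field_def flux_coeff_def sum_distrib_left sum_distrib_right mult_ac)
 also have "\<dots> = (\<Sigma> \<alpha> i k j. N y $ j * (h i k y * u \<alpha> j y - h i j y * u \<alpha> k y) * F \<alpha> i k y)"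
  by (rule sum_swap4[symmetric])
 also have "\<dots> = (\<Sigma> \<alpha> i k. l \<alpha> / (1 + s) * (kron i k - N y $ i * N y $ k) * F \<alpha> i k y)"
  unfolding sum_distrib_right[symmetric] coeff ..
 also have "\<dots> = (\<Sigma> \<alpha>. l \<alpha> / (1 + s) * ((\<Sigma> k. F \<alpha> k k y) - (\<Sigma> k j. N y $ k * N y $ j * F \<alpha> k j y)))"
 proof (rule sum.cong[OF refl])
  fix \<alpha>
  define c where "c = l \<alpha> / (1 + s)"
  have "c * (kron i k - N y $ i * N y $ k) * F \<alpha> i k y
   = c * (if i = k then F \<alpha> i k y else 0) - c * (N y $ i * N y $ k * F \<alpha> i k y)" for i k
   by (simp add: algebra_simps)
  then have "(\<Sigma> i k. c * (kron i k - N y $ i * N y $ k) * F \<alpha> i k y)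
   = c * (\<Sigma> i k. if i = k then F \<alpha> i k y else 0) - c * (\<Sigma> i k. N y $ i * N y $ k * F \<alpha> i k y)"
   by (simp only: sum_subtractf sum_distrib_left)
  then show "(\<Sigma> i k. l \<alpha> / (1 + s) * (kron i k - N y $ i * N y $ k) * F \<alpha> i k y)
   = l \<alpha> / (1 + s) * ((\<Sigma> k. F \<alpha> k k y) - (\<Sigma> k j. N y $ k * N y $ j * F \<alpha> k j y))"
   unfolding c_def[symmetric] by (simp add: right_diff_distrib)
 qed
 also have "\<dots> = s / (1 + s) * divergence U N y"
  unfolding hessian_tangential_trace[OF y U] l_def[symmetric] s_def \<sigma>l by (simp add: sum_divide_distrib sum_distrib_left sum_distrib_right mult_ac)
 finally show ?thesis unfolding boundary_term_def mean_curvature_eq[OF open_\<Omega> y U] s_def by simp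
qed

end

section \<open>The boundary where the gradient does not vanish\<close>

context exterior_map begin

text \<open>Although the mean curvature may be unbounded, the boundary term is not: where the mean curvature exists, the
term is a component of the flux field, which is continuous up to the boundary.\<close>

lemma boundary_term_le: "y \<in> frontier \<Omega> \<Longrightarrow> \<bar>boundary_term y\<bar> \<le> norm (flux_field D f y)"
proof -
 assume y: "y \<in> frontier \<Omega>"
 show ?thesis
 proof (cases "C2_boundary_point \<Omega> y")
  case True
  then obtain U N where U: "y \<in> U" "unit_normal_field \<Omega> U N" unfolding C2_boundary_point_def by blast
  have "\<bar>boundary_term y\<bar> = \<bar>flux_field D f y \<bullet> N y\<bar>" unfolding flux_normal[OF y U(2,1)] by simp
  also have "\<dots> \<le> norm (flux_field D f y) * norm (N y)" by (rule Cauchy_Schwarz_ineq2)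
  finally show ?thesis using unit_normal_fieldD(3)[OF U(2,1)] by simp
 next
  case False
  then show ?thesis by (simp add: boundary_term_def mean_curvature_def)
 qed
qed

lemma compact_boundary: "compact (frontier \<Omega>)"
 using bounded_\<Omega> by (rule compact_frontier_bounded)

lemma boundary_term_integrable: "set_integrable \<A> (frontier \<Omega>) boundary_term"
proof -
 let ?P = "{y. C2_boundary_point \<Omega> y}"
 have [measurable]: "?P \<in> sets borel" by (rule C2_boundary_points_borel)
 have PD: "?P \<subseteq> D" using frontier_D by (auto simp: C2_boundary_point_def)
 have "continuous_on ?P boundary_term"
  unfolding boundary_term_def[abs_def]
 proof (intro continuous_intros mean_curvature_cont open_\<Omega> continuous_on_subset[OF \<sigma>_cont PD] ballI)
  fix x show "1 + \<sigma> x \<noteq> 0" using \<sigma>_nonneg[of x] by linarith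
 qed
 then have "(\<lambda>x. indicator ?P x *\<^sub>R boundary_term x) \<in> borel_measurable borel"
  by (intro borel_measurable_continuous_on_indicator) auto
 moreover have "(\<lambda>x. indicator ?P x *\<^sub>R boundary_term x) = (\<lambda>x. indicator (frontier \<Omega>) x *\<^sub>R boundary_term x)"
  by (rule ext) (auto simp: indicator_def C2_boundary_point_def boundary_term_def mean_curvature_def)
 ultimately have m: "(\<lambda>x. indicator (frontier \<Omega>) x *\<^sub>R boundary_term x) \<in> borel_measurable \<A>"
  by (simp only: measurable_cong_sets[OF sets_area_measure refl])
 have "bounded (flux_field D f ` frontier \<Omega>)"
  by (intro compact_imp_bounded compact_continuous_image continuous_on_subset[OF flux_field_cont] compact_boundary subsetI frontier_D)
 then obtain B where B: "\<And>y. y \<in> frontier \<Omega> \<Longrightarrow> norm (flux_field D f y) \<le> B" unfolding bounded_iff by blast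
 show ?thesis unfolding set_integrable_def
 proof (rule integrableI_bounded_set[where A = "frontier \<Omega>" and B = B])
  show "emeasure \<A> (frontier \<Omega>) < \<infinity>"
   using boundary_area_finite[OF n open_\<Omega> bounded_\<Omega> lip] by simp
  show "AE x in \<A>. x \<in> frontier \<Omega> \<longrightarrow> norm (indicator (frontier \<Omega>) x *\<^sub>R boundary_term x) \<le> B"
   using boundary_term_le B by (intro AE_I2) (auto intro: order_trans)
 qed (use m in auto)
qed

text \<open>The first-order expansion of \<open>f\<^sup>\<alpha>\<close> at a boundary point, evaluated along the boundary, where \<open>f\<^sup>\<alpha>\<close> does not change.
It says that \<open>\<Phi>\<close> is differentiable as soon as \<open>\<partial>\<^sub>e f\<^sup>\<alpha> \<noteq> 0\<close>.\<close>

lemma chart_derivative: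
 fixes \<alpha> :: "'m"
 assumes "lipschitz_chart \<Omega> y0 e r L \<Phi>" and z: "norm (proj e (z - y0)) < r / (1 + L) / (1 + L)"
 defines "c \<equiv> grad D f \<alpha> (lift e \<Phi> z)"
 shows "((\<lambda>w. (c \<bullet> e) * \<Phi> w) has_derivative (\<lambda>h. - (proj e c \<bullet> h))) (at z)"
proof -
 interpret chart: lipschitz_chart \<Omega> y0 e r L \<Phi> by fact
 let ?G = "lift e \<Phi>"
 have L1: "1 + L > 0" using chart.L by simp
 define s where "s = chart.\<rho> / (1 + L)"
 have s: "s \<le> chart.\<rho>" using L1 chart.\<rho> chart.L by (simp add: s_def field_simps)
 have zs: "norm (proj e (z - y0)) < s" using z by (simp add: s_def chart.\<rho>_def)
 have G: "?G w \<in> frontier \<Omega>" "?G w \<in> ball y0 chart.\<rho>" if "norm (proj e (w - y0)) < s" for w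
 proof -
  show "?G w \<in> frontier \<Omega>" using chart.lift_near(2) that s by simp
  have "dist (?G w) y0 \<le> (1 + L) * norm (proj e (w - y0))" using chart.lift_dist[of w y0] by (simp add: chart.lift_y0)
  also have "\<dots> < (1 + L) * s" using that L1 by simp
  also have "\<dots> = chart.\<rho>" using L1 by (simp add: s_def)
  finally show "?G w \<in> ball y0 chart.\<rho>" by (simp add: dist_commute)
 qed
 have fG: "f (?G w) = f y0" if "norm (proj e (w - y0)) < s" for w
  by (rule chart.locally_constant[OF const G[OF that]])
 have cp: "c \<bullet> proj e x = proj e c \<bullet> x" for x
  by (simp add: proj_def inner_diff_left inner_diff_right inner_commute)
 show ?thesis unfolding has_derivative_at_alt
 proof (intro conjI allI impI)
  show "bounded_linear (\<lambda>h. - (proj e c \<bullet> h))" by (intro bounded_linear_minus bounded_linear_inner_right)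
  fix b :: real assume b: "0 < b"
  define b' where "b' = b / (1 + L)"
  have b': "b' > 0" "b' * (1 + L) = b" using b L1 by (auto simp: b'_def)
  obtain d where d: "d > 0" "\<And>y. y \<in> D \<Longrightarrow> norm (y - ?G z) < d \<Longrightarrow> norm (f y $ \<alpha> - f (?G z) $ \<alpha> - c \<bullet> (y - ?G z)) \<le> b' * norm (y - ?G z)"
   using f_deriv[OF frontier_D[OF G(1)[OF zs]], of \<alpha>] b'(1) unfolding has_derivative_within_alt c_def by blast
  define t where "t = min (d / (1 + L)) (s - norm (proj e (z - y0)))"
  have t: "t > 0" using d L1 zs by (simp add: t_def)
  have "norm ((c \<bullet> e) * \<Phi> w - (c \<bullet> e) * \<Phi> z - - (proj e c \<bullet> (w - z))) \<le> b * norm (w - z)" if w: "norm (w - z) < t" for w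
  proof -
   have "proj e (w - y0) = proj e (w - z) + proj e (z - y0)" by (simp add: proj_def inner_diff_right algebra_simps)
   then have "norm (proj e (w - y0)) \<le> norm (w - z) + norm (proj e (z - y0))"
    using norm_triangle_ineq[of "proj e (w - z)" "proj e (z - y0)"] norm_proj_le[OF chart.e, of "w - z"] by simp
   then have ws: "norm (proj e (w - y0)) < s" using w by (simp add: t_def)
   have Gd: "norm (?G w - ?G z) \<le> (1 + L) * norm (w - z)" using chart.lift_dist'[of w z] by (simp add: dist_norm)
   also have "\<dots> < (1 + L) * (d / (1 + L))" using w L1 by (intro mult_strict_left_mono) (auto simp: t_def)
   finally have "norm (?G w - ?G z) < d" using L1 by simp
   then have "norm (f (?G w) $ \<alpha> - f (?G z) $ \<alpha> - c \<bullet> (?G w - ?G z)) \<le> b' * norm (?G w - ?G z)"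
    by (rule d(2)[OF frontier_D[OF G(1)[OF ws]]])
   also have "\<dots> \<le> b' * ((1 + L) * norm (w - z))" using Gd b' by (intro mult_left_mono) auto
   also have "\<dots> = b * norm (w - z)" using b'(2) by (simp only: mult.assoc[symmetric])
   finally have "\<bar>c \<bullet> (?G w - ?G z)\<bar> \<le> b * norm (w - z)" by (simp add: fG[OF ws] fG[OF zs])
   moreover have "c \<bullet> (?G w - ?G z) = (c \<bullet> e) * \<Phi> w - (c \<bullet> e) * \<Phi> z - - (proj e c \<bullet> (w - z))"
    unfolding chart.lift_diff inner_add_right cp inner_scaleR_right by (simp add: algebra_simps)
   ultimately show ?thesis by simp
  qed
  then show "\<exists>t>0. \<forall>w. norm (w - z) < t \<longrightarrow> norm ((c \<bullet> e) * \<Phi> w - (c \<bullet> e) * \<Phi> z - - (proj e c \<bullet> (w - z))) \<le> b * norm (w - z)"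
   using t by blast
 qed
qed

text \<open>Where \<open>Df \<noteq> 0\<close> the boundary is a level set with nonvanishing gradient. The Lipschitz graph
 function is then differentiable, and its gradient is given by implicit differentiation.\<close>

lemma C1_chart:
 assumes y0: "y0 \<in> frontier \<Omega>" and nz: "\<sigma> y0 \<noteq> 0"
 shows "\<exists>r>0. \<exists>e \<Phi> q W. graph_chart e \<Phi> q W \<and> ball y0 r \<subseteq> W \<and> D \<inter> ball y0 r = {x\<in>ball y0 r. e \<bullet> x \<le> \<Phi> x} \<and>
  frontier \<Omega> \<inter> ball y0 r = graph e \<Phi> \<inter> ball y0 r \<and>
  (\<forall>z\<in>frontier \<Omega> \<inter> ball y0 r. inner_unit_normal \<Omega> z (graph_chart.normal e q z))"
proof -
 obtain \<alpha> where \<alpha>: "grad D f \<alpha> y0 \<noteq> 0"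
 proof -
  have "\<exists>\<alpha>. grad D f \<alpha> y0 \<noteq> 0"
  proof (rule ccontr)
   assume "\<nexists>\<alpha>. grad D f \<alpha> y0 \<noteq> 0"
   then have "\<sigma> y0 = 0" by (simp add: grad_norm_sq_def)
   then show False using nz by simp
  qed
  then show thesis using that by blast
 qed
 obtain e r L \<Phi> where chart: "lipschitz_chart \<Omega> y0 e r L \<Phi>" by (rule lipschitz_chart_exists[OF open_\<Omega> lip y0])
 then interpret chart: lipschitz_chart \<Omega> y0 e r L \<Phi> .
 let ?G = "lift e \<Phi>"
 have L1: "1 + L > 0" using chart.L by simp
 define t where "t = chart.\<rho> / (1 + L)"
 have t: "0 < t" "t = r / (1 + L) / (1 + L)" using chart.\<rho> L1 by (auto simp: t_def chart.\<rho>_def)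
 define a where "a y = grad D f \<alpha> y \<bullet> e" for y
 define P where "P y = proj e (grad D f \<alpha> y)" for y
 have \<Phi>': "((\<lambda>w. a (?G z) * \<Phi> w) has_derivative (\<lambda>h. - (P (?G z) \<bullet> h))) (at z)" if "norm (proj e (z - y0)) < t" for z
  unfolding a_def P_def by (rule chart_derivative[OF chart]) (use that t(2) in simp)
 \<comment> \<open>otherwise \<open>chart_derivative\<close> makes the part of \<open>Df\<^sup>\<alpha>\<close> orthogonal to \<open>e\<close> vanish as well\<close>
 have a0: "a y0 \<noteq> 0"
 proof
  assume 0: "a y0 = 0"
  have "((\<lambda>w. 0) has_derivative (\<lambda>h. - (P y0 \<bullet> h))) (at y0)"
   using \<Phi>'[of y0] t(1) by (simp add: chart.lift_y0 0 proj_def)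
  then have "(\<lambda>h. - (P y0 \<bullet> h)) = (\<lambda>h. 0)" using has_derivative_unique[OF _ has_derivative_const] by blast
  from fun_cong[OF this, of "P y0"] have "P y0 = 0" by simp
  then show False using \<alpha> 0 by (simp add: P_def a_def proj_def inner_commute)
 qed
 have ac: "continuous_on D a" unfolding a_def by (intro continuous_intros metric_grad_cont)
 have Pc: "continuous_on D P" unfolding P_def proj_def by (intro continuous_intros metric_grad_cont)
 obtain d where d: "d > 0" "\<And>y. y \<in> D \<Longrightarrow> dist y y0 < d \<Longrightarrow> a y \<noteq> 0"
 proof -
  obtain d where "d > 0" "\<forall>y\<in>D. dist y y0 < d \<longrightarrow> dist (a y) (a y0) < \<bar>a y0\<bar>"
   using ac frontier_D[OF y0] a0 unfolding continuous_on_iff by (metis zero_less_abs_iff)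
  then show thesis by (intro that[of d]) (auto simp: dist_real_def)
 qed
 define s where "s = min d chart.\<rho>"
 define r' where "r' = s / (1 + L)"
 have s: "s > 0" "s \<le> d" "s \<le> chart.\<rho>" using d chart.\<rho> by (auto simp: s_def)
 have r': "0 < r'" "r' \<le> t" "r' \<le> s"
 proof -
  show "0 < r'" "r' \<le> t" using s L1 by (auto simp: r'_def t_def divide_right_mono)
  have "s * 1 \<le> s * (1 + L)" using s chart.L by (intro mult_left_mono) auto
  then show "r' \<le> s" using L1 by (simp add: r'_def divide_le_eq)
 qed
 define W where "W = {z. norm (proj e (z - y0)) < r'}"
 define q where "q z = - (1 / a (?G z)) *\<^sub>R P (?G z)" for z
 have GW: "?G z \<in> frontier \<Omega>" "a (?G z) \<noteq> 0" if "z \<in> W" for z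
 proof -
  have zr: "norm (proj e (z - y0)) < r'" using that by (simp add: W_def)
  show fr: "?G z \<in> frontier \<Omega>" using zr r' s by (intro chart.lift_near(2)) simp
  have "dist (?G z) y0 \<le> (1 + L) * norm (proj e (z - y0))" using chart.lift_dist[of z y0] by (simp add: chart.lift_y0)
  also have "\<dots> < (1 + L) * r'" using zr L1 by simp
  also have "\<dots> = s" using L1 by (simp add: r'_def)
  finally show "a (?G z) \<noteq> 0" using s(2) by (intro d(2) frontier_D fr) simp
 qed
 have Gc: "continuous_on S ?G" for S unfolding lift_def[abs_def] by (intro continuous_intros chart.\<Phi>_cont)
 have gc: "graph_chart e \<Phi> q W"
 proof
  show "continuous_on UNIV \<Phi>" by (rule chart.\<Phi>_cont)
  show "\<Phi> (x + s *\<^sub>R e) = \<Phi> x" for x s by (rule chart.\<Phi>_line)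
  show "open W" unfolding W_def proj_def by (intro open_Collect_less continuous_intros)
  show "x + s *\<^sub>R e \<in> W" if "x \<in> W" for x s
  proof -
   have "proj e (x + s *\<^sub>R e - y0) = proj e (x - y0)"
    using proj_add_line[OF chart.e, of "x - y0" s] by (simp add: add_diff_eq diff_add_eq)
   then show ?thesis using that by (simp add: W_def)
  qed
  show "(\<Phi> has_derivative (\<lambda>h. q x \<bullet> h)) (at x)" if "x \<in> W" for x
  proof -
   have "norm (proj e (x - y0)) < t" using that r'(2) by (simp add: W_def)
   from has_derivative_mult_right[OF \<Phi>'[OF this], of "1 / a (?G x)"]
   show ?thesis using GW(2)[OF that] by (simp add: q_def)
  qed
  have im: "?G ` W \<subseteq> D" using GW(1) frontier_D by blast
  show "continuous_on W q" unfolding q_def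
  proof (intro continuous_intros)
   show "continuous_on W (\<lambda>x. a (?G x))" by (rule continuous_on_compose2[OF ac Gc im])
   show "continuous_on W (\<lambda>x. P (?G x))" by (rule continuous_on_compose2[OF Pc Gc im])
  qed (use GW in auto)
 qed (rule n chart.e)+
 then interpret gc: graph_chart e \<Phi> q W .
 have r'r: "r' \<le> r" using r' s chart.\<rho> by simp
 have sub: "ball y0 r' \<subseteq> W" unfolding W_def using chart.proj_ball by auto
 have inb: "x \<in> ball y0 r" if "x \<in> ball y0 r'" for x using that r'r by simp
 have 1: "D \<inter> ball y0 r' = {x\<in>ball y0 r'. e \<bullet> x \<le> \<Phi> x}"
  using chart.\<Omega>_chart[OF inb] by (intro set_eqI) (auto simp del: mem_ball)
 have 2: "frontier \<Omega> \<inter> ball y0 r' = graph e \<Phi> \<inter> ball y0 r'"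
  using chart.frontier_iff[OF inb] by (intro set_eqI) (auto simp: graph_def simp del: mem_ball)
 have 3: "inner_unit_normal \<Omega> z (gc.normal z)" if z: "z \<in> frontier \<Omega> \<inter> ball y0 r'" for z
 proof -
  have zW: "z \<in> W" and zb: "z \<in> ball y0 r" and ez: "e \<bullet> z = \<Phi> z" using z sub inb chart.frontier_iff by auto
  have J1: "gc.J z \<ge> 1" by (simp add: gc.J_def)
  have Jn: "gc.J z * (gc.normal z \<bullet> v) = (e - q z) \<bullet> v" for v using J1 by (simp add: gc.normal_def)
  have "(norm (e - q z))\<^sup>2 = (gc.J z)\<^sup>2"
   using gc.q_e[OF zW] gc.ee by (simp add: power2_norm_eq_inner inner_diff_left inner_diff_right inner_commute gc.J_def)
  then have "norm (e - q z) = gc.J z" using J1 by (simp add: power2_eq_iff_nonneg)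
  then have nn: "norm (gc.normal z) = 1" using J1 by (simp add: gc.normal_def)
  show ?thesis unfolding inner_unit_normal_def
  proof (intro conjI nn allI impI)
   fix c :: real assume c: "c > 0"
   obtain d where d: "d > 0" "\<And>w. norm (w - z) < d \<Longrightarrow> norm (\<Phi> w - \<Phi> z - q z \<bullet> (w - z)) \<le> c * norm (w - z)"
    using gc.\<Phi>_deriv[OF zW] c unfolding has_derivative_at_alt by blast
   have "\<forall>\<^sub>F w in nhds z. w \<in> ball y0 r \<inter> ball z d"
    using zb d(1) by (intro eventually_nhds_in_open) auto
   then show "\<forall>\<^sub>F w in nhds z. (gc.normal z \<bullet> (w - z) > c * norm (w - z) \<longrightarrow> w \<in> \<Omega>) \<and>
     (gc.normal z \<bullet> (w - z) < - c * norm (w - z) \<longrightarrow> w \<notin> \<Omega>)"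
   proof eventually_elim
    case (elim w)
    let ?b = "gc.normal z \<bullet> (w - z)"
    have w: "w \<in> ball y0 r" "norm (w - z) < d" using elim by (auto simp: dist_norm norm_minus_commute)
    have err: "\<bar>\<Phi> w - \<Phi> z - q z \<bullet> (w - z)\<bar> \<le> c * norm (w - z)" using d(2)[OF w(2)] by simp
    have ew: "e \<bullet> w - \<Phi> w = gc.J z * ?b - (\<Phi> w - \<Phi> z - q z \<bullet> (w - z))"
     unfolding Jn using ez by (simp add: inner_diff_left inner_diff_right)
    have "w \<in> \<Omega>" if "?b > c * norm (w - z)"
    proof -
     have "?b \<ge> 0" using that c by (smt (verit) mult_nonneg_nonneg norm_ge_zero)
     then have "1 * ?b \<le> gc.J z * ?b" using J1 by (intro mult_right_mono) auto
     then have "\<Phi> w < e \<bullet> w" using ew err that by linarith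
     then show ?thesis using chart.\<Omega>_chart[OF w(1)] by simp
    qed
    moreover have "w \<notin> \<Omega>" if "?b < - c * norm (w - z)"
    proof -
     have "?b \<le> 0" using that c by (smt (verit) mult_nonneg_nonneg norm_ge_zero mult_minus_left)
     then have "gc.J z * ?b \<le> 1 * ?b" using J1 by (intro mult_right_mono_neg) auto
     then have "e \<bullet> w < \<Phi> w" using ew err that by linarith
     then show ?thesis using chart.\<Omega>_chart[OF w(1)] by simp
    qed
    ultimately show ?case by blast
   qed
  qed
 qed
 show ?thesis using r'(1) gc sub 1 2 3 by blast
qed

lemma flux_chart_normal:
 assumes x: "C2_boundary_point \<Omega> x" and \<nu>: "inner_unit_normal \<Omega> x \<nu>"
 shows "flux_field D f x \<bullet> \<nu> = - boundary_term x"
proof -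
 obtain U N where U: "x \<in> frontier \<Omega>" "x \<in> U" "unit_normal_field \<Omega> U N" using x unfolding C2_boundary_point_def by blast
 have "\<nu> = N x" by (rule inner_unit_normal_unique[OF \<nu> unit_normal_fieldD(4)[OF U(3,1,2)]])
 then show ?thesis using flux_normal[OF U(1,3,2)] by simp
qed

end

section \<open>Round spheres\<close>

text \<open>The round sphere is the graph of \<open>sqrt (r\<^sup>2 - |x'|\<^sup>2)\<close> near each of its points; the cut-off
 by \<open>max\<close> only serves to have a function on the whole space.\<close>

lemma sphere_chart:
 fixes y :: "real^'n"
 assumes n: "CARD('n) \<ge> 2" and r: "r > 0" and y: "norm y = r"
 shows "\<exists>e \<Phi> q W. graph_chart e \<Phi> q W \<and> ball y r \<subseteq> W \<and>
  (\<forall>x\<in>ball y r. (norm x \<le> r \<longleftrightarrow> e \<bullet> x \<le> \<Phi> x) \<and> (norm x = r \<longleftrightarrow> e \<bullet> x = \<Phi> x) \<and>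
   (norm x = r \<longrightarrow> graph_chart.normal e q x = (1 / r) *\<^sub>R x))"
proof -
 define e where "e = (1 / r) *\<^sub>R y"
 have e: "norm e = 1" using r y by (simp add: e_def)
 have ee: "e \<bullet> e = 1" using e by (simp add: norm_eq_1)
 let ?P = "proj e"
 have Pc: "continuous_on S ?P" for S unfolding proj_def by (intro continuous_intros)
 define \<Phi> where "\<Phi> x = sqrt (max 0 (r\<^sup>2 - (norm (?P x))\<^sup>2))" for x
 define W where "W = {x. norm (?P x) < r}"
 define q where "q x = - (1 / \<Phi> x) *\<^sub>R ?P x" for x
 have \<Phi>c: "continuous_on S \<Phi>" for S unfolding \<Phi>_def by (intro continuous_intros Pc)
 have rP: "r\<^sup>2 - (norm (?P x))\<^sup>2 > 0" if "x \<in> W" for x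
  using that r power_strict_mono[of "norm (?P x)" r 2] by (simp add: W_def)
 have \<Phi>pos: "\<Phi> x > 0" "\<Phi> x = sqrt (r\<^sup>2 - (norm (?P x))\<^sup>2)" if "x \<in> W" for x
  using rP[OF that] by (simp_all add: \<Phi>_def)
 have Wo: "open W" unfolding W_def by (intro open_Collect_less continuous_intros Pc)
 have Pline: "?P (x + s *\<^sub>R e) = ?P x" for x s by (rule proj_add_line[OF e])
 have Pin: "?P x \<bullet> ?P h = ?P x \<bullet> h" for x h
  using ee by (simp add: proj_def inner_diff_left inner_diff_right inner_commute)
 have bl: "bounded_linear ?P" unfolding proj_def
  by (intro bounded_linear_sub bounded_linear_ident bounded_linear_scaleR_const bounded_linear_inner_right)
 have gc: "graph_chart e \<Phi> q W"
 proof
  show "(\<Phi> has_derivative (\<lambda>h. q x \<bullet> h)) (at x)" if x: "x \<in> W" for x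
  proof (rule has_derivative_transform_within_open[OF _ Wo x])
   have P': "(?P has_derivative ?P) (at x)" by (rule bounded_linear_imp_has_derivative[OF bl])
   have "((\<lambda>x. r\<^sup>2 - ?P x \<bullet> ?P x) has_derivative (\<lambda>h. 0 - (?P x \<bullet> ?P h + ?P h \<bullet> ?P x))) (at x)"
    by (intro has_derivative_diff has_derivative_const has_derivative_inner P')
   then have d: "((\<lambda>x. r\<^sup>2 - (norm (?P x))\<^sup>2) has_derivative (\<lambda>h. - 2 * (?P x \<bullet> h))) (at x)"
   proof -
    have "0 - (?P x \<bullet> ?P h + ?P h \<bullet> ?P x) = - 2 * (?P x \<bullet> h)" for h
     using Pin[of x h] inner_commute[of "?P h" "?P x"] by simp
    then show ?thesis using \<open>((\<lambda>x. r\<^sup>2 - ?P x \<bullet> ?P x) has_derivative _) (at x)\<close>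
     unfolding power2_norm_eq_inner by (simp only:)
   qed
   have eq: "(\<lambda>h. (- 2 * (?P x \<bullet> h)) * (inverse (sqrt (r\<^sup>2 - (norm (?P x))\<^sup>2)) / 2)) = (\<lambda>h. q x \<bullet> h)"
   proof (rule ext)
    fix h
    have "q x \<bullet> h = - (?P x \<bullet> h) / \<Phi> x" by (simp add: q_def)
    then show "(- 2 * (?P x \<bullet> h)) * (inverse (sqrt (r\<^sup>2 - (norm (?P x))\<^sup>2)) / 2) = q x \<bullet> h"
     by (simp add: \<Phi>pos(2)[OF x] inverse_eq_divide)
   qed
   show "((\<lambda>x. sqrt (r\<^sup>2 - (norm (?P x))\<^sup>2)) has_derivative (\<lambda>h. q x \<bullet> h)) (at x)"
    unfolding eq[symmetric] by (rule DERIV_compose_FDERIV[OF DERIV_real_sqrt[OF rP[OF x]] d])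
  qed (simp add: \<Phi>pos(2))
  show "continuous_on W q" unfolding q_def
  proof (intro continuous_intros \<Phi>c Pc ballI)
   fix x assume "x \<in> W" then show "\<Phi> x \<noteq> 0" using \<Phi>pos(1)[of x] by simp
  qed
  show "\<Phi> (x + s *\<^sub>R e) = \<Phi> x" for x s unfolding \<Phi>_def Pline ..
  show "x + s *\<^sub>R e \<in> W" if "x \<in> W" for x s using that unfolding W_def mem_Collect_eq Pline .
 qed (rule n e \<Phi>c Wo)+
 interpret gc: graph_chart e \<Phi> q W by (rule gc)
 have split: "(norm x)\<^sup>2 = (e \<bullet> x)\<^sup>2 + (norm (?P x))\<^sup>2" for x
  unfolding power2_norm_eq_inner using ee by (simp add: proj_def inner_diff_left inner_diff_right inner_commute power2_eq_square)
 have near: "x \<in> W" "e \<bullet> x > 0" if x: "x \<in> ball y r" for x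
 proof -
  have d: "norm (x - y) < r" using x by (simp add: dist_norm norm_minus_commute)
  have "?P y = 0" using r y by (simp add: proj_def e_def power2_norm_eq_inner[symmetric] power2_eq_square)
  then have "?P x = ?P (x - y)" by (simp add: proj_def inner_diff_right algebra_simps)
  then show "x \<in> W" using norm_proj_le[OF e, of "x - y"] d by (simp add: W_def)
  have "e \<bullet> y = r" using r y by (simp add: e_def power2_norm_eq_inner[symmetric] power2_eq_square)
  moreover have "\<bar>e \<bullet> (x - y)\<bar> \<le> norm (x - y)" using Cauchy_Schwarz_ineq2[of e "x - y"] e by simp
  ultimately show "e \<bullet> x > 0" using d by (simp add: inner_diff_right)
 qed
 have "(norm x \<le> r \<longleftrightarrow> e \<bullet> x \<le> \<Phi> x) \<and> (norm x = r \<longleftrightarrow> e \<bullet> x = \<Phi> x) \<and> (norm x = r \<longrightarrow> gc.normal x = (1 / r) *\<^sub>R x)"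
  if x: "x \<in> ball y r" for x
 proof -
  have \<Phi>2: "(\<Phi> x)\<^sup>2 = r\<^sup>2 - (norm (?P x))\<^sup>2" using rP[OF near(1)[OF x]] \<Phi>pos(2)[OF near(1)[OF x]] by simp
  have "norm x \<le> r \<longleftrightarrow> (norm x)\<^sup>2 \<le> r\<^sup>2" using r by (simp add: abs_le_square_iff[symmetric])
  also have "\<dots> \<longleftrightarrow> (e \<bullet> x)\<^sup>2 \<le> (\<Phi> x)\<^sup>2" using split[of x] \<Phi>2 by linarith
  also have "\<dots> \<longleftrightarrow> e \<bullet> x \<le> \<Phi> x" using near[OF x] \<Phi>pos(1)[OF near(1)[OF x]] by (simp add: abs_le_square_iff[symmetric])
  finally have 1: "norm x \<le> r \<longleftrightarrow> e \<bullet> x \<le> \<Phi> x" .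
  have "norm x = r \<longleftrightarrow> (norm x)\<^sup>2 = r\<^sup>2" using r by (simp add: power2_eq_iff_nonneg)
  also have "\<dots> \<longleftrightarrow> (e \<bullet> x)\<^sup>2 = (\<Phi> x)\<^sup>2" using split[of x] \<Phi>2 by linarith
  also have "\<dots> \<longleftrightarrow> e \<bullet> x = \<Phi> x" using near[OF x] \<Phi>pos(1)[OF near(1)[OF x]] by (simp add: power2_eq_iff_nonneg)
  finally have 2: "norm x = r \<longleftrightarrow> e \<bullet> x = \<Phi> x" .
  have 3: "gc.normal x = (1 / r) *\<^sub>R x" if nx: "norm x = r"
  proof -
   have ex: "e \<bullet> x = \<Phi> x" using 2 nx by simp
   have p: "\<Phi> x > 0" using \<Phi>pos(1)[OF near(1)[OF x]] .
   have "1 + (norm (q x))\<^sup>2 = ((\<Phi> x)\<^sup>2 + (norm (?P x))\<^sup>2) / (\<Phi> x)\<^sup>2"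
    using p by (simp add: q_def power_mult_distrib power_divide add_divide_distrib)
   also have "\<dots> = (r / \<Phi> x)\<^sup>2" unfolding \<Phi>2 by (simp add: power_divide \<Phi>2)
   finally have J: "gc.J x = r / \<Phi> x" using r p by (simp add: gc.J_def)
   have "e - q x = (1 / \<Phi> x) *\<^sub>R (\<Phi> x *\<^sub>R e + ?P x)" using p by (simp add: q_def scaleR_add_right)
   also have "\<Phi> x *\<^sub>R e + ?P x = x" by (simp add: ex[symmetric] proj_def)
   finally show ?thesis using p r by (simp add: gc.normal_def J)
  qed
  show ?thesis using 1 2 3 by blast
 qed
 then show ?thesis using gc near(1) by blast
qed

lemma radial_projection_lipschitz:
 fixes x y :: "'a::real_normed_vector"
 assumes "norm x \<ge> 1" "norm y \<ge> 1"
 shows "dist ((1 / norm x) *\<^sub>R x) ((1 / norm y) *\<^sub>R y) \<le> 2 * dist x y"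
proof -
 have x0: "norm x > 0" and y0: "norm y > 0" using assms by linarith+
 have "(1 / norm x) *\<^sub>R x - (1 / norm y) *\<^sub>R y = (1 / norm x) *\<^sub>R (x - y) + (1 / norm x - 1 / norm y) *\<^sub>R y"
  by (simp add: scaleR_diff_right scaleR_diff_left)
 then have "norm ((1 / norm x) *\<^sub>R x - (1 / norm y) *\<^sub>R y) \<le> norm ((1 / norm x) *\<^sub>R (x - y)) + norm ((1 / norm x - 1 / norm y) *\<^sub>R y)"
  by (simp only: norm_triangle_ineq)
 also have "norm ((1 / norm x - 1 / norm y) *\<^sub>R y) = \<bar>norm y - norm x\<bar> / norm x"
 proof -
  have "1 / norm x - 1 / norm y = (norm y - norm x) / (norm x * norm y)" using x0 y0 by (simp add: field_simps)
  then show ?thesis using x0 y0 by (simp add: abs_mult)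
 qed
 also have "norm ((1 / norm x) *\<^sub>R (x - y)) = norm (x - y) / norm x" by simp
 also have "norm (x - y) / norm x + \<bar>norm y - norm x\<bar> / norm x \<le> norm (x - y) / 1 + norm (x - y) / 1"
  using assms x0 norm_triangle_ineq3[of y x] by (intro add_mono frac_le) (auto simp: norm_minus_commute)
 finally show ?thesis by (simp add: dist_norm)
qed

text \<open>Near \<open>y\<close> the unit sphere is the radial projection of a ball in its tangent hyperplane at \<open>y\<close>, and that projection
is Lipschitz outside the unit ball.\<close>

lemma unit_sphere_area_finite:
 assumes n: "CARD('n) \<ge> 2"
 shows "emeasure \<A> (sphere (0::real^'n) 1) < top"
proof (rule compact_area_finite[OF compact_sphere])
 fix y :: "real^'n" assume "y \<in> sphere 0 1"
 then have y: "norm y = 1" by simp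
 have yy: "y \<bullet> y = 1" using y by (simp add: norm_eq_1)
 let ?A = "{x. y \<bullet> x = 0} \<inter> cball 0 3 :: (real^'n) set"
 define g where "g w = (1 / norm (w + y)) *\<^sub>R (w + y)" for w :: "real^'n"
 have cA: "compact ?A" by (intro closed_Int_compact closed_hyperplane compact_cball)
 have ge1: "norm (w + y) \<ge> 1" if "w \<in> ?A" for w
  using Cauchy_Schwarz_ineq2[of y "w + y"] that y by (simp add: inner_add_right yy)
 have "continuous_on ?A g" unfolding g_def using ge1 by (intro continuous_intros) force
 then have cg: "compact (g ` ?A)" using cA by (rule compact_continuous_image)
 have [measurable]: "?A \<in> sets borel" "g ` ?A \<in> sets borel" using cA cg by (auto intro: borel_closed compact_imp_closed)
 have sub: "sphere 0 1 \<inter> ball y (1/2) \<subseteq> g ` ?A"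
 proof
  fix x assume "x \<in> sphere 0 1 \<inter> ball y (1/2)"
  then have x: "norm x = 1" "norm (x - y) < 1 / 2" by (auto simp: dist_norm norm_minus_commute)
  have "\<bar>y \<bullet> (x - y)\<bar> \<le> norm (x - y)" using Cauchy_Schwarz_ineq2[of y "x - y"] y by simp
  then have yx: "y \<bullet> x \<ge> 1 / 2" using x(2) by (simp add: inner_diff_right yy)
  define w where "w = (1 / (y \<bullet> x)) *\<^sub>R x - y"
  have "norm w \<le> norm ((1 / (y \<bullet> x)) *\<^sub>R x) + norm y" unfolding w_def by (rule norm_triangle_ineq4)
  also have "\<dots> = 1 / (y \<bullet> x) + 1" using x y yx by simp
  also have "1 / (y \<bullet> x) \<le> 2" using yx by (simp add: field_simps)
  finally have "w \<in> ?A" using yx yy by (simp add: w_def inner_diff_right)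
  moreover have "x = g w" using x yx by (simp add: g_def w_def)
  ultimately show "x \<in> g ` ?A" by (rule rev_image_eqI)
 qed
 have "emeasure \<A> (g ` ?A) \<le> ennreal (2 ^ (CARD('n) - 1)) * emeasure \<A> ?A"
 proof (rule area_lipschitz_image[OF n])
  fix u v assume "u \<in> ?A" "v \<in> ?A"
  then show "dist (g u) (g v) \<le> 2 * dist u v"
   using radial_projection_lipschitz[OF ge1 ge1, of u v] by (simp add: g_def)
 qed auto
 also have "\<dots> < top"
 proof -
  have "emeasure \<A> ?A = emeasure (\<L> y) ?A" by (rule area_hyperplane[OF n y]) auto
  also have "\<dots> \<le> emeasure (\<L> y) (cball 0 3)" by (rule emeasure_mono) auto
  also have "\<dots> < top" unfolding plane_measure_cball_0[OF y zero_less_numeral] using plane_measure_unit_ball[OF y]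
   by (intro ennreal_mult_less_top[THEN iffD2]) (simp add: less_top)
  finally show ?thesis by (simp add: ennreal_mult_less_top)
 qed
 finally have fin: "emeasure \<A> (g ` ?A) < top" .
 show "\<exists>r>0. \<exists>B\<in>sets borel. sphere 0 1 \<inter> ball y r \<subseteq> B \<and> emeasure \<A> B < top" using sub fin
  by (intro exI[of _ "1/2"] conjI bexI[of _ "g ` ?A"]) auto
qed

lemma sphere_area_le:
 assumes n: "CARD('n) \<ge> 2" and r: "r > 0"
 shows "emeasure \<A> (sphere (0::real^'n) r) < top"
  and "measure \<A> (sphere (0::real^'n) r) \<le> r ^ (CARD('n) - 1) * measure \<A> (sphere (0::real^'n) 1)"
proof -
 let ?S = "sphere (0::real^'n)"
 have im: "?S r = (\<lambda>x. r *\<^sub>R x) ` ?S 1"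
 proof
  show "?S r \<subseteq> (\<lambda>x. r *\<^sub>R x) ` ?S 1"
  proof
   fix x assume "x \<in> ?S r"
   then show "x \<in> (\<lambda>x. r *\<^sub>R x) ` ?S 1" using r by (intro image_eqI[of _ _ "(1 / r) *\<^sub>R x"]) auto
  qed
 qed (use r in auto)
 have le: "emeasure \<A> (?S r) \<le> ennreal (r ^ (CARD('n) - 1)) * emeasure \<A> (?S 1)"
  unfolding im
 proof (rule area_lipschitz_image[OF n r])
  show "(\<lambda>x. r *\<^sub>R x) ` ?S 1 \<in> sets borel" unfolding im[symmetric] by simp
 qed (use r in \<open>auto simp: dist_norm scaleR_diff_right[symmetric]\<close>)
 also have "\<dots> < top" using unit_sphere_area_finite[OF n] by (simp add: ennreal_mult_less_top)
 finally show fin: "emeasure \<A> (?S r) < top" .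
 have "measure \<A> (?S r) \<le> enn2real (ennreal (r ^ (CARD('n) - 1)) * emeasure \<A> (?S 1))"
  unfolding measure_def using unit_sphere_area_finite[OF n] by (intro enn2real_mono le) (simp add: ennreal_mult_less_top)
 also have "\<dots> = r ^ (CARD('n) - 1) * measure \<A> (?S 1)" using r by (simp add: enn2real_mult measure_def)
 finally show "measure \<A> (?S r) \<le> r ^ (CARD('n) - 1) * measure \<A> (?S 1)" .
qed

lemma area_integral_continuous:
 fixes h :: "real^'n \<Rightarrow> real"
 assumes S: "compact S" "emeasure \<A> S < top" and h: "continuous_on S h"
 shows "set_integrable \<A> S h"
  and "(\<And>x. x \<in> S \<Longrightarrow> \<bar>h x\<bar> \<le> B) \<Longrightarrow> \<bar>LINT x:S|\<A>. h x\<bar> \<le> B * measure \<A> S"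
proof -
 have [measurable]: "S \<in> sets borel" using S(1) by (auto intro: borel_closed compact_imp_closed)
 have "(\<lambda>x. indicator S x *\<^sub>R h x) \<in> borel_measurable borel"
  using h by (intro borel_measurable_continuous_on_indicator) auto
 then have m: "(\<lambda>x. indicator S x *\<^sub>R h x) \<in> borel_measurable \<A>"
  by (simp only: measurable_cong_sets[OF sets_area_measure refl])
 have "bounded (h ` S)" by (intro compact_imp_bounded compact_continuous_image h S)
 then obtain C where C: "\<And>y. y \<in> S \<Longrightarrow> norm (h y) \<le> C" unfolding bounded_iff by blast
 show int: "set_integrable \<A> S h" unfolding set_integrable_def
  by (rule integrableI_bounded_set[where A = S and B = C]) (use S m C in auto)
 have i1: "integrable \<A> (\<lambda>x. indicator S x * B)" for B :: real
  by (rule integrableI_bounded_set[where A = S and B = "\<bar>B\<bar>"]) (use S in auto)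
 show "\<bar>LINT x:S|\<A>. h x\<bar> \<le> B * measure \<A> S" if B: "\<And>x. x \<in> S \<Longrightarrow> \<bar>h x\<bar> \<le> B"
 proof -
  have "\<bar>LINT x:S|\<A>. h x\<bar> \<le> (LINT x|\<A>. norm (indicator S x *\<^sub>R h x))"
   unfolding set_lebesgue_integral_def using integral_norm_bound[of \<A> "\<lambda>x. indicator S x *\<^sub>R h x"] by simp
  also have "\<dots> \<le> (LINT x|\<A>. indicator S x * B)"
   using int B by (intro integral_mono integrable_norm i1) (auto simp: set_integrable_def indicator_def)
  also have "\<dots> = B * measure \<A> S" by (simp add: mult.commute)
  finally show ?thesis .
 qed
qed

section \<open>Cutting off the zero set\<close>

lemma bounded_convergence:
 fixes F :: "nat \<Rightarrow> 'a::topological_space \<Rightarrow> real"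
 assumes M [measurable_cong]: "sets M = sets borel" and E [measurable]: "E \<in> sets borel" and fin: "emeasure M E < top"
  and m: "\<And>k. (\<lambda>x. indicator E x *\<^sub>R F k x) \<in> borel_measurable borel"
  and B: "\<And>k x. x \<in> E \<Longrightarrow> \<bar>F k x\<bar> \<le> B" and lim: "\<And>x. x \<in> E \<Longrightarrow> (\<lambda>k. F k x) \<longlonglongrightarrow> G x"
 shows "(\<lambda>k. LINT x:E|M. F k x) \<longlonglongrightarrow> (LINT x:E|M. G x)"
  and "set_integrable M E G"
proof -
 have lim': "(\<lambda>k. indicator E x *\<^sub>R F k x) \<longlonglongrightarrow> indicator E x *\<^sub>R G x" for x
  using lim[of x] by (cases "x \<in> E") auto
 have m': "(\<lambda>x. indicator E x *\<^sub>R F k x) \<in> borel_measurable M" for k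
  using m[of k] by (simp only: measurable_cong_sets[OF M refl])
 have mG: "(\<lambda>x. indicator E x *\<^sub>R G x) \<in> borel_measurable M"
  by (rule borel_measurable_LIMSEQ_real[OF lim' m'])
 have EM: "E \<in> sets M" by simp
 have i: "integrable M (\<lambda>x. indicator E x * B)"
  by (rule integrableI_bounded_set[where A = E and B = "\<bar>B\<bar>"]) (use fin EM in \<open>auto simp: less_top\<close>)
 have b: "AE x in M. norm (indicator E x *\<^sub>R F k x) \<le> indicator E x * B" for k
  using B by (intro AE_I2) (auto simp: indicator_def)
 have al: "AE x in M. (\<lambda>k. indicator E x *\<^sub>R F k x) \<longlonglongrightarrow> indicator E x *\<^sub>R G x"
  by (rule AE_I2) (rule lim')
 show "(\<lambda>k. LINT x:E|M. F k x) \<longlonglongrightarrow> (LINT x:E|M. G x)"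
  unfolding set_lebesgue_integral_def by (rule integral_dominated_convergence[OF mG m' i al b])
 show "set_integrable M E G"
  unfolding set_integrable_def by (rule integrable_dominated_convergence[OF mG m' i al b])
qed

lemma dominated_cutoff:
 fixes w :: "nat \<Rightarrow> 'a \<Rightarrow> real"
 assumes b: "set_integrable M A b" and m: "\<And>k. (\<lambda>x. indicator A x *\<^sub>R w k x) \<in> borel_measurable M"
  and w: "\<And>k x. 0 \<le> w k x" "\<And>k x. w k x \<le> 1" and lim: "\<And>x. (\<lambda>k. w k x * b x) \<longlonglongrightarrow> c x"
 shows "\<And>k. set_integrable M A (\<lambda>x. w k x * b x)" and "set_integrable M A c"
  and "(\<lambda>k. LINT x:A|M. w k x * b x) \<longlonglongrightarrow> (LINT x:A|M. c x)"
proof -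
 have eq: "indicator A x *\<^sub>R (w k x * b x) = (indicator A x *\<^sub>R w k x) * (indicator A x *\<^sub>R b x)" for k x
  by (simp add: indicator_def)
 have bi: "integrable M (\<lambda>x. indicator A x *\<^sub>R b x)" using b by (simp add: set_integrable_def)
 have m': "(\<lambda>x. indicator A x *\<^sub>R (w k x * b x)) \<in> borel_measurable M" for k
  unfolding eq by (rule borel_measurable_times[OF m borel_measurable_integrable[OF bi]])
 have l: "(\<lambda>k. indicator A x *\<^sub>R (w k x * b x)) \<longlonglongrightarrow> indicator A x *\<^sub>R c x" for x
  by (intro tendsto_scaleR tendsto_const lim)
 have mc: "(\<lambda>x. indicator A x *\<^sub>R c x) \<in> borel_measurable M" by (rule borel_measurable_LIMSEQ_real[OF l m'])
 have le: "AE x in M. norm (indicator A x *\<^sub>R (w k x * b x)) \<le> norm (indicator A x *\<^sub>R b x)" for k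
  using w by (intro AE_I2) (auto simp: indicator_def abs_mult mult_left_le_one_le)
 show "set_integrable M A (\<lambda>x. w k x * b x)" for k
  unfolding set_integrable_def by (rule Bochner_Integration.integrable_bound[OF bi m' le])
 have al: "AE x in M. (\<lambda>k. indicator A x *\<^sub>R (w k x * b x)) \<longlonglongrightarrow> indicator A x *\<^sub>R c x" by (rule AE_I2) (rule l)
 show "set_integrable M A c" unfolding set_integrable_def
  by (rule integrable_dominated_convergence[OF mc m' integrable_norm[OF bi] al le])
 show "(\<lambda>k. LINT x:A|M. w k x * b x) \<longlonglongrightarrow> (LINT x:A|M. c x)" unfolding set_lebesgue_integral_def
  by (rule integral_dominated_convergence[OF mc m' integrable_norm[OF bi] al le])
qed

text \<open>Cutting off near the zero set of \<open>\<sigma>\<close>: if \<open>\<nabla>\<sigma> \<bullet> X = O(\<sigma>)\<close>, as happens when both factors are \<open>O(\<sqrt>\<sigma>)\<close>, the gradient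
of the cut-off contributes a bounded term that tends to \<open>0\<close> pointwise. The zero set itself carries no divergence:
testing the weak divergence with the complementary cut-off, times any test function \<open>\<phi>\<close>, leaves in the limit the
integral of \<open>\<phi> s\<close> over the zero set, because \<open>X\<close> vanishes there.\<close>

lemma divergence_cutoff_limit:
 fixes X D\<sigma> :: "'a::euclidean_space \<Rightarrow> 'a"
 assumes E: "compact E" and X: "continuous_on E X" and s: "continuous_on E s" and weak: "weak_divergence E s X"
  and null: "AE x in lborel. x \<in> E \<longrightarrow> x \<in> interior E"
  and \<sigma>: "\<And>x. x \<in> interior E \<Longrightarrow> GDERIV \<sigma> x :> D\<sigma> x" "continuous_on E \<sigma>" "continuous_on E D\<sigma>" "\<And>x. \<sigma> x \<ge> 0"
  and XD: "\<And>x. x \<in> E \<Longrightarrow> \<bar>D\<sigma> x \<bullet> X x\<bar> \<le> C * \<sigma> x" and X0: "\<And>x. x \<in> E \<Longrightarrow> \<sigma> x = 0 \<Longrightarrow> X x = 0"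
 defines "w \<equiv> \<lambda>k x. step (real (Suc k) * \<sigma> x)" and "gw \<equiv> \<lambda>k x. (real (Suc k) * step' (real (Suc k) * \<sigma> x)) *\<^sub>R D\<sigma> x"
 shows "\<And>k x. x \<in> interior E \<Longrightarrow> GDERIV (w k) x :> gw k x"
  and "\<And>k. continuous_on E (w k)" and "\<And>k. continuous_on E (gw k)"
  and "\<And>x. (\<lambda>k. w k x) \<longlonglongrightarrow> (if \<sigma> x = 0 then 0 else 1)"
  and "(\<lambda>k. LINT x:E|lborel. w k x * s x + gw k x \<bullet> X x) \<longlonglongrightarrow> (LINT x:E|lborel. s x)"
proof -
 have Eb [measurable]: "E \<in> sets borel" using E by (auto intro: borel_closed compact_imp_closed)
 have fin: "emeasure lborel E < top" using emeasure_bounded_finite[OF compact_imp_bounded[OF E]] by simp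
 show gw: "GDERIV (w k) x :> gw k x" if "x \<in> interior E" for k x
 proof -
  have "(\<sigma> has_derivative (\<lambda>h. h \<bullet> D\<sigma> x)) (at x)" using \<sigma>(1)[OF that] by (simp add: gderiv_def)
  then have "((\<lambda>x. real (Suc k) * \<sigma> x) has_derivative (\<lambda>h. real (Suc k) * (h \<bullet> D\<sigma> x))) (at x)"
   by (rule has_derivative_mult_right)
  from DERIV_compose_FDERIV[OF DERIV_step this]
  show ?thesis by (simp add: gderiv_def w_def gw_def mult_ac)
 qed
 show wc: "continuous_on E (w k)" for k unfolding w_def
  by (rule continuous_on_compose2[OF step_cont]) (auto intro!: continuous_intros \<sigma>)
 show gwc: "continuous_on E (gw k)" for k unfolding gw_def
  by (intro continuous_intros \<sigma>(3) continuous_on_compose2[OF step'_cont]) (auto intro!: continuous_intros \<sigma>)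
 have ev: "\<forall>\<^sub>F k in sequentially. real (Suc k) * t \<ge> 2" if "t > 0" for t
 proof -
  obtain N where "2 / t < real N" using reals_Archimedean2 by blast
  then have N: "2 < real N * t" using that by (simp add: field_simps)
  show ?thesis
  proof (rule eventually_sequentiallyI[of N])
   fix k assume "N \<le> k"
   then have "real N * t \<le> real (Suc k) * t" using that by (intro mult_right_mono) auto
   then show "real (Suc k) * t \<ge> 2" using N by linarith
  qed
 qed
 show wl: "(\<lambda>k. w k x) \<longlonglongrightarrow> (if \<sigma> x = 0 then 0 else 1)" for x
 proof (cases "\<sigma> x = 0")
  case True then show ?thesis by (simp add: w_def step_eq_0)
 next
  case False
  then have "\<sigma> x > 0" using \<sigma>(4)[of x] by simp
  from ev[OF this] have "\<forall>\<^sub>F k in sequentially. w k x = 1" by eventually_elim (simp add: w_def step_eq_1)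
  then show ?thesis using False tendsto_eventually by auto
 qed
 have gl: "(\<lambda>k. gw k x \<bullet> X x) \<longlonglongrightarrow> 0" for x
 proof (cases "\<sigma> x = 0")
  case True then show ?thesis by (simp add: gw_def step'_eq_0)
 next
  case False
  then have "\<sigma> x > 0" using \<sigma>(4)[of x] by simp
  from ev[OF this] have "\<forall>\<^sub>F k in sequentially. gw k x \<bullet> X x = 0" by eventually_elim (simp add: gw_def step'_eq_0)
  then show ?thesis by (rule tendsto_eventually)
 qed
 obtain M where M: "\<And>t. step' t \<le> M" using step'_bounded by blast
 have M0: "M \<ge> 0" using M[of 0] step'_nonneg[of 0] by linarith
 \<comment> \<open>\<open>step'\<close> vanishes unless \<open>(k + 1) \<sigma> \<le> 2\<close>, which balances the factor \<open>k + 1\<close> of the gradient\<close>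
 have gb: "\<bar>gw k x \<bullet> X x\<bar> \<le> M * 2 * \<bar>C\<bar>" if x: "x \<in> E" for k x
 proof (cases "real (Suc k) * \<sigma> x \<le> 2")
  case True
  have "\<bar>gw k x \<bullet> X x\<bar> = real (Suc k) * step' (real (Suc k) * \<sigma> x) * \<bar>D\<sigma> x \<bullet> X x\<bar>"
   using step'_nonneg by (simp add: gw_def abs_mult)
  also have "\<dots> \<le> real (Suc k) * M * (\<bar>C\<bar> * \<sigma> x)"
  proof (intro mult_mono order_refl M)
   show "\<bar>D\<sigma> x \<bullet> X x\<bar> \<le> \<bar>C\<bar> * \<sigma> x" using XD[OF x] \<sigma>(4)[of x] by (meson abs_ge_self mult_right_mono order_trans)
  qed (use M0 step'_nonneg in auto)
  also have "\<dots> = M * (real (Suc k) * \<sigma> x) * \<bar>C\<bar>" by (simp only: mult_ac)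
  also have "\<dots> \<le> M * 2 * \<bar>C\<bar>" using True M0 by (intro mult_right_mono mult_left_mono) auto
  finally show ?thesis .
 next
  case False
  then have "gw k x = 0" by (simp add: gw_def step'_eq_0)
  then show ?thesis using M0 by simp
 qed
 have bdd: "\<exists>B. \<forall>x\<in>E. \<bar>u x\<bar> \<le> B" if "continuous_on E u" for u :: "'a \<Rightarrow> real"
 proof -
  have "bounded (u ` E)" by (intro compact_imp_bounded compact_continuous_image that E)
  then show ?thesis unfolding bounded_iff by auto
 qed
 obtain S where S: "\<And>x. x \<in> E \<Longrightarrow> \<bar>s x\<bar> \<le> S" using bdd[OF s] by blast
 have S1: "\<bar>a * s x\<bar> \<le> \<bar>S\<bar>" if "x \<in> E" "0 \<le> a" "a \<le> 1" for a x
 proof -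
  have "\<bar>a\<bar> * \<bar>s x\<bar> \<le> 1 * \<bar>S\<bar>" using S[OF that(1)] that by (intro mult_mono) auto
  then show ?thesis by (simp add: abs_mult)
 qed
 have w01: "0 \<le> w k x" "w k x \<le> 1" for k x by (simp_all add: w_def step_bounds)
 have meas: "(\<lambda>x. indicator E x *\<^sub>R u x) \<in> borel_measurable borel" if "continuous_on E u" for u :: "'a \<Rightarrow> real"
  by (rule borel_measurable_continuous_on_indicator[OF Eb that])
 let ?z = "\<lambda>x. if \<sigma> x = 0 then 1 else 0 :: real"
 have sint: "set_integrable lborel E s" by (rule set_integrable_compact[OF E s])
 have z1: "(\<lambda>k. (1 - w k x) * s x) \<longlonglongrightarrow> ?z x * s x" and z2: "(\<lambda>k. w k x * s x) \<longlonglongrightarrow> (1 - ?z x) * s x" for x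
  using tendsto_mult_right[OF tendsto_diff[OF tendsto_const wl], of 1 x "s x"] tendsto_mult_right[OF wl, of x "s x"]
  by (simp_all split: if_splits)
 have mw: "(\<lambda>x. indicator E x *\<^sub>R w k x) \<in> borel_measurable lborel" "(\<lambda>x. indicator E x *\<^sub>R (1 - w k x)) \<in> borel_measurable lborel" for k
  using meas[OF wc] meas[OF continuous_on_diff[OF continuous_on_const wc]] by simp_all
 note dw = dominated_cutoff[OF sint mw(1) w01 z2]
 have zint: "set_integrable lborel E (\<lambda>x. ?z x * s x)" by (rule dominated_cutoff(2)[OF sint mw(2) _ _ z1]) (use w01 in auto)
 have gi: "set_integrable lborel E (\<lambda>x. gw k x \<bullet> X x)" for k by (intro set_integrable_compact E continuous_intros gwc X)
 have "(\<lambda>k. LINT x:E|lborel. gw k x \<bullet> X x) \<longlonglongrightarrow> (LINT x:E|lborel. 0)"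
  by (rule bounded_convergence(1)[OF sets_lborel Eb fin meas gb gl]) (intro continuous_intros gwc X)
 then have g0: "(\<lambda>k. LINT x:E|lborel. gw k x \<bullet> X x) \<longlonglongrightarrow> 0" by (simp add: set_lebesgue_integral_def)
 have lim1: "(\<lambda>k. LINT x:E|lborel. w k x * s x + gw k x \<bullet> X x) \<longlonglongrightarrow> (LINT x:E|lborel. (1 - ?z x) * s x)"
  unfolding set_integral_add(2)[OF dw(1) gi] using tendsto_add[OF dw(3) g0] by simp
 have zero\<phi>: "(LINT x:E|lborel. \<phi> x * (?z x * s x)) = 0" if \<phi>: "C1c (interior E) \<phi> g" "\<And>x. 0 \<le> \<phi> x" "\<And>x. \<phi> x \<le> 1" for \<phi> g
 proof -
  have c\<phi>: "C1fun \<phi> g" using \<phi>(1) by (simp add: C1c_def)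
  obtain K where K: "compact K" "K \<subseteq> interior E" "\<And>x. x \<notin> K \<Longrightarrow> \<phi> x = 0" using \<phi>(1) by (auto simp: C1c_def)
  have g0: "g x = 0" if "x \<notin> K" for x by (rule C1c_grad_zero[OF c\<phi> K(1,3) that])
  let ?F = "\<lambda>k x. \<phi> x * (1 - w k x) * s x + (\<phi> x *\<^sub>R (- gw k x) + (1 - w k x) *\<^sub>R g x) \<bullet> X x"
  note \<phi>c = C1fun_cont[OF c\<phi>, of E] and gc = C1fun_grad_cont[OF c\<phi>, of E]
  have F0: "(LINT x:E|lborel. ?F k x) = 0" for k
  proof -
   have "C1c (interior E) (\<lambda>x. \<phi> x * (1 - w k x)) (\<lambda>x. \<phi> x *\<^sub>R (- gw k x) + (1 - w k x) *\<^sub>R g x)"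
   proof (rule C1c_glue[OF open_interior K(1,2)])
    show "GDERIV (\<lambda>x. \<phi> x * (1 - w k x)) x :> \<phi> x *\<^sub>R (- gw k x) + (1 - w k x) *\<^sub>R g x" if "x \<in> interior E" for x
    proof -
     have "GDERIV (\<lambda>x. 1 - w k x) x :> 0 - gw k x" by (intro GDERIV_diff GDERIV_const gw that)
     then show ?thesis using c\<phi> by (intro GDERIV_mult) (auto simp: C1fun_def)
    qed
    show "continuous_on (interior E) (\<lambda>x. \<phi> x *\<^sub>R (- gw k x) + (1 - w k x) *\<^sub>R g x)"
     by (rule continuous_on_subset[OF _ interior_subset]) (intro continuous_intros \<phi>c gc wc gwc)
   qed (use K(3) g0 in auto)
   then show ?thesis using weak unfolding weak_divergence_def by blast
  qed
  have "continuous_on E (\<lambda>x. g x \<bullet> X x)" by (intro continuous_intros gc X)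
  then obtain Q where Q: "\<And>x. x \<in> E \<Longrightarrow> \<bar>g x \<bullet> X x\<bar> \<le> Q" using bdd by blast
  have Feq: "?F k x = \<phi> x * (1 - w k x) * s x - \<phi> x * (gw k x \<bullet> X x) + (1 - w k x) * (g x \<bullet> X x)" for k x
   by (simp add: inner_add_left inner_diff_left)
  have "(\<lambda>k. LINT x:E|lborel. ?F k x) \<longlonglongrightarrow> (LINT x:E|lborel. \<phi> x * (?z x * s x))"
  proof (rule bounded_convergence[OF sets_lborel Eb fin meas])
   show "continuous_on E (?F k)" for k by (intro continuous_intros \<phi>c gc wc gwc s X)
   show "\<bar>?F k x\<bar> \<le> \<bar>S\<bar> + (M * 2 * \<bar>C\<bar> + \<bar>Q\<bar>)" if x: "x \<in> E" for k x
   proof -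
    have "\<bar>\<phi> x * (1 - w k x) * s x\<bar> \<le> \<bar>S\<bar>"
     using \<phi>(2,3)[of x] w01[of k x] by (intro S1 x mult_nonneg_nonneg mult_le_one) auto
    moreover have "\<bar>\<phi> x * (gw k x \<bullet> X x)\<bar> \<le> 1 * (M * 2 * \<bar>C\<bar>)"
     unfolding abs_mult using \<phi>(2,3)[of x] gb[OF x, of k] by (intro mult_mono) auto
    moreover have "\<bar>(1 - w k x) * (g x \<bullet> X x)\<bar> \<le> 1 * \<bar>Q\<bar>"
     unfolding abs_mult using w01[of k x] Q[OF x] by (intro mult_mono) auto
    ultimately show ?thesis unfolding Feq by linarith
   qed
   fix x assume x: "x \<in> E"
   have "(\<lambda>k. \<phi> x * (1 - w k x) * s x - \<phi> x * (gw k x \<bullet> X x) + (1 - w k x) * (g x \<bullet> X x))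
     \<longlonglongrightarrow> \<phi> x * (1 - (if \<sigma> x = 0 then 0 else 1)) * s x - \<phi> x * 0 + (1 - (if \<sigma> x = 0 then 0 else 1)) * (g x \<bullet> X x)"
    by (intro tendsto_intros wl gl)
   then show "(\<lambda>k. ?F k x) \<longlonglongrightarrow> \<phi> x * (?z x * s x)" unfolding Feq using X0[OF x] by (simp split: if_splits)
  qed
  then have "(\<lambda>k. 0) \<longlonglongrightarrow> (LINT x:E|lborel. \<phi> x * (?z x * s x))" unfolding F0 .
  then show ?thesis using LIMSEQ_unique[OF tendsto_const] by metis
 qed
 have "\<bar>LINT x:E|lborel. ?z x * s x\<bar> \<le> 0"
 proof (rule field_le_epsilon)
  fix e :: real assume e: "e > 0"
  define d where "d = e / (\<bar>S\<bar> + 1)"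
  have d: "d > 0" "\<bar>S\<bar> * d \<le> e" using e by (auto simp: d_def field_simps)
  obtain T where T: "closed T" "T \<subseteq> interior E" "measure lebesgue (interior E - T) < d"
  proof -
   have "interior E \<in> sets lebesgue" by simp
   then obtain T where T: "closed T" "T \<subseteq> interior E" "interior E - T \<in> lmeasurable" "emeasure lebesgue (interior E - T) < ennreal d"
    by (rule sets_lebesgue_inner_closed[OF _ d(1)])
   then have "measure lebesgue (interior E - T) < d" using d(1) by (simp add: emeasure_eq_measure2 ennreal_less_iff)
   then show thesis using T(1,2) by (intro that)
  qed
  have cT: "compact T" using T E by (meson bounded_subset compact_eq_bounded_closed compact_imp_bounded interior_subset subset_trans)
  have [measurable]: "T \<in> sets borel" using T by simp
  obtain \<phi> g V where \<phi>: "C1c (interior E) \<phi> g" "\<And>x. 0 \<le> \<phi> x" "\<And>x. \<phi> x \<le> 1" "T \<subseteq> V" "\<And>x. x \<in> V \<Longrightarrow> \<phi> x = 1"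
   using cutoff_exists[OF cT T(2) open_interior] by metis
  have c\<phi>: "continuous_on E \<phi>" using \<phi>(1) unfolding C1c_def by (blast intro: C1fun_cont)
  have \<phi>int: "set_integrable lborel E (\<lambda>x. \<phi> x * (?z x * s x))"
   by (rule dominated_cutoff(1)[OF zint, where w = "\<lambda>_. \<phi>" and c = "\<lambda>x. \<phi> x * (?z x * s x)"]) (use meas[OF c\<phi>] \<phi>(2,3) in auto)
  have "(LINT x:E|lborel. ?z x * s x) = (LINT x:E|lborel. ?z x * s x) - (LINT x:E|lborel. \<phi> x * (?z x * s x))"
   unfolding zero\<phi>[OF \<phi>(1-3)] by simp
  also have "\<dots> = (LINT x:E|lborel. ?z x * s x - \<phi> x * (?z x * s x))"
   by (rule set_integral_diff(2)[OF zint \<phi>int, symmetric])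
  finally have "\<bar>LINT x:E|lborel. ?z x * s x\<bar> = \<bar>LINT x|lborel. indicator E x *\<^sub>R (?z x * s x - \<phi> x * (?z x * s x))\<bar>"
   by (simp only: set_lebesgue_integral_def)
  also have "\<dots> \<le> (LINT x|lborel. norm (indicator E x *\<^sub>R (?z x * s x - \<phi> x * (?z x * s x))))"
   using integral_norm_bound[of lborel "\<lambda>x. indicator E x *\<^sub>R (?z x * s x - \<phi> x * (?z x * s x))"] by simp
  also have "\<dots> \<le> (LINT x|lborel. indicator (interior E - T) x * \<bar>S\<bar>)"
  proof (rule integral_mono_AE)
   show "integrable lborel (\<lambda>x. norm (indicator E x *\<^sub>R (?z x * s x - \<phi> x * (?z x * s x))))"
    using set_integral_diff(1)[OF zint \<phi>int] unfolding set_integrable_def by (rule integrable_norm)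
   show "integrable lborel (\<lambda>x. indicator (interior E - T) x * \<bar>S\<bar>)"
   proof (intro integrable_mult_left integrable_real_indicator)
    have "emeasure lborel (interior E - T) \<le> emeasure lborel E" using interior_subset[of E] by (intro emeasure_mono) auto
    then show "emeasure lborel (interior E - T) < \<infinity>" using fin by (simp add: order_le_less_trans)
   qed simp
   show "AE x in lborel. norm (indicator E x *\<^sub>R (?z x * s x - \<phi> x * (?z x * s x))) \<le> indicator (interior E - T) x * \<bar>S\<bar>"
    using null
   proof eventually_elim
    case (elim x)
    show ?case
    proof (cases "x \<in> E \<and> x \<notin> T")
     case True
     have "\<bar>((1 - \<phi> x) * ?z x) * s x\<bar> \<le> \<bar>S\<bar>"
      using True \<phi>(2,3)[of x] by (intro S1) (auto intro: mult_le_one)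
     then show ?thesis using True elim by (simp add: algebra_simps)
    next
     case False
     then show ?thesis using \<phi>(4,5) by (auto simp: indicator_def)
    qed
   qed
  qed
  also have "\<dots> = \<bar>S\<bar> * measure lborel (interior E - T)" by simp
  also have "\<dots> \<le> \<bar>S\<bar> * d"
   using T(3) by (intro mult_left_mono) (simp_all add: measure_completion less_imp_le)
  finally show "\<bar>LINT x:E|lborel. ?z x * s x\<bar> \<le> 0 + e" using d(2) by linarith
 qed
 then have z0: "(LINT x:E|lborel. ?z x * s x) = 0" by simp
 have "(LINT x:E|lborel. (1 - ?z x) * s x) = (LINT x:E|lborel. s x - ?z x * s x)"
  by (simp only: left_diff_distrib mult_1)
 also have "\<dots> = (LINT x:E|lborel. s x)" unfolding set_integral_diff(2)[OF sint zint] z0 by simp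
 finally show "(\<lambda>k. LINT x:E|lborel. w k x * s x + gw k x \<bullet> X x) \<longlonglongrightarrow> (LINT x:E|lborel. s x)"
  using lim1 by (simp only:)
qed

section \<open>The flux identity on large balls\<close>

context exterior_map begin

text \<open>The gradient of \<open>|Df|\<^sup>2\<close>. Like the flux field (\<open>flux_field_eq\<close>), it is a combination of the first
derivatives of \<open>f\<close> with continuous coefficients.\<close>

definition D\<sigma> where "D\<sigma> x = (\<chi> j. \<Sigma> \<alpha> i. 2 * p \<alpha> i x * F \<alpha> i j x)"

lemma \<sigma>_eq: "\<sigma> x = (\<Sigma> \<alpha> i. (p \<alpha> i x)\<^sup>2)"
 unfolding grad_norm_sq_def power2_norm_eq_inner inner_vec_def grad_def by (simp add: power2_eq_square)

lemma \<sigma>_GDERIV: assumes "x \<in> interior D" shows "GDERIV \<sigma> x :> D\<sigma> x"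
proof -
 have "GDERIV (\<lambda>x. \<Sigma> \<alpha> i. p \<alpha> i x * p \<alpha> i x) x
   :> (\<Sigma> \<alpha> i. p \<alpha> i x *\<^sub>R (\<chi> j. F \<alpha> i j x) + p \<alpha> i x *\<^sub>R (\<chi> j. F \<alpha> i j x))"
  by (intro GDERIV_sum GDERIV_mult p_GDERIV assms)
 moreover have "(\<Sigma> \<alpha> i. p \<alpha> i x *\<^sub>R (\<chi> j. F \<alpha> i j x) + p \<alpha> i x *\<^sub>R (\<chi> j. F \<alpha> i j x)) = D\<sigma> x"
  by (simp add: vec_eq_iff D\<sigma>_def sum_component mult_ac)
 ultimately show ?thesis unfolding \<sigma>_eq power2_eq_square by simp
qed

lemma D\<sigma>_cont: "continuous_on D D\<sigma>"
 unfolding D\<sigma>_def[abs_def] by (intro continuous_intros p_cont F_cont)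

lemma p_le: "\<bar>p \<alpha> i x\<bar> \<le> sqrt (\<sigma> x)"
proof (rule real_le_rsqrt)
 have "(p \<alpha> i x)\<^sup>2 \<le> (\<Sigma> i. (p \<alpha> i x)\<^sup>2)" by (rule member_le_sum) auto
 also have "\<dots> \<le> \<sigma> x" unfolding \<sigma>_eq
  by (rule member_le_sum[where f = "\<lambda>\<alpha>. \<Sigma> i. (p \<alpha> i x)\<^sup>2"]) (auto intro!: sum_nonneg)
 finally show "\<bar>p \<alpha> i x\<bar>\<^sup>2 \<le> \<sigma> x" by simp
qed

lemma norm_combination_le: "norm (\<Sigma> \<alpha> i. p \<alpha> i x *\<^sub>R V \<alpha> i) \<le> sqrt (\<sigma> x) * (\<Sigma> \<alpha> i. norm (V \<alpha> i))"
proof -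
 have "norm (\<Sigma> \<alpha> i. p \<alpha> i x *\<^sub>R V \<alpha> i) \<le> (\<Sigma> \<alpha> i. norm (p \<alpha> i x *\<^sub>R V \<alpha> i))"
  by (intro order_trans[OF norm_sum] sum_mono order_refl)
 also have "\<dots> \<le> (\<Sigma> \<alpha> i. sqrt (\<sigma> x) * norm (V \<alpha> i))"
  unfolding norm_scaleR by (intro sum_mono mult_right_mono p_le norm_ge_zero)
 finally show ?thesis by (simp add: sum_distrib_left)
qed

definition Z where "Z \<alpha> c x = (\<chi> j. \<Sigma> i k. (h i k x * h j c x - h i j x * h k c x) * F \<alpha> i k x)"

lemma flux_field_eq: "flux_field D f x = (\<Sigma> \<alpha> c. p \<alpha> c x *\<^sub>R Z \<alpha> c x)"
proof -
 have "flux_field D f x $ j = (\<Sigma> \<alpha> i k c. (h i k x * h j c x - h i j x * h k c x) * F \<alpha> i k x * p \<alpha> c x)" for j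
  by (simp add: flux_field_def flux_coeff_def metric_grad_component sum_distrib_left sum_distrib_right
   sum_subtractf[symmetric] algebra_simps)
 also have "\<dots> j = (\<Sigma> \<alpha> c i k. (h i k x * h j c x - h i j x * h k c x) * F \<alpha> i k x * p \<alpha> c x)" for j
  by (intro sum.cong refl sum_swap3)
 finally show ?thesis by (simp add: vec_eq_iff Z_def sum_component sum_distrib_left mult.commute)
qed

lemma D\<sigma>_flux_bound:
 assumes "compact E" "E \<subseteq> D"
 obtains K where "\<And>x. x \<in> E \<Longrightarrow> \<bar>D\<sigma> x \<bullet> flux_field D f x\<bar> \<le> K * \<sigma> x"
proof -
 define H where "H \<alpha> i x = (\<chi> j. 2 * F \<alpha> i j x)" for \<alpha> i x
 define g where "g x = (\<Sigma> \<alpha> i. norm (H \<alpha> i x)) * (\<Sigma> \<alpha> c. norm (Z \<alpha> c x))" for x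
 have "continuous_on E g" unfolding g_def H_def Z_def
  by (intro continuous_intros continuous_on_subset[OF h_cont assms(2)] continuous_on_subset[OF F_cont assms(2)])
 then have "bounded (g ` E)" by (intro compact_imp_bounded compact_continuous_image assms)
 then obtain K where K: "\<And>x. x \<in> E \<Longrightarrow> \<bar>g x\<bar> \<le> K" unfolding bounded_iff by auto
 have "\<bar>D\<sigma> x \<bullet> flux_field D f x\<bar> \<le> K * \<sigma> x" if "x \<in> E" for x
 proof -
  have "D\<sigma> x = (\<Sigma> \<alpha> i. p \<alpha> i x *\<^sub>R H \<alpha> i x)"
   by (simp add: vec_eq_iff D\<sigma>_def H_def sum_component mult_ac)
  then have "\<bar>D\<sigma> x \<bullet> flux_field D f x\<bar> \<le> norm (\<Sigma> \<alpha> i. p \<alpha> i x *\<^sub>R H \<alpha> i x) * norm (\<Sigma> \<alpha> c. p \<alpha> c x *\<^sub>R Z \<alpha> c x)"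
   unfolding flux_field_eq by (simp only: Cauchy_Schwarz_ineq2)
  also have "\<dots> \<le> (sqrt (\<sigma> x) * (\<Sigma> \<alpha> i. norm (H \<alpha> i x))) * (sqrt (\<sigma> x) * (\<Sigma> \<alpha> c. norm (Z \<alpha> c x)))"
   using \<sigma>_nonneg[of x] by (intro mult_mono norm_combination_le mult_nonneg_nonneg sum_nonneg) auto
  also have "\<dots> = (sqrt (\<sigma> x) * sqrt (\<sigma> x)) * g x" by (simp only: g_def mult_ac)
  also have "\<dots> \<le> K * \<sigma> x" using K[OF that] \<sigma>_nonneg[of x] by (simp add: mult.commute[of _ "\<sigma> x"] mult_left_mono)
  finally show ?thesis .
 qed
 then show thesis by (rule that)
qed

text \<open>Near boundary points with \<open>Df = 0\<close> the boundary need not be a \<open>C\<^sup>1\<close> graph. The cut-off in \<open>|Df|\<^sup>2\<close> removes these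
points, and the flux field and the boundary term vanish there. At the other points, boundary points of class
\<open>C\<^sup>2\<close> have full measure, so the flux through the boundary is known almost everywhere. The normal of the charts
points out of \<open>D\<close>, which is into \<open>\<Omega>\<close> along the inner boundary.\<close>

theorem flux_identity:
 assumes C2pt: "AE x in \<A>. x \<in> frontier \<Omega> \<longrightarrow> C2_boundary_point \<Omega> x"
  and r: "0 < r" and sub: "closure \<Omega> \<subseteq> ball 0 r"
 shows "(LINT x:D \<inter> cball 0 r|lborel. scalar_curv D f x + normal_scalar D f x)
  = (LINT x:sphere 0 r|\<A>. flux_field D f x \<bullet> ((1 / r) *\<^sub>R x)) - (LINT x:frontier \<Omega>|\<A>. boundary_term x)"
proof -
 let ?X = "flux_field D f" and ?s = "\<lambda>x. scalar_curv D f x + normal_scalar D f x"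
 define E where "E = D \<inter> cball 0 r"
 have clD: "closed D" using open_\<Omega> by (simp add: closed_Compl)
 have E: "compact E" unfolding E_def by (rule closed_Int_compact[OF clD compact_cball])
 have ED: "E \<subseteq> D" by (simp add: E_def)
 have iD: "interior D = - closure \<Omega>" by (simp add: interior_complement)
 have iE: "interior E = - closure \<Omega> \<inter> ball 0 r" unfolding E_def interior_Int iD by simp
 have iEm: "x \<in> interior E \<longleftrightarrow> x \<notin> closure \<Omega> \<and> norm x < r" for x
  unfolding iE by (simp only: Int_iff Compl_iff mem_ball_0)
 have fr: "frontier \<Omega> \<subseteq> ball 0 r" using sub by (auto simp: frontier_def)
 have frE: "frontier \<Omega> \<subseteq> E" using fr frontier_D by (auto simp: E_def)
 have spD: "sphere 0 r \<subseteq> D"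
 proof
  fix x :: "real^'n" assume "x \<in> sphere 0 r"
  then have "x \<notin> ball 0 r" by simp
  then have "x \<notin> closure \<Omega>" using sub by blast
  then show "x \<in> D" using closure_subset by blast
 qed
 have spE: "sphere 0 r \<subseteq> E" using spD by (auto simp: E_def)
 have disj: "frontier \<Omega> \<inter> sphere 0 r = {}" using fr by auto
 have cX: "continuous_on E ?X" by (rule continuous_on_subset[OF flux_field_cont ED])
 have cs: "continuous_on E ?s" by (intro continuous_intros continuous_on_subset[OF curvature_cont(1) ED] continuous_on_subset[OF curvature_cont(2) ED])
 have weak: "weak_divergence E ?s ?X" by (rule weak_divergence_flux) (simp add: iE iD)
 have c\<sigma>: "continuous_on E \<sigma>" by (rule continuous_on_subset[OF \<sigma>_cont ED])
 have cD\<sigma>: "continuous_on E D\<sigma>" by (rule continuous_on_subset[OF D\<sigma>_cont ED])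
 have \<sigma>': "GDERIV \<sigma> x :> D\<sigma> x" if "x \<in> interior E" for x using that by (intro \<sigma>_GDERIV) (simp add: iE iD)
 have spc: "AE x in lborel. x \<notin> sphere (0::real^'n) r"
 proof (rule AE_I)
  show "emeasure lborel (sphere (0::real^'n) r) = 0"
   using negligible_sphere[of "0::real^'n" r] by (simp add: negligible_iff_null_sets null_sets_completion_iff null_sets_def)
 qed auto
 have null: "AE x in lborel. x \<in> E \<longrightarrow> x \<in> interior E"
  using spc boundary_null[OF open_\<Omega> bounded_\<Omega> lip]
 proof eventually_elim
  case (elim x)
  show ?case
  proof
   assume "x \<in> E"
   then have "x \<in> D" "norm x \<le> r" by (auto simp: E_def)
   then show "x \<in> interior E" using elim open_\<Omega> unfolding iEm by (simp add: frontier_def interior_open)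
  qed
 qed
 have X0: "?X x = 0" if "\<sigma> x = 0" for x
  using p_le[of _ _ x] that unfolding flux_field_eq by simp
 obtain K where XD: "\<And>x. x \<in> E \<Longrightarrow> \<bar>D\<sigma> x \<bullet> ?X x\<bar> \<le> K * \<sigma> x" using D\<sigma>_flux_bound[OF E ED] by blast
 define w where "w k x = step (real (Suc k) * \<sigma> x)" for k x
 define gw where "gw k x = (real (Suc k) * step' (real (Suc k) * \<sigma> x)) *\<^sub>R D\<sigma> x" for k x
 note cut = divergence_cutoff_limit[OF E cX cs weak null \<sigma>' c\<sigma> cD\<sigma> \<sigma>_nonneg XD X0, folded w_def gw_def]
 have w01: "0 \<le> w k x" "w k x \<le> 1" for k x by (simp_all add: w_def step_bounds)
 define b where "b = boundary_term"
 have bint: "set_integrable \<A> (frontier \<Omega>) b" unfolding b_def by (rule boundary_term_integrable)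
 define fl where "fl x = ?X x \<bullet> ((1 / r) *\<^sub>R x)" for x
 have flc: "continuous_on (sphere 0 r) fl" unfolding fl_def
  by (intro continuous_intros continuous_on_subset[OF cX spE])
 define h where "h k x = (if x \<in> frontier \<Omega> then - (w k x * b x) else w k x * fl x)" for k x
 have spf: "emeasure \<A> (sphere (0::real^'n) r) < top" by (rule sphere_area_le[OF n r])
 have flint: "set_integrable \<A> (sphere 0 r) fl" by (rule area_integral_continuous(1)[OF compact_sphere spf flc])
 have wm: "(\<lambda>x. indicator A x *\<^sub>R w k x) \<in> borel_measurable \<A>" if "closed A" "A \<subseteq> E" for k A
  using borel_measurable_continuous_on_indicator[OF _ continuous_on_subset[OF cut(2) that(2)]] that(1)
  by (simp add: measurable_cong_sets[OF sets_area_measure refl])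
 have "(\<lambda>k. w k x * fl x) \<longlonglongrightarrow> fl x" "(\<lambda>k. w k x * b x) \<longlonglongrightarrow> b x" for x
  using tendsto_mult_right[OF cut(4), of x "fl x"] tendsto_mult_right[OF cut(4), of x "b x"] X0[of x]
  by (auto simp: fl_def b_def boundary_term_def split: if_splits)
 note wf = dominated_cutoff[OF flint wm w01 this(1), OF closed_sphere spE]
  and wb = dominated_cutoff[OF bint wm w01 this(2), OF frontier_closed frE]
 have "indicator (frontier \<Omega>) x *\<^sub>R h k x = - (indicator (frontier \<Omega>) x *\<^sub>R (w k x * b x))" for k x
  by (simp add: h_def indicator_def)
 then have hfr: "set_integrable \<A> (frontier \<Omega>) (h k)" "(LINT x:frontier \<Omega>|\<A>. h k x) = - (LINT x:frontier \<Omega>|\<A>. w k x * b x)" for k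
  using wb(1)[of k] unfolding set_integrable_def set_lebesgue_integral_def by simp_all
 have eq: "indicator (sphere 0 r) x *\<^sub>R h k x = indicator (sphere 0 r) x *\<^sub>R (w k x * fl x)" for k x
  using disj by (auto simp: h_def indicator_def)
 have hsp: "set_integrable \<A> (sphere 0 r) (h k)" "(LINT x:sphere 0 r|\<A>. h k x) = (LINT x:sphere 0 r|\<A>. w k x * fl x)" for k
  using wf(1)[of k] unfolding set_integrable_def set_lebesgue_integral_def eq by simp_all
 let ?Bd = "frontier \<Omega> \<union> sphere 0 r"
 have gg: "(LINT x:E|lborel. w k x * ?s x + gw k x \<bullet> ?X x) = (LINT x:?Bd|\<A>. h k x)" for k
 proof (rule gauss_green[OF E cX cs weak cut(1,2,3)])
  show "?Bd \<in> sets borel" by auto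
  show "?Bd \<subseteq> E" using frE spE by simp
  show "set_integrable \<A> ?Bd (h k)" by (intro set_integrable_Un hfr hsp) auto
  fix y assume y: "y \<in> E"
  let ?A = "\<lambda>t. ball y t \<subseteq> interior E \<and> ?Bd \<inter> ball y t = {}"
  let ?B = "\<lambda>t. (\<forall>x\<in>E \<inter> ball y t. w k x = 0 \<and> gw k x = 0) \<and> (\<forall>x\<in>?Bd \<inter> ball y t. h k x = 0)"
  let ?C = "\<lambda>t. \<exists>e \<Phi> q W. graph_chart e \<Phi> q W \<and> ball y t \<subseteq> W \<and> E \<inter> ball y t = {x\<in>ball y t. e \<bullet> x \<le> \<Phi> x} \<and>
     ?Bd \<inter> ball y t = graph e \<Phi> \<inter> ball y t \<and>
     (AE x in \<A>. x \<in> ?Bd \<inter> ball y t \<longrightarrow> h k x = w k x * (?X x \<bullet> graph_chart.normal e q x))"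
  have "\<exists>t>0. ?A t \<or> ?B t \<or> ?C t"
  proof (cases "y \<in> interior E")
   case True
   then obtain t where t: "t > 0" "ball y t \<subseteq> interior E" by (rule openE[OF open_interior])
   moreover have "?Bd \<inter> interior E = {}" by (auto simp: iEm frontier_def)
   ultimately have "?A t" by auto
   then show ?thesis using t(1) by blast
  next
   case nint: False
   show ?thesis
   proof (cases "norm y = r")
    case True
    obtain e \<Phi> q W where ch: "graph_chart e \<Phi> q W" "ball y r \<subseteq> W"
     and ch': "\<And>x. x \<in> ball y r \<Longrightarrow> (norm x \<le> r \<longleftrightarrow> e \<bullet> x \<le> \<Phi> x) \<and> (norm x = r \<longleftrightarrow> e \<bullet> x = \<Phi> x) \<and>
      (norm x = r \<longrightarrow> graph_chart.normal e q x = (1 / r) *\<^sub>R x)"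
     using sphere_chart[OF n r True] by (elim exE conjE) blast
    have "y \<in> - closure \<Omega>" using True sub by auto
    then obtain t1 where t1: "t1 > 0" "ball y t1 \<subseteq> - closure \<Omega>" by (rule openE[OF open_Compl[OF closed_closure]])
    define t where "t = min r t1"
    have t: "t > 0" "t \<le> r" "t \<le> t1" using r t1 by (auto simp: t_def)
    have inb: "x \<in> ball y r" "x \<notin> closure \<Omega>" if "x \<in> ball y t" for x
    proof -
     have "x \<in> ball y t1" using that t by simp
     then show "x \<notin> closure \<Omega>" using t1(2) by blast
     show "x \<in> ball y r" using that t by simp
    qed
    have inD: "x \<in> D" "x \<notin> frontier \<Omega>" if "x \<in> ball y t" for x
     using inb(2)[OF that] closure_subset[of \<Omega>] by (auto simp: frontier_def)
    have "?C t"
    proof (intro exI conjI)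
     show "graph_chart e \<Phi> q W" by (rule ch)
     show "ball y t \<subseteq> W" using ch(2) inb(1) by blast
     show "E \<inter> ball y t = {x\<in>ball y t. e \<bullet> x \<le> \<Phi> x}"
      using ch'[OF inb(1)] inD(1) by (intro set_eqI) (auto simp: E_def simp del: mem_ball)
     show "?Bd \<inter> ball y t = graph e \<Phi> \<inter> ball y t"
      using ch'[OF inb(1)] inD(2) by (intro set_eqI) (auto simp: graph_def simp del: mem_ball)
     show "AE x in \<A>. x \<in> ?Bd \<inter> ball y t \<longrightarrow> h k x = w k x * (?X x \<bullet> graph_chart.normal e q x)"
     proof (intro AE_I2 impI)
      fix x assume x: "x \<in> ?Bd \<inter> ball y t"
      then have xf: "x \<notin> frontier \<Omega>" and xn: "norm x = r" using inD(2)[of x] by auto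
      then have "graph_chart.normal e q x = (1 / r) *\<^sub>R x" using ch'[OF inb(1), of x] x by blast
      then show "h k x = w k x * (?X x \<bullet> graph_chart.normal e q x)" using xf by (simp add: h_def fl_def)
     qed
    qed
    then show ?thesis using t(1) by blast
   next
    case False
    have yr: "y \<in> ball 0 r" and yD: "y \<in> D" using y False by (auto simp: E_def)
    then have yf: "y \<in> frontier \<Omega>" using nint open_\<Omega> yr yD unfolding iEm by (simp add: frontier_def interior_open)
    show ?thesis
    proof (cases "\<sigma> y = 0")
     case True
     have "0 < 1 / real (Suc k)" by simp
     then obtain t where t: "t > 0" "\<And>x. x \<in> E \<Longrightarrow> dist x y < t \<Longrightarrow> dist (\<sigma> x) (\<sigma> y) < 1 / real (Suc k)"
      using c\<sigma> y unfolding continuous_on_iff by meson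
     have small: "w k x = 0" "gw k x = 0" if "x \<in> E \<inter> ball y t" for x
     proof -
      have "dist x y < t" using that by (simp add: dist_commute)
      then have "\<sigma> x < 1 / real (Suc k)" using t(2)[of x] that True by (simp add: dist_real_def)
      then have "real (Suc k) * \<sigma> x \<le> 1" by (simp add: field_simps)
      then show "w k x = 0" "gw k x = 0" by (simp_all add: w_def gw_def step_eq_0 step'_eq_0)
     qed
     have "h k x = 0" if "x \<in> ?Bd \<inter> ball y t" for x
      using small(1)[of x] that frE spE by (auto simp: h_def)
     then have "?B t" using small by blast
     then show ?thesis using t(1) by blast
    next
     case nz: False
     obtain t1 e \<Phi> q W where t1: "t1 > 0" and ch: "graph_chart e \<Phi> q W" "ball y t1 \<subseteq> W"
      "D \<inter> ball y t1 = {x\<in>ball y t1. e \<bullet> x \<le> \<Phi> x}" "frontier \<Omega> \<inter> ball y t1 = graph e \<Phi> \<inter> ball y t1"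
      "\<forall>z\<in>frontier \<Omega> \<inter> ball y t1. inner_unit_normal \<Omega> z (graph_chart.normal e q z)"
      using C1_chart[OF yf nz] by (elim exE conjE) (rule that)
     obtain t2 where t2: "t2 > 0" "ball y t2 \<subseteq> ball 0 r" by (rule openE[OF open_ball yr])
     define t where "t = min t1 t2"
     have t: "t > 0" using t1 t2 by (simp add: t_def)
     have in1: "x \<in> ball y t1" if "x \<in> ball y t" for x using that by (simp add: t_def)
     have in2: "norm x < r" if "x \<in> ball y t" for x
     proof -
      have "x \<in> ball y t2" using that by (simp add: t_def)
      then have "x \<in> ball 0 r" using t2(2) by blast
      then show ?thesis by simp
     qed
     have D1: "x \<in> D \<longleftrightarrow> e \<bullet> x \<le> \<Phi> x" if "x \<in> ball y t" for x
      using eqset_imp_iff[OF ch(3), of x] in1[OF that] by simp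
     have D2: "x \<in> frontier \<Omega> \<longleftrightarrow> x \<in> graph e \<Phi>" if "x \<in> ball y t" for x
      using eqset_imp_iff[OF ch(4), of x] in1[OF that] by simp
     have "?C t"
     proof (intro exI conjI)
      show "graph_chart e \<Phi> q W" by (rule ch)
      show "ball y t \<subseteq> W" using ch(2) in1 by blast
      show "E \<inter> ball y t = {x\<in>ball y t. e \<bullet> x \<le> \<Phi> x}"
      proof (rule set_eqI)
       fix x show "x \<in> E \<inter> ball y t \<longleftrightarrow> x \<in> {x\<in>ball y t. e \<bullet> x \<le> \<Phi> x}"
        using D1[of x] in2[of x] unfolding E_def by (auto simp del: mem_ball ComplD Compl_iff)
      qed
      show "?Bd \<inter> ball y t = graph e \<Phi> \<inter> ball y t"
      proof (rule set_eqI)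
       fix x show "x \<in> ?Bd \<inter> ball y t \<longleftrightarrow> x \<in> graph e \<Phi> \<inter> ball y t"
        using D2[of x] in2[of x] by (auto simp del: mem_ball)
      qed
      show "AE x in \<A>. x \<in> ?Bd \<inter> ball y t \<longrightarrow> h k x = w k x * (?X x \<bullet> graph_chart.normal e q x)"
       using C2pt
      proof eventually_elim
       case (elim x)
       show ?case
       proof
        assume x: "x \<in> ?Bd \<inter> ball y t"
        then have xf: "x \<in> frontier \<Omega>" using in2[of x] by auto
        have nu: "inner_unit_normal \<Omega> x (graph_chart.normal e q x)" using ch(5) xf in1[of x] x by blast
        have "C2_boundary_point \<Omega> x" using elim xf by blast
        from flux_chart_normal[OF this nu]
        show "h k x = w k x * (?X x \<bullet> graph_chart.normal e q x)" using xf by (simp add: h_def b_def)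
       qed
      qed
     qed
     then show ?thesis using t by blast
    qed
   qed
  qed
  then show "\<exists>t>0. ?A t \<or> ?B t \<or> ?C t" .
 qed
 have gg': "(LINT x:E|lborel. w k x * ?s x + gw k x \<bullet> ?X x)
   = (LINT x:sphere 0 r|\<A>. w k x * fl x) - (LINT x:frontier \<Omega>|\<A>. w k x * b x)" for k
  unfolding gg using set_integral_Un[OF disj hfr(1) hsp(1), of k] by (simp add: hfr(2) hsp(2))
 have "(\<lambda>k. LINT x:E|lborel. w k x * ?s x + gw k x \<bullet> ?X x) \<longlonglongrightarrow> (LINT x:sphere 0 r|\<A>. fl x) - (LINT x:frontier \<Omega>|\<A>. b x)"
  unfolding gg' by (rule tendsto_diff[OF wf(3) wb(3)])
 from LIMSEQ_unique[OF cut(5) this] show ?thesis by (simp only: E_def fl_def b_def)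
qed

end

section \<open>Decay at infinity\<close>

text \<open>On the dyadic shell \<open>2\<^sup>k \<le> |x| < 2\<^sup>k\<^sup>+\<^sup>1\<close> the function is at most \<open>2\<^sup>-\<^sup>q\<^sup>k\<close>, and the ball around the shell has volume
proportional to \<open>2\<^sup>k\<^sup>d\<close> in dimension \<open>d\<close>, so a geometric series dominates the integral.\<close>

lemma power_decay_integrable:
 assumes q: "q > real DIM('a)"
 shows "integrable lborel (\<lambda>x::'a::euclidean_space. indicator {x. 1 \<le> norm x} x * norm x powr (- q))"
proof (rule integrableI_bounded)
 let ?f = "\<lambda>x::'a. indicator {x. 1 \<le> norm x} x * norm x powr (- q)"
 define V where "V = unit_ball_vol (real DIM('a))"
 have V: "V \<ge> 0" by (simp add: V_def)
 define b where "b = 2 powr (real DIM('a) - q)"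
 have b: "0 \<le> b" "b < 1" using q powr_less_mono[of "real DIM('a) - q" 0 2] by (auto simp: b_def)
 define B where "B k = cball (0::'a) (2 ^ Suc k)" for k
 have [measurable]: "B k \<in> sets borel" for k by (simp add: B_def)
 have dom: "ennreal (norm (?f x)) \<le> (\<Sum>k. ennreal (2 powr (- q * real k)) * indicator (B k) x)" for x
 proof (cases "1 \<le> norm x")
  case True
  define k where "k = nat \<lfloor>log 2 (norm x)\<rfloor>"
  have pos: "0 < norm x" using True by linarith
  then have "log 2 (norm x) \<ge> 0" using True by simp
  then have k: "real k \<le> log 2 (norm x)" "log 2 (norm x) < real k + 1" by (simp_all add: k_def)
  have eq: "norm x = 2 powr (log 2 (norm x))" using pos by simp
  have 1: "2 powr real k \<le> norm x" using k(1) by (subst eq) (intro powr_mono, auto)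
  have "norm x < 2 powr (real k + 1)" using k(2) by (subst eq) (intro powr_less_mono, auto)
  also have "\<dots> = 2 ^ Suc k" by (simp add: powr_add powr_realpow)
  finally have 2: "x \<in> B k" by (simp add: B_def)
  have "norm x powr (- q) \<le> (2 powr real k) powr (- q)"
   using 1 q by (intro powr_mono2') auto
  also have "\<dots> = 2 powr (- q * real k)" by (simp add: powr_powr mult.commute)
  finally have "ennreal (norm (?f x)) \<le> ennreal (2 powr (- q * real k)) * indicator (B k) x"
   using 2 True by (simp add: ennreal_leI)
  also have "\<dots> \<le> (\<Sum>k. ennreal (2 powr (- q * real k)) * indicator (B k) x)"
  proof -
   have "t k \<le> (\<Sum>k. t k)" for t :: "nat \<Rightarrow> ennreal"
    using sum_le_suminf[of t "{k}"] by simp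
   then show ?thesis .
  qed
  finally show ?thesis .
 qed simp
 have trm: "ennreal (2 powr (- q * real k)) * emeasure lborel (B k) = ennreal (V * 2 ^ DIM('a) * b ^ k)" for k
 proof -
  have "emeasure lborel (B k) = ennreal (V * (2 ^ Suc k) ^ DIM('a))"
   unfolding B_def V_def by (rule emeasure_cball) simp
  moreover have "2 powr (- q * real k) * (V * (2 ^ Suc k) ^ DIM('a)) = V * 2 ^ DIM('a) * b ^ k"
  proof -
   have "b ^ k = 2 powr (real k * (real DIM('a) - q))"
    unfolding b_def by (simp add: powr_powr powr_realpow[symmetric] mult.commute)
   also have "\<dots> = 2 powr (- q * real k) * 2 powr (real (k * DIM('a)))"
    by (simp add: powr_add[symmetric] algebra_simps)
   also have "2 powr (real (k * DIM('a))) = (2::real) ^ (k * DIM('a))" by (rule powr_realpow) simp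
   finally have "b ^ k = 2 powr (- q * real k) * 2 ^ (k * DIM('a))" .
   moreover have "(2 ^ Suc k) ^ DIM('a) = (2::real) ^ DIM('a) * 2 ^ (k * DIM('a))"
    by (simp add: power_mult_distrib power_mult)
   ultimately show ?thesis by (simp add: mult_ac)
  qed
  ultimately show ?thesis by (simp only: ennreal_mult'[symmetric] powr_ge_zero)
 qed
 have "(\<integral>\<^sup>+x. ennreal (norm (?f x)) \<partial>lborel) \<le> (\<integral>\<^sup>+x. (\<Sum>k. ennreal (2 powr (- q * real k)) * indicator (B k) x) \<partial>lborel)"
  by (intro nn_integral_mono dom)
 also have "\<dots> = (\<Sum>k. \<integral>\<^sup>+x. ennreal (2 powr (- q * real k)) * indicator (B k) x \<partial>lborel)"
  by (rule nn_integral_suminf) measurable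
 also have "\<dots> = (\<Sum>k. ennreal (V * 2 ^ DIM('a) * b ^ k))"
 proof -
  have "(\<integral>\<^sup>+x. ennreal (2 powr (- q * real k)) * indicator (B k) x \<partial>lborel) = ennreal (2 powr (- q * real k)) * emeasure lborel (B k)" for k
   by (rule nn_integral_cmult_indicator) simp
  then show ?thesis by (simp only: trm)
 qed
 also have "\<dots> < top"
 proof -
  have "summable (\<lambda>k. V * 2 ^ DIM('a) * b ^ k)" using b by (intro summable_mult summable_geometric) simp
  then have "(\<Sum>k. ennreal (V * 2 ^ DIM('a) * b ^ k)) \<noteq> top"
   by (rule ennreal_suminf_neq_top) (use V b in auto)
  then show ?thesis by (simp add: less_top)
 qed
 finally show "(\<integral>\<^sup>+x. ennreal (norm (?f x)) \<partial>lborel) < \<infinity>" by simp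
qed measurable

text \<open>The metric is joined to the Euclidean one by positive definite matrices, on which the
 determinant cannot change sign.\<close>

lemma det_graph_metric_pos: "det (graph_metric D f x) > 0"
proof (rule ccontr)
 assume neg: "\<not> det (graph_metric D f x) > 0"
 let ?g = "graph_metric D f x"
 define A where "A t = (\<chi> i j. (1 - t) * kron i j + t * ?g $ i $ j)" for t :: real
 have A: "A t = (1 - t) *\<^sub>R mat 1 + t *\<^sub>R ?g" for t
  by (simp add: A_def vec_eq_iff mat_def)
 have "continuous_on {0..1} (\<lambda>t. det (A t))"
  unfolding det_def A_def by (simp, intro continuous_intros)
 moreover have "det (A 0) = 1" "det (A 1) \<le> 0" using neg by (simp_all add: A)
 ultimately obtain t where t: "0 \<le> t" "t \<le> 1" "det (A t) = 0"
  using IVT2'[of "\<lambda>t. det (A t)" 1 0 0] by auto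
 have "invertible (A t)"
  unfolding invertible_left_inverse matrix_left_invertible_ker
 proof (intro allI impI)
  fix v assume v: "A t *v v = 0"
  have "v \<bullet> (A t *v v) = (1 - t) * (v \<bullet> v) + t * (v \<bullet> (?g *v v))"
   by (simp add: A matrix_vector_mult_add_rdistrib scaleR_matrix_vector_assoc[symmetric] inner_add_right)
  also have "\<dots> = v \<bullet> v + t * (\<Sigma> \<alpha>. (grad D f \<alpha> x \<bullet> v)\<^sup>2)"
   unfolding metric_pos by (simp add: algebra_simps)
  finally have "v \<bullet> v + t * (\<Sigma> \<alpha>. (grad D f \<alpha> x \<bullet> v)\<^sup>2) = 0" using v by simp
  moreover have "t * (\<Sigma> \<alpha>. (grad D f \<alpha> x \<bullet> v)\<^sup>2) \<ge> 0" using t by (simp add: sum_nonneg)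
  ultimately have "v \<bullet> v \<le> 0" by linarith
  then show "v = 0" using inner_ge_zero[of v] by simp
 qed
 then show False using t(3) by (simp add: invertible_det_nz)
qed

lemma partial_deriv_GDERIV:
 assumes "x \<in> interior D" "GDERIV w x :> G"
 shows "partial_deriv D k w x = G $ k"
proof -
 have "partial_deriv D k w x = axis k 1 \<bullet> G"
  unfolding partial_deriv_def at_within_interior[OF assms(1)]
   frechet_derivative_at[OF assms(2)[unfolded gderiv_def], symmetric] ..
 then show ?thesis by (simp add: inner_axis')
qed

lemma powr_bigo_mult:
 assumes "f \<in> O[F](\<lambda>x. norm x powr a)" "g \<in> O[F](\<lambda>x. norm x powr b)"
 shows "(\<lambda>x. f x * g x :: real) \<in> O[F](\<lambda>x. norm x powr (a + b))"
 using landau_o.big.mult[OF assms] by (simp add: powr_add)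

lemma powr_bigo_bound:
 fixes f :: "'a::real_normed_vector \<Rightarrow> real"
 assumes "f \<in> decay a"
 obtains C R where "C \<ge> 0" "R \<ge> 1" "\<And>x. R \<le> norm x \<Longrightarrow> \<bar>f x\<bar> \<le> C * norm x powr a"
proof -
 obtain C where C: "C > 0" "\<forall>\<^sub>F x in at_infinity. norm (f x) \<le> C * norm (norm x powr a)"
  using assms by (rule landau_o.bigE)
 then obtain R where "\<And>x. R \<le> norm x \<Longrightarrow> norm (f x) \<le> C * norm (norm x powr a)"
  unfolding eventually_at_infinity by blast
 then show thesis using C(1) by (intro that[of C "max 1 R"]) auto
qed

context exterior_map begin

text \<open>The integrand of the ADM mass is the flux field with the inverse metric replaced by the
 Euclidean one.\<close>

definition flat_flux where
 "flat_flux x = (\<chi> j. \<Sigma> \<alpha> i k.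
  (kron i k * p \<alpha> j x - kron i j * p \<alpha> k x) * F \<alpha> i k x)"

lemma adm_integrand:
 assumes x: "x \<in> interior D"
 shows "(\<Sigma> i j. (metric_deriv D f i j i x - metric_deriv D f i i j x) * (x $ j / r)) = flat_flux x \<bullet> ((1 / r) *\<^sub>R x)"
proof -
 have md: "metric_deriv D f i j k x = (\<Sigma> \<alpha>. F \<alpha> i k x * p \<alpha> j x + p \<alpha> i x * F \<alpha> j k x)" for i j k
 proof -
  have "GDERIV (\<lambda>y. kron i j + (\<Sigma> \<alpha>. p \<alpha> i y * p \<alpha> j y)) x
   :> 0 + (\<Sigma> \<alpha>. p \<alpha> i x *\<^sub>R (\<chi> k. F \<alpha> j k x) + p \<alpha> j x *\<^sub>R (\<chi> k. F \<alpha> i k x))"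
   by (intro GDERIV_add GDERIV_const GDERIV_sum GDERIV_mult p_GDERIV x)
  from partial_deriv_GDERIV[OF x this, of k] show ?thesis
   unfolding metric_deriv_def g_eq by (simp add: sum_component mult.commute add.commute)
 qed
 have md': "metric_deriv D f i j i x - metric_deriv D f i i j x = (\<Sigma> \<alpha>. F \<alpha> i i x * p \<alpha> j x - p \<alpha> i x * F \<alpha> i j x)" for i j
  unfolding md sum_subtractf[symmetric] using F_sym[OF x, of _ j i] by (simp add: algebra_simps)
 have ff: "flat_flux x $ j = (\<Sigma> \<alpha> i. F \<alpha> i i x * p \<alpha> j x - p \<alpha> i x * F \<alpha> i j x)" for j
 proof -
  have "(\<Sigma> i k. (kron i k * p \<alpha> j x - kron i j * p \<alpha> k x) * F \<alpha> i k x)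
   = (\<Sigma> i k. if i = k then p \<alpha> j x * F \<alpha> i k x else 0) - (\<Sigma> i. if i = j then (\<Sigma> k. p \<alpha> k x * F \<alpha> i k x) else 0)" for \<alpha>
   unfolding sum_subtractf[symmetric] by (intro sum.cong refl) (auto simp: sum_subtractf left_diff_distrib if_distrib[of "\<lambda>t. t * _"] cong: if_cong)
  then have "(\<Sigma> i k. (kron i k * p \<alpha> j x - kron i j * p \<alpha> k x) * F \<alpha> i k x)
   = (\<Sigma> i. F \<alpha> i i x * p \<alpha> j x - p \<alpha> i x * F \<alpha> i j x)" for \<alpha>
   by (simp add: sum_subtractf mult.commute F_sym[OF x, of \<alpha> j])
  then show ?thesis by (simp add: flat_flux_def)
 qed
 have "(\<Sigma> i j. (metric_deriv D f i j i x - metric_deriv D f i i j x) * (x $ j / r))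
  = (\<Sigma> j i \<alpha>. (F \<alpha> i i x * p \<alpha> j x - p \<alpha> i x * F \<alpha> i j x) * (x $ j / r))"
  unfolding md' sum_distrib_right by (rule sum.swap)
 also have "\<dots> = (\<Sigma> j \<alpha> i. (F \<alpha> i i x * p \<alpha> j x - p \<alpha> i x * F \<alpha> i j x) * (x $ j / r))"
  by (rule sum.cong[OF refl]) (rule sum.swap)
 also have "\<dots> = flat_flux x \<bullet> ((1 / r) *\<^sub>R x)"
  unfolding inner_vec_def ff by (simp add: sum_distrib_right sum_divide_distrib)
 finally show ?thesis .
qed

lemma flat_flux_cont: "continuous_on D flat_flux"
 unfolding flat_flux_def[abs_def] by (intro continuous_intros p_cont F_cont)

end

section \<open>The mass formula\<close>

context exterior_map begin

lemma closed_D: "closed D" using open_\<Omega> by (simp add: closed_Compl)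

lemma exhaustion_limit:
 fixes s :: "real^'n \<Rightarrow> real"
 assumes s: "set_integrable lborel D s"
 shows "((\<lambda>r. LINT x:D \<inter> cball 0 r|lborel. s x) \<longlongrightarrow> (LINT x:D|lborel. s x)) at_top"
 unfolding set_lebesgue_integral_def
proof (rule integral_dominated_convergence_at_top[where w = "\<lambda>x. norm (indicator D x *\<^sub>R s x)"])
 let ?D = "- \<Omega>"
 have i: "integrable lborel (\<lambda>x. indicator ?D x *\<^sub>R s x)" using s by (simp add: set_integrable_def)
 then show m: "(\<lambda>x. indicator ?D x *\<^sub>R s x) \<in> borel_measurable lborel" by (rule borel_measurable_integrable)
 show "integrable lborel (\<lambda>x. norm (indicator ?D x *\<^sub>R s x))" using i by (rule integrable_norm)
 have eq: "indicator (?D \<inter> cball 0 r) x *\<^sub>R s x = indicator (cball 0 r) x *\<^sub>R (indicator ?D x *\<^sub>R s x)" for r x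
  by (simp add: indicator_def)
 show "(\<lambda>x. indicator (?D \<inter> cball 0 r) x *\<^sub>R s x) \<in> borel_measurable lborel" for r
  unfolding eq by (intro borel_measurable_scaleR borel_measurable_indicator m) simp
 show "AE x in lborel. ((\<lambda>r. indicator (?D \<inter> cball 0 r) x *\<^sub>R s x) \<longlongrightarrow> indicator ?D x *\<^sub>R s x) at_top"
 proof (rule AE_I2, rule tendsto_eventually)
  fix x :: "real^'n"
  show "\<forall>\<^sub>F r in at_top. indicator (?D \<inter> cball 0 r) x *\<^sub>R s x = indicator ?D x *\<^sub>R s x"
   using eventually_ge_at_top[of "norm x"] by eventually_elim (simp add: indicator_def)
 qed
 show "\<forall>\<^sub>F r in at_top. AE x in lborel. norm (indicator (?D \<inter> cball 0 r) x *\<^sub>R s x) \<le> norm (indicator ?D x *\<^sub>R s x)"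
  by (intro always_eventually allI AE_I2) (simp add: indicator_def)
qed

text \<open>The factor \<open>1 / \<surd>G\<close> cancels the density of the Riemannian volume.\<close>

lemma graph_volume_integral:
 fixes s :: "real^'n \<Rightarrow> real"
 assumes s: "continuous_on D s" "set_integrable lborel D s"
 shows "integrable (graph_volume D f) (\<lambda>x. s x * (1 / sqrt (det (graph_metric D f x))))"
  and "(LINT x|graph_volume D f. s x * (1 / sqrt (det (graph_metric D f x)))) = (LINT x:D|lborel. s x)"
proof -
 let ?d = "\<lambda>x. sqrt (det (graph_metric D f x))" and ?R = "restrict_space lborel (- \<Omega>)"
 have d: "?d x > 0" for x by (simp add: det_graph_metric_pos)
 have detc: "continuous_on D (\<lambda>x. det (graph_metric D f x))" unfolding det_def by (intro continuous_intros g_cont)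
 have dc: "continuous_on D ?d" by (intro continuous_intros detc)
 have D: "D \<inter> space lborel \<in> sets lborel" using closed_D by simp
 have m: "w \<in> borel_measurable ?R" if "continuous_on D w" for w :: "real^'n \<Rightarrow> real"
  using borel_measurable_continuous_on_restrict[OF that]
  by (simp add: measurable_cong_sets[OF sets_restrict_space_cong[OF sets_lborel] refl])
 have sm: "(\<lambda>x. s x * (1 / ?d x)) \<in> borel_measurable ?R"
 proof (rule m, intro continuous_intros s(1) detc ballI)
  fix x show "?d x \<noteq> 0" using d[of x] by simp
 qed
 have nn: "AE x in ?R. 0 \<le> ?d x" using d by (intro AE_I2 less_imp_le)
 have eq: "(\<lambda>x. ?d x *\<^sub>R (s x * (1 / ?d x))) = s" using d by (simp add: fun_eq_iff less_imp_neq[THEN not_sym])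
 show "integrable (graph_volume D f) (\<lambda>x. s x * (1 / ?d x))"
  unfolding graph_volume_def integrable_density[OF sm m[OF dc] nn] eq integrable_restrict_space[OF D]
  using s(2) by (simp only: set_integrable_def)
 show "(LINT x|graph_volume D f. s x * (1 / ?d x)) = (LINT x:D|lborel. s x)"
  unfolding graph_volume_def integral_density[OF sm m[OF dc] nn] eq integral_restrict_space[OF D] set_lebesgue_integral_def ..
qed

end

locale flat_exterior_map = exterior_map \<Omega> f for \<Omega> :: "(real^'n) set" and f :: "real^'n \<Rightarrow> real^'m" +
 fixes q :: real
 assumes q: "q > (real CARD('n) - 2) / 2"
  and p_O: "D1 D f \<alpha> i \<in> decay (- q / 2)"
  and F_O: "D2 D f \<alpha> i j \<in> decay (- q / 2 - 1)"
  and S_integrable: "set_integrable lborel D (scalar_curv D f)"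
begin

lemma h_mult_O: "v \<in> O[at_infinity](w) \<Longrightarrow> (\<lambda>x. h i j x * v x) \<in> O[at_infinity](w)"
 by (rule landau_o.big_trans[rotated], assumption, rule landau_o.bigI[of 1])
  (auto intro!: always_eventually mult_left_le_one_le inv_metric_bound simp: abs_mult)

lemma u_O: "(\<lambda>x. u \<alpha> i x) \<in> decay (- q / 2)"
 unfolding metric_grad_component by (intro big_sum_in_bigo h_mult_O p_O)

text \<open>\<open>S\<^sup>\<bottom>\<close> is quadratic in products of a Hessian with a gradient, hence \<open>O(r\<^sup>-\<^sup>2\<^sup>q\<^sup>-\<^sup>2)\<close>, and \<open>2 q + 2 > n\<close>.\<close>

lemma normal_scalar_integrable: "set_integrable lborel D (normal_scalar D f)"
proof -
 have V: "(\<lambda>x. \<Sigma> k. F \<alpha> i k x * u \<beta> k x) \<in> decay ((- q / 2 - 1) + - q / 2)" for \<alpha> \<beta> i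
  by (intro big_sum_in_bigo powr_bigo_mult F_O u_O)
 have "normal_scalar D f \<in> decay (((- q / 2 - 1) + - q / 2) + ((- q / 2 - 1) + - q / 2))"
  unfolding normal_scalar_formula[abs_def] by (intro big_sum_in_bigo sum_in_bigo powr_bigo_mult h_mult_O V)
 then obtain C R where C: "C \<ge> 0" "R \<ge> 1"
  and bound: "\<And>x. R \<le> norm x \<Longrightarrow> \<bar>normal_scalar D f x\<bar> \<le> C * norm x powr (((- q / 2 - 1) + - q / 2) + ((- q / 2 - 1) + - q / 2))"
  by (rule powr_bigo_bound) (rule that)
 have e: "((- q / 2 - 1) + - q / 2) + ((- q / 2 - 1) + - q / 2) = - (2 * q + 2)" by simp
 let ?A = "D \<inter> {x. R \<le> norm x}"
 have cA: "closed ?A" by (intro closed_Int closed_D closed_Collect_le continuous_intros)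
 have "set_integrable lborel ?A (normal_scalar D f)" unfolding set_integrable_def
 proof (rule Bochner_Integration.integrable_bound)
  show "integrable lborel (\<lambda>x::real^'n. C * (indicator {x. 1 \<le> norm x} x * norm x powr (- (2 * q + 2))))"
   using q by (intro integrable_mult_right power_decay_integrable) (simp add: field_simps)
  have "continuous_on ?A (normal_scalar D f)" by (rule continuous_on_subset[OF curvature_cont(2)]) simp
  then show "(\<lambda>x. indicator ?A x *\<^sub>R normal_scalar D f x) \<in> borel_measurable lborel"
   using borel_measurable_continuous_on_indicator[of ?A "normal_scalar D f"] cA by simp
  show "AE x in lborel. norm (indicator ?A x *\<^sub>R normal_scalar D f x) \<le> norm (C * (indicator {x. 1 \<le> norm x} x * norm x powr (- (2 * q + 2))))"
   using bound[unfolded e] C by (intro AE_I2) (auto simp: indicator_def abs_mult)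
 qed
 moreover have "set_integrable lborel (D \<inter> cball 0 R) (normal_scalar D f)"
  by (rule set_integrable_compact[OF closed_Int_compact[OF closed_D compact_cball]])
   (rule continuous_on_subset[OF curvature_cont(2)], simp)
 ultimately have "set_integrable lborel (?A \<union> (D \<inter> cball 0 R)) (normal_scalar D f)"
  using cA closed_D by (intro set_integrable_Un) auto
 moreover have "?A \<union> (D \<inter> cball 0 R) = D" by auto
 ultimately show ?thesis by simp
qed

text \<open>Inverse metric and Euclidean metric differ by \<open>O(r\<^sup>-\<^sup>q)\<close>, gradients are \<open>O(r\<^sup>-\<^sup>q\<^sup>/\<^sup>2)\<close>, and Hessians are
\<open>O(r\<^sup>-\<^sup>q\<^sup>/\<^sup>2\<^sup>-\<^sup>1)\<close>.\<close>

lemma flux_flat_O: "(\<lambda>x. flux_field D f x $ j - flat_flux x $ j) \<in> decay (- 2 * q - 1)"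
proof -
 let ?k = "\<lambda>i j. if i = j then 1 else 0 :: real"
 have P: "(\<lambda>x. \<Sigma> \<alpha>. p \<alpha> i x * p \<alpha> j x) \<in> decay (- q / 2 + - q / 2)" for i j
  by (intro big_sum_in_bigo powr_bigo_mult p_O)
 have "(\<Sigma> k. h i k x * (\<Sigma> \<alpha>. p \<alpha> k x * p \<alpha> j x)) = ?k i j - h i j x" for i j x
 proof -
  have "?k i j = (\<Sigma> k. h i k x * g k j x)" by (simp only: inv_metric_entries)
  also have "\<dots> = (\<Sigma> k. h i k x * ?k k j) + (\<Sigma> k. h i k x * (\<Sigma> \<alpha>. p \<alpha> k x * p \<alpha> j x))"
   unfolding g_eq by (simp only: distrib_left sum.distrib)
  finally show ?thesis by (simp add: if_distrib[of "\<lambda>t. _ * t"] cong: if_cong)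
 qed
 moreover have "(\<lambda>x. \<Sigma> k. h i k x * (\<Sigma> \<alpha>. p \<alpha> k x * p \<alpha> j x)) \<in> decay (- q / 2 + - q / 2)" for i j
  by (intro big_sum_in_bigo h_mult_O P)
 ultimately have "(\<lambda>x. ?k i j - h i j x) \<in> decay (- q / 2 + - q / 2)" for i j
  by (simp only:)
 then have hk: "(\<lambda>x. h i j x - ?k i j) \<in> decay (- q / 2 + - q / 2)" for i j
  using landau_o.big.uminus_in_iff[of "\<lambda>x. ?k i j - h i j x"] by simp
 have up: "(\<lambda>x. u \<alpha> j x - p \<alpha> j x) \<in> decay ((- q / 2 + - q / 2) + - q / 2)" for \<alpha> j
 proof -
  have "u \<alpha> j x - p \<alpha> j x = (\<Sigma> c. (h j c x - ?k j c) * p \<alpha> c x)" for x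
   unfolding metric_grad_component left_diff_distrib sum_subtractf
   by (simp add: if_distrib[of "\<lambda>t. t * _"] cong: if_cong)
  then show ?thesis by (simp only:) (intro big_sum_in_bigo powr_bigo_mult hk p_O)
 qed
 have co: "(\<lambda>x. h i k x * u \<alpha> j x - ?k i k * p \<alpha> j x) \<in> decay ((- q / 2 + - q / 2) + - q / 2)" for i k \<alpha> j
 proof -
  have "h i k x * u \<alpha> j x - ?k i k * p \<alpha> j x = (h i k x - ?k i k) * u \<alpha> j x + ?k i k * (u \<alpha> j x - p \<alpha> j x)" for x
   by (simp add: algebra_simps)
  moreover have "(\<lambda>x. ?k i k * (u \<alpha> j x - p \<alpha> j x)) \<in> decay ((- q / 2 + - q / 2) + - q / 2)"
   using up[of \<alpha> j] by (cases "i = k") simp_all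
  ultimately show ?thesis using sum_in_bigo(1)[OF powr_bigo_mult[OF hk u_O]] by (simp only:)
 qed
 have "flux_field D f x $ j - flat_flux x $ j = (\<Sigma> \<alpha> i k. ((h i k x * u \<alpha> j x - ?k i k * p \<alpha> j x) - (h i j x * u \<alpha> k x - ?k i j * p \<alpha> k x)) * F \<alpha> i k x)" for x
  unfolding flux_field_def flat_flux_def flux_coeff_def vec_lambda_beta sum_subtractf[symmetric]
  by (intro sum.cong refl) (simp only: algebra_simps)
 moreover have "((- q / 2 + - q / 2) + - q / 2) + (- q / 2 - 1) = - 2 * q - 1" by simp
 moreover have "(\<lambda>x. \<Sigma> \<alpha> i k. ((h i k x * u \<alpha> j x - ?k i k * p \<alpha> j x) - (h i j x * u \<alpha> k x - ?k i j * p \<alpha> k x)) * F \<alpha> i k x)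
   \<in> decay (((- q / 2 + - q / 2) + - q / 2) + (- q / 2 - 1))"
  by (intro big_sum_in_bigo powr_bigo_mult[OF sum_in_bigo(2)[OF co co] F_O])
 ultimately show ?thesis by (simp only:)
qed

text \<open>The area of the sphere, of order \<open>r\<^sup>n\<^sup>-\<^sup>1\<close>, does not compensate the decay \<open>r\<^sup>-\<^sup>2\<^sup>q\<^sup>-\<^sup>1\<close>, because \<open>2 q > n - 2\<close>.\<close>

lemma flat_flux_limit:
 "((\<lambda>r. (LINT x:sphere 0 r|\<A>. flux_field D f x \<bullet> ((1 / r) *\<^sub>R x))
   - (LINT x:sphere 0 r|\<A>. flat_flux x \<bullet> ((1 / r) *\<^sub>R x))) \<longlongrightarrow> 0) at_top"
proof -
 have "(\<lambda>x. \<Sigma> j. \<bar>flux_field D f x $ j - flat_flux x $ j\<bar>) \<in> decay (- 2 * q - 1)"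
  using flux_flat_O by (intro big_sum_in_bigo) simp
 then obtain C R where C: "C \<ge> 0" and R: "R \<ge> 1"
  and CR: "\<And>x. R \<le> norm x \<Longrightarrow> \<bar>\<Sigma> j. \<bar>flux_field D f x $ j - flat_flux x $ j\<bar>\<bar> \<le> C * norm x powr (- 2 * q - 1)"
  by (rule powr_bigo_bound) (rule that)
 obtain b where b: "\<And>x. x \<in> \<Omega> \<Longrightarrow> norm x \<le> b" using bounded_\<Omega> unfolding bounded_iff by blast
 define A where "A = measure \<A> (sphere (0::real^'n) 1)"
 let ?X = "\<lambda>r x. flux_field D f x \<bullet> ((1 / r) *\<^sub>R x)" and ?Y = "\<lambda>r x. flat_flux x \<bullet> ((1 / r) *\<^sub>R x)"
 have bound: "\<bar>(LINT x:sphere 0 r|\<A>. ?X r x) - (LINT x:sphere 0 r|\<A>. ?Y r x)\<bar> \<le> C * A * r powr (real CARD('n) - 2 - 2 * q)"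
  if r: "max R (b + 1) \<le> r" for r
 proof -
  have r0: "r > 0" using r R by simp
  have spf: "emeasure \<A> (sphere (0::real^'n) r) < top" by (rule sphere_area_le[OF n r0])
  have spD: "sphere 0 r \<subseteq> D" using b r by fastforce
  have cX: "continuous_on (sphere 0 r) (?X r)" by (intro continuous_intros continuous_on_subset[OF flux_field_cont spD])
  have cY: "continuous_on (sphere 0 r) (?Y r)" by (intro continuous_intros continuous_on_subset[OF flat_flux_cont spD])
  have pt: "\<bar>?X r x - ?Y r x\<bar> \<le> C * r powr (- 2 * q - 1)" if "x \<in> sphere 0 r" for x
  proof -
   have nx: "norm x = r" using that by simp
   have "\<bar>?X r x - ?Y r x\<bar> = \<bar>(flux_field D f x - flat_flux x) \<bullet> ((1 / r) *\<^sub>R x)\<bar>" by (simp only: inner_diff_left)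
   also have "\<dots> \<le> norm (flux_field D f x - flat_flux x) * norm ((1 / r) *\<^sub>R x)" by (rule Cauchy_Schwarz_ineq2)
   also have "\<dots> = norm (flux_field D f x - flat_flux x)" using nx r0 by simp
   also have "\<dots> \<le> (\<Sigma> j. \<bar>flux_field D f x $ j - flat_flux x $ j\<bar>)"
    using norm_le_l1_cart[of "flux_field D f x - flat_flux x"] by simp
   also have "\<dots> \<le> C * r powr (- 2 * q - 1)" using CR[of x] r unfolding nx by simp
   finally show ?thesis .
  qed
  have "(LINT x:sphere 0 r|\<A>. ?X r x) - (LINT x:sphere 0 r|\<A>. ?Y r x) = (LINT x:sphere 0 r|\<A>. ?X r x - ?Y r x)"
   by (rule set_integral_diff(2)[symmetric]) (rule area_integral_continuous(1)[OF compact_sphere spf cX] area_integral_continuous(1)[OF compact_sphere spf cY])+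
  also have "\<bar>\<dots>\<bar> \<le> C * r powr (- 2 * q - 1) * measure \<A> (sphere (0::real^'n) r)"
   by (rule area_integral_continuous(2)[OF compact_sphere spf continuous_on_diff[OF cX cY] pt])
  also have "\<dots> \<le> C * r powr (- 2 * q - 1) * (r ^ (CARD('n) - 1) * A)"
   unfolding A_def using C by (intro mult_left_mono sphere_area_le(2)[OF n r0]) simp
  also have "r ^ (CARD('n) - 1) = r powr (real CARD('n) - 1)"
   using r0 n by (simp add: powr_realpow[symmetric] of_nat_diff)
  also have "C * r powr (- 2 * q - 1) * (r powr (real CARD('n) - 1) * A) = C * A * (r powr (- 2 * q - 1) * r powr (real CARD('n) - 1))"
   by (simp only: mult_ac)
  also have "r powr (- 2 * q - 1) * r powr (real CARD('n) - 1) = r powr (real CARD('n) - 2 - 2 * q)"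
   unfolding powr_add[symmetric] by (rule arg_cong[where f = "(powr) r"]) simp
  finally show ?thesis .
 qed
 show ?thesis
 proof (rule Lim_null_comparison)
  show "\<forall>\<^sub>F r in at_top. norm ((LINT x:sphere 0 r|\<A>. ?X r x) - (LINT x:sphere 0 r|\<A>. ?Y r x)) \<le> C * A * r powr (real CARD('n) - 2 - 2 * q)"
   using eventually_ge_at_top[of "max R (b + 1)"] by eventually_elim (simp only: real_norm_def bound)
  have "((\<lambda>r. r powr (real CARD('n) - 2 - 2 * q)) \<longlongrightarrow> 0) at_top"
   using q by (intro tendsto_neg_powr filterlim_ident) (simp add: field_simps)
  from tendsto_mult_left[OF this, of "C * A"] show "((\<lambda>r. C * A * r powr (real CARD('n) - 2 - 2 * q)) \<longlongrightarrow> 0) at_top" by simp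
 qed
qed

lemma curvature_integrable: "set_integrable lborel D (\<lambda>x. scalar_curv D f x + normal_scalar D f x)"
 by (rule set_integral_add(1)[OF S_integrable normal_scalar_integrable])

lemma adm_limit:
 assumes C2pt: "AE x in \<A>. x \<in> frontier \<Omega> \<longrightarrow> C2_boundary_point \<Omega> x"
 shows "(adm_flux D f \<longlongrightarrow> 1 / (2 * (real CARD('n) - 1) * sphere_area TYPE('n)) *
   ((LINT x:D|lborel. scalar_curv D f x + normal_scalar D f x) + (LINT x:frontier \<Omega>|\<A>. boundary_term x))) at_top"
proof -
 let ?s = "\<lambda>x. scalar_curv D f x + normal_scalar D f x"
 let ?b = "LINT x:frontier \<Omega>|\<A>. boundary_term x"
 let ?X = "\<lambda>r. LINT x:sphere 0 r|\<A>. flux_field D f x \<bullet> ((1 / r) *\<^sub>R x)"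
 let ?Y = "\<lambda>r. LINT x:sphere 0 r|\<A>. flat_flux x \<bullet> ((1 / r) *\<^sub>R x)"
 have "bounded (closure \<Omega>)" using bounded_\<Omega> by (rule bounded_closure)
 then obtain R where R: "\<And>x. x \<in> closure \<Omega> \<Longrightarrow> norm x \<le> R" unfolding bounded_iff by blast
 have ev: "\<forall>\<^sub>F r in at_top. r > max R 0" by (rule eventually_gt_at_top)
 have sub: "closure \<Omega> \<subseteq> ball 0 r" if "r > max R 0" for r
  using R that by (force simp: subset_iff)
 have X: "(?X \<longlongrightarrow> (LINT x:D|lborel. ?s x) + ?b) at_top"
 proof (rule Lim_transform_eventually)
  show "((\<lambda>r. (LINT x:D \<inter> cball 0 r|lborel. ?s x) + ?b) \<longlongrightarrow> (LINT x:D|lborel. ?s x) + ?b) at_top"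
   by (intro tendsto_add tendsto_const exhaustion_limit curvature_integrable)
  show "\<forall>\<^sub>F r in at_top. (LINT x:D \<inter> cball 0 r|lborel. ?s x) + ?b = ?X r"
   using ev
  proof eventually_elim
   case (elim r)
   then show ?case using flux_identity[OF C2pt _ sub[OF elim]] by simp
  qed
 qed
 have Y: "(?Y \<longlongrightarrow> (LINT x:D|lborel. ?s x) + ?b) at_top"
  using tendsto_diff[OF X flat_flux_limit] by simp
 define c where "c = 1 / (2 * (real CARD('n) - 1) * sphere_area TYPE('n))"
 have "(adm_flux D f \<longlongrightarrow> c * ((LINT x:D|lborel. ?s x) + ?b)) at_top"
 proof (rule Lim_transform_eventually[OF tendsto_mult_left[OF Y]])
  show "\<forall>\<^sub>F r in at_top. c * ?Y r = adm_flux D f r"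
   using ev
  proof eventually_elim
   case (elim r)
   have "(LINT x:sphere 0 r|\<A>. \<Sigma> i j. (metric_deriv D f i j i x - metric_deriv D f i i j x) * (x $ j / r)) = ?Y r"
   proof (rule set_lebesgue_integral_cong)
    show "sphere 0 r \<in> sets \<A>" by simp
    show "\<forall>x. x \<in> sphere 0 r \<longrightarrow> (\<Sigma> i j. (metric_deriv D f i j i x - metric_deriv D f i i j x) * (x $ j / r)) = flat_flux x \<bullet> ((1 / r) *\<^sub>R x)"
    proof (intro allI impI adm_integrand)
     fix x :: "real^'n" assume "x \<in> sphere 0 r"
     then have "x \<notin> ball 0 r" by simp
     then have "x \<notin> closure \<Omega>" using sub[OF elim] by blast
     then show "x \<in> interior D" unfolding interior_complement by simp
    qed
   qed
   then show ?case by (simp only: adm_flux_def c_def)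
  qed
 qed
 then show ?thesis unfolding c_def .
qed

end

theorem theorem1p2:
  fixes \<Omega> :: "(real^'n) set" and f :: "real^'n \<Rightarrow> real^'m"
  assumes "CARD('n) \<ge> 2"
    and "open \<Omega>" and "bounded \<Omega>" and "lipschitz_boundary \<Omega>"
    and "AE x in area_measure. x \<in> frontier \<Omega> \<longrightarrow> C2_boundary_point \<Omega> x"
    and "asymptotically_flat (- \<Omega>) f"
    and "\<forall>C\<in>components (frontier \<Omega>). f constant_on C"
  shows "(adm_flux (- \<Omega>) f \<longlongrightarrow> adm_mass (- \<Omega>) f) at_top \<and>
    integrable (graph_volume (- \<Omega>) f)
      (\<lambda>x. (scalar_curv (- \<Omega>) f x + normal_scalar (- \<Omega>) f x) * (1 / sqrt (det (graph_metric (- \<Omega>) f x)))) \<and>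
    set_integrable area_measure (frontier \<Omega>)
      (\<lambda>x. grad_norm_sq (- \<Omega>) f x / (1 + grad_norm_sq (- \<Omega>) f x) * mean_curvature \<Omega> x) \<and>
    adm_mass (- \<Omega>) f = 1 / (2 * (real CARD('n) - 1) * sphere_area TYPE('n)) *
      ((LINT x|graph_volume (- \<Omega>) f.
          (scalar_curv (- \<Omega>) f x + normal_scalar (- \<Omega>) f x) * (1 / sqrt (det (graph_metric (- \<Omega>) f x)))) +
       (LINT x:frontier \<Omega>|area_measure.
          grad_norm_sq (- \<Omega>) f x / (1 + grad_norm_sq (- \<Omega>) f x) * mean_curvature \<Omega> x))"
proof -
 obtain q where "q > (real CARD('n) - 2) / 2" "\<forall>\<alpha> i. D1 (- \<Omega>) f \<alpha> i \<in> O[at_infinity](\<lambda>x. norm x powr (- q / 2))"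
  "\<forall>\<alpha> i j. D2 (- \<Omega>) f \<alpha> i j \<in> O[at_infinity](\<lambda>x. norm x powr (- q / 2 - 1))"
  "\<forall>\<alpha>. C2_on (- \<Omega>) (\<lambda>x. f x $ \<alpha>)" "set_integrable lborel (- \<Omega>) (scalar_curv (- \<Omega>) f)"
  using assms(6) unfolding asymptotically_flat_def by blast
 then interpret flat_exterior_map \<Omega> f q using assms by unfold_locales blast+
 let ?s = "\<lambda>x. scalar_curv (- \<Omega>) f x + normal_scalar (- \<Omega>) f x"
 have sc: "continuous_on (- \<Omega>) ?s" by (intro continuous_intros curvature_cont)
 have lim: "(adm_flux (- \<Omega>) f \<longlongrightarrow> 1 / (2 * (real CARD('n) - 1) * sphere_area TYPE('n)) *
   ((LINT x|graph_volume (- \<Omega>) f. ?s x * (1 / sqrt (det (graph_metric (- \<Omega>) f x)))) + (LINT x:frontier \<Omega>|area_measure. boundary_term x))) at_top"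
  unfolding graph_volume_integral(2)[OF sc curvature_integrable] by (rule adm_limit[OF assms(5)])
 have mass: "adm_mass (- \<Omega>) f = 1 / (2 * (real CARD('n) - 1) * sphere_area TYPE('n)) *
   ((LINT x|graph_volume (- \<Omega>) f. ?s x * (1 / sqrt (det (graph_metric (- \<Omega>) f x)))) + (LINT x:frontier \<Omega>|area_measure. boundary_term x))"
  unfolding adm_mass_def by (rule tendsto_Lim[OF _ lim]) simp
 show ?thesis
  unfolding boundary_term_def[symmetric]
  using lim[folded mass] graph_volume_integral(1)[OF sc curvature_integrable] boundary_term_integrable mass by blast
qed

end
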